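(* Let $k$ be a field and $\Delta$ a $(d-1)$-dimensional simplicial complex. Suppose there are subcomplexes $\Delta_1,\dots,\Delta_m$ such that: (i) $\Delta=\Delta_1\cup\cdots\cup\Delta_m$; (ii) $\Delta_1$ is a $(d-1)$-dimensional orientable homology manifold (without boundary) over $k$; (iii) for $2\le i\le m$, $\Delta_i$ is a $(d-1)$-dimensional connected orientable homology manifold over $k$ with boundary $\partial\Delta_i$ such that (a) $\partial\Delta_i$ is a $(d-2)$-dimensional connected orientable homology manifold (without boundary) over $k$, (b) $\partial\Delta_i=\Delta_i\cap(\Delta_1\cup\cdots\cup\Delta_{i-1})$, and (c) the maps induced by inclusion $\widetilde{H}_{d-2}(\partial\Delta_i;k)\to\widetilde{H}_{d-2}(\Delta_1\cup\cdots\cup\Delta_{i-1};k)$ and $\widetilde{H}_{d-3}(\partial\Delta_i;k)\to\widetilde{H}_{d-3}(\Delta_1\cup\cdots\cup\Delta_{i-1};k)$ are both zero. Then $\Delta$ is Buchsbaum* over $k$.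
   Context: A simplicial complex is a finite collection of subsets of a finite ground set closed under taking subsets; $|\Delta|$ is its geometric realization, $\widetilde{H}_*(\cdot;k)$ reduced homology over $k$. A complex is called a homology manifold (with boundary) over $k$ when its geometric realization is one. $\Delta$ is Buchsbaum over $k$ if its face ring $k[\Delta]$ is a Buchsbaum ring. A $(d-1)$-dimensional complex $\Delta$ which is Buchsbaum over $k$ is Buchsbaum* over $k$ if $\dim_k \widetilde{H}_{d-2}(|\Delta|-p;k) = \dim_k \widetilde{H}_{d-2}(|\Delta|;k)$ for every $p\in|\Delta|$. *)

theory Defs
  imports "HOL-Homology.Homology" "HOL-Algebra.QuotRing" "HOL-Algebra.Ring_Divisibility"
    "HOL-Library.Extended_Nat"
begin

section \<open>Singular homology with coefficients in a field\<close>

text \<open>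
  The simplices and faces are those of HOL-Homology, whose homology groups have integer
  coefficients only.  Degrees are integers; all chain groups in negative degree vanish.
\<close>

type_synonym ('a, 'k) kchain = "((nat \<Rightarrow> real) \<Rightarrow> 'a) \<Rightarrow>\<^sub>0 'k"

definition chains :: "int \<Rightarrow> 'a::topological_space set \<Rightarrow> ('a, 'k::field) kchain set" where
  "chains n X =
     {c. \<forall>f \<in> Poly_Mapping.keys c. 0 \<le> n \<and> singular_simplex (nat n) (top_of_set X) f}"

definition bdry :: "int \<Rightarrow> ('a, 'k::field) kchain \<Rightarrow> ('a, 'k) kchain" where
  "bdry n c =
     (if n \<le> 0 then 0
      else \<Sum>f \<in> Poly_Mapping.keys c. \<Sum>j \<le> nat n.
             Poly_Mapping.single (singular_face (nat n) j f) ((-1) ^ j * Poly_Mapping.lookup c f))"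

definition rel_cycles ::
    "int \<Rightarrow> 'a::topological_space set \<Rightarrow> 'a set \<Rightarrow> ('a, 'k::field) kchain set" where
  "rel_cycles n X A = {c \<in> chains n X. bdry n c \<in> chains (n - 1) A}"

definition rel_boundaries ::
    "int \<Rightarrow> 'a::topological_space set \<Rightarrow> 'a set \<Rightarrow> ('a, 'k::field) kchain set" where
  "rel_boundaries n X A = {c \<in> chains n X. \<exists>e \<in> chains (n + 1) X. c - bdry (n + 1) e \<in> chains n A}"

text \<open>
  Reduced homology is the kernel of the map to the homology of a point, as in HOL-Homology:
  in degree 0 the coefficients of a reduced cycle add up to 0, and every reduced group of
  negative degree is 0, also for the empty space.
\<close>

definition red_cycles :: "int \<Rightarrow> 'a::topological_space set \<Rightarrow> ('a, 'k::field) kchain set" where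
  "red_cycles n X =
     {c \<in> rel_cycles n X {}. n = 0 \<longrightarrow> (\<Sum>f \<in> Poly_Mapping.keys c. Poly_Mapping.lookup c f) = 0}"

text \<open>
  The dimension of the quotient space \<open>Z / B\<close>, for subspaces \<open>B \<subseteq> Z\<close>: the supremum of the sizes
  of the finite subsets of \<open>Z\<close> that are linearly independent modulo \<open>B\<close>.
\<close>

definition independent_mod :: "('x \<Rightarrow>\<^sub>0 'k::field) set \<Rightarrow> ('x \<Rightarrow>\<^sub>0 'k) set \<Rightarrow> bool" where
  "independent_mod B S \<longleftrightarrow>
     (\<forall>a. (\<Sum>s \<in> S. Poly_Mapping.map ((*) (a s)) s) \<in> B \<longrightarrow> (\<forall>s \<in> S. a s = 0))"

definition quot_dim :: "('x \<Rightarrow>\<^sub>0 'k::field) set \<Rightarrow> ('x \<Rightarrow>\<^sub>0 'k) set \<Rightarrow> enat" where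
  "quot_dim Z B = (SUP S \<in> {S. finite S \<and> S \<subseteq> Z \<and> independent_mod B S}. enat (card S))"

definition homology_dim ::
    "'k::field itself \<Rightarrow> int \<Rightarrow> 'a::topological_space set \<Rightarrow> 'a set \<Rightarrow> enat" where
  "homology_dim K n X A =
     quot_dim (rel_cycles n X A :: ('a, 'k) kchain set) (rel_boundaries n X A)"

definition reduced_homology_dim ::
    "'k::field itself \<Rightarrow> int \<Rightarrow> 'a::topological_space set \<Rightarrow> enat" where
  "reduced_homology_dim K n X =
     quot_dim (red_cycles n X :: ('a, 'k) kchain set) (rel_boundaries n X {})"

text \<open>
  For \<open>A \<subseteq> X\<close> the map on reduced homology induced by inclusion sends the class of a cycle \<open>z\<close> of \<open>A\<close>
  to the class of \<open>z\<close> in \<open>X\<close>; it is zero iff each such \<open>z\<close> bounds in \<open>X\<close>.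
\<close>

definition inclusion_induces_zero ::
    "'k::field itself \<Rightarrow> int \<Rightarrow> 'a::topological_space set \<Rightarrow> 'a set \<Rightarrow> bool" where
  "inclusion_induces_zero K n A X \<longleftrightarrow>
     A \<subseteq> X \<and> (\<forall>z \<in> (red_cycles n A :: ('a, 'k) kchain set). z \<in> rel_boundaries n X {})"


section \<open>Homology manifolds\<close>

definition homology_manifold ::
    "'k::field itself \<Rightarrow> int \<Rightarrow> 'a::topological_space set \<Rightarrow> bool" where
  "homology_manifold K n X \<longleftrightarrow>
     (\<forall>p \<in> X. \<forall>i. homology_dim K i X (X - {p}) = (if i = n then 1 else 0))"

definition boundary_points ::
    "'k::field itself \<Rightarrow> int \<Rightarrow> 'a::topological_space set \<Rightarrow> 'a set" where
  "boundary_points K n X = {p \<in> X. homology_dim K n X (X - {p}) = 0}"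

definition homology_manifold_with_boundary ::
    "'k::field itself \<Rightarrow> int \<Rightarrow> 'a::topological_space set \<Rightarrow> bool" where
  "homology_manifold_with_boundary K n X \<longleftrightarrow>
     (\<forall>p \<in> X. (\<forall>i. i \<noteq> n \<longrightarrow> homology_dim K i X (X - {p}) = 0) \<and>
              homology_dim K n X (X - {p}) \<in> {0, 1}) \<and>
     homology_manifold K (n - 1) (boundary_points K n X)"

text \<open>For compact \<open>X\<close>: every connected component has a fundamental class relative to its boundary.\<close>

definition orientable ::
    "'k::field itself \<Rightarrow> int \<Rightarrow> 'a::topological_space set \<Rightarrow> bool" where
  "orientable K n X \<longleftrightarrow>
     (\<forall>C \<in> components X. homology_dim K n C (C \<inter> boundary_points K n X) = 1)"


section \<open>Simplicial complexes\<close>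

definition simplicial_complex :: "'v set set \<Rightarrow> bool" where
  "simplicial_complex \<Delta> \<longleftrightarrow> finite (\<Union>\<Delta>) \<and> (\<forall>F \<in> \<Delta>. \<forall>G. G \<subseteq> F \<longrightarrow> G \<in> \<Delta>)"

definition subcomplex :: "'v set set \<Rightarrow> 'v set set \<Rightarrow> bool" where
  "subcomplex \<Gamma> \<Delta> \<longleftrightarrow> simplicial_complex \<Gamma> \<and> \<Gamma> \<subseteq> \<Delta>"

text \<open>The complex \<open>{{}}\<close> has dimension -1; the void complex has no dimension.\<close>

definition has_dim :: "'v set set \<Rightarrow> int \<Rightarrow> bool" where
  "has_dim \<Delta> n \<longleftrightarrow> (\<exists>F \<in> \<Delta>. int (card F) = n + 1) \<and> (\<forall>F \<in> \<Delta>. int (card F) \<le> n + 1)"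

text \<open>
  Points are given by their barycentric coordinates; the topology is the one induced by the product
  topology on \<^typ>\<open>'v \<Rightarrow> real\<close>, the usual one as the complex is finite.
\<close>

definition geom :: "'v set set \<Rightarrow> ('v \<Rightarrow> real) set" where
  "geom \<Delta> = {x. (\<forall>v. 0 \<le> x v) \<and> {v. x v \<noteq> 0} \<in> \<Delta> \<and> (\<Sum>v \<in> {v. x v \<noteq> 0}. x v) = 1}"

definition boundary_complex :: "'k::field itself \<Rightarrow> int \<Rightarrow> 'v set set \<Rightarrow> 'v set set" where
  "boundary_complex K n \<Delta> = {F \<in> \<Delta>. geom (Pow F) \<subseteq> boundary_points K n (geom \<Delta>)}"


section \<open>Buchsbaum local rings\<close>

definition krull_dim :: "('a, 'b) ring_scheme \<Rightarrow> enat" where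
  "krull_dim A = (SUP n \<in> {n. \<exists>P :: nat \<Rightarrow> 'a set.
                     (\<forall>i \<le> n. primeideal (P i) A) \<and> (\<forall>i < n. P i \<subset> P (Suc i))}. enat n)"

definition system_of_parameters :: "('a, 'b) ring_scheme \<Rightarrow> 'a set \<Rightarrow> 'a list \<Rightarrow> bool" where
  "system_of_parameters A M xs \<longleftrightarrow>
     set xs \<subseteq> M \<and> enat (length xs) = krull_dim A \<and>
     (\<forall>a \<in> M. \<exists>n::nat. a [^]\<^bsub>A\<^esub> n \<in> Idl\<^bsub>A\<^esub> (set xs))"

text \<open>\<open>M \<cdot> ((x\<^sub>1,\<dots>,x\<^sub>i) : x\<^sub>i\<^sub>+\<^sub>1) \<subseteq> (x\<^sub>1,\<dots>,x\<^sub>i)\<close> for all \<open>i\<close>\<close>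

definition weak_sequence :: "('a, 'b) ring_scheme \<Rightarrow> 'a set \<Rightarrow> 'a list \<Rightarrow> bool" where
  "weak_sequence A M xs \<longleftrightarrow>
     (\<forall>i < length xs. \<forall>a \<in> carrier A.
        a \<otimes>\<^bsub>A\<^esub> (xs ! i) \<in> Idl\<^bsub>A\<^esub> (set (take i xs)) \<longrightarrow>
        (\<forall>b \<in> M. b \<otimes>\<^bsub>A\<^esub> a \<in> Idl\<^bsub>A\<^esub> (set (take i xs))))"

definition buchsbaum_local_ring :: "('a, 'b) ring_scheme \<Rightarrow> bool" where
  "buchsbaum_local_ring A \<longleftrightarrow>
     cring A \<and> noetherian_ring A \<and>
     (\<exists>M. {I. maximalideal I A} = {M} \<and>
          (\<forall>xs. system_of_parameters A M xs \<longrightarrow> weak_sequence A M xs))"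

text \<open>The localization of a commutative ring at a prime ideal \<open>P\<close>; \<open>loc_frac R P a s\<close> is \<open>a/s\<close>.\<close>

definition loc_frac :: "('a, 'b) ring_scheme \<Rightarrow> 'a set \<Rightarrow> 'a \<Rightarrow> 'a \<Rightarrow> ('a \<times> 'a) set" where
  "loc_frac R P a s =
     {(b, t). b \<in> carrier R \<and> t \<in> carrier R - P \<and>
              (\<exists>u \<in> carrier R - P. u \<otimes>\<^bsub>R\<^esub> (a \<otimes>\<^bsub>R\<^esub> t) = u \<otimes>\<^bsub>R\<^esub> (b \<otimes>\<^bsub>R\<^esub> s))}"

definition localization :: "('a, 'b) ring_scheme \<Rightarrow> 'a set \<Rightarrow> ('a \<times> 'a) set ring" where
  "localization R P =
     \<lparr>carrier = {loc_frac R P a s | a s. a \<in> carrier R \<and> s \<in> carrier R - P},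
      monoid.mult = (\<lambda>X Y. \<Union>(a, s) \<in> X. \<Union>(b, t) \<in> Y. loc_frac R P (a \<otimes>\<^bsub>R\<^esub> b) (s \<otimes>\<^bsub>R\<^esub> t)),
      one = loc_frac R P \<one>\<^bsub>R\<^esub> \<one>\<^bsub>R\<^esub>,
      zero = loc_frac R P \<zero>\<^bsub>R\<^esub> \<one>\<^bsub>R\<^esub>,
      add = (\<lambda>X Y. \<Union>(a, s) \<in> X. \<Union>(b, t) \<in> Y.
               loc_frac R P (a \<otimes>\<^bsub>R\<^esub> t \<oplus>\<^bsub>R\<^esub> b \<otimes>\<^bsub>R\<^esub> s) (s \<otimes>\<^bsub>R\<^esub> t))\<rparr>"


section \<open>Face rings and Buchsbaum* complexes\<close>

type_synonym ('v, 'k) mpol = "('v \<Rightarrow>\<^sub>0 nat) \<Rightarrow>\<^sub>0 'k"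

text \<open>The polynomial ring over \<^typ>\<open>'k\<close> in the variables indexed by \<open>V\<close>\<close>

definition polynomial_ring :: "'k::field itself \<Rightarrow> 'v set \<Rightarrow> ('v, 'k) mpol ring" where
  "polynomial_ring K V =
     \<lparr>carrier = {p. \<forall>m \<in> Poly_Mapping.keys p. Poly_Mapping.keys m \<subseteq> V},
      monoid.mult = (*), one = 1, zero = 0, add = (+)\<rparr>"

definition face_monomial :: "'v set \<Rightarrow> ('v, 'k::field) mpol" where
  "face_monomial F = Poly_Mapping.single (\<Sum>v \<in> F. Poly_Mapping.single v 1) 1"

definition stanley_reisner_ideal :: "'k::field itself \<Rightarrow> 'v set set \<Rightarrow> ('v, 'k) mpol set" where
  "stanley_reisner_ideal K \<Delta> =
     Idl\<^bsub>polynomial_ring K (\<Union>\<Delta>)\<^esub> {face_monomial F | F. F \<subseteq> \<Union>\<Delta> \<and> F \<notin> \<Delta>}"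

definition face_ring :: "'k::field itself \<Rightarrow> 'v set set \<Rightarrow> ('v, 'k) mpol set ring" where
  "face_ring K \<Delta> = polynomial_ring K (\<Union>\<Delta>) Quot stanley_reisner_ideal K \<Delta>"

definition irrelevant_ideal :: "'k::field itself \<Rightarrow> 'v set set \<Rightarrow> ('v, 'k) mpol set set" where
  "irrelevant_ideal K \<Delta> =
     Idl\<^bsub>face_ring K \<Delta>\<^esub>
       {stanley_reisner_ideal K \<Delta> +>\<^bsub>polynomial_ring K (\<Union>\<Delta>)\<^esub> face_monomial {v} | v. v \<in> \<Union>\<Delta>}"

text \<open>A graded algebra is a Buchsbaum ring if its localization at the irrelevant maximal ideal is one.\<close>

definition buchsbaum :: "'k::field itself \<Rightarrow> 'v set set \<Rightarrow> bool" where
  "buchsbaum K \<Delta> \<longleftrightarrow> buchsbaum_local_ring (localization (face_ring K \<Delta>) (irrelevant_ideal K \<Delta>))"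

text \<open>Here \<open>\<Delta>\<close> is a complex of dimension \<open>d - 1\<close>.\<close>

definition buchsbaum_star :: "'k::field itself \<Rightarrow> nat \<Rightarrow> 'v set set \<Rightarrow> bool" where
  "buchsbaum_star K d \<Delta> \<longleftrightarrow>
     simplicial_complex \<Delta> \<and> has_dim \<Delta> (int d - 1) \<and> buchsbaum K \<Delta> \<and>
     (\<forall>p \<in> geom \<Delta>. reduced_homology_dim K (int d - 2) (geom \<Delta> - {p}) =
                    reduced_homology_dim K (int d - 2) (geom \<Delta>))"

end

theory Submission
 imports Defs "HOL-Library.Function_Algebras" "HOL-Computational_Algebra.Polynomial"
begin


text \<open>
 The Buchsbaum property. Double cochains of the complex with values in Koszul complexes show by a
 zigzag that the maximal ideal annihilates the first Koszul homology of each system of parameters,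
 provided that the cohomology relative to the faces not containing a given nonempty face vanishes below
 the top degree. Applied to powers of the parameters, Krull's intersection theorem turns this into
 the weak sequence property.

 Singular chains. A singular simplex that has been subdivided finely enough is sent to the oriented
 simplex of vertices chosen at its corners. Straight-line prisms show that this inverts the
 realization of simplicial chains, also relative to the complement of a point, so every hypothesis
 and the conclusion become statements about simplicial chains.

 Gluing. By induction on i, at each nonempty face of the union of the first i pieces the local
 homology vanishes below the top degree and every local top cycle extends to an absolute one. At a face of
 the common boundary this is a Mayer-Vietoris argument. The fundamental chain of the new piece is
 nonzero on every facet, as stars and the whole piece are strongly connected; its boundary bounds in
 the old part by hypothesis, and the difference is the absolute cycle needed to extend the local ones.
 Extension of local top cycles makes removing a point harmless in degree d - 2.
\<close>

section \<open>Signed wedge products and contractions\<close>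

text \<open>Computations in the localization are replaced by identities between polynomials in
  normal form that hold up to a multiplier \<open>u\<close> with nonzero constant term. In the
  zigzag over the empty face, a monomial other than 1 has a vertex in its support, and the faces
  compatible with it form a cone over that vertex. Only the coefficient of 1 sees the cohomology of
  the whole complex, on which nothing is assumed; multiplying by an element of the maximal ideal
  erases exactly this coefficient. The resulting relation holds modulo all other parameters, the
  later ones included, while a weak sequence allows only the earlier ones. Replacing the later ones
  by their N-th powers, for every N, is what removes them. In the gluing, a union of pieces is in
  general no manifold, and its local homology at a glued face may have any dimension in the top
  degree. Hence the induction carries, instead of the manifold property, the vanishing below the top
  degree and the extension of local top cycles.\<close>

text \<open>The sign is (-1) to the number of elements of G that precede v in the list; wd and ct are exterior multiplication and contraction by v, so that signed (co)boundaries of functions on faces satisfy Clifford relations.\<close>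

primrec sg :: "'v list => 'v => 'v set => 'r::comm_ring_1" where
 "sg [] v G = 1"
| "sg (a # l) v G = (if a = v then 1 else if a \<in> G then - sg l v G else sg l v G)"

definition wd :: "'v list => 'v => ('v set => 'r::comm_ring_1) => 'v set => 'r" where
 "wd l v f = (\<lambda>G. if v \<in> G then sg l v G * f (G - {v}) else 0)"

definition ct :: "'v list => 'v => ('v set => 'r::comm_ring_1) => 'v set => 'r" where
 "ct l v f = (\<lambda>G. if v \<notin> G then sg l v (insert v G) * f (insert v G) else 0)"

lemma sg_square [simp]: "sg l v G * sg l v G = 1"
 by (induction l) auto

lemma sg_square_left [simp]: "sg l v G * (sg l v G * x) = x"
 by (simp add: mult.assoc[symmetric])

lemma sg_nonzero [simp]: "sg l v G ~= (0::'r::comm_ring_1)"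
 using sg_square[of l v G, where 'a='r] by (metis mult_zero_left zero_neq_one)

lemma sg_insert_self [simp]: "sg l v (insert v G) = sg l v G"
 by (induction l) auto

lemma sg_remove_self [simp]: "sg l v (G - {v}) = sg l v G"
 by (induction l) auto

text \<open>Whichever of v and w comes later in l has its sign changed when the other one is
  deleted, and the earlier one does not notice the deletion; so exactly one of the two factors
  changes.\<close>

lemma sg_remove: "w \<in> set l ==> v \<in> set l ==> distinct l ==> v ~= w ==> v \<in> G ==> w \<in> G ==>
  sg l v (G - {w}) * sg l w G = - (sg l w (G - {v}) * sg l v G)"
proof (induction l)
 case (Cons a l)
 have notin: "sg l x (G - {y}) = sg l x G" if "y \<notin> set l" for x y
  using that by (induction l) auto
 show ?case
  using Cons notin by auto
qed simp

lemma ct_wd_same: "ct l v (wd l v f) G + wd l v (ct l v f) G = f G"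
 by (auto simp: ct_def wd_def insert_absorb)

lemma mult_anti_assoc: "a * b = - (c * e) ==> a * (b * f) = - (c * (e * f))" for a :: "'r::comm_ring_1"
 by (metis mult.assoc mult_minus_left)

lemma ct_wd_anti:
 fixes f :: "'v set => 'r::comm_ring_1"
 assumes "distinct l" "v \<in> set l" "w \<in> set l" "v ~= w"
 shows "ct l v (wd l w f) G = - wd l w (ct l v f) G"
proof (cases "v \<notin> G \<and> w \<in> G")
 case True
 then have i: "insert v G - {w} = insert v (G - {w})" using assms by auto
 have "sg l v (insert v G - {w}) * sg l w (insert v G) = - (sg l w (insert v G - {v}) * sg l v (insert v G) :: 'r)"
  by (rule sg_remove) (use True assms in auto)
 then have a: "sg l v (G - {w}) * sg l w (insert v G) = - (sg l w G * sg l v G :: 'r)"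
  using True by (simp add: i)
 \<comment> \<open>Signs are their own inverses: the inserted square of
   \<open>sg l v (G - {w})\<close> makes relation \<open>a\<close> applicable.\<close>
 have "sg l v G * sg l w (insert v G) = sg l v G * (sg l v (G - {w}) * (sg l v (G - {w}) * sg l w (insert v G)) :: 'r)"
  by simp
 also have "\<dots> = - (sg l w G * sg l v (G - {w})) * (sg l v G * sg l v G)"
  unfolding a by (simp only: mult.commute mult.left_commute mult_minus_left mult_minus_right)
 finally have "sg l v G * sg l w (insert v G) = - (sg l w G * sg l v (G - {w}) :: 'r)"
  by simp
 then have "sg l v G * (sg l w (insert v G) * f (insert v (G - {w}))) = - (sg l w G * (sg l v (G - {w}) * f (insert v (G - {w}))))"
  by (rule mult_anti_assoc)
 with True assms i show ?thesis
  by (simp add: ct_def wd_def)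
qed (use assms in \<open>auto simp: ct_def wd_def\<close>)

lemma ct_ct_anti:
 fixes f :: "'v set => 'r::comm_ring_1"
 assumes "distinct l" "v \<in> set l" "w \<in> set l"
 shows "ct l v (ct l w f) G = - ct l w (ct l v f) G"
proof (cases "v ~= w \<and> v \<notin> G \<and> w \<notin> G")
 case True
 have "sg l v (insert v (insert w G) - {w}) * sg l w (insert v (insert w G))
   = - (sg l w (insert v (insert w G) - {v}) * sg l v (insert v (insert w G)) :: 'r)"
  by (rule sg_remove) (use True assms in auto)
 moreover have "insert v (insert w G) - {w} = insert v G" "insert v (insert w G) - {v} = insert w G" using True by auto
 ultimately have "sg l v G * sg l w (insert w (insert v G)) = - (sg l w G * sg l v (insert v (insert w G)) :: 'r)"
  by (metis insert_commute sg_insert_self)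
 then have "sg l v G * sg l w (insert v G) = - (sg l w G * sg l v (insert w G) :: 'r)"
  by simp
 then have "sg l v G * (sg l w (insert v G) * f (insert v (insert w G))) = - (sg l w G * (sg l v (insert w G) * f (insert v (insert w G))))"
  by (rule mult_anti_assoc)
 moreover have "ct l v (ct l w f) G = sg l v G * (sg l w (insert v G) * f (insert w (insert v G)))"
  using True by (auto simp: ct_def)
 moreover have "ct l w (ct l v f) G = sg l w G * (sg l v (insert w G) * f (insert v (insert w G)))"
  using True by (auto simp: ct_def)
 moreover have "f (insert w (insert v G)) = f (insert v (insert w G))"
  by (simp only: insert_commute)
 ultimately show ?thesis by (simp only:)
qed (auto simp: ct_def insert_absorb)

lemma wd_wd_anti:
 fixes f :: "'v set => 'r::comm_ring_1"
 assumes "distinct l" "v \<in> set l" "w \<in> set l"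
 shows "wd l v (wd l w f) G = - wd l w (wd l v f) G"
proof (cases "v ~= w \<and> v \<in> G \<and> w \<in> G")
 case True
 have "sg l v (G - {w}) * sg l w G = - (sg l w (G - {v}) * sg l v G :: 'r)"
  by (rule sg_remove) (use True assms in auto)
 then have "sg l w G * sg l v (G - {w}) = - (sg l v G * sg l w (G - {v}) :: 'r)"
  by (simp add: mult.commute)
 then have "sg l w G * (sg l v (G - {w}) * f (G - {v} - {w})) = - (sg l v G * (sg l w (G - {v}) * f (G - {v} - {w})))"
  by (rule mult_anti_assoc)
 moreover have "G - {w} - {v} = G - {v} - {w}" by auto
 ultimately have "sg l v G * (sg l w (G - {v}) * f (G - {v} - {w})) = - (sg l w G * (sg l v (G - {w}) * f (G - {w} - {v})))"
  by simp
 with True show ?thesis by (auto simp: wd_def)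
qed (auto simp: wd_def)

definition bnd :: "'v list => ('v set => 'r::comm_ring_1) => 'v set => 'r" where
 "bnd l f G = (\<Sum>v\<in>set l. ct l v f G)"

definition cob :: "'v list => ('v set => 'r::comm_ring_1) => 'v set => 'r" where
 "cob l f G = (\<Sum>v\<in>set l. wd l v f G)"

lemma ct_sum: "ct l v (\<lambda>G. \<Sum>i\<in>I. f i G) G = (\<Sum>i\<in>I. ct l v (f i) G)"
 by (simp add: ct_def sum_distrib_left)

lemma wd_sum: "wd l v (\<lambda>G. \<Sum>i\<in>I. f i G) G = (\<Sum>i\<in>I. wd l v (f i) G)"
 by (simp add: wd_def sum_distrib_left)

lemma ct_linear:
 "ct l v (\<lambda>G. f G + g G) G = ct l v f G + ct l v g G"
 "ct l v (\<lambda>G. f G - g G) G = ct l v f G - ct l v g G"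
 "ct l v (\<lambda>G. - f G) G = - ct l v f G"
 "ct l v (\<lambda>G. c * f G) G = c * ct l v f G"
 "ct l v (\<lambda>G. 0) G = 0"
 by (simp_all add: ct_def distrib_left right_diff_distrib mult.left_commute[of _ c])

lemma wd_linear:
 "wd l v (\<lambda>G. f G + g G) G = wd l v f G + wd l v g G"
 "wd l v (\<lambda>G. f G - g G) G = wd l v f G - wd l v g G"
 "wd l v (\<lambda>G. - f G) G = - wd l v f G"
 "wd l v (\<lambda>G. c * f G) G = c * wd l v f G"
 "wd l v (\<lambda>G. 0) G = 0"
 by (simp_all add: wd_def distrib_left right_diff_distrib mult.left_commute[of _ c])

lemma bnd_linear:
 "bnd l (\<lambda>G. f G + g G) G = bnd l f G + bnd l g G"
 "bnd l (\<lambda>G. f G - g G) G = bnd l f G - bnd l g G"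
 "bnd l (\<lambda>G. - f G) G = - bnd l f G"
 "bnd l (\<lambda>G. c * f G) G = c * bnd l f G"
 "bnd l (\<lambda>G. 0) G = 0"
 by (auto simp: bnd_def ct_linear sum.distrib sum_subtractf sum_negf sum_distrib_left)

lemma cob_linear:
 "cob l (\<lambda>G. f G + g G) G = cob l f G + cob l g G"
 "cob l (\<lambda>G. f G - g G) G = cob l f G - cob l g G"
 "cob l (\<lambda>G. - f G) G = - cob l f G"
 "cob l (\<lambda>G. c * f G) G = c * cob l f G"
 "cob l (\<lambda>G. 0) G = 0"
 by (auto simp: cob_def wd_linear sum.distrib sum_subtractf sum_negf sum_distrib_left)

text \<open>All mixed terms cancel by anticommutation, so contraction by a single vertex is a
  contracting homotopy of the full coboundary. This is the acyclicity of cones, used for the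
  monomials in \<open>row\<close>.\<close>

lemma ct_cob:
 assumes l: "distinct l" "v \<in> set l"
 shows "ct l v (cob l f) G + cob l (ct l v f) G = f G"
proof -
 have "ct l v (cob l f) G = (\<Sum>w\<in>set l. ct l v (wd l w f) G)"
  using ct_sum[of l v "\<lambda>w. wd l w f" "set l" G] by (simp add: cob_def[abs_def])
 then have "ct l v (cob l f) G + cob l (ct l v f) G = (\<Sum>w\<in>set l. ct l v (wd l w f) G + wd l w (ct l v f) G)"
  by (simp add: cob_def sum.distrib)
 also have "\<dots> = (\<Sum>w\<in>{v}. ct l v (wd l w f) G + wd l w (ct l v f) G)"
  by (intro sum.mono_neutral_right ballI) (use l in \<open>simp_all add: ct_wd_anti[OF l, OF _ not_sym]\<close>)
 finally show ?thesis by (simp add: ct_wd_same)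
qed

lemma bnd_wd:
 assumes l: "distinct l" "v \<in> set l"
 shows "bnd l (wd l v f) G + wd l v (bnd l f) G = f G"
proof -
 have "wd l v (bnd l f) G = (\<Sum>w\<in>set l. wd l v (ct l w f) G)"
  using wd_sum[of l v "\<lambda>w. ct l w f" "set l" G] by (simp add: bnd_def[abs_def])
 then have "bnd l (wd l v f) G + wd l v (bnd l f) G = (\<Sum>w\<in>set l. ct l w (wd l v f) G + wd l v (ct l w f) G)"
  by (simp add: bnd_def sum.distrib)
 also have "\<dots> = (\<Sum>w\<in>{v}. ct l w (wd l v f) G + wd l v (ct l w f) G)"
  by (intro sum.mono_neutral_right ballI) (use l in \<open>simp_all add: ct_wd_anti\<close>)
 finally show ?thesis by (simp add: ct_wd_same)
qed

lemma ct_ct_same: "ct l v (ct l v f) G = 0" by (simp add: ct_def)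
lemma wd_wd_same: "wd l v (wd l v f) G = 0" by (simp add: wd_def)

text \<open>The sum is not compared with its own negative, since the characteristic may be 2; for
  the same reason the vanishing of the diagonal is a separate assumption.\<close>

lemma antisym_sum_zero:
 fixes a :: "'i => 'i => 'r::ab_group_add"
 assumes "finite I" "\<And>i. i \<in> I ==> a i i = 0" "\<And>i j. i \<in> I ==> j \<in> I ==> i ~= j ==> a i j = - a j i"
 shows "(\<Sum>i\<in>I. \<Sum>j\<in>I. a i j) = 0"
 using assms
proof (induction I)
 case empty
 show ?case by simp
next
 case (insert x I)
 have "(\<Sum>i\<in>I. \<Sum>j\<in>I. a i j) = 0"
 proof (rule insert.IH)
  show "a i i = 0" if "i \<in> I" for i
   by (rule insert.prems(1)) (use that in simp)
  show "a i j = - a j i" if "i \<in> I" "j \<in> I" "i ~= j" for i j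
   by (rule insert.prems(2)) (use that in simp_all)
 qed
 moreover have "(\<Sum>i\<in>I. a i x) = (\<Sum>i\<in>I. - a x i)"
  by (rule sum.cong[OF refl], rule insert.prems(2)) (use insert.hyps in auto)
 moreover have "a x x = 0" by (rule insert.prems(1)) simp
 ultimately show ?case using insert.hyps by (simp add: sum.distrib sum_negf)
qed

lemma bnd_bnd: assumes "distinct l" shows "bnd l (bnd l f) G = 0"
proof -
 have "bnd l (bnd l f) G = (\<Sum>v\<in>set l. \<Sum>w\<in>set l. ct l v (ct l w f) G)"
  using ct_sum[of l _ "\<lambda>w. ct l w f" "set l" G] by (simp add: bnd_def[abs_def])
 also have "\<dots> = 0" by (rule antisym_sum_zero) (rule finite_set, rule ct_ct_same, rule ct_ct_anti[OF assms])
 finally show ?thesis .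
qed

lemma cob_cob: assumes "distinct l" shows "cob l (cob l f) G = 0"
proof -
 have "cob l (cob l f) G = (\<Sum>v\<in>set l. \<Sum>w\<in>set l. wd l v (wd l w f) G)"
  using wd_sum[of l _ "\<lambda>w. wd l w f" "set l" G] by (simp add: cob_def[abs_def])
 also have "\<dots> = 0" by (rule antisym_sum_zero) (rule finite_set, rule wd_wd_same, rule wd_wd_anti[OF assms])
 finally show ?thesis .
qed

section \<open>The Koszul double complex of a complex relative to a face\<close>

text \<open>A diagram chase in a double complex with cochain degree p and Koszul degree q, running
  from column p up to column e and back. As \<open>del t\<close> is a coboundary, \<open>d t\<close>
  is a Koszul cycle, hence up to a multiplier a Koszul boundary \<open>del s1\<close>, and
  \<open>s1\<close> satisfies the same hypothesis one step further along the diagonal. On the way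
  back the multiple of t by b, corrected by a Koszul boundary, becomes a cocycle in the subcomplex
  \<open>Tp\<close>, whose rows are exact.\<close>

lemma zigzag:
 fixes T Tp :: "int => nat => 'a::ab_group_add set" and act :: "'s::comm_monoid_mult => 'a => 'a"
  and d del :: "'a => 'a"
 assumes Tpd: "\<And>p q x y. x \<in> Tp p q ==> y \<in> Tp p q ==> x - y \<in> Tp p q"
  and TpT: "\<And>p q. Tp p q \<subseteq> T p q"
  and aT: "\<And>p q u x. x \<in> T p q ==> act u x \<in> T p q"
  and aTp: "\<And>p q u x. x \<in> Tp p q ==> act u x \<in> Tp p q"
  and bT: "\<And>p q x. x \<in> T p q ==> act b x \<in> Tp p q"
  and dT: "\<And>p q x. x \<in> T p q ==> d x \<in> T (p + 1) q"
  and delTp: "\<And>p q x. x \<in> Tp p (Suc q) ==> del x \<in> Tp p q"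
  and d_diff: "\<And>x y. d (x - y) = d x - d y"
  and del_add: "\<And>x y. del (x + y) = del x + del y"
  and comm: "\<And>x. d (del x) = del (d x)" and dd: "\<And>x. d (d x) = 0" and deldel: "\<And>x. del (del x) = 0"
  and act_d: "\<And>u x. act u (d x) = d (act u x)" and act_del: "\<And>u x. act u (del x) = del (act u x)"
  and act_act: "\<And>u w x. act u (act w x) = act (u * w) x"
  and U: "\<And>u w. u \<in> U ==> w \<in> U ==> u * w \<in> U"
  and col: "\<And>p q t. f < p ==> p \<le> e ==> 1 \<le> q ==> t \<in> T p q ==> del t = 0 ==>
     \<exists>u\<in>U. \<exists>s\<in>T p (Suc q). act u t = del s"
  and row: "\<And>p q t. f \<le> p ==> p < e ==> t \<in> Tp p q ==> d t = 0 ==> \<exists>s\<in>Tp (p - 1) q. t = d s"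
  and top: "\<And>q t. e - f < int q ==> t \<in> T e q ==> del t \<in> d ` T (e - 1) (q - 1) ==>
     \<exists>u\<in>U. \<exists>s\<in>Tp e (Suc q). \<exists>r\<in>Tp (e - 1) q. act u (act b t) = del s + d r"
  and p: "f \<le> p" "p \<le> e"
  and t: "p - f < int q" "t \<in> T p q" "del t \<in> d ` T (p - 1) (q - 1)"
 shows "\<exists>u\<in>U. \<exists>s\<in>Tp p (Suc q). \<exists>r\<in>Tp (p - 1) q. act u (act b t) = del s + d r"
 using p(2) p(1) t
proof (induction p arbitrary: q t rule: int_le_induct)
 case base
 then show ?case using top by blast
next
 case (step p)
 define p' where "p' = p - 1"
 have pp: "p' + 1 = p" "p' - 1 + 1 = p'" by (auto simp: p'_def)
 have dt: "d t \<in> T p q" using dT step.prems(3) pp by (metis p'_def)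
 obtain r0 where r0: "del t = d r0" using step.prems(4) by auto
 have "del (d t) = 0" by (metis comm r0 dd)
 moreover have "f < p" "1 \<le> q" using step.prems(1,2) by auto
 ultimately obtain u s1 where u: "u \<in> U" "s1 \<in> T p (Suc q)" "act u (d t) = del s1"
  using col[of p q "d t"] dt step.hyps by auto
 \<comment> \<open>The Koszul boundary of \<open>s1\<close> is the coboundary of
   \<open>act u t\<close>, so the induction hypothesis applies to \<open>s1\<close> with q raised by
   one.\<close>
 have "del s1 \<in> d ` T (p - 1) (Suc q - 1)"
  using u(3) aT[OF step.prems(3)] act_d by (metis diff_Suc_1 imageI)
 moreover have "p - f < int (Suc q)" using step.prems(2) by simp
 moreover have "f \<le> p" using step.prems(1) by simp
 ultimately obtain w s2 s3 where w: "w \<in> U" "s2 \<in> Tp p (Suc (Suc q))" "s3 \<in> Tp p' (Suc q)"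
   "act w (act b s1) = del s2 + d s3"
  using step.IH[of "Suc q" s1] u(2) unfolding p'_def by blast
 \<comment> \<open>The factor b puts this multiple of t into \<open>Tp\<close>; the Koszul boundary
   of \<open>s3\<close> has the same coboundary, so the difference is a cocycle.\<close>
 define t' where "t' = act w (act b (act u t))"
 have t': "t' \<in> Tp p' q"
  unfolding t'_def p'_def by (intro aTp bT aT step.prems(3))
 have "d t' = act w (act b (act u (d t)))" by (simp add: t'_def act_d)
 also have "\<dots> = del (act w (act b s1))" by (simp add: u(3) act_del)
 also have "\<dots> = d (del s3)" by (simp add: w(4) del_add deldel comm)
 finally have "d (t' - del s3) = 0" by (simp add: d_diff)
 moreover have "t' - del s3 \<in> Tp p' q" by (intro Tpd t' delTp w(3))
 moreover have "f \<le> p'" "p' < e" using step.prems(1) step.hyps by (auto simp: p'_def)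
 ultimately obtain r where r: "r \<in> Tp (p' - 1) q" "t' - del s3 = d r" using row by blast
 have "act (w * u) (act b t) = t'" by (simp add: t'_def act_act ac_simps)
 then have "act (w * u) (act b t) = del s3 + d r" using r(2) by (simp add: algebra_simps)
 then show ?case using U[OF w(1) u(1)] w(3) r(1) unfolding p'_def by blast
qed

section \<open>Polynomials by coefficients, and reduction to normal form\<close>

abbreviation lk :: "('a \<Rightarrow>\<^sub>0 'b::zero) => 'a => 'b" where "lk \<equiv> Poly_Mapping.lookup"
abbreviation kys :: "('a \<Rightarrow>\<^sub>0 'b::zero) => 'a set" where "kys \<equiv> Poly_Mapping.keys"
abbreviation sngl :: "'a => 'b => 'a \<Rightarrow>\<^sub>0 'b::zero" where "sngl \<equiv> Poly_Mapping.single"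

definition flt :: "('a => bool) => ('a \<Rightarrow>\<^sub>0 'k::zero) => ('a \<Rightarrow>\<^sub>0 'k)" where
 "flt P p = Poly_Mapping.mapp (\<lambda>m c. if P m then c else 0) p"

lemma lookup_flt: "lk (flt P p) m = (if P m then lk p m else 0)"
 by (simp add: flt_def lookup_mapp when_def in_keys_iff)

lemma keys_flt: "kys (flt P p) = {m \<in> kys p. P m}"
 by (auto simp: in_keys_iff lookup_flt split: if_splits)

lemma flt_add: "flt P (p + q) = flt P p + flt P (q :: 'a \<Rightarrow>\<^sub>0 'k::comm_ring_1)"
 by (rule poly_mapping_eqI) (simp add: lookup_flt lookup_add)
lemma flt_diff: "flt P (p - q) = flt P p - flt P (q :: 'a \<Rightarrow>\<^sub>0 'k::comm_ring_1)"
 by (rule poly_mapping_eqI) (simp add: lookup_flt lookup_minus)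
lemma flt_uminus: "flt P (- q) = - flt P (q :: 'a \<Rightarrow>\<^sub>0 'k::comm_ring_1)"
 by (rule poly_mapping_eqI) (simp add: lookup_flt lookup_uminus)
lemma flt_zero [simp]: "flt P 0 = 0"
 by (rule poly_mapping_eqI) (simp add: lookup_flt)
lemma flt_sum: "flt P (\<Sum>i\<in>I. f i) = (\<Sum>i\<in>I. flt P (f i :: 'a \<Rightarrow>\<^sub>0 'k::comm_ring_1))"
 by (induction I rule: infinite_finite_induct) (auto simp: flt_add)
text \<open>When P passes from a product to its factors, the monomials violating P span an ideal,
  and \<open>flt P\<close> is the normal form modulo this ideal.\<close>

lemma flt_mult:
 fixes p s :: "('v, 'k::comm_ring_1) mpol"
 assumes "\<And>m m'. P (m + m') ==> P m'"
 shows "flt P (s * flt P p) = flt P (s * p)"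
proof -
 have p: "p = flt P p + flt (\<lambda>m. \<not> P m) p"
  by (rule poly_mapping_eqI) (simp add: lookup_flt lookup_add)
 have "flt P (s * flt (\<lambda>m. \<not> P m) p) = 0"
 proof (rule poly_mapping_eqI)
  fix m
  have "lk (s * flt (\<lambda>m. \<not> P m) p) m = 0" if "P m"
  proof (rule ccontr)
   assume "lk (s * flt (\<lambda>m. \<not> P m) p) m ~= 0"
   then have "m \<in> kys (s * flt (\<lambda>m. \<not> P m) p)" by (simp add: in_keys_iff)
   then obtain a b where "m = a + b" "b \<in> kys (flt (\<lambda>m. \<not> P m) p)"
    using keys_mult by blast
   then show False using that assms by (auto simp: keys_flt)
  qed
  then show "lk (flt P (s * flt (\<lambda>m. \<not> P m) p)) m = lk 0 m" by (simp add: lookup_flt)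
 qed
 then show ?thesis by (subst (2) p) (simp add: distrib_left flt_add)
qed

lemma lookup_sg_mult:
 "lk ((sg l v G :: ('v, 'k::comm_ring_1) mpol) * p) m = sg l v G * lk p m"
 by (induction l) (auto simp: lookup_uminus)

lemma flt_sg: "flt P ((sg l v G :: ('v, 'k::comm_ring_1) mpol) * p) = sg l v G * flt P p"
 by (rule poly_mapping_eqI) (simp add: lookup_flt lookup_sg_mult)

lemma lookup_cob: "lk (cob l (f :: _ => ('v, 'k::comm_ring_1) mpol) G) m = cob l (\<lambda>G. lk (f G) m) G"
 by (simp add: cob_def wd_def lookup_sum lookup_sg_mult if_distrib[of "\<lambda>p. lk p m"] cong: if_cong)

type_synonym ('w, 'l) cell = "'w set => nat set => ('w, 'l) mpol"

text \<open>An element t of the double complex assigns to a face G containing F and a set J of indices a normal form t G J in the face ring of the star of G; d is the cochain differential and del the Koszul differential.\<close>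

locale face_modules =
 fixes \<Delta> :: "'v set set" and vs :: "'v list" and n :: nat and x :: "nat => ('v, 'k::field) mpol"
 assumes vs: "distinct vs" "\<Delta> \<subseteq> Pow (set vs)"
  and down: "\<And>F G. F \<in> \<Delta> ==> G \<subseteq> F ==> G \<in> \<Delta>"
begin

text \<open>For the empty face this is reduction modulo the Stanley-Reisner ideal; for a non-face G
  everything is sent to 0, so cells need no separate condition that G be a face.\<close>

definition cpt :: "'v set => ('v, 'k) mpol => ('v, 'k) mpol" where
 "cpt G = flt (\<lambda>m. kys m \<union> G \<in> \<Delta>)"

lemma lookup_cpt: "lk (cpt G p) m = (if kys m \<union> G \<in> \<Delta> then lk p m else 0)"
 by (simp add: cpt_def lookup_flt)

lemma keys_plus_nat: "kys (m + m' :: 'v \<Rightarrow>\<^sub>0 nat) = kys m \<union> kys m'"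
 by (auto simp: in_keys_iff lookup_add)

lemma cpt_mult: "cpt G (s * cpt G p) = cpt G (s * p)"
 unfolding cpt_def by (rule flt_mult) (erule down, auto simp: keys_plus_nat)

lemma cpt_linear:
 "cpt G (p + q) = cpt G p + cpt G q" "cpt G (p - q) = cpt G p - cpt G q" "cpt G (- q) = - cpt G q"
 "cpt G (\<Sum>i\<in>I. h i) = (\<Sum>i\<in>I. cpt G (h i))" "cpt G (sg l v J * p) = sg l v J * cpt G p"
 by (simp_all add: cpt_def flt_add flt_diff flt_uminus flt_sum flt_sg)

lemma cpt_0 [simp]: "cpt G 0 = 0" by (simp add: cpt_def)

lemma cpt_cpt: "H \<subseteq> G ==> cpt G (cpt H p) = cpt G p"
 by (rule poly_mapping_eqI) (auto simp: lookup_cpt intro: down)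

lemma cpt_eq_mono: "H \<subseteq> G ==> cpt H p = cpt H q ==> cpt G p = cpt G q"
 by (metis cpt_cpt)

lemma cpt_eq_mult: "cpt G p = cpt G q ==> cpt G (s * p) = cpt G (s * q)"
 by (metis cpt_mult)

lemma cpt_nonface: "G \<notin> \<Delta> ==> cpt G p = 0"
 by (rule poly_mapping_eqI) (auto simp: lookup_cpt intro: down)

lemma finite_face: "G \<in> \<Delta> ==> finite G"
 using vs(2) finite_subset by blast

text \<open>\<open>DD\<close>, \<open>KK\<close> and \<open>SS\<close> act on arbitrary functions,
  where the relations of a double complex are formal. The operators \<open>d\<close>,
  \<open>del\<close> and \<open>act\<close> compose them with the projection \<open>PP\<close>; the
  congruence lemmas below show that projecting earlier makes no difference, so the relations
  descend.\<close>

definition DD :: "('v, 'k) cell => ('v, 'k) cell" where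
 "DD t = (\<lambda>G J. cob vs (\<lambda>G'. t G' J) G)"
definition KK :: "('v, 'k) cell => ('v, 'k) cell" where
 "KK t = (\<lambda>G J. \<Sum>j<n. x j * ct [0..<n] j (t G) J)"
definition PP :: "('v, 'k) cell => ('v, 'k) cell" where
 "PP t = (\<lambda>G J. cpt G (t G J))"
definition SS :: "('v, 'k) mpol => ('v, 'k) cell => ('v, 'k) cell" where
 "SS s t = (\<lambda>G J. s * t G J)"
definition d where "d t = PP (DD t)"
definition del where "del t = PP (KK t)"
definition act where "act s t = PP (SS s t)"

lemma PP_eq_iff: "PP a = PP b \<longleftrightarrow> (\<forall>G J. cpt G (a G J) = cpt G (b G J))"
 by (auto simp: PP_def fun_eq_iff)

lemma PP_DD_cong: "PP a = PP b ==> PP (DD a) = PP (DD b)"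
proof -
 assume ab: "PP a = PP b"
 have "cpt G (sg vs v G * a (G - {v}) J) = cpt G (sg vs v G * b (G - {v}) J)" for G J v
  by (rule cpt_eq_mult, rule cpt_eq_mono[of "G - {v}"]) (use ab in \<open>auto simp: PP_eq_iff\<close>)
 then show ?thesis
  by (auto simp: PP_eq_iff DD_def cob_def wd_def cpt_linear(4) intro!: sum.cong)
qed

lemma PP_KK_cong: "PP a = PP b ==> PP (KK a) = PP (KK b)"
proof -
 assume ab: "PP a = PP b"
 have "cpt G (x j * ct [0..<n] j (a G) J) = cpt G (x j * ct [0..<n] j (b G) J)" for G J j
  by (rule cpt_eq_mult) (use ab in \<open>auto simp: PP_eq_iff ct_def intro: cpt_eq_mult\<close>)
 then show ?thesis
  by (auto simp: PP_eq_iff KK_def cpt_linear(4) intro!: sum.cong)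
qed

lemma PP_SS_cong: "PP a = PP b ==> PP (SS s a) = PP (SS s b)"
 by (auto simp: PP_eq_iff SS_def intro: cpt_eq_mult)

lemma PP_PP [simp]: "PP (PP t) = PP t" by (auto simp: PP_def cpt_cpt)

lemma PP_DD_PP [simp]: "PP (DD (PP t)) = PP (DD t)" by (rule PP_DD_cong) simp
lemma PP_KK_PP [simp]: "PP (KK (PP t)) = PP (KK t)" by (rule PP_KK_cong) simp
lemma PP_SS_PP [simp]: "PP (SS s (PP t)) = PP (SS s t)" by (rule PP_SS_cong) simp

lemma PP_diff: "PP (a - b) = PP a - PP b" by (simp add: PP_def fun_eq_iff cpt_linear)
lemma PP_add: "PP (a + b) = PP a + PP b" by (simp add: PP_def fun_eq_iff cpt_linear)
lemma PP_0 [simp]: "PP 0 = 0" by (simp add: PP_def fun_eq_iff)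
lemma DD_diff: "DD (a - b) = DD a - DD b" by (simp add: DD_def fun_eq_iff cob_linear)
lemma DD_add: "DD (a + b) = DD a + DD b" by (simp add: DD_def fun_eq_iff cob_linear)
lemma KK_diff: "KK (a - b) = KK a - KK b"
 by (simp add: KK_def fun_eq_iff ct_def right_diff_distrib sum_subtractf fun_diff_def if_distrib cong: if_cong)
  (auto intro!: sum.cong simp: sum_subtractf[symmetric] right_diff_distrib)
lemma KK_add: "KK (a + b) = KK a + KK b"
 by (auto simp: KK_def fun_eq_iff ct_def distrib_left sum.distrib[symmetric] intro!: sum.cong)
lemma SS_diff: "SS s (a - b) = SS s a - SS s b" by (simp add: SS_def fun_eq_iff right_diff_distrib)
lemma SS_add: "SS s (a + b) = SS s a + SS s b" by (simp add: SS_def fun_eq_iff distrib_left)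

lemma d_linear: "d (a - b) = d a - d b" "d (a + b) = d a + d b"
 by (simp_all add: d_def DD_diff DD_add PP_diff PP_add)
lemma del_linear: "del (a - b) = del a - del b" "del (a + b) = del a + del b"
 by (simp_all add: del_def KK_diff KK_add PP_diff PP_add)
lemma act_linear: "act s (a - b) = act s a - act s b" "act s (a + b) = act s a + act s b"
 by (simp_all add: act_def SS_diff SS_add PP_diff PP_add)

lemma DD_DD: "DD (DD t) = 0"
 by (simp add: DD_def fun_eq_iff cob_cob vs)

lemma KK_KK: "KK (KK t) = 0"
proof (intro ext)
 fix G J
 have "KK (KK t) G J = (\<Sum>i<n. \<Sum>j<n. x i * (x j * ct [0..<n] i (ct [0..<n] j (t G)) J))"
  unfolding KK_def ct_sum ct_linear(4) by (simp add: sum_distrib_left)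
 also have "\<dots> = 0"
 proof (rule antisym_sum_zero)
  fix i j assume ij: "i \<in> {..<n}" "j \<in> {..<n}" "i ~= j"
  have "ct [0..<n] i (ct [0..<n] j (t G)) J = - ct [0..<n] j (ct [0..<n] i (t G)) J"
   by (rule ct_ct_anti) (use ij in auto)
  then show "x i * (x j * ct [0..<n] i (ct [0..<n] j (t G)) J) = - (x j * (x i * ct [0..<n] j (ct [0..<n] i (t G)) J))"
   by (simp add: mult.left_commute)
 qed (auto simp: ct_ct_same)
 finally show "KK (KK t) G J = 0 G J" by simp
qed

lemma DD_KK: "DD (KK t) = KK (DD t)"
proof (intro ext)
 fix G J
 have "DD (KK t) G J = (\<Sum>v\<in>set vs. \<Sum>j<n. x j * wd vs v (\<lambda>G'. ct [0..<n] j (t G') J) G)"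
  unfolding DD_def KK_def cob_def wd_sum wd_linear(4) ..
 also have "\<dots> = (\<Sum>j<n. \<Sum>v\<in>set vs. x j * wd vs v (\<lambda>G'. ct [0..<n] j (t G') J) G)"
  by (rule sum.swap)
 also have "\<dots> = (\<Sum>j<n. x j * (\<Sum>v\<in>set vs. ct [0..<n] j (\<lambda>J. wd vs v (\<lambda>G'. t G' J) G) J))"
  unfolding sum_distrib_left by (intro sum.cong refl) (simp add: wd_def ct_def mult.left_commute)
 also have "\<dots> = KK (DD t) G J"
  unfolding DD_def KK_def cob_def by (simp only: ct_sum)
 finally show "DD (KK t) G J = KK (DD t) G J" .
qed

lemma DD_SS: "DD (SS s t) = SS s (DD t)" by (simp add: DD_def SS_def fun_eq_iff cob_linear)
lemma KK_SS: "KK (SS s t) = SS s (KK t)"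
 by (simp add: KK_def SS_def fun_eq_iff ct_linear sum_distrib_left mult.left_commute)

lemma comm: "d (del t) = del (d t)" by (simp add: d_def del_def DD_KK)
lemma dd: "d (d t) = 0" by (simp add: d_def DD_DD)
lemma deldel: "del (del t) = 0" by (simp add: del_def KK_KK)
lemma act_d: "act s (d t) = d (act s t)" by (simp add: d_def act_def DD_SS)
lemma act_del: "act s (del t) = del (act s t)" by (simp add: del_def act_def KK_SS)
lemma act_act: "act s (act r t) = act (s * r) t" by (simp add: act_def) (simp add: SS_def mult.assoc)

text \<open>The index p counts the vertices of G and is an integer, so that the column before the
  first one is simply 0.\<close>

definition T :: "'v set => int => nat => ('v, 'k) cell set" where
 "T F p q = {t. PP t = t \<and> (\<forall>G J. t G J ~= 0 --> F \<subseteq> G \<and> int (card G) = p \<and> J \<subseteq> {..<n} \<and> card J = q)}"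

lemma T_0: "0 \<in> T F p q" by (simp add: T_def)

lemma T_PP: "t \<in> T F p q ==> PP t = t" by (simp add: T_def)
lemma T_face: "t \<in> T F p q ==> t G J ~= 0 ==> G \<in> \<Delta> \<and> F \<subseteq> G \<and> int (card G) = p \<and> J \<subseteq> {..<n} \<and> card J = q"
 by (auto simp: T_def PP_def fun_eq_iff) (metis cpt_nonface)

lemma T_I: "PP t = t ==> (\<And>G J. t G J ~= 0 ==> F \<subseteq> G \<and> int (card G) = p \<and> J \<subseteq> {..<n} \<and> card J = q) ==> t \<in> T F p q"
 by (simp add: T_def)

lemma T_diff: assumes "a \<in> T F p q" "b \<in> T F p q" shows "a - b \<in> T F p q"
proof (rule T_I)
 show "PP (a - b) = a - b" using assms by (simp add: PP_diff T_PP)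
 fix G J assume "(a - b) G J ~= 0"
 then have "a G J ~= 0 \<or> b G J ~= 0" by auto
 then show "F \<subseteq> G \<and> int (card G) = p \<and> J \<subseteq> {..<n} \<and> card J = q"
  using T_face[OF assms(1), of G J] T_face[OF assms(2), of G J] by blast
qed

lemma T_add: assumes "a \<in> T F p q" "b \<in> T F p q" shows "a + b \<in> T F p q"
 using T_diff[OF assms(1) T_diff[OF T_0 assms(2)]] by simp

lemma T_act: assumes "t \<in> T F p q" shows "act s t \<in> T F p q"
proof (rule T_I)
 show "PP (act s t) = act s t" by (simp add: act_def)
 fix G J assume "act s t G J ~= 0"
 then have "t G J ~= 0" by (auto simp: act_def PP_def SS_def)
 then show "F \<subseteq> G \<and> int (card G) = p \<and> J \<subseteq> {..<n} \<and> card J = q"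
  using T_face[OF assms] by auto
qed

lemma T_d: assumes "t \<in> T F p q" shows "d t \<in> T F (p + 1) q"
proof -
 have "F \<subseteq> G \<and> int (card G) = p + 1 \<and> J \<subseteq> {..<n} \<and> card J = q" if nz: "d t G J ~= 0" for G J
 proof -
  have "finite G" using nz finite_face cpt_nonface unfolding d_def PP_def by metis
  moreover have "DD t G J ~= 0" using nz by (auto simp: d_def PP_def)
  then obtain v where v: "v \<in> G" "t (G - {v}) J ~= 0"
   unfolding DD_def cob_def wd_def by (smt (verit) mult_zero_right sum.neutral)
  ultimately have "card G = Suc (card (G - {v}))" using card.remove by fastforce
  then show ?thesis using T_face[OF assms v(2)] by auto
 qed
 then show ?thesis by (simp add: T_def d_def)
qed

lemma T_del: assumes "t \<in> T F p (Suc q)" shows "del t \<in> T F p q"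
proof -
 have "F \<subseteq> G \<and> int (card G) = p \<and> J \<subseteq> {..<n} \<and> card J = q" if nz: "del t G J ~= 0" for G J
 proof -
  have "KK t G J ~= 0" using nz by (auto simp: del_def PP_def)
  then obtain j where j: "j < n" "j \<notin> J" "t G (insert j J) ~= 0"
   unfolding KK_def ct_def by (smt (verit) mult_zero_right sum.neutral lessThan_iff)
  then have h: "F \<subseteq> G" "int (card G) = p" "insert j J \<subseteq> {..<n}" "card (insert j J) = Suc q"
   using T_face[OF assms j(3)] by auto
  then have "finite J" by (meson finite_subset finite_lessThan subset_insertI)
  then show ?thesis using h j(2) by auto
 qed
 then show ?thesis by (simp add: T_def del_def)
qed

text \<open>The cochain differential preserves the coefficient of each monomial m. If m involves a
  vertex v outside F, the faces compatible with m form a cone over v and contraction by v gives a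
  primitive. Otherwise m is supported in F and its row is the cochain complex of the faces
  containing F, where \<open>coh\<close> applies. The last clause of the conclusion says that no new
  monomials appear; it keeps the primitive free of constant terms when t is.\<close>

lemma row:
 assumes t: "t \<in> T F p q" "d t = 0"
  and coh: "\<And>m f. (\<exists>G J. lk (t G J) m ~= 0) ==> kys m \<subseteq> F ==>
   (\<And>G. f G ~= (0::'k) ==> G \<in> \<Delta> \<and> F \<subseteq> G \<and> int (card G) = p) ==> (\<And>G. G \<in> \<Delta> ==> cob vs f G = 0) ==>
   \<exists>g. (\<forall>G. g G ~= 0 --> G \<in> \<Delta> \<and> F \<subseteq> G \<and> int (card G) = p - 1) \<and> (\<forall>G\<in>\<Delta>. cob vs g G = f G)"
 shows "\<exists>s\<in>T F (p - 1) q. t = d s \<and> (\<forall>m. (\<forall>G J. lk (t G J) m = 0) --> (\<forall>G J. lk (s G J) m = 0))"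
proof -
 have supp: "kys m \<union> G \<in> \<Delta> \<and> F \<subseteq> G \<and> int (card G) = p \<and> J \<subseteq> {..<n} \<and> card J = q"
  if "lk (t G J) m ~= 0" for G J m
 proof -
  have "t G J ~= 0" using that by auto
  moreover have "t G J = cpt G (t G J)" using T_PP[OF t(1)] by (simp add: PP_def fun_eq_iff)
  then have "kys m \<union> G \<in> \<Delta>" using that by (metis lookup_cpt)
  ultimately show ?thesis using T_face[OF t(1)] by blast
 qed
 have closed: "cob vs (\<lambda>G. lk (t G J) m) G = 0" if "kys m \<union> G \<in> \<Delta>" for G J m
 proof -
  have "lk (d t G J) m = 0" using t(2) by simp
  then show ?thesis using that by (simp add: d_def PP_def DD_def lookup_cpt lookup_cob)
 qed
 have "\<exists>g. (\<forall>G. g G ~= 0 --> kys m \<union> G \<in> \<Delta> \<and> F \<subseteq> G \<and> int (card G) = p - 1)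
   \<and> (\<forall>G. kys m \<union> G \<in> \<Delta> --> cob vs g G = lk (t G J) m) \<and> ((\<forall>G. lk (t G J) m = 0) --> g = 0)"
  for m J
 proof (cases "\<forall>G. lk (t G J) m = 0")
  case True
  then show ?thesis by (intro exI[of _ 0]) (simp add: zero_fun_def cob_linear)
 next
  case nz: False
  show ?thesis
  proof (cases "kys m \<subseteq> F")
   case True
   have "\<exists>g. (\<forall>G. g G ~= 0 --> G \<in> \<Delta> \<and> F \<subseteq> G \<and> int (card G) = p - 1) \<and> (\<forall>G\<in>\<Delta>. cob vs g G = lk (t G J) m)"
   proof (rule coh)
    show "\<exists>G J. lk (t G J) m ~= 0" using nz by auto
    show "kys m \<subseteq> F" by fact
    show "G \<in> \<Delta> \<and> F \<subseteq> G \<and> int (card G) = p" if "lk (t G J) m ~= 0" for G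
     using supp[OF that] by (meson down Un_upper2)
    show "cob vs (\<lambda>G. lk (t G J) m) G = 0" if "G \<in> \<Delta>" for G
    proof (cases "F \<subseteq> G")
     case True
     then have "kys m \<union> G = G" using \<open>kys m \<subseteq> F\<close> by auto
     then show ?thesis using closed[of m G] that by simp
    next
     case False
     then have "lk (t (G - {v}) J) m = 0" for v using supp[of "G - {v}" J m] by blast
     then show ?thesis by (auto simp: cob_def wd_def intro!: sum.neutral)
    qed
   qed
   then obtain g where g: "\<And>G. g G ~= 0 ==> G \<in> \<Delta> \<and> F \<subseteq> G \<and> int (card G) = p - 1"
    "\<And>G. G \<in> \<Delta> ==> cob vs g G = lk (t G J) m" by blast
   have "kys m \<union> G \<in> \<Delta> \<and> F \<subseteq> G \<and> int (card G) = p - 1" if "g G ~= 0" for G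
   proof -
    have "kys m \<union> G = G" using g(1)[OF that] True by auto
    then show ?thesis using g(1)[OF that] by simp
   qed
   moreover have "cob vs g G = lk (t G J) m" if "kys m \<union> G \<in> \<Delta>" for G
    using g(2) down[OF that] by blast
   ultimately show ?thesis using nz by blast
  next
   case False
   then obtain v where v: "v \<in> kys m" "v \<notin> F" by auto
   obtain G J' where "lk (t G J') m ~= 0" using nz by auto
   then have vv: "v \<in> set vs" using supp vs(2) v(1) by blast
   \<comment> \<open>Adding v to G does not change the union of G with the support of m, so
     compatibility with m survives the contraction; as v is outside F, so does containing F.\<close>
   define g where "g = ct vs v (\<lambda>G. lk (t G J) m)"
   have "kys m \<union> G \<in> \<Delta> \<and> F \<subseteq> G \<and> int (card G) = p - 1" if "g G ~= 0" for G
   proof -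
    have a: "v \<notin> G" "lk (t (insert v G) J) m ~= 0" using that by (auto simp: g_def ct_def split: if_splits)
    note s = supp[OF a(2)]
    have "finite (insert v G)" using s finite_face down Un_upper2 by metis
    then have "card (insert v G) = Suc (card G)" using a(1) by simp
    moreover have "kys m \<union> insert v G = kys m \<union> G" using v(1) by auto
    ultimately show ?thesis using s v(2) by auto
   qed
   moreover have "cob vs g G = lk (t G J) m" if G: "kys m \<union> G \<in> \<Delta>" for G
   proof -
    have "kys m \<union> insert v G \<in> \<Delta>" using G v(1) by (simp add: insert_absorb)
    then have "ct vs v (cob vs (\<lambda>G. lk (t G J) m)) G = 0"
     using closed by (simp add: ct_def)
    then show ?thesis using ct_cob[OF vs(1) vv, of "\<lambda>G. lk (t G J) m" G] by (simp add: g_def)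
   qed
   ultimately show ?thesis using nz by blast
  qed
 qed
 then have "\<forall>m J. \<exists>g. (\<forall>G. g G ~= 0 --> kys m \<union> G \<in> \<Delta> \<and> F \<subseteq> G \<and> int (card G) = p - 1)
   \<and> (\<forall>G. kys m \<union> G \<in> \<Delta> --> cob vs g G = lk (t G J) m) \<and> ((\<forall>G. lk (t G J) m = 0) --> g = 0)"
  by blast
 then obtain gg where gg1: "\<And>m J G. gg m J G ~= 0 ==> kys m \<union> G \<in> \<Delta> \<and> F \<subseteq> G \<and> int (card G) = p - 1"
  and gg2: "\<And>m J G. kys m \<union> G \<in> \<Delta> ==> cob vs (gg m J) G = lk (t G J) m"
  and gg3: "\<And>m J. (\<forall>G. lk (t G J) m = 0) ==> gg m J = 0"
  unfolding choice_iff by blast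
 \<comment> \<open>The monomials occurring in t: a finite set, so that the primitives chosen
   coefficient by coefficient can be summed to a polynomial.\<close>
 define M where "M = (\<Union>G\<in>Pow (set vs). \<Union>J\<in>Pow {..<n}. kys (t G J))"
 have finM: "finite M" by (auto simp: M_def)
 define s where "s = (\<lambda>G J. \<Sum>m\<in>M. sngl m (gg m J G))"
 have ls: "lk (s G J) m = gg m J G" for G J m
 proof -
  have "lk (s G J) m = (\<Sum>m'\<in>M. if m' = m then gg m J G else 0)"
   unfolding s_def lookup_sum by (rule sum.cong) (auto simp: lookup_single when_def)
  also have "\<dots> = (if m \<in> M then gg m J G else 0)" using finM by simp
  also have "\<dots> = gg m J G"
  proof (cases "m \<in> M")
   case False
   have "lk (t G' J) m = 0" for G'
   proof (rule ccontr)
    assume nz: "lk (t G' J) m ~= 0"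
    have "G' \<subseteq> set vs" "J \<subseteq> {..<n}" using supp[OF nz] vs(2) by auto
    then show False using False nz by (auto simp: M_def in_keys_iff)
   qed
   then show ?thesis using False gg3 by (simp add: zero_fun_def)
  qed simp
  finally show ?thesis .
 qed
 have "PP s = s"
  by (intro ext poly_mapping_eqI) (use gg1 in \<open>auto simp: PP_def lookup_cpt ls\<close>)
 moreover have "F \<subseteq> G \<and> int (card G) = p - 1 \<and> J \<subseteq> {..<n} \<and> card J = q" if nz: "s G J ~= 0" for G J
 proof -
  obtain m where m: "gg m J G ~= 0" using nz by (metis ls lookup_zero poly_mapping_eqI)
  then have "\<not> (\<forall>G. lk (t G J) m = 0)" using gg3[of J m] by (metis zero_fun_apply)
  then show ?thesis using gg1[OF m] supp by blast
 qed
 ultimately have "s \<in> T F (p - 1) q" by (rule T_I)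
 moreover have "t = d s"
 proof (intro ext poly_mapping_eqI)
  fix G J m
  show "lk (t G J) m = lk (d s G J) m"
   using supp[of G J m] gg2[of m G J] by (cases "kys m \<union> G \<in> \<Delta>") (auto simp: d_def PP_def DD_def lookup_cpt lookup_cob ls)
 qed
 moreover have "\<forall>m. (\<forall>G J. lk (t G J) m = 0) --> (\<forall>G J. lk (s G J) m = 0)"
  using gg3 by (simp add: ls)
 ultimately show ?thesis by blast
qed

end

section \<open>Multiplication by monomials and division by a power of a variable\<close>

lemma poly_mapping_sum_single: "p = (\<Sum>m\<in>kys p. sngl m (lk p m))"
proof (rule poly_mapping_eqI)
 fix m
 have "lk (\<Sum>m\<in>kys p. sngl m (lk p m)) m = (\<Sum>m'\<in>kys p. if m' = m then lk p m else 0)"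
  unfolding lookup_sum by (rule sum.cong) (auto simp: lookup_single when_def)
 also have "\<dots> = lk p m" by (auto simp: in_keys_iff)
 finally show "lk p m = lk (\<Sum>m\<in>kys p. sngl m (lk p m)) m" by simp
qed

lemma lookup_single_mult:
 fixes p :: "('v, 'k::comm_ring_1) mpol"
 shows "lk (sngl k c * p) (k + m) = c * lk p m"
proof -
 have "sngl k c * p = (\<Sum>m\<in>kys p. sngl (k + m) (c * lk p m))"
  by (subst (1) poly_mapping_sum_single[of p]) (simp add: sum_distrib_left mult_single)
 then have "lk (sngl k c * p) (k + m) = (\<Sum>m'\<in>kys p. if m' = m then c * lk p m else 0)"
  by (auto simp: lookup_sum lookup_single when_def intro!: sum.cong)
 also have "\<dots> = c * lk p m" by (auto simp: in_keys_iff)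
 finally show ?thesis .
qed

lemma lookup_single_mult_0:
 fixes p :: "('v, 'k::comm_ring_1) mpol"
 assumes "\<And>m'. m ~= k + m'"
 shows "lk (sngl k c * p) m = 0"
proof (rule ccontr)
 assume "lk (sngl k c * p) m ~= 0"
 then have "m \<in> kys (sngl k c * p)" by (simp add: in_keys_iff)
 then obtain a b where "m = a + b" "a \<in> kys (sngl k c)" using keys_mult by blast
 then show False using assms by (auto split: if_splits)
qed

text \<open>Taking the constant term is a ring homomorphism, since a product of monomials is 1 only
  if both factors are. Multipliers are therefore closed under products, and polynomials without
  constant term form an ideal.\<close>

lemma lookup_mult_0: "lk (p * q) 0 = lk p 0 * lk q 0" for p :: "('v, 'k::comm_ring_1) mpol"
proof -
 define p' where "p' = p - sngl 0 (lk p 0)"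
 have p': "lk p' 0 = 0" by (simp add: p'_def lookup_minus)
 have "lk (p' * q) 0 = 0"
 proof (rule ccontr)
  assume "lk (p' * q) 0 ~= 0"
  then have "0 \<in> kys (p' * q)" by (simp add: in_keys_iff)
  then obtain a b where ab: "0 = a + b" "a \<in> kys p'" using keys_mult by blast
  have "a = 0"
  proof (rule poly_mapping_eqI)
   fix k have "lk a k + lk b k = 0" using ab(1) by (metis lookup_add lookup_zero)
   then show "lk a k = lk 0 k" by simp
  qed
  then show False using ab(2) p' by (simp add: in_keys_iff)
 qed
 moreover have "p * q = sngl 0 (lk p 0) * q + p' * q" by (simp add: p'_def algebra_simps)
 moreover have "lk (sngl 0 (lk p 0) * q) 0 = lk p 0 * lk q 0"
  using lookup_single_mult[of 0 "lk p 0" q 0] by simp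
 ultimately show ?thesis by (simp add: lookup_add)
qed

definition Xp :: "'v => nat => ('v, 'k::comm_ring_1) mpol" where
 "Xp v N = sngl (sngl v N) 1"

text \<open>Division by the power of v that drops all monomials not divisible by it: a left inverse
  of multiplication by \<open>Xp v N\<close> which commutes with the powers of the other
  variables.\<close>

definition dvx :: "'v => nat => ('v, 'k::comm_ring_1) mpol => ('v, 'k) mpol" where
 "dvx v N p = Poly_Mapping.map_key (\<lambda>m. sngl v N + m) p"

lemma lookup_dvx: "lk (dvx v N p) m = lk p (sngl v N + m)"
 unfolding dvx_def by (subst map_key.rep_eq) (auto simp: inj_def)

lemma dvx_X_same: "dvx v N (Xp v N * p) = p"
 by (rule poly_mapping_eqI) (simp add: lookup_dvx Xp_def lookup_single_mult)

lemma dvx_X_other: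
 assumes "v ~= w"
 shows "dvx v N (Xp w M * p) = Xp w M * dvx v N p"
proof (rule poly_mapping_eqI)
 fix m :: "'a \<Rightarrow>\<^sub>0 nat"
 let ?v = "sngl v N :: 'a \<Rightarrow>\<^sub>0 nat" and ?w = "sngl w M :: 'a \<Rightarrow>\<^sub>0 nat"
 show "lk (dvx v N (Xp w M * p)) m = lk (Xp w M * dvx v N p) m"
 proof (cases "\<exists>m'. m = ?w + m'")
  case True
  then obtain m' where m': "m = ?w + m'" by blast
  then have "?v + m = ?w + (?v + m')" by (simp add: ac_simps)
  then show ?thesis by (simp add: lookup_dvx Xp_def lookup_single_mult m')
 next
  case False
  have "?v + m ~= ?w + m'" for m'
  proof
   assume e: "?v + m = ?w + m'"
   have le: "lk ?w u \<le> lk m u" for u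
    using arg_cong[OF e, of "\<lambda>f. lk f u"] assms by (auto simp: lookup_add lookup_single when_def)
   have "m = ?w + (m - ?w)"
    by (rule poly_mapping_eqI) (use le in \<open>simp add: lookup_add lookup_minus\<close>)
   then show False using False by blast
  qed
  then show ?thesis using False by (simp add: lookup_dvx Xp_def lookup_single_mult_0)
 qed
qed

lemma dvx_linear:
 "dvx v N (p + q) = dvx v N p + dvx v N q" "dvx v N 0 = 0"
 "dvx v N (\<Sum>i\<in>I. h i) = (\<Sum>i\<in>I. dvx v N (h i))"
 "dvx v N (sg l w G * p) = sg l w G * dvx v N p"
 by (rule poly_mapping_eqI, simp add: lookup_dvx lookup_add lookup_sum lookup_sg_mult)+

lemma additive_sum:
 fixes f :: "'a::comm_monoid_add => 'b::comm_monoid_add"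
 shows "f 0 = 0 ==> (\<And>a b. f (a + b) = f a + f b) ==> f (sum h I) = (\<Sum>i\<in>I. f (h i))"
 by (induction I rule: infinite_finite_induct) auto

lemma diff_swap: "a - c = d + e ==> a - e = c + d" for a :: "'a::ab_group_add"
 by (simp add: diff_eq_eq eq_diff_eq ac_simps)

context face_modules
begin

text \<open>For v in G, a factor v does not change the union of the support with G, so the normal
  form cannot tell whether v divides a monomial. This is why the variables of a face act injectively
  on the ring of its star.\<close>

lemma dvx_cpt: "v \<in> G ==> dvx v N (cpt G p) = cpt G (dvx v N p)"
proof (rule poly_mapping_eqI)
 fix m assume "v \<in> G"
 then have "kys (sngl v N + m) \<union> G = kys m \<union> G"
  by (auto simp: keys_plus_nat split: if_splits)
 then show "lk (dvx v N (cpt G p)) m = lk (cpt G (dvx v N p)) m"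
  by (simp add: lookup_dvx lookup_cpt)
qed

definition th :: "'v => nat => ('v, 'k) cell => ('v, 'k) cell" where
 "th v N t = (\<lambda>G J. dvx v N (t G J))"

lemma th_linear: "th v N (a + b) = th v N a + th v N b" "th v N 0 = 0"
 by (simp_all add: th_def fun_eq_iff dvx_linear)

lemma th_sum: "th v N (\<Sum>i\<in>I. h i) = (\<Sum>i\<in>I. th v N (h i))"
 by (rule additive_sum[of "th v N", OF th_linear(2,1)])

lemma T_nz: "t \<in> T F p q ==> \<not> F \<subseteq> G ==> t G J = 0"
 using T_face by blast

lemma th_PP: assumes "\<And>G J. v \<notin> G ==> cpt G (t G J) = 0 \<and> cpt G (dvx v N (t G J)) = 0" shows "th v N (PP t) = PP (th v N t)"
proof (intro ext)
 fix G J
 show "th v N (PP t) G J = PP (th v N t) G J"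
  using assms[of G J] by (cases "v \<in> G") (auto simp: th_def PP_def dvx_cpt dvx_linear)
qed

lemma th_T: assumes "t \<in> T F p q" "v \<in> F" shows "th v N t \<in> T F p q"
proof (rule T_I)
 have "th v N (PP t) = PP (th v N t)"
 proof (rule th_PP)
  fix G J assume "v \<notin> G"
  then have "t G J = 0" using T_nz[OF assms(1)] assms(2) by blast
  then show "cpt G (t G J) = 0 \<and> cpt G (dvx v N (t G J)) = 0" by (simp add: dvx_linear)
 qed
 then show "PP (th v N t) = th v N t" using T_PP[OF assms(1)] by simp
 fix G J assume "th v N t G J ~= 0"
 then have "t G J ~= 0" by (auto simp: th_def dvx_linear)
 then show "F \<subseteq> G \<and> int (card G) = p \<and> J \<subseteq> {..<n} \<and> card J = q" using T_face[OF assms(1)] by blast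
qed

lemma th_d: assumes "r \<in> T F p q" "v \<in> F" shows "th v N (d r) = d (th v N r)"
proof -
 have "DD r G J = 0" if "v \<notin> G" for G J
 proof -
  have "\<not> F \<subseteq> G - {w}" for w using that assms(2) by blast
  then show ?thesis using T_nz[OF assms(1)] by (auto simp: DD_def cob_def wd_def intro!: sum.neutral)
 qed
 then have "th v N (PP (DD r)) = PP (th v N (DD r))" by (intro th_PP) (simp add: dvx_linear)
 moreover have "th v N (DD r) = DD (th v N r)"
  by (auto simp: th_def DD_def cob_def wd_def dvx_linear fun_eq_iff intro!: sum.cong)
 ultimately show ?thesis by (simp add: d_def)
qed

lemma th_act_same: assumes "z \<in> T F p q" "v \<in> F" shows "th v N (act (Xp v N) z) = z"
proof -
 have z: "z G J = 0" if "v \<notin> G" for G J using T_nz[OF assms(1)] that assms(2) by blast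
 have "th v N (PP (SS (Xp v N) z)) = PP (th v N (SS (Xp v N) z))"
  by (intro th_PP) (simp add: SS_def z dvx_linear)
 also have "\<dots> = PP z" by (simp add: SS_def th_def dvx_X_same)
 finally show ?thesis using T_PP[OF assms(1)] by (simp add: act_def)
qed

lemma th_act_other: assumes "z \<in> T F p q" "v \<in> F" "v ~= w" shows "th v N (act (Xp w M) z) = act (Xp w M) (th v N z)"
proof -
 have z: "z G J = 0" if "v \<notin> G" for G J using T_nz[OF assms(1)] that assms(2) by blast
 have "th v N (PP (SS (Xp w M) z)) = PP (th v N (SS (Xp w M) z))"
  by (intro th_PP) (simp add: SS_def z dvx_linear)
 then show ?thesis using assms(3) by (simp add: act_def) (simp add: SS_def th_def dvx_X_other)
qed

section \<open>Koszul homotopies and depth\<close>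

definition WW :: "(nat => ('v, 'k) mpol) => ('v, 'k) cell => ('v, 'k) cell" where
 "WW c t = (\<lambda>G J. \<Sum>j<n. c j * wd [0..<n] j (t G) J)"
definition hh where "hh c t = PP (WW c t)"

lemma PP_WW_cong: "PP a = PP b ==> PP (WW c a) = PP (WW c b)"
proof -
 assume ab: "PP a = PP b"
 have "cpt G (c j * wd [0..<n] j (a G) J) = cpt G (c j * wd [0..<n] j (b G) J)" for G J j
  by (rule cpt_eq_mult) (use ab in \<open>auto simp: PP_eq_iff wd_def intro: cpt_eq_mult\<close>)
 then show ?thesis
  by (auto simp: PP_eq_iff WW_def cpt_linear(4) intro!: sum.cong)
qed
lemma PP_WW_PP [simp]: "PP (WW c (PP t)) = PP (WW c t)" by (rule PP_WW_cong) simp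

lemma WW_add: "WW c (a + b) = WW c a + WW c b"
 by (auto simp: WW_def fun_eq_iff wd_def distrib_left sum.distrib[symmetric] intro!: sum.cong)
lemma hh_add: "hh c (a + b) = hh c a + hh c b" by (simp add: hh_def WW_add PP_add)

lemma DD_WW: "DD (WW c t) = WW c (DD t)"
proof (intro ext)
 fix G J
 have "DD (WW c t) G J = (\<Sum>v\<in>set vs. \<Sum>j<n. c j * wd vs v (\<lambda>G'. wd [0..<n] j (t G') J) G)"
  unfolding DD_def WW_def cob_def wd_sum wd_linear(4) ..
 also have "\<dots> = (\<Sum>j<n. \<Sum>v\<in>set vs. c j * wd vs v (\<lambda>G'. wd [0..<n] j (t G') J) G)"
  by (rule sum.swap)
 also have "\<dots> = (\<Sum>j<n. c j * (\<Sum>v\<in>set vs. wd [0..<n] j (\<lambda>J. wd vs v (\<lambda>G'. t G' J) G) J))"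
  unfolding sum_distrib_left by (intro sum.cong refl) (simp add: wd_def mult.left_commute)
 also have "\<dots> = WW c (DD t) G J"
  unfolding DD_def WW_def cob_def by (simp only: wd_sum)
 finally show "DD (WW c t) G J = WW c (DD t) G J" .
qed

lemma WW_SS: "WW c (SS s t) = SS s (WW c t)"
 by (simp add: WW_def SS_def fun_eq_iff wd_linear sum_distrib_left mult.left_commute)

lemma hh_d: "hh c (d t) = d (hh c t)" by (simp add: hh_def d_def DD_WW)
lemma hh_act: "hh c (act s t) = act s (hh c t)" by (simp add: hh_def act_def WW_SS)

text \<open>The off-diagonal terms cancel by anticommutation. Hence every element of the ideal of
  the x j acts on the Koszul complex by a map homotopic to zero.\<close>

lemma KK_WW: "KK (WW c t) + WW c (KK t) = SS (\<Sum>j<n. c j * x j) t"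
proof (intro ext)
 fix G J
 have 1: "KK (WW c t) G J = (\<Sum>i<n. \<Sum>j<n. x i * (c j * ct [0..<n] i (wd [0..<n] j (t G)) J))"
  unfolding KK_def WW_def ct_sum ct_linear(4) sum_distrib_left ..
 have "WW c (KK t) G J = (\<Sum>j<n. \<Sum>i<n. c j * (x i * wd [0..<n] j (ct [0..<n] i (t G)) J))"
  unfolding KK_def WW_def wd_sum wd_linear(4) sum_distrib_left ..
 also have "\<dots> = (\<Sum>i<n. \<Sum>j<n. c j * (x i * wd [0..<n] j (ct [0..<n] i (t G)) J))"
  by (rule sum.swap)
 finally have 2: "WW c (KK t) G J = \<dots>" .
 have "(KK (WW c t) + WW c (KK t)) G J = (\<Sum>i<n. \<Sum>j<n. x i * c j * (ct [0..<n] i (wd [0..<n] j (t G)) J + wd [0..<n] j (ct [0..<n] i (t G)) J))"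
  unfolding plus_fun_apply 1 2 sum.distrib[symmetric] by (simp add: algebra_simps)
 also have "\<dots> = (\<Sum>i<n. \<Sum>j<n. if j = i then x i * c i * t G J else 0)"
  by (intro sum.cong refl) (auto simp: ct_wd_same ct_wd_anti)
 also have "\<dots> = SS (\<Sum>j<n. c j * x j) t G J"
  by (simp add: SS_def sum_distrib_right mult.commute[of "x _"])
 finally show "(KK (WW c t) + WW c (KK t)) G J = SS (\<Sum>j<n. c j * x j) t G J" .
qed

lemma del_hh: "del (hh c t) + hh c (del t) = act (\<Sum>j<n. c j * x j) t"
 using KK_WW[of c t] by (simp add: del_def hh_def act_def PP_add[symmetric])

lemma T_hh: assumes "t \<in> T F p q" shows "hh c t \<in> T F p (Suc q)"
proof (rule T_I)
 show "PP (hh c t) = hh c t" by (simp add: hh_def)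
 fix G J assume nz: "hh c t G J ~= 0"
 then have "WW c t G J ~= 0" by (auto simp: hh_def PP_def)
 then obtain j where j: "j < n" "j \<in> J" "t G (J - {j}) ~= 0"
  unfolding WW_def wd_def by (smt (verit) mult_zero_right sum.neutral lessThan_iff)
 then have h: "F \<subseteq> G" "int (card G) = p" "J - {j} \<subseteq> {..<n}" "card (J - {j}) = q"
  using T_face[OF assms j(3)] by auto
 have "finite (J - {j})" using h(3) finite_subset by blast
 then have "card J = Suc q" using card.remove[of J j] j(2) h(4) by auto
 then show "F \<subseteq> G \<and> int (card G) = p \<and> J \<subseteq> {..<n} \<and> card J = Suc q" using h j by auto
qed

lemma act_cong: "cpt {} s = cpt {} s' ==> act s t = act s' t"
proof -
 assume e: "cpt {} s = cpt {} s'"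
 have "cpt G (s * t G J) = cpt G (s' * t G J)" for G J
  using cpt_eq_mult[of G s s' "t G J"] cpt_eq_mono[OF empty_subsetI e, of G] by (simp add: mult.commute)
 then show ?thesis by (simp add: act_def PP_eq_iff SS_def)
qed

text \<open>The polynomials that become units in the localization at the irrelevant ideal.\<close>

definition U :: "('v, 'k) mpol set" where "U = {u. lk u 0 ~= 0}"

lemma U_mult: "u \<in> U ==> w \<in> U ==> u * w \<in> U" by (simp add: U_def lookup_mult_0)
lemma U_1: "1 \<in> U" by (simp add: U_def)

lemma d_0 [simp]: "d 0 = 0" using d_linear(1)[of 0 0] by simp
lemma del_0 [simp]: "del 0 = 0" using del_linear(1)[of 0 0] by simp
lemma hh_0 [simp]: "hh c 0 = 0" using hh_add[of c 0 0] by simp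
lemma act_0 [simp]: "act s 0 = 0" using act_linear(1)[of s 0 0] by simp
lemma del_sum: "del (\<Sum>i\<in>I. h i) = (\<Sum>i\<in>I. del (h i))"
 by (rule additive_sum[of del, OF del_0 del_linear(2)])
lemma hh_sum: "hh c (\<Sum>i\<in>I. h i) = (\<Sum>i\<in>I. hh c (h i))"
 by (rule additive_sum[of "hh c", OF hh_0 hh_add])
lemma act_sum: "act s (\<Sum>i\<in>I. h i) = (\<Sum>i\<in>I. act s (h i))"
 by (rule additive_sum[of "act s", OF act_0 act_linear(2)])

text \<open>What is divided out of column e in the depth argument: the coboundaries together with
  the multiples of the powers of the variables in B.\<close>

definition DB :: "nat => 'v set => int => 'v set => nat => ('v, 'k) cell set" where
 "DB N F e B q = {y. \<exists>r\<in>T F (e - 1) q. \<exists>c. (\<forall>v\<in>B. c v \<in> T F e q) \<and> y = d r + (\<Sum>v\<in>B. act (Xp v N) (c v))}"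

lemma DB_I: "r \<in> T F (e - 1) q ==> (\<And>v. v \<in> B ==> c v \<in> T F e q) ==> d r + (\<Sum>v\<in>B. act (Xp v N) (c v)) \<in> DB N F e B q"
 unfolding DB_def by blast

lemma DB_0: "0 \<in> DB N F e B q"
 using DB_I[of 0 F e q B "\<lambda>_. 0" N] by (simp add: T_0)

lemma DB_add: assumes "a \<in> DB N F e B q" "b \<in> DB N F e B q" shows "a + b \<in> DB N F e B q"
proof -
 from assms obtain r c r' c' where "r \<in> T F (e - 1) q" "\<forall>v\<in>B. c v \<in> T F e q" "a = d r + (\<Sum>v\<in>B. act (Xp v N) (c v))"
  "r' \<in> T F (e - 1) q" "\<forall>v\<in>B. c' v \<in> T F e q" "b = d r' + (\<Sum>v\<in>B. act (Xp v N) (c' v))"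
  unfolding DB_def by blast
 then show ?thesis
  using DB_I[of "r + r'" F e q B "\<lambda>v. c v + c' v" N] by (simp add: T_add d_linear act_linear sum.distrib algebra_simps)
qed

lemma DB_act: assumes "a \<in> DB N F e B q" shows "act s a \<in> DB N F e B q"
proof -
 from assms obtain r c where "r \<in> T F (e - 1) q" "\<forall>v\<in>B. c v \<in> T F e q" "a = d r + (\<Sum>v\<in>B. act (Xp v N) (c v))"
  unfolding DB_def by blast
 then show ?thesis
  using DB_I[of "act s r" F e q B "\<lambda>v. act s (c v)" N]
  by (simp add: T_act act_linear act_sum act_d act_act mult.commute)
qed

lemma DB_diff: assumes "a \<in> DB N F e B q" "b \<in> DB N F e B q" shows "a - b \<in> DB N F e B q"
proof -
 have "act (- 1) b = - b" if "PP b = b" using that by (simp add: act_def PP_def SS_def fun_eq_iff cpt_linear)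
 moreover have "PP b = b"
 proof -
  have "PP (\<Sum>v\<in>B. act (Xp v N) (c v)) = (\<Sum>v\<in>B. act (Xp v N) (c v))" for c
   by (subst additive_sum[of PP]) (auto simp: PP_add act_def)
  then show ?thesis using assms(2) by (auto simp: DB_def PP_add) (simp add: d_def)
 qed
 ultimately show ?thesis using DB_add[OF assms(1) DB_act[OF assms(2), of "-1"]] by simp
qed

lemma DB_del: assumes "a \<in> DB N F e B (Suc q)" shows "del a \<in> DB N F e B q"
proof -
 from assms obtain r c where "r \<in> T F (e - 1) (Suc q)" "\<forall>v\<in>B. c v \<in> T F e (Suc q)" "a = d r + (\<Sum>v\<in>B. act (Xp v N) (c v))"
  unfolding DB_def by blast
 then show ?thesis
  using DB_I[of "del r" F e q B "\<lambda>v. del (c v)" N]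
  by (simp add: T_del del_linear del_sum comm act_del)
qed

lemma DB_hh: assumes "a \<in> DB N F e B q" shows "hh s a \<in> DB N F e B (Suc q)"
proof -
 from assms obtain r c where "r \<in> T F (e - 1) q" "\<forall>v\<in>B. c v \<in> T F e q" "a = d r + (\<Sum>v\<in>B. act (Xp v N) (c v))"
  unfolding DB_def by blast
 then show ?thesis
  using DB_I[of "hh s r" F e "Suc q" B "\<lambda>v. hh s (c v)" N]
  by (simp add: T_hh hh_add hh_sum hh_d hh_act)
qed

text \<open>Division by the power of v commutes with d and with the powers of the variables in B, so
  it turns an expression for the multiple of z into one for z. Thus the powers of the variables of F
  form a regular sequence on the cokernel of d.\<close>

lemma DB_regular:
 assumes "v \<in> F" "v \<notin> B" "finite B" "z \<in> T F e q" "act (Xp v N) z \<in> DB N F e B q"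
 shows "z \<in> DB N F e B q"
proof -
 from assms(5) obtain r c where rc: "r \<in> T F (e - 1) q" "\<forall>w\<in>B. c w \<in> T F e q"
   "act (Xp v N) z = d r + (\<Sum>w\<in>B. act (Xp w N) (c w))"
  unfolding DB_def by blast
 have "z = th v N (d r + (\<Sum>w\<in>B. act (Xp w N) (c w)))"
  using th_act_same[OF assms(4,1), of N] rc(3) by simp
 also have "\<dots> = d (th v N r) + (\<Sum>w\<in>B. th v N (act (Xp w N) (c w)))"
  by (simp add: th_linear th_sum th_d[OF rc(1) assms(1)])
 also have "(\<Sum>w\<in>B. th v N (act (Xp w N) (c w))) = (\<Sum>w\<in>B. act (Xp w N) (th v N (c w)))"
 proof (rule sum.cong[OF refl])
  fix w assume w: "w \<in> B"
  show "th v N (act (Xp w N) (c w)) = act (Xp w N) (th v N (c w))"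
   by (rule th_act_other[OF bspec[OF rc(2) w] assms(1)]) (use w assms(2) in blast)
 qed
 finally have "z = d (th v N r) + (\<Sum>w\<in>B. act (Xp w N) (th v N (c w)))" .
 then show ?thesis
  using DB_I[of "th v N r" F e q B "\<lambda>w. th v N (c w)" N] th_T[OF _ assms(1)] rc(1,2) by simp
qed

text \<open>Depth sensitivity of the Koszul complex: the powers of the variables in C are a regular
  sequence on the quotient by \<open>DB\<close>, and up to multipliers they lie in the ideal of the
  x j, so homology vanishes in degrees above n - card C. In the induction on C, the homotopy
  \<open>hh c\<close> turns t into a cycle of degree one higher modulo the power of v, where the
  hypothesis for the smaller C applies.\<close>

lemma rees:
 assumes F: "finite F"
  and par: "\<And>v. v \<in> F ==> \<exists>u\<in>U. \<exists>c. cpt {} (u * Xp v N) = cpt {} (\<Sum>j<n. c j * x j)"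
  and q: "1 \<le> q" and C: "C \<subseteq> F" "n < q + card C" and t: "t \<in> T F e q" "del t \<in> DB N F e (F - C) (q - 1)"
 shows "\<exists>u\<in>U. \<exists>s\<in>T F e (Suc q). \<exists>y\<in>DB N F e (F - C) q. act u t = del s + y"
 using finite_subset[OF C(1) F] q C t
proof (induction C arbitrary: q t rule: finite_induct)
 case empty
 have "t = 0"
 proof (intro ext, rule ccontr)
  fix G J assume "t G J ~= 0 G J"
  then have "J \<subseteq> {..<n}" "card J = q" using T_face[OF empty.prems(4), of G J] by auto
  then have "q \<le> n" using card_mono[of "{..<n}" J] by simp
  then show False using empty.prems(3) by simp
 qed
 then show ?case
  by (intro bexI[OF _ U_1] bexI[OF _ T_0] bexI[OF _ DB_0]) (simp only: act_0 del_0 add_0_right)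
next
 case (insert v C)
 define B where "B = F - insert v C"
 have B: "F - C = insert v B" "v \<notin> B" "finite B" "v \<in> F" using insert.hyps insert.prems(2) F by (auto simp: B_def)
 obtain u0 c where u0: "u0 \<in> U" "cpt {} (u0 * Xp v N) = cpt {} (\<Sum>j<n. c j * x j)" using par B(4) by blast
 have h: "del (hh c t) = act (u0 * Xp v N) t - hh c (del t)"
  using del_hh[of c t] act_cong[OF u0(2), of t] by (simp add: algebra_simps)
 note tT = insert.prems(4)
 obtain q' where q': "q = Suc q'" using insert.prems(1) by (cases q) auto
 have dt: "del t \<in> DB N F e B q'" using insert.prems(5) by (simp add: B_def q')
 have sub: "y \<in> DB N F e (insert v B) k" if y: "y \<in> DB N F e B k" for y k
 proof -
  obtain r g where rg: "r \<in> T F (e - 1) k" "\<forall>w\<in>B. g w \<in> T F e k" "y = d r + (\<Sum>w\<in>B. act (Xp w N) (g w))"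
   using y unfolding DB_def by blast
  have "(\<Sum>w\<in>B. act (Xp w N) (if w = v then 0 else g w)) = (\<Sum>w\<in>B. act (Xp w N) (g w))"
   by (rule sum.cong) (use B(2) in auto)
  moreover have "(if w = v then 0 else g w) \<in> T F e k" if "w \<in> insert v B" for w
   using that rg(2) T_0 by (cases "w = v") simp_all
  note DB_I[where c = "\<lambda>w. if w = v then 0 else g w" and N = N and B = "insert v B", OF rg(1) this]
  ultimately show ?thesis using rg(3) B(2,3) by (simp add: act_0)
 qed
 have ut: "act u0 t \<in> T F e q" by (rule T_act[OF tT])
 \<comment> \<open>Once the power of v is divided out as well, the first term in the formula for
   \<open>del (hh c t)\<close> is zero; the witness has \<open>act u0 t\<close> as its coefficient
   at v.\<close>
 have "act (Xp v N) (act u0 t) \<in> DB N F e (insert v B) q"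
 proof -
  have "(\<Sum>w\<in>B. act (Xp w N) (if w = v then act u0 t else 0)) = 0"
   by (rule sum.neutral) (use B(2) in auto)
  then show ?thesis
   using DB_I[of 0 F e q "insert v B" "\<lambda>w. if w = v then act u0 t else 0" N] B ut by (simp add: T_0)
 qed
 moreover have "hh c (del t) \<in> DB N F e B q" using DB_hh[OF dt] by (simp add: q')
 moreover have "del (hh c t) = act (Xp v N) (act u0 t) - hh c (del t)" using h by (simp add: act_act mult.commute)
 ultimately have dh: "del (hh c t) \<in> DB N F e (F - C) (Suc q - 1)"
  using DB_diff sub B(1) by simp
 have "n < Suc q + card C" "C \<subseteq> F" "1 \<le> Suc q" using insert.prems insert.hyps by auto
 then have "\<exists>u\<in>U. \<exists>s\<in>T F e (Suc (Suc q)). \<exists>y\<in>DB N F e (insert v B) (Suc q). act u (hh c t) = del s + y"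
  using insert.IH[OF _ _ _ T_hh[OF tT] dh] unfolding B(1) by blast
 then obtain u s y where us: "u \<in> U" "s \<in> T F e (Suc (Suc q))" "y \<in> DB N F e (insert v B) (Suc q)" "act u (hh c t) = del s + y"
  by blast
 then obtain r g where rg: "r \<in> T F (e - 1) (Suc q)" "\<forall>w\<in>insert v B. g w \<in> T F e (Suc q)" "y = d r + (\<Sum>w\<in>insert v B. act (Xp w N) (g w))"
  unfolding DB_def by blast
 \<comment> \<open>The part of y at v is split off; its coefficient \<open>g v\<close> turns out to
   be the Koszul primitive of t.\<close>
 define y' where "y' = d r + (\<Sum>w\<in>B. act (Xp w N) (g w))"
 have y': "y' \<in> DB N F e B (Suc q)" "y = y' + act (Xp v N) (g v)"
  using DB_I[of r F e "Suc q" B g N] rg B by (auto simp: y'_def)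
 have "act u (del (hh c t)) = del y' + act (Xp v N) (del (g v))"
  by (simp add: act_del us(4) del_linear deldel y'(2))
 moreover have "act u (del (hh c t)) = act (Xp v N) (act (u * u0) t) - act u (hh c (del t))"
  by (simp only: h act_linear act_act ac_simps)
 ultimately have e: "act (Xp v N) (act (u * u0) t) - act u (hh c (del t)) = del y' + act (Xp v N) (del (g v))"
  by (simp only:)
 have "act (Xp v N) (act (u * u0) t - del (g v)) = act (Xp v N) (act (u * u0) t) - act (Xp v N) (del (g v))"
  by (rule act_linear)
 also have "\<dots> = act u (hh c (del t)) + del y'"
  by (rule diff_swap[OF e])
 finally have "act (Xp v N) (act (u * u0) t - del (g v)) = act u (hh c (del t)) + del y'" .
 moreover have "act u (hh c (del t)) + del y' \<in> DB N F e B q"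
  by (intro DB_add DB_act DB_del y'(1)) fact
 \<comment> \<open>Both sides of \<open>e\<close> were the Koszul boundary of the same equation, so
   the power of v can be cancelled by regularity.\<close>
 ultimately have "act (u * u0) t - del (g v) \<in> DB N F e B q"
  using DB_regular[OF B(4,2,3) T_diff[OF T_act[OF tT] T_del]] rg(2) by (metis insertI1)
 moreover have "act (u * u0) t = del (g v) + (act (u * u0) t - del (g v))" by (metis add.commute diff_add_cancel)
 ultimately show ?case using U_mult[OF us(1) u0(1)] rg(2) unfolding B_def by blast
qed

lemma finite_Delta: "finite \<Delta>" using vs(2) by (meson finite_Pow_iff finite_set finite_subset)

text \<open>The Koszul differential acts face by face. A cycle in column p is the sum of its
  restrictions to the faces G with p vertices, each of which is an element of the first column
  belonging to G itself; the multipliers are multiplied up.\<close>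

lemma col_split:
 assumes hyp: "\<And>G t. G \<in> \<Delta> ==> F \<subseteq> G ==> int (card G) = p ==> t \<in> T G p q ==> del t = 0 ==> \<exists>u\<in>U. \<exists>s\<in>T G p (Suc q). act u t = del s"
  and t: "t \<in> T F p q" "del t = 0"
 shows "\<exists>u\<in>U. \<exists>s\<in>T F p (Suc q). act u t = del s"
proof -
 define rs where "rs A = (\<lambda>G J. if G \<in> A then t G J else 0)" for A
 have PP_rs: "PP (rs A) = rs A" for A
  using T_PP[OF t(1)] by (auto simp: rs_def PP_def fun_eq_iff)
 have del_rs: "del (rs A) = 0" for A
 proof (intro ext)
  fix G J
  have "del (rs A) G J = (if G \<in> A then del t G J else 0)"
   by (cases "G \<in> A") (simp_all add: del_def PP_def KK_def rs_def ct_def cong: if_cong)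
  then show "del (rs A) G J = 0 G J" using t(2) by simp
 qed
 have main: "\<exists>u\<in>U. \<exists>s\<in>T F p (Suc q). act u (rs A) = del s" if "finite A" "A \<subseteq> {G \<in> \<Delta>. F \<subseteq> G \<and> int (card G) = p}" for A
  using that
 proof (induction A rule: finite_induct)
  case empty
  have "rs {} = 0" by (simp add: rs_def fun_eq_iff)
  then show ?case by (intro bexI[OF _ U_1] bexI[OF _ T_0]) (simp only: act_0 del_0)
 next
  case (insert G A)
  then obtain u s where us: "u \<in> U" "s \<in> T F p (Suc q)" "act u (rs A) = del s" by auto
  have G: "G \<in> \<Delta>" "F \<subseteq> G" "int (card G) = p" using insert.prems by auto
  have "rs {G} \<in> T G p q"
   by (rule T_I[OF PP_rs]) (use T_face[OF t(1)] in \<open>auto simp: rs_def split: if_splits\<close>)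
  then obtain w r where wr: "w \<in> U" "r \<in> T G p (Suc q)" "act w (rs {G}) = del r"
   using hyp[OF G _ del_rs] by blast
  have rT: "r \<in> T F p (Suc q)"
  proof (rule T_I[OF T_PP[OF wr(2)]])
   fix G' J assume "r G' J ~= 0"
   from T_face[OF wr(2) this] G(2) show "F \<subseteq> G' \<and> int (card G') = p \<and> J \<subseteq> {..<n} \<and> card J = Suc q" by auto
  qed
  have "rs (insert G A) = rs A + rs {G}" using insert.hyps by (auto simp: rs_def fun_eq_iff)
  then have "act (w * u) (rs (insert G A)) = act w (act u (rs A)) + act u (act w (rs {G}))"
   by (simp add: act_linear act_act mult.commute)
  also have "\<dots> = del (act w s + act u r)" by (simp add: us(3) wr(3) act_del del_linear)
  finally show ?case using U_mult[OF wr(1) us(1)] T_add[OF T_act[OF us(2)] T_act[OF rT]] by blast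
 qed
 have eq: "rs {G \<in> \<Delta>. F \<subseteq> G \<and> int (card G) = p} = t"
 proof (intro ext)
  fix G J
  show "rs {G \<in> \<Delta>. F \<subseteq> G \<and> int (card G) = p} G J = t G J"
   using T_face[OF t(1), of G J] by (cases "t G J = 0") (simp_all add: rs_def)
 qed
 have "finite {G \<in> \<Delta>. F \<subseteq> G \<and> int (card G) = p}" using finite_Delta by simp
 from main[OF this subset_refl] show ?thesis unfolding eq .
qed

section \<open>Koszul homology of systems of parameters\<close>

text \<open>What a system of parameters provides once denominators are cleared: a power of each
  variable is, up to a multiplier and modulo the Stanley-Reisner ideal, in the ideal of the x
  j.\<close>

definition parameters :: bool where
 "parameters \<longleftrightarrow> (\<forall>v\<in>set vs. \<exists>N. \<exists>u\<in>U. \<exists>c. cpt {} (u * Xp v N) = cpt {} (\<Sum>j<n. c j * x j))"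

lemma Xp_add: "Xp v (M + N) = Xp v M * (Xp v N :: ('v, 'k) mpol)"
 by (simp add: Xp_def mult_single single_add)

lemma parameters_uniform:
 assumes parameters
 shows "\<exists>N. \<forall>v\<in>set vs. \<exists>u\<in>U. \<exists>c. cpt {} (u * Xp v N) = cpt {} (\<Sum>j<n. c j * x j)"
proof -
 obtain N where N: "\<And>v. v \<in> set vs ==> \<exists>u\<in>U. \<exists>c. cpt {} (u * Xp v (N v)) = cpt {} (\<Sum>j<n. c j * x j)"
  using assms unfolding parameters_def by metis
 have "\<exists>u\<in>U. \<exists>c. cpt {} (u * Xp v (sum N (set vs))) = cpt {} (\<Sum>j<n. c j * x j)" if v: "v \<in> set vs" for v
 proof -
  obtain u c where uc: "u \<in> U" "cpt {} (u * Xp v (N v)) = cpt {} (\<Sum>j<n. c j * x j)" using N[OF v] by blast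
  have "sum N (set vs) = (sum N (set vs) - N v) + N v" using member_le_sum[of v "set vs" N] v by simp
  then have "u * Xp v (sum N (set vs)) = Xp v (sum N (set vs) - N v) * (u * Xp v (N v))"
   using Xp_add by (metis mult.left_commute)
  then have "cpt {} (u * Xp v (sum N (set vs))) = cpt {} (Xp v (sum N (set vs) - N v) * (\<Sum>j<n. c j * x j))"
   using cpt_eq_mult[OF uc(2)] by simp
  also have "\<dots> = cpt {} (\<Sum>j<n. (Xp v (sum N (set vs) - N v) * c j) * x j)"
   by (simp add: sum_distrib_left mult.assoc)
  finally show ?thesis using uc(1) by (intro bexI[OF _ uc(1)] exI)
 qed
 then show ?thesis by blast
qed

text \<open>Cochains on the faces containing F compute the reduced cohomology of the link of F,
  shifted by \<open>card F\<close>. Since p counts vertices, p < e means below the top degree when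
  facets have e vertices.\<close>

definition acyclic_links :: "nat => bool" where
 "acyclic_links e \<longleftrightarrow> (\<forall>F\<in>\<Delta>. F ~= {} --> (\<forall>p < int e. \<forall>f::'v set => 'k.
  (\<forall>G. f G ~= 0 --> G \<in> \<Delta> \<and> F \<subseteq> G \<and> int (card G) = p) --> (\<forall>G\<in>\<Delta>. cob vs f G = 0) -->
  (\<exists>g. (\<forall>G. g G ~= 0 --> G \<in> \<Delta> \<and> F \<subseteq> G \<and> int (card G) = p - 1) \<and> (\<forall>G\<in>\<Delta>. cob vs g G = f G))))"

lemma acyclic_linksD:
 fixes f :: "'v set => 'k"
 assumes "acyclic_links e" "F \<in> \<Delta>" "F ~= {}" "p < int e"
  "\<And>G. f G ~= 0 ==> G \<in> \<Delta> \<and> F \<subseteq> G \<and> int (card G) = p" "\<And>G. G \<in> \<Delta> ==> cob vs f G = 0"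
 shows "\<exists>g. (\<forall>G. g G ~= 0 --> G \<in> \<Delta> \<and> F \<subseteq> G \<and> int (card G) = p - 1) \<and> (\<forall>G\<in>\<Delta>. cob vs g G = f G)"
 using assms(1)[unfolded acyclic_links_def, THEN bspec[OF _ assms(2)], THEN mp[OF _ assms(3)], THEN spec[of _ p], THEN mp[OF _ assms(4)], THEN spec[of _ f]]
  assms(5,6) by simp

lemma T_low: assumes "F \<in> \<Delta>" "p < int (card F)" "t \<in> T F p q" shows "t = 0"
proof (intro ext, rule ccontr)
 fix G J assume "t G J ~= 0 G J"
 then have "G \<in> \<Delta>" "F \<subseteq> G" "int (card G) = p" using T_face[OF assms(3), of G J] by auto
 then show False using card_mono[OF finite_face] assms(2) by (metis not_le of_nat_le_iff)
qed

text \<open>In column \<open>card F\<close> the only face is F, so this is exactness of the Koszul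
  complex of the star of F in positive degrees. The zigzag starts there: larger faces are covered by
  induction, the rows by acyclicity, and in the last column all variables of F are available for the
  depth argument.\<close>

lemma koszul_acyclic:
 assumes par: parameters and ac: "acyclic_links e" and n: "n \<le> e" and dim: "\<And>G. G \<in> \<Delta> ==> card G \<le> e"
 shows "F \<in> \<Delta> ==> F ~= {} ==> 1 \<le> q ==> t \<in> T F (int (card F)) q ==> del t = 0 ==>
  \<exists>u\<in>U. \<exists>s\<in>T F (int (card F)) (Suc q). act u t = del s"
proof (induction "e - card F" arbitrary: F q t rule: less_induct)
 case less
 note F = less.prems(1,2)
 obtain N where N: "\<And>v. v \<in> set vs ==> \<exists>u\<in>U. \<exists>c. cpt {} (u * Xp v N) = cpt {} (\<Sum>j<n. c j * x j)"
  using parameters_uniform[OF par] by blast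
 have act1: "act 1 y = y" if "y \<in> T F p k" for y p k
  using T_PP[OF that] by (simp add: act_def SS_def)
 have "\<exists>u\<in>U. \<exists>s\<in>T F (int (card F)) (Suc q). \<exists>r\<in>T F (int (card F) - 1) q. act u (act 1 t) = del s + d r"
 \<comment> \<open>As F is nonempty, all rows below the last column are exact, so both families can
   be \<open>T F\<close> and b can be 1.\<close>
 proof (rule zigzag[where f = "int (card F)" and e = "int e" and T = "T F" and Tp = "T F" and d = d and del = del and act = act and U = U])
  show "\<exists>u\<in>U. \<exists>s\<in>T F p (Suc k). act u y = del s"
   if pk: "int (card F) < p" "p \<le> int e" "1 \<le> k" "y \<in> T F p k" "del y = 0" for p k y
  proof (rule col_split[OF _ pk(4,5)])
   fix G z assume G: "G \<in> \<Delta>" "F \<subseteq> G" "int (card G) = p" "z \<in> T G p k" "del z = 0"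
   have "e - card G < e - card F" "G ~= {}" using G(2,3) pk(1,2) F(2) by auto
   then show "\<exists>u\<in>U. \<exists>s\<in>T G p (Suc k). act u z = del s"
    using less.hyps[of G k z] G pk(3) by blast
  qed
  show "\<exists>s\<in>T F (p - 1) k. y = d s" if "int (card F) \<le> p" "p < int e" "y \<in> T F p k" "d y = 0" for p k y
  proof -
   have "\<exists>s\<in>T F (p - 1) k. y = d s \<and> (\<forall>m. (\<forall>G J. lk (y G J) m = 0) --> (\<forall>G J. lk (s G J) m = 0))"
    by (rule row[OF that(3,4)], rule acyclic_linksD[OF ac F that(2)])
   then show ?thesis by blast
  qed
  show "\<exists>u\<in>U. \<exists>s\<in>T F (int e) (Suc k). \<exists>r\<in>T F (int e - 1) k. act u (act 1 y) = del s + d r"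
   if k: "int e - int (card F) < int k" "y \<in> T F (int e) k" "del y \<in> d ` T F (int e - 1) (k - 1)" for k y
  proof -
   \<comment> \<open>With C = F no variable is left over, and \<open>DB\<close> consists of
     coboundaries only.\<close>
   have "\<exists>u\<in>U. \<exists>s\<in>T F (int e) (Suc k). \<exists>y'\<in>DB N F (int e) (F - F) k. act u y = del s + y'"
   proof (rule rees)
    show "finite F" using F finite_face by blast
    show "\<exists>u\<in>U. \<exists>c. cpt {} (u * Xp v N) = cpt {} (\<Sum>j<n. c j * x j)" if "v \<in> F" for v
     by (rule N) (use that F vs(2) in blast)
    show "1 \<le> k" "n < k + card F" using k(1) n dim[OF F(1)] by linarith+
    show "del y \<in> DB N F (int e) (F - F) (k - 1)"
     using k(3) unfolding DB_def by auto
   qed (use k(2) in auto)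
   then obtain u s r where "u \<in> U" "s \<in> T F (int e) (Suc k)" "r \<in> T F (int e - 1) k" "act u y = del s + d r"
    unfolding DB_def by auto
   then show ?thesis using act1[OF k(2)] by metis
  qed
  show "int (card F) \<le> int e" using dim[OF F(1)] by simp
  show "int (card F) - int (card F) < int q" using less.prems(3) by simp
  show "t \<in> T F (int (card F)) q" by fact
  show "del t \<in> d ` T F (int (card F) - 1) (q - 1)"
   using less.prems(5) T_0 d_0 by (metis imageI)
 qed (simp_all only: T_diff T_act T_d T_del d_linear del_linear comm dd deldel act_d act_del act_act U_mult order_refl)
 then obtain u s r where "u \<in> U" "s \<in> T F (int (card F)) (Suc q)" "r \<in> T F (int (card F) - 1) q" "act u (act 1 t) = del s + d r"
  by blast
 \<comment> \<open>A set with \<open>card F - 1\<close> vertices cannot contain F, so the coboundary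
   term disappears.\<close>
 moreover have "r = 0" by (rule T_low[OF F(1) _ calculation(3)]) simp
 ultimately show ?case using act1[OF less.prems(4)] by (metis add.right_neutral d_0)
qed

text \<open>A relation between the x j is a Koszul 1-cycle over the empty face. There the row of the
  monomial 1 is the augmented cochain complex of the whole complex, which need not be exact; b has
  no constant term, so its multiples avoid this monomial and the zigzag runs with \<open>Tp\<close>
  the cells without constant terms.\<close>

lemma koszul_annihilated:
 assumes par: parameters and ac: "acyclic_links e" and n: "n \<le> e" and dim: "\<And>G. G \<in> \<Delta> ==> card G \<le> e"
  and ne: "{} \<in> \<Delta>" and b: "lk b 0 = 0" and rel: "cpt {} (\<Sum>j<n. x j * a j) = 0" and i: "i < n"
 shows "\<exists>u\<in>U. \<exists>c. cpt {} (u * (b * a i)) = cpt {} (\<Sum>j\<in>{..<n} - {i}. c j * x j)"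
proof -
 define Tp where "Tp p q = {t \<in> T {} p q. \<forall>G J. lk (t G J) 0 = 0}" for p q
 \<comment> \<open>The sign is the one that \<open>ct\<close> produces when j is removed, so that
   \<open>del t\<close> is the plain sum of the products x j * a j.\<close>
 define t where "t = (\<lambda>(G::'v set) J. if G = {} \<and> (\<exists>j<n. J = {j}) then cpt {} (sg [0..<n] (the_elem J) {} * a (the_elem J)) else 0)"
 have t1: "t {} {j} = cpt {} (sg [0..<n] j {} * a j)" if "j < n" for j using that by (simp add: t_def)
 have tT: "t \<in> T {} 0 1"
  by (rule T_I) (auto simp: t_def PP_def fun_eq_iff cpt_cpt split: if_splits)
 have delt: "del t = 0"
 proof (intro ext)
  fix G J
  show "del t G J = 0 G J"
  proof (cases "G = {} \<and> J = {}")
   case True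
   have "cpt {} (x j * ct [0..<n] j (t {}) {}) = cpt {} (x j * a j)" if "j < n" for j
   proof -
    have "cpt {} (sg [0..<n] j {} * t {} {j}) = cpt {} (sg [0..<n] j {} * (sg [0..<n] j {} * a j))"
     unfolding t1[OF that] by (rule cpt_mult)
    then have "cpt {} (ct [0..<n] j (t {}) {}) = cpt {} (a j)" by (simp add: ct_def)
    then show ?thesis by (rule cpt_eq_mult)
   qed
   then have "del t {} {} = cpt {} (\<Sum>j<n. x j * a j)"
    by (simp add: del_def PP_def KK_def cpt_linear(4))
   then show ?thesis using True rel by simp
  next
   case False
   have "ct [0..<n] j (t G) J = 0" for j
   proof -
    have "t G (insert j J) = 0" if "j \<notin> J"
     using False that by (auto simp: t_def)
    then show ?thesis by (simp add: ct_def)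
   qed
   then show ?thesis by (simp add: del_def PP_def KK_def)
  qed
 qed
 have "\<exists>u\<in>U. \<exists>s\<in>Tp 0 (Suc 1). \<exists>r\<in>Tp (0 - 1) 1. act u (act b t) = del s + d r"
 proof (rule zigzag[where f = 0 and e = "int e" and T = "T {}" and Tp = Tp and d = d and del = del and act = act and U = U])
  show "x' - y \<in> Tp p q" if "x' \<in> Tp p q" "y \<in> Tp p q" for x' y p q
   using that by (auto simp: Tp_def T_diff lookup_minus)
  show "act u y \<in> Tp p q" if "y \<in> Tp p q" for u y p q
   using that by (auto simp: Tp_def T_act) (simp add: act_def PP_def SS_def lookup_cpt lookup_mult_0)
  show "act b y \<in> Tp p q" if "y \<in> T {} p q" for y p q
   using that by (auto simp: Tp_def T_act) (simp add: act_def PP_def SS_def lookup_cpt lookup_mult_0 b)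
  show "del y \<in> Tp p q" if "y \<in> Tp p (Suc q)" for y p q
   using that by (auto simp: Tp_def T_del)
    (auto simp: del_def PP_def KK_def ct_def lookup_cpt lookup_sum lookup_mult_0 lookup_sg_mult intro!: sum.neutral)
  show "\<exists>u\<in>U. \<exists>s\<in>T {} p (Suc k). act u y = del s"
   if pk: "0 < p" "p \<le> int e" "1 \<le> k" "y \<in> T {} p k" "del y = 0" for p k y
  proof (rule col_split[OF _ pk(4,5)])
   fix G z assume G: "G \<in> \<Delta>" "{} \<subseteq> G" "int (card G) = p" "z \<in> T G p k" "del z = 0"
   have "G ~= {}" using G(3) pk(1) by auto
   then show "\<exists>u\<in>U. \<exists>s\<in>T G p (Suc k). act u z = del s"
    using koszul_acyclic[OF par ac n dim G(1) _ pk(3), of z] G by simp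
  qed
  show "\<exists>s\<in>Tp (p - 1) k. y = d s" if "0 \<le> p" "p < int e" "y \<in> Tp p k" "d y = 0" for p k y
  proof -
   have y: "y \<in> T {} p k" "\<And>G J. lk (y G J) 0 = 0" using that(3) by (auto simp: Tp_def)
   have "\<exists>s\<in>T {} (p - 1) k. y = d s \<and> (\<forall>m. (\<forall>G J. lk (y G J) m = 0) --> (\<forall>G J. lk (s G J) m = 0))"
   proof (rule row[OF y(1) that(4)])
    fix m :: "'v \<Rightarrow>\<^sub>0 nat" and f :: "'v set => 'k"
    assume "\<exists>G J. lk (y G J) m ~= 0" "kys m \<subseteq> {}"
    then have False using y(2) by auto
    then show "\<exists>g. (\<forall>G. g G ~= 0 --> G \<in> \<Delta> \<and> {} \<subseteq> G \<and> int (card G) = p - 1) \<and> (\<forall>G\<in>\<Delta>. cob vs g G = f G)" ..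
   qed
   then show ?thesis using y(2) by (auto simp: Tp_def)
  qed
  show "\<exists>u\<in>U. \<exists>s\<in>Tp (int e) (Suc k). \<exists>r\<in>Tp (int e - 1) k. act u (act b y) = del s + d r"
   if k: "int e - 0 < int k" "y \<in> T {} (int e) k" for k y
  proof -
   \<comment> \<open>Beyond column e the zigzag stops: J would have k > e elements among n \<le> e
     indices.\<close>
   have "y = 0"
   proof (intro ext, rule ccontr)
    fix G J assume "y G J ~= 0 G J"
    then have "J \<subseteq> {..<n}" "card J = k" using T_face[OF k(2), of G J] by auto
    then show False using card_mono[of "{..<n}" J] k(1) n by simp
   qed
   moreover have "0 \<in> Tp p q" for p q by (simp add: Tp_def T_0)
   ultimately show ?thesis
    by (intro bexI[OF _ U_1]) (metis act_0 add.right_neutral d_0 del_0)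
  qed
  show "del t \<in> d ` T {} (0 - 1) (1 - 1)" using delt T_0 d_0 by (metis imageI)
 qed (use tT in \<open>simp_all only: Tp_def T_diff T_act T_d T_del d_linear del_linear comm dd deldel act_d act_del act_act U_mult order_refl, auto\<close>)
 then obtain u s r where us: "u \<in> U" "s \<in> Tp 0 2" "r \<in> Tp (- 1) 1" "act u (act b t) = del s + d r"
  by (auto simp: numeral_2_eq_2)
 have "r = 0" by (rule T_low[of "{}" "-1" _ 1]) (use us(3) ne in \<open>auto simp: Tp_def\<close>)
 then have e: "act (u * b) t = del s" using us(4) by (simp add: act_act)
 let ?s = "sg [0..<n] i {} :: ('v, 'k) mpol"
 have "cpt {} (u * (b * a i)) = cpt {} (?s * ((u * b) * (?s * a i)))"
  by (simp add: mult.left_commute[of ?s] mult.assoc)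
 also have "\<dots> = cpt {} (?s * ((u * b) * t {} {i}))"
  by (intro cpt_eq_mult) (simp add: t1[OF i] cpt_cpt)
 also have "\<dots> = cpt {} (?s * cpt {} ((u * b) * t {} {i}))" by (rule cpt_mult[symmetric])
 also have "cpt {} ((u * b) * t {} {i}) = del s {} {i}"
  using fun_cong[OF fun_cong[OF e, of "{}"], of "{i}"] by (simp add: act_def PP_def SS_def)
 also have "cpt {} (?s * del s {} {i}) = cpt {} (?s * (\<Sum>j<n. x j * ct [0..<n] j (s {}) {i}))"
  by (simp add: del_def PP_def KK_def cpt_mult)
 \<comment> \<open>Contraction by i vanishes on an index set containing i, which is why x i itself
   does not occur in the result.\<close>
 also have "(\<Sum>j<n. x j * ct [0..<n] j (s {}) {i}) = (\<Sum>j\<in>{..<n} - {i}. x j * ct [0..<n] j (s {}) {i})"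
  by (rule sum.mono_neutral_right) (auto simp: ct_def)
 also have "?s * \<dots> = (\<Sum>j\<in>{..<n} - {i}. (?s * ct [0..<n] j (s {}) {i}) * x j)"
  by (simp add: sum_distrib_left ac_simps)
 finally show ?thesis
  by (intro bexI[OF _ us(1)] exI[of _ "\<lambda>j. sg [0..<n] i {} * ct [0..<n] j (s {}) {i}"])
qed

end

section \<open>Noetherian subrings and Krull intersections\<close>

text \<open>Subrings are sets inside a ring type; thus polynomials in the vertices of the complex
  live in the type of all polynomials in \<open>'v\<close>, whether or not that type is
  finite.\<close>

definition subr :: "'r::comm_ring_1 set => bool" where
 "subr R \<longleftrightarrow> 1 \<in> R \<and> (\<forall>a\<in>R. \<forall>b\<in>R. a - b \<in> R \<and> a * b \<in> R)"

definition idl :: "'r::comm_ring_1 set => 'r set => bool" where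
 "idl R I \<longleftrightarrow> I \<subseteq> R \<and> 0 \<in> I \<and> (\<forall>a\<in>I. \<forall>b\<in>I. a + b \<in> I) \<and> (\<forall>r\<in>R. \<forall>a\<in>I. r * a \<in> I)"

definition lin :: "'r::comm_ring_1 set => 'r set => 'r set" where
 "lin R X = {(\<Sum>y\<in>X. c y * y) | c. \<forall>y\<in>X. c y \<in> R}"

definition noeth :: "'r::comm_ring_1 set => bool" where
 "noeth R \<longleftrightarrow> (\<forall>I. idl R I --> (\<exists>X. finite X \<and> X \<subseteq> I \<and> I \<subseteq> lin R X))"

lemma subrD:
 assumes "subr R"
 shows "1 \<in> R" "0 \<in> R" "a \<in> R ==> b \<in> R ==> a - b \<in> R" "a \<in> R ==> b \<in> R ==> a * b \<in> R"
  "a \<in> R ==> - a \<in> R" "a \<in> R ==> b \<in> R ==> a + b \<in> R" "a \<in> R ==> a ^ k \<in> R"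
proof -
 show 1: "1 \<in> R" and d: "a \<in> R ==> b \<in> R ==> a - b \<in> R" and m: "a \<in> R ==> b \<in> R ==> a * b \<in> R" for a b
  using assms by (auto simp: subr_def)
 show 0: "0 \<in> R" using d[OF 1 1] by simp
 show n: "- a \<in> R" if "a \<in> R" for a using d[OF 0 that] by simp
 show "a \<in> R ==> b \<in> R ==> a + b \<in> R" using d[OF _ n, of a b] by simp
 show "a \<in> R ==> a ^ k \<in> R" by (induction k) (auto intro: 1 m)
qed

lemma idlD:
 assumes "idl R I"
 shows "a \<in> I ==> a \<in> R" "0 \<in> I" "a \<in> I ==> b \<in> I ==> a + b \<in> I" "r \<in> R ==> a \<in> I ==> r * a \<in> I"
 using assms by (auto simp: idl_def)

lemma idl_diff: "subr R ==> idl R I ==> a \<in> I ==> b \<in> I ==> a - b \<in> I"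
 using idlD(3)[of R I a "(- 1) * b"] idlD(4)[of R I "- 1" b] subrD(1,5) by fastforce

lemma idl_sum: "idl R I ==> (\<And>i. i \<in> A ==> f i \<in> I) ==> sum f A \<in> I"
 by (induction A rule: infinite_finite_induct) (auto intro: idlD)

lemma subr_sum: "subr R ==> (\<And>i. i \<in> A ==> f i \<in> R) ==> sum f A \<in> R"
 by (induction A rule: infinite_finite_induct) (auto intro: subrD)

lemma subr_prod: "subr R ==> (\<And>i. i \<in> A ==> f i \<in> R) ==> prod f A \<in> R"
 by (induction A rule: infinite_finite_induct) (auto intro: subrD)

lemma lin_subset: "idl R I ==> X \<subseteq> I ==> lin R X \<subseteq> I"
 unfolding lin_def by (auto intro!: idl_sum idlD(4))

lemma lin_idl:
 assumes "subr R" "X \<subseteq> R"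
 shows "idl R (lin R X)"
 unfolding idl_def
proof (intro conjI ballI)
 show "lin R X \<subseteq> R" using assms by (auto simp: lin_def intro!: subr_sum subrD)
 show "0 \<in> lin R X" using assms by (auto simp: lin_def subrD intro!: exI[of _ "\<lambda>_. 0"])
 show "a + b \<in> lin R X" if ab: "a \<in> lin R X" "b \<in> lin R X" for a b
 proof -
  obtain c c' where "a = (\<Sum>y\<in>X. c y * y)" "\<forall>y\<in>X. c y \<in> R" "b = (\<Sum>y\<in>X. c' y * y)" "\<forall>y\<in>X. c' y \<in> R"
   using ab unfolding lin_def by blast
  then show ?thesis unfolding lin_def
   by (auto intro!: exI[of _ "\<lambda>y. c y + c' y"] simp: sum.distrib distrib_right subrD(6)[OF assms(1)])
 qed
 show "r * a \<in> lin R X" if r: "r \<in> R" and ra: "a \<in> lin R X" for r a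
 proof -
  obtain c where "a = (\<Sum>y\<in>X. c y * y)" "\<forall>y\<in>X. c y \<in> R" using ra unfolding lin_def by blast
  then show ?thesis unfolding lin_def using r
   by (auto intro!: exI[of _ "\<lambda>y. r * c y"] simp: sum_distrib_left mult.assoc subrD(4)[OF assms(1)])
 qed
qed

lemma lin_base: assumes "subr R" "finite X" "y \<in> X" shows "y \<in> lin R X"
proof -
 have "y = (\<Sum>z\<in>X. (if z = y then 1 else 0) * z)" using assms(2,3) by (simp add: if_distrib[of "\<lambda>c. c * _"] cong: if_cong)
 then show ?thesis unfolding lin_def using assms(1) by (auto intro!: exI[of _ "\<lambda>z. if z = y then 1 else 0"] simp: subrD)
qed

text \<open>The union is an ideal, and its finitely many generators already lie in one member of the
  chain.\<close>

lemma noeth_chain: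
 assumes R: "subr R" "noeth R" and ne: "C ~= {}" and ch: "subset.chain UNIV C" and I: "\<And>I. I \<in> C ==> idl R I"
 shows "\<Union>C \<in> C"
proof -
 have "idl R (\<Union>C)"
  unfolding idl_def
 proof (intro conjI ballI)
  show "\<Union>C \<subseteq> R" "0 \<in> \<Union>C" using I ne by (auto dest: idlD)
  show "a + b \<in> \<Union>C" if ab: "a \<in> \<Union>C" "b \<in> \<Union>C" for a b
  proof -
   obtain A B where AB: "A \<in> C" "a \<in> A" "B \<in> C" "b \<in> B" using ab by blast
   then have "A \<subseteq> B \<or> B \<subseteq> A" using ch by (auto simp: subset_chain_def)
   then show ?thesis using AB I idlD(3) by (metis UnionI subsetD)
  qed
  show "r * a \<in> \<Union>C" if "r \<in> R" "a \<in> \<Union>C" for r a using that I idlD(4) by blast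
 qed
 then obtain X where X: "finite X" "X \<subseteq> \<Union>C" "\<Union>C \<subseteq> lin R X" using R(2) unfolding noeth_def by blast
 obtain A where A: "A \<in> C" "X \<subseteq> A" using finite_subset_Union_chain[OF X(1,2) ne ch] by blast
 then have "\<Union>C \<subseteq> A" using X(3) lin_subset[OF I[OF A(1)] A(2)] by blast
 then show ?thesis using A(1) by (metis Sup_upper subset_antisym)
qed

lemma noeth_stable:
 assumes R: "subr R" "noeth R" and I: "\<And>k. idl R (I k)" and mono: "\<And>k. I k \<subseteq> I (Suc k)"
 shows "\<exists>k. \<forall>l\<ge>k. I l = I k"
proof -
 have inc: "k \<le> l ==> I k \<subseteq> I l" for k l using lift_Suc_mono_le[of I k l, OF mono] by simp
 have "subset.chain UNIV (range I)" by (auto simp: subset_chain_def) (metis inc nat_le_linear subsetD)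
 then have "\<Union>(range I) \<in> range I" by (intro noeth_chain[OF R]) (use I in auto)
 then obtain k where k: "\<Union>(range I) = I k" by auto
 have "I l = I k" if "k \<le> l" for l using inc[OF that] k by blast
 then show ?thesis by blast
qed

text \<open>Krull's intersection theorem modulo J for a single element a, with multipliers in place
  of units. Among the ideals that contain \<open>J + M * a\<close> and meet \<open>J + R * a\<close>
  in nothing more, a maximal one L contains a power of every element of M. For large N the
  hypothesis puts u * a into L, hence into \<open>J + M * a\<close>, and u is then corrected by an
  element of M.\<close>

lemma krull_intersection:
 assumes R: "subr R" "noeth R" and J: "idl R J" and a: "a \<in> R" and M: "idl R M"
  and U: "U \<subseteq> R" "\<And>u \<mu>. u \<in> U ==> \<mu> \<in> M ==> u - \<mu> \<in> U"
  and Y: "finite Y" "Y \<subseteq> M"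
  and h: "\<And>N. \<exists>u\<in>U. \<exists>j\<in>J. \<exists>c. (\<forall>y\<in>Y. c y \<in> R) \<and> u * a = j + (\<Sum>y\<in>Y. c y * y ^ N)"
 shows "\<exists>u\<in>U. u * a \<in> J"
proof -
 define C where "C = {j + \<mu> * a | j \<mu>. j \<in> J \<and> \<mu> \<in> M}"
 define E where "E = {j + r * a | j r. j \<in> J \<and> r \<in> R}"
 have idlE: "idl R {j + r * a | j r. j \<in> J \<and> r \<in> S}" if S: "idl R S" for S
  unfolding idl_def
 proof (intro conjI ballI)
  show "{j + r * a |j r. j \<in> J \<and> r \<in> S} \<subseteq> R" using idlD(1)[OF J] idlD(1)[OF S] a subrD[OF R(1)] by auto
  show "0 \<in> {j + r * a |j r. j \<in> J \<and> r \<in> S}" using idlD(2)[OF J] idlD(2)[OF S] by force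
  show "b + c \<in> {j + r * a |j r. j \<in> J \<and> r \<in> S}" if bc: "b \<in> {j + r * a |j r. j \<in> J \<and> r \<in> S}" "c \<in> {j + r * a |j r. j \<in> J \<and> r \<in> S}" for b c
  proof -
   obtain j r j' r' where "b = j + r * a" "c = j' + r' * a" "j \<in> J" "j' \<in> J" "r \<in> S" "r' \<in> S" using bc by blast
   then have "b + c = (j + j') + (r + r') * a" "j + j' \<in> J" "r + r' \<in> S" using idlD(3)[OF J] idlD(3)[OF S] by (auto simp: algebra_simps)
   then show ?thesis by blast
  qed
  show "s * b \<in> {j + r * a |j r. j \<in> J \<and> r \<in> S}" if bc: "s \<in> R" "b \<in> {j + r * a |j r. j \<in> J \<and> r \<in> S}" for b s
  proof -
   obtain j r where "b = j + r * a" "j \<in> J" "r \<in> S" using bc by blast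
   then have "s * b = (s * j) + (s * r) * a" "s * j \<in> J" "s * r \<in> S" using idlD(4)[OF J bc(1)] idlD(4)[OF S bc(1)] by (auto simp: algebra_simps)
   then show ?thesis by blast
  qed
 qed
 have idlR: "idl R R" using subrD[OF R(1)] by (auto simp: idl_def)
 have C: "idl R C" and E: "idl R E" unfolding C_def E_def by (rule idlE, fact M) (rule idlE, fact idlR)
 have CE: "C \<subseteq> E" using idlD(1)[OF M] by (auto simp: C_def E_def)
 have ME: "y * z \<in> C" if "y \<in> M" "z \<in> E" for y z
 proof -
  obtain j r where z: "z = j + r * a" "j \<in> J" "r \<in> R" using \<open>z \<in> E\<close> by (auto simp: E_def)
  have "y * z = y * j + (r * y) * a" by (simp add: z(1) algebra_simps)
  moreover have "y * j \<in> J" "r * y \<in> M" using idlD(4)[OF J idlD(1)[OF M that(1)] z(2)] idlD(4)[OF M z(3) that(1)] by auto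
  ultimately show ?thesis by (auto simp: C_def)
 qed
 define \<C> where "\<C> = {L. idl R L \<and> C \<subseteq> L \<and> L \<inter> E \<subseteq> C}"
 \<comment> \<open>Zorn's lemma applies because, by \<open>noeth_chain\<close>, a chain of ideals
   contains its union.\<close>
 have "\<exists>L\<in>\<C>. \<forall>X\<in>\<C>. L \<subseteq> X --> X = L"
 proof (rule subset_Zorn_nonempty)
  show "\<C> ~= {}" using C by (auto simp: \<C>_def)
  fix K assume K: "K ~= {}" "subset.chain \<C> K"
  then have "\<Union>K \<in> K" by (intro noeth_chain[OF R]) (auto simp: subset_chain_def \<C>_def)
  then show "\<Union>K \<in> \<C>" using K(2) by (auto simp: subset_chain_def)
 qed
 then obtain L where L: "idl R L" "C \<subseteq> L" "L \<inter> E \<subseteq> C" and Lmax: "\<And>X. X \<in> \<C> ==> L \<subseteq> X ==> X = L"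
  by (auto simp: \<C>_def)
 have pow: "\<exists>k. \<forall>l\<ge>k. y ^ l \<in> L" if y: "y \<in> M" for y
 proof -
  have yR: "y \<in> R" using idlD(1)[OF M y] .
  \<comment> \<open>The colon ideals of L by powers of y stabilize at some k; the ideal generated by
    L and y ^ k then still belongs to \<open>\<C>\<close>, so by maximality it is L.\<close>
  define I where "I k = {r \<in> R. r * y ^ k \<in> L}" for k
  have "idl R (I k)" for k
   unfolding idl_def I_def using subrD[OF R(1)] idlD[OF L(1)]
   by (auto simp: distrib_right mult.assoc)
  moreover have "I k \<subseteq> I (Suc k)" for k
   unfolding I_def using idlD(4)[OF L(1) yR] by (auto simp: mult.left_commute[of _ y])
  ultimately obtain k where k: "\<forall>l\<ge>k. I l = I k" using noeth_stable[OF R] by blast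
  define L' where "L' = {l + r * y ^ k | l r. l \<in> L \<and> r \<in> R}"
  have "idl R L'"
   unfolding idl_def
  proof (intro conjI ballI)
   show "L' \<subseteq> R" using idlD(1)[OF L(1)] yR subrD[OF R(1)] by (auto simp: L'_def)
   show "0 \<in> L'" using idlD(2)[OF L(1)] subrD(2)[OF R(1)] by (force simp: L'_def)
   show "b + c \<in> L'" if bc: "b \<in> L'" "c \<in> L'" for b c
   proof -
    obtain l r l' r' where "b = l + r * y ^ k" "c = l' + r' * y ^ k" "l \<in> L" "l' \<in> L" "r \<in> R" "r' \<in> R"
     using bc unfolding L'_def by blast
    then have "b + c = (l + l') + (r + r') * y ^ k" "l + l' \<in> L" "r + r' \<in> R"
     using idlD(3)[OF L(1)] subrD(6)[OF R(1)] by (auto simp: algebra_simps)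
    then show ?thesis unfolding L'_def by blast
   qed
   show "s * b \<in> L'" if bc: "s \<in> R" "b \<in> L'" for b s
   proof -
    obtain l r where "b = l + r * y ^ k" "l \<in> L" "r \<in> R" using bc unfolding L'_def by blast
    then have "s * b = (s * l) + (s * r) * y ^ k" "s * l \<in> L" "s * r \<in> R"
     using idlD(4)[OF L(1) bc(1)] subrD(4)[OF R(1) bc(1)] by (auto simp: algebra_simps)
    then show ?thesis unfolding L'_def by blast
   qed
  qed
  moreover have LL': "L \<subseteq> L'"
  proof
   fix l assume "l \<in> L"
   then show "l \<in> L'" unfolding L'_def using subrD(2)[OF R(1)] by (intro CollectI exI[of _ l] exI[of _ 0]) simp
  qed
  moreover have "L' \<inter> E \<subseteq> C"
  proof
   fix z assume z: "z \<in> L' \<inter> E"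
   then obtain l r where lr: "z = l + r * y ^ k" "l \<in> L" "r \<in> R" unfolding L'_def by blast
   \<comment> \<open>Since M multiplies \<open>J + R * a\<close> into C, multiplying z by y lands in
     L; then r * y ^ Suc k is in L, and stability gives r * y ^ k in L.\<close>
   have "y * z \<in> L" using ME[OF y] z L(2) by blast
   moreover have "y * l \<in> L" using idlD(4)[OF L(1) yR lr(2)] .
   ultimately have "y * z - y * l \<in> L" using idl_diff[OF R(1) L(1)] by blast
   then have "r * y ^ Suc k \<in> L" by (simp add: lr(1) algebra_simps)
   then have "r \<in> I (Suc k)" using lr(3) by (simp add: I_def)
   moreover have "I (Suc k) = I k" using k[rule_format, of "Suc k"] by simp
   ultimately have "r \<in> I k" by blast
   then have "r * y ^ k \<in> L" by (simp add: I_def)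
   then have "z \<in> L" using lr idlD(3)[OF L(1)] by blast
   then show "z \<in> C" using z L(3) by blast
  qed
  ultimately have "L' = L" using Lmax[of L'] L(2) by (auto simp: \<C>_def)
  moreover have "y ^ k \<in> L'" unfolding L'_def
   using idlD(2)[OF L(1)] subrD(1)[OF R(1)] by (intro CollectI exI[of _ 0] exI[of _ 1]) simp
  ultimately have "y ^ k \<in> L" by simp
  then have "y ^ l \<in> L" if "k \<le> l" for l
  proof -
   have "y ^ l = y ^ (l - k) * y ^ k" using that by (simp add: power_add[symmetric])
   then show ?thesis using idlD(4)[OF L(1) subrD(7)[OF R(1) yR] \<open>y ^ k \<in> L\<close>] by metis
  qed
  then show ?thesis by blast
 qed
 have "\<exists>N. \<forall>y\<in>Y. y ^ N \<in> L"
 proof -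
  obtain f where f: "\<And>y. y \<in> Y ==> \<forall>l\<ge>f y. y ^ l \<in> L" using pow Y(2) by (metis subsetD)
  have "f y \<le> sum f Y" if "y \<in> Y" for y using Y(1) that by (simp add: member_le_sum)
  then show ?thesis using f by blast
 qed
 then obtain N where N: "\<And>y. y \<in> Y ==> y ^ N \<in> L" by blast
 obtain u j c where u: "u \<in> U" "j \<in> J" "\<forall>y\<in>Y. c y \<in> R" "u * a = j + (\<Sum>y\<in>Y. c y * y ^ N)" using h[of N] by blast
 have "j \<in> C" using u(2) idlD(2)[OF M] unfolding C_def by force
 then have "u * a \<in> L" unfolding u(4)
  using L(2) u(3) N by (intro idlD(3)[OF L(1)] idl_sum[OF L(1)] idlD(4)[OF L(1)]) auto
 moreover have "u * a \<in> E" unfolding E_def using u(1) U(1) idlD(2)[OF J] by force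
 ultimately have "u * a \<in> C" using L(3) by blast
 then obtain j' \<mu> where "u * a = j' + \<mu> * a" "j' \<in> J" "\<mu> \<in> M" unfolding C_def by blast
 \<comment> \<open>The step of Nakayama's lemma: u - \<mu> is again a multiplier.\<close>
 then have "(u - \<mu>) * a \<in> J" "u - \<mu> \<in> U" using U(2) u(1) by (auto simp: algebra_simps)
 then show ?thesis by blast
qed

section \<open>Hilbert's basis theorem\<close>

definition adj :: "'r::comm_ring_1 set => 'r => 'r set" where
 "adj R x = {poly P x | P. \<forall>i. Polynomial.coeff P i \<in> R}"

text \<open>The argument with leading coefficients. The element x may be algebraic over R, so
  degrees make no sense in \<open>adj R x\<close>; the proof works with the set \<open>PI\<close> of
  all polynomials over R whose value at x lies in I.\<close>

lemma hilbert_basis: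
 fixes R :: "'r::comm_ring_1 set"
 assumes R: "subr R" "noeth R"
 shows "noeth (adj R x)"
 unfolding noeth_def
proof (intro allI impI)
 fix I assume I: "idl (adj R x) I"
 define PI where "PI = {P. (\<forall>i. Polynomial.coeff P i \<in> R) \<and> poly P x \<in> I}"
 have PI_add: "P + Q \<in> PI" if "P \<in> PI" "Q \<in> PI" for P Q
  using that idlD(3)[OF I] subrD(6)[OF R(1)] by (auto simp: PI_def)
 have PI_smult: "Polynomial.smult r P \<in> PI" if "P \<in> PI" "r \<in> R" for P r
 proof -
  have "poly [:r:] x \<in> adj R x" unfolding adj_def
   by (rule CollectI, rule exI[of _ "[:r:]"]) (auto simp: coeff_pCons subrD(2)[OF R(1)] that(2) split: nat.splits)
  then show ?thesis using that idlD(4)[OF I] subrD(4)[OF R(1)] by (auto simp: PI_def)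
 qed
 have PI_diff: "P - Q \<in> PI" if "P \<in> PI" "Q \<in> PI" for P Q
  using PI_add[OF that(1) PI_smult[OF that(2) subrD(5)[OF R(1) subrD(1)[OF R(1)]]]] by simp
 have xR: "x ^ k \<in> adj R x" for k unfolding adj_def
  by (rule CollectI, rule exI[of _ "Polynomial.monom 1 k"]) (auto simp: poly_monom subrD[OF R(1)])
 have PI_shift: "Polynomial.monom 1 k * P \<in> PI" if "P \<in> PI" for P k
  using that idlD(4)[OF I xR] subrD(2)[OF R(1)] by (auto simp: PI_def poly_monom coeff_monom_mult)
 have PI_0: "0 \<in> PI" using idlD(2)[OF I] subrD(2)[OF R(1)] by (simp add: PI_def)
 define L where "L n = {Polynomial.coeff P n | P. P \<in> PI \<and> Polynomial.degree P \<le> n}" for n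
 have idlL: "idl R (L n)" for n
  unfolding idl_def L_def
 proof (intro conjI ballI)
  show "{Polynomial.coeff P n |P. P \<in> PI \<and> Polynomial.degree P \<le> n} \<subseteq> R" by (auto simp: PI_def)
  show "0 \<in> {Polynomial.coeff P n |P. P \<in> PI \<and> Polynomial.degree P \<le> n}" using PI_0 by force
  show "a + b \<in> {Polynomial.coeff P n |P. P \<in> PI \<and> Polynomial.degree P \<le> n}" if ab: "a \<in> {Polynomial.coeff P n |P. P \<in> PI \<and> Polynomial.degree P \<le> n}" "b \<in> {Polynomial.coeff P n |P. P \<in> PI \<and> Polynomial.degree P \<le> n}" for a b
  proof -
   obtain P Q where "P \<in> PI" "Polynomial.degree P \<le> n" "a = Polynomial.coeff P n" "Q \<in> PI" "Polynomial.degree Q \<le> n" "b = Polynomial.coeff Q n" using ab by blast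
   then show ?thesis using PI_add degree_add_le by (intro CollectI exI[of _ "P + Q"]) auto
  qed
  show "r * a \<in> {Polynomial.coeff P n |P. P \<in> PI \<and> Polynomial.degree P \<le> n}" if ra: "r \<in> R" "a \<in> {Polynomial.coeff P n |P. P \<in> PI \<and> Polynomial.degree P \<le> n}" for r a
  proof -
   obtain P where "P \<in> PI" "Polynomial.degree P \<le> n" "a = Polynomial.coeff P n" using ra by blast
   then show ?thesis using PI_smult[OF _ ra(1)] degree_smult_le[of r P] by (intro CollectI exI[of _ "Polynomial.smult r P"]) auto
  qed
 qed
 have Lmono: "L n \<subseteq> L (Suc n)" for n
 proof
  fix a assume "a \<in> L n"
  then obtain P where P: "P \<in> PI" "Polynomial.degree P \<le> n" "a = Polynomial.coeff P n" by (auto simp: L_def)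
  have "Polynomial.coeff (Polynomial.monom 1 1 * P) (Suc n) = a" by (simp add: coeff_monom_mult P(3))
  moreover have "Polynomial.degree (Polynomial.monom 1 1 * P) \<le> Suc n"
   using degree_mult_le[of "Polynomial.monom 1 1" P] degree_monom_le[of "1::'r" 1] P(2) by linarith
  ultimately show "a \<in> L (Suc n)" unfolding L_def using PI_shift[OF P(1), of 1] by (metis (mono_tags, lifting) mem_Collect_eq)
 qed
 from noeth_stable[where I = L, OF R idlL Lmono] obtain n0 where n0: "\<forall>l\<ge>n0. L l = L n0" by auto
 have exG: "\<exists>G. finite G \<and> G \<subseteq> {P \<in> PI. Polynomial.degree P \<le> n} \<and> L n \<subseteq> lin R ((\<lambda>P. Polynomial.coeff P n) ` G)" for n
 proof -
  obtain X where X: "finite X" "X \<subseteq> L n" "L n \<subseteq> lin R X" using R(2)[unfolded noeth_def, rule_format, OF idlL[of n]] by auto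
  have sub: "X \<subseteq> (\<lambda>P. Polynomial.coeff P n) ` {P \<in> PI. Polynomial.degree P \<le> n}" using X(2) by (auto simp: L_def)
  then obtain G where "G \<subseteq> {P \<in> PI. Polynomial.degree P \<le> n}" "finite G" "X = (\<lambda>P. Polynomial.coeff P n) ` G"
   using finite_subset_image[OF X(1) sub] by auto
  then show ?thesis using X(3) by auto
 qed
 have "\<exists>G. \<forall>n. finite (G n) \<and> G n \<subseteq> {P \<in> PI. Polynomial.degree P \<le> n} \<and> L n \<subseteq> lin R ((\<lambda>P. Polynomial.coeff P n) ` G n)"
  by (rule choice) (rule allI, rule exG)
 then obtain G where G: "\<And>n. finite (G n)" "\<And>n. G n \<subseteq> {P \<in> PI. Polynomial.degree P \<le> n}" "\<And>n. L n \<subseteq> lin R ((\<lambda>P. Polynomial.coeff P n) ` G n)"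
  by auto
 \<comment> \<open>Beyond degree n0 the ideals of leading coefficients no longer grow, so generators
   of degree at most n0 suffice.\<close>
 define Y where "Y = (\<Union>n\<le>n0. (\<lambda>P. poly P x) ` G n)"
 have Y: "finite Y" "Y \<subseteq> I" using G(1,2) by (auto simp: Y_def PI_def)
 have sA: "subr (adj R x)"
  unfolding subr_def adj_def
 proof (intro conjI ballI)
  show "1 \<in> {poly P x |P. \<forall>i. Polynomial.coeff P i \<in> R}"
   by (rule CollectI, rule exI[of _ 1]) (auto simp: subrD[OF R(1)])
  fix a b assume "a \<in> {poly P x |P. \<forall>i. Polynomial.coeff P i \<in> R}" "b \<in> {poly P x |P. \<forall>i. Polynomial.coeff P i \<in> R}"
  then obtain P Q where PQ: "a = poly P x" "\<forall>i. Polynomial.coeff P i \<in> R" "b = poly Q x" "\<forall>i. Polynomial.coeff Q i \<in> R" by blast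
  show "a - b \<in> {poly P x |P. \<forall>i. Polynomial.coeff P i \<in> R}"
   by (rule CollectI, rule exI[of _ "P - Q"]) (auto simp: PQ subrD(3)[OF R(1)])
  show "a * b \<in> {poly P x |P. \<forall>i. Polynomial.coeff P i \<in> R}"
   by (rule CollectI, rule exI[of _ "P * Q"]) (auto simp: PQ coeff_mult intro!: subr_sum[OF R(1)] subrD(4)[OF R(1)])
 qed
 have YA: "Y \<subseteq> adj R x" using Y(2) idlD(1)[OF I] by blast
 note linY = lin_idl[OF sA YA]
 have claim: "poly P x \<in> lin (adj R x) Y" if "P \<in> PI" "Polynomial.degree P \<le> n" for n P
  using that
 proof (induction n arbitrary: P rule: less_induct)
  case (less n)
  \<comment> \<open>Generators are taken in degree m and shifted up by
    \<open>monom 1 (n - m)\<close>, which does not change the leading coefficient.\<close>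
  define m where "m = min n n0"
  have "Polynomial.coeff P n \<in> L n" using less.prems by (auto simp: L_def)
  moreover have "L n = L m" using n0[rule_format, of n] by (cases "n \<le> n0") (simp_all add: m_def min_def)
  ultimately have "Polynomial.coeff P n \<in> lin R ((\<lambda>P. Polynomial.coeff P m) ` G m)" using G(3) by blast
  then obtain c where c: "\<forall>y\<in>(\<lambda>P. Polynomial.coeff P m) ` G m. c y \<in> R" "Polynomial.coeff P n = (\<Sum>y\<in>(\<lambda>P. Polynomial.coeff P m) ` G m. c y * y)"
   unfolding lin_def by blast
  \<comment> \<open>One generator per leading coefficient, so that the sum over coefficients can be
    rewritten as a sum over polynomials.\<close>
  obtain H where H: "H \<subseteq> G m" "inj_on (\<lambda>P. Polynomial.coeff P m) H" "(\<lambda>P. Polynomial.coeff P m) ` H = (\<lambda>P. Polynomial.coeff P m) ` G m"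
   by (metis subset_image_inj subset_refl)
  have finH: "finite H" using H(1) G(1) finite_subset by blast
  have cP: "Polynomial.coeff P n = (\<Sum>g\<in>H. c (Polynomial.coeff g m) * Polynomial.coeff g m)"
   unfolding c(2) H(3)[symmetric] using H(2) by (simp add: sum.reindex)
  \<comment> \<open>Q agrees with P in the coefficient at n and lies in \<open>PI\<close>; P - Q has
    smaller degree, or is 0.\<close>
  define Q where "Q = (\<Sum>g\<in>H. Polynomial.smult (c (Polynomial.coeff g m)) (Polynomial.monom 1 (n - m) * g))"
  have gPI: "g \<in> PI" "Polynomial.degree g \<le> m" if "g \<in> H" for g using that H(1) G(2) by auto
  have QPI: "Q \<in> PI"
  proof -
   have "Polynomial.smult (c (Polynomial.coeff g m)) (Polynomial.monom 1 (n - m) * g) \<in> PI" if "g \<in> H" for g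
    by (rule PI_smult[OF PI_shift]) (use gPI that c(1) H(1) in auto)
   note gQ = this
   have "(\<Sum>g\<in>H'. Polynomial.smult (c (Polynomial.coeff g m)) (Polynomial.monom 1 (n - m) * g)) \<in> PI" if "finite H'" "H' \<subseteq> H" for H'
    using that by (induction H' rule: finite_induct) (simp_all add: PI_0 PI_add gQ)
   then show ?thesis unfolding Q_def using finH by simp
  qed
  have mn: "m \<le> n" "m \<le> n0" by (auto simp: m_def)
  have dQ: "Polynomial.degree Q \<le> n" unfolding Q_def
  proof (rule degree_sum_le[OF finH])
   fix g assume g: "g \<in> H"
   have "Polynomial.degree (Polynomial.smult (c (Polynomial.coeff g m)) (Polynomial.monom 1 (n - m) * g)) \<le> Polynomial.degree (Polynomial.monom (1::'r) (n - m)) + Polynomial.degree g"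
    by (rule order_trans[OF degree_smult_le degree_mult_le])
   also have "\<dots> \<le> (n - m) + m" by (intro add_mono degree_monom_le gPI(2)[OF g])
   finally show "Polynomial.degree (Polynomial.smult (c (Polynomial.coeff g m)) (Polynomial.monom 1 (n - m) * g)) \<le> n" using mn by simp
  qed
  have cQ: "Polynomial.coeff Q n = Polynomial.coeff P n"
  proof -
   have "Polynomial.coeff (Polynomial.monom 1 (n - m) * g) n = Polynomial.coeff g m" for g :: "'r poly"
    using mn by (simp add: coeff_monom_mult)
   then show ?thesis by (simp add: Q_def coeff_sum cP)
  qed
  have PQ: "poly (P - Q) x \<in> lin (adj R x) Y"
  proof (cases "P - Q = 0")
   case True then show ?thesis using idlD(2)[OF linY] by simp
  next
   case False
   have "Polynomial.degree (P - Q) \<le> n" using degree_diff_le less.prems(2) dQ by blast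
   moreover have "Polynomial.degree (P - Q) ~= n" using cQ False by (metis coeff_diff leading_coeff_0_iff right_minus_eq)
   ultimately have "Polynomial.degree (P - Q) < n" by simp
   then show ?thesis using less.IH PI_diff[OF less.prems(1) QPI] by blast
  qed
  have "poly Q x \<in> lin (adj R x) Y"
  proof -
   have "c (Polynomial.coeff g m) * x ^ (n - m) * poly g x \<in> lin (adj R x) Y" if g: "g \<in> H" for g
   proof (rule idlD(4)[OF linY])
    show "c (Polynomial.coeff g m) * x ^ (n - m) \<in> adj R x" unfolding adj_def
     by (rule CollectI, rule exI[of _ "Polynomial.monom (c (Polynomial.coeff g m)) (n - m)"])
      (use c(1) H(1) g in \<open>auto simp: poly_monom subrD[OF R(1)]\<close>)
    show "poly g x \<in> lin (adj R x) Y"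
     by (rule lin_base[OF sA Y(1)]) (use g H(1) mn in \<open>auto simp: Y_def\<close>)
   qed
   then show ?thesis unfolding Q_def by (auto simp: poly_sum poly_monom mult.assoc intro!: idl_sum[OF linY])
  qed
  then have "poly (P - Q) x + poly Q x \<in> lin (adj R x) Y" using PQ idlD(3)[OF linY] by blast
  then show ?case by simp
 qed
 have "I \<subseteq> lin (adj R x) Y"
 proof
  fix a assume a: "a \<in> I"
  then obtain P where P: "a = poly P x" "\<forall>i. Polynomial.coeff P i \<in> R" using idlD(1)[OF I] by (auto simp: adj_def)
  then have "P \<in> PI" using a by (simp add: PI_def)
  then show "a \<in> lin (adj R x) Y" using claim[of P "Polynomial.degree P"] P(1) by simp
 qed
 then show "\<exists>X. finite X \<and> X \<subseteq> I \<and> I \<subseteq> lin (adj R x) X" using Y by blast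
qed

section \<open>Polynomials in finitely many variables\<close>

definition SV :: "'v set => ('v, 'k::field) mpol set" where
 "SV V = {p. \<forall>m\<in>kys p. kys m \<subseteq> V}"

lemma keys_plus_nat': "kys (m + m' :: 'v \<Rightarrow>\<^sub>0 nat) = kys m \<union> kys m'"
 by (auto simp: in_keys_iff lookup_add)

lemma SV_subr: "subr (SV V)"
 unfolding subr_def SV_def
proof (intro conjI ballI)
 show "1 \<in> {p. \<forall>m\<in>kys p. kys m \<subseteq> V}" by simp
 fix a b :: "('a, 'b) mpol" assume "a \<in> {p. \<forall>m\<in>kys p. kys m \<subseteq> V}" "b \<in> {p. \<forall>m\<in>kys p. kys m \<subseteq> V}"
 then have a: "\<And>m. m \<in> kys a ==> kys m \<subseteq> V" and b: "\<And>m. m \<in> kys b ==> kys m \<subseteq> V" by auto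
 have "m \<in> kys a \<or> m \<in> kys b" if "m \<in> kys (a - b)" for m
  using that by (auto simp: in_keys_iff lookup_minus)
 then show "a - b \<in> {p. \<forall>m\<in>kys p. kys m \<subseteq> V}" using a b by auto
 show "a * b \<in> {p. \<forall>m\<in>kys p. kys m \<subseteq> V}"
 proof (intro CollectI ballI)
  fix m assume "m \<in> kys (a * b)"
  then obtain m1 m2 where "m = m1 + m2" "m1 \<in> kys a" "m2 \<in> kys b" using keys_mult by blast
  then show "kys m \<subseteq> V" using a[of m1] b[of m2] by (simp add: keys_plus_nat')
 qed
qed

lemma SV_single: "kys m \<subseteq> V ==> sngl m c \<in> SV V"
 by (auto simp: SV_def split: if_splits)

lemma SV_insert: "SV (insert v V) = adj (SV V) (Xp v 1)"
proof
 have mono: "SV V \<subseteq> SV (insert v V)" by (auto simp: SV_def)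
 have X: "Xp v 1 \<in> SV (insert v V)" unfolding Xp_def by (rule SV_single) (auto split: if_splits)
 show "adj (SV V) (Xp v 1) \<subseteq> SV (insert v V)"
  unfolding adj_def poly_altdef using mono X
  by (auto intro!: subr_sum[OF SV_subr] subrD(4,7)[OF SV_subr])
 have sA: "a + b \<in> adj (SV V) (Xp v 1)" if ab: "a \<in> adj (SV V) (Xp v 1)" "b \<in> adj (SV V) (Xp v 1)" for a b
 proof -
  obtain P Q where PQ: "a = poly P (Xp v 1)" "\<forall>i. Polynomial.coeff P i \<in> SV V" "b = poly Q (Xp v 1)" "\<forall>i. Polynomial.coeff Q i \<in> SV V"
   using ab unfolding adj_def by blast
  show ?thesis unfolding adj_def
   by (rule CollectI, rule exI[of _ "P + Q"]) (auto simp: PQ subrD(6)[OF SV_subr])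
 qed
 have z: "0 \<in> adj (SV V) (Xp v 1)" unfolding adj_def
  by (rule CollectI, rule exI[of _ 0]) (auto simp: subrD(2)[OF SV_subr])
 show "SV (insert v V) \<subseteq> adj (SV V) (Xp v 1 :: ('a, 'b) mpol)"
 proof
  fix p :: "('a, 'b) mpol" assume p: "p \<in> SV (insert v V)"
  have pw: "Xp v 1 ^ k = (Xp v k :: ('a, 'b) mpol)" for k
   by (induction k) (auto simp: Xp_def mult_single single_add[symmetric])
  have sing: "sngl m c \<in> adj (SV V) (Xp v 1)" if "kys m \<subseteq> insert v V" for m :: "'a \<Rightarrow>\<^sub>0 nat" and c :: 'b
  proof -
   define m' where "m' = flt (\<lambda>w. w ~= v) m"
   have m: "m = m' + sngl v (lk m v)"
    by (rule poly_mapping_eqI) (auto simp: m'_def lookup_flt lookup_add lookup_single when_def)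
   have "kys m' \<subseteq> V" using that by (auto simp: m'_def keys_flt)
   then have "sngl m' c \<in> SV V" by (rule SV_single)
   moreover have "sngl m c = sngl m' c * Xp v 1 ^ lk m v"
    unfolding pw by (subst m) (simp add: Xp_def mult_single)
   ultimately show ?thesis unfolding adj_def
    by (intro CollectI exI[of _ "Polynomial.monom (sngl m' c) (lk m v)"]) (auto simp: poly_monom subrD(2)[OF SV_subr])
  qed
  have kp: "m \<in> kys p ==> kys m \<subseteq> insert v V" for m using p by (simp add: SV_def)
  have "(\<Sum>m\<in>A. sngl m (lk p m)) \<in> adj (SV V) (Xp v 1)" if "finite A" "A \<subseteq> kys p" for A
   using that by (induction A rule: finite_induct) (simp_all add: z sA sing kp del: One_nat_def)
  then show "p \<in> adj (SV V) (Xp v 1)" by (metis finite_keys order_refl poly_mapping_sum_single)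
 qed
qed

lemma SV_noeth: "finite V ==> noeth (SV V :: ('v, 'k::field) mpol set)"
proof (induction V rule: finite_induct)
 case empty
 show ?case unfolding noeth_def
 proof (intro allI impI)
  fix I :: "('v, 'k) mpol set" assume I: "idl (SV {}) I"
  show "\<exists>X. finite X \<and> X \<subseteq> I \<and> I \<subseteq> lin (SV {}) X"
  proof (cases "I \<subseteq> {0}")
   case True
   then show ?thesis by (intro exI[of _ "{}"]) (auto simp: lin_def)
  next
   case False
   then obtain p where p: "p \<in> I" "p ~= 0" by blast
   have const: "q = sngl 0 (lk q 0)" if "q \<in> SV {}" for q :: "('v, 'k) mpol"
   proof (rule poly_mapping_eqI)
    fix m show "lk q m = lk (sngl 0 (lk q 0)) m"
     using that by (cases "m = 0") (auto simp: SV_def lookup_single in_keys_iff)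
   qed
   have "lk p 0 ~= 0" using const[OF idlD(1)[OF I p(1)]] p(2) by auto
   have "I \<subseteq> lin (SV {}) {p}"
   proof
    fix q assume "q \<in> I"
    then have "q = sngl 0 (lk q 0 / lk p 0) * p"
     using const[OF idlD(1)[OF I p(1)]] const[OF idlD(1)[OF I \<open>q \<in> I\<close>]] \<open>lk p 0 ~= 0\<close>
     by (metis mult_single add_0 nonzero_divide_eq_eq)
    then show "q \<in> lin (SV {}) {p}" unfolding lin_def
     by (auto intro!: exI[of _ "\<lambda>_. sngl 0 (lk q 0 / lk p 0)"] SV_single)
   qed
   then show ?thesis using p(1) by (intro exI[of _ "{p}"]) auto
  qed
 qed
next
 case (insert v V)
 then show ?case unfolding SV_insert by (intro hilbert_basis SV_subr)
qed

section \<open>Chains of prime ideals\<close>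

text \<open>Gaussian elimination: a vector \<open>i0\<close> with nonzero entry at j is the pivot
  that clears the coordinate j from the other vectors.\<close>

lemma linear_dependence:
 fixes w :: "'i => 'j => 'k::field"
 assumes "finite J" "finite I" "card J < card I"
 shows "\<exists>a. (\<exists>i\<in>I. a i ~= 0) \<and> (\<forall>j\<in>J. (\<Sum>i\<in>I. a i * w i j) = 0)"
 using assms
proof (induction J arbitrary: I w rule: finite_induct)
 case empty
 then obtain i where "i \<in> I" by fastforce
 then show ?case by (intro exI[of _ "\<lambda>_. 1"]) auto
next
 case (insert j J)
 show ?case
 proof (cases "\<forall>i\<in>I. w i j = 0")
  case True
  have "card J < card I" using insert.prems insert.hyps by simp
  from insert.IH[OF insert.prems(1) this, of w]
  obtain a where "\<exists>i\<in>I. a i ~= 0" "\<forall>j\<in>J. (\<Sum>i\<in>I. a i * w i j) = 0" by auto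
  then show ?thesis using True by (intro exI[of _ a]) simp
 next
  case False
  then obtain i0 where i0: "i0 \<in> I" "w i0 j ~= 0" by blast
  define w' where "w' i l = w i l - w i j / w i0 j * w i0 l" for i l
  have "card J < card (I - {i0})" using insert.prems insert.hyps i0 by simp
  from insert.IH[OF _ this, of w'] insert.prems(1)
  obtain a where a: "\<exists>i\<in>I - {i0}. a i ~= 0" "\<forall>l\<in>J. (\<Sum>i\<in>I - {i0}. a i * w' i l) = 0" by auto
  define b where "b i = (if i = i0 then - (\<Sum>i\<in>I - {i0}. a i * w i j) / w i0 j else a i)" for i
  have s: "(\<Sum>i\<in>I. b i * w i l) = (\<Sum>i\<in>I - {i0}. a i * w' i l)" for l
  proof -
   have "(\<Sum>i\<in>I. b i * w i l) = b i0 * w i0 l + (\<Sum>i\<in>I - {i0}. b i * w i l)"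
    by (rule sum.remove[OF insert.prems(1) i0(1)])
   also have "(\<Sum>i\<in>I - {i0}. b i * w i l) = (\<Sum>i\<in>I - {i0}. a i * w i l)"
    by (rule sum.cong) (auto simp: b_def)
   also have "b i0 * w i0 l = - (\<Sum>i\<in>I - {i0}. a i * w i j / w i0 j * w i0 l)"
    by (simp add: b_def sum_divide_distrib sum_distrib_right)
   finally show ?thesis by (simp add: w'_def right_diff_distrib sum_subtractf mult.assoc)
  qed
  have "w' i j = 0" for i using i0 by (simp add: w'_def)
  then have "\<forall>l\<in>insert j J. (\<Sum>i\<in>I. b i * w i l) = 0" using a(2) by (simp add: s)
  moreover have "\<exists>i\<in>I. b i ~= 0" using a(1) by (auto simp: b_def)
  ultimately show ?thesis by blast
 qed
qed

definition prm :: "'r::comm_ring_1 set => 'r set => bool" where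
 "prm R P \<longleftrightarrow> idl R P \<and> 1 \<notin> P \<and> (\<forall>a\<in>R. \<forall>b\<in>R. a * b \<in> P --> a \<in> P \<or> b \<in> P)"

lemma prm_power: "subr R ==> prm R P ==> a \<in> R ==> a ^ k \<in> P ==> a \<in> P"
proof (induction k)
 case (Suc k)
 then have "a * a ^ k \<in> P" "a ^ k \<in> R" by (simp_all add: subrD(7))
 then show ?case using Suc unfolding prm_def by blast
qed (simp add: prm_def)

definition ymon :: "(nat => 'r::comm_ring_1) => nat list => 'r" where
 "ymon y \<mu> = (\<Prod>i<length \<mu>. y i ^ (\<mu> ! i))"

lemma ymon_Cons: "ymon y (k # \<mu>) = y 0 ^ k * ymon (\<lambda>i. y (Suc i)) \<mu>"
 by (simp add: ymon_def prod.lessThan_Suc_shift del: prod.lessThan_Suc)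

lemma ymon_in: "subr R ==> (\<And>i. y i \<in> R) ==> ymon y \<mu> \<in> R"
 unfolding ymon_def by (intro subr_prod subrD(7)) auto

text \<open>Elements that climb a chain of primes satisfy no relation modulo \<open>P 0\<close> with
  unit coefficients. The least power of \<open>y 0\<close> in the relation can be cancelled because
  \<open>y 0\<close> is not in \<open>P 0\<close>; modulo \<open>P 1\<close>, where
  \<open>y 0\<close> vanishes, the terms of exactly this exponent survive and give a shorter
  relation for the rest of the chain.\<close>

lemma chain_algebraic_independence:
 fixes c :: "nat list => 'r::comm_ring_1"
 assumes R: "subr R"
 shows "(\<And>i. i \<le> r ==> prm R (P i)) ==> (\<And>i. i < r ==> P i \<subseteq> P (Suc i) \<and> y i \<in> P (Suc i) - P i) ==> (\<And>i. y i \<in> R) ==>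
  finite S ==> S ~= {} ==> (\<And>\<mu>. \<mu> \<in> S ==> length \<mu> = r \<and> c \<mu> \<in> R \<and> (\<exists>c'\<in>R. c \<mu> * c' = 1)) ==>
  (\<Sum>\<mu>\<in>S. c \<mu> * ymon y \<mu>) \<in> P 0 ==> False"
proof (induction r arbitrary: P y S c)
 case 0
 then have "S = {[]}" by fastforce
 then have "c [] \<in> P 0" using 0(7) by (simp add: ymon_def)
 moreover obtain c' where "c' \<in> R" "c [] * c' = 1" using 0(6) \<open>S = {[]}\<close> by blast
 moreover have "prm R (P 0)" using 0(1) by simp
 ultimately show False unfolding prm_def using idlD(4)[of R "P 0" c' "c []"] by (simp add: mult.commute)
next
 case (Suc r)
 define k where "k = Min (hd ` S)"
 have len: "\<mu> \<in> S ==> length \<mu> = Suc r" and cR: "\<mu> \<in> S ==> c \<mu> \<in> R" for \<mu> using Suc.prems(6) by blast+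
 have kmin: "k \<le> hd \<mu>" if "\<mu> \<in> S" for \<mu> unfolding k_def using Suc.prems(4) that by simp
 have "k \<in> hd ` S" unfolding k_def by (rule Min_in) (use Suc.prems(4,5) in auto)
 have P0: "prm R (P 0)" and P1: "prm R (P 1)" using Suc.prems(1) by auto
 have y0: "y 0 \<in> P 1" "y 0 \<notin> P 0" "P 0 \<subseteq> P 1" using Suc.prems(2)[of 0] by auto
 have I1: "idl R (P 1)" using P1 by (simp add: prm_def)
 define z where "z i = y (Suc i)" for i
 have zR: "z i \<in> R" for i using Suc.prems(3) by (simp add: z_def)
 have monz: "ymon z \<nu> \<in> R" for \<nu> by (rule ymon_in[OF R zR])
 define f where "f \<mu> = c \<mu> * (y 0 ^ (hd \<mu> - k) * ymon z (tl \<mu>))" for \<mu>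
 have fR: "f \<mu> \<in> R" if "\<mu> \<in> S" for \<mu> unfolding f_def
  by (intro subrD(4,7)[OF R] cR[OF that] Suc.prems(3) monz)
 have "(\<Sum>\<mu>\<in>S. c \<mu> * ymon y \<mu>) = y 0 ^ k * (\<Sum>\<mu>\<in>S. f \<mu>)"
  unfolding sum_distrib_left
 proof (rule sum.cong[OF refl])
  fix \<mu> assume m: "\<mu> \<in> S"
  then obtain a \<nu> where mu: "\<mu> = a # \<nu>" using len by (metis length_Suc_conv)
  have "k + (a - k) = a" using kmin[OF m] mu by simp
  then have "y 0 ^ a = y 0 ^ k * y 0 ^ (a - k)" by (metis power_add)
  then show "c \<mu> * ymon y \<mu> = y 0 ^ k * f \<mu>"
   by (simp add: f_def mu ymon_Cons z_def[abs_def] ac_simps)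
 qed
 then have "y 0 ^ k * (\<Sum>\<mu>\<in>S. f \<mu>) \<in> P 0" using Suc.prems(7) by simp
 moreover have "y 0 ^ k \<in> R" "(\<Sum>\<mu>\<in>S. f \<mu>) \<in> R" using subrD(7)[OF R Suc.prems(3)] subr_sum[OF R fR] by auto
 moreover have "y 0 ^ k \<notin> P 0" using prm_power[OF R P0 Suc.prems(3)] y0(2) by blast
 ultimately have "(\<Sum>\<mu>\<in>S. f \<mu>) \<in> P 0" using P0 unfolding prm_def by blast
 then have s1: "(\<Sum>\<mu>\<in>S. f \<mu>) \<in> P 1" using y0(3) by blast
 \<comment> \<open>The exponent lists starting with the least exponent k; the remaining summands
   keep a factor \<open>y 0\<close> and therefore lie in \<open>P 1\<close>.\<close>
 define S0 where "S0 = {\<mu> \<in> S. hd \<mu> = k}"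
 have S0: "finite S0" "S0 \<subseteq> S" using Suc.prems(4) by (auto simp: S0_def)
 have "(\<Sum>\<mu>\<in>S - S0. f \<mu>) \<in> P 1"
 proof (rule idl_sum[OF I1])
  fix \<mu> assume m: "\<mu> \<in> S - S0"
  define j where "j = hd \<mu> - k - 1"
  have "hd \<mu> - k = Suc j" using kmin[of \<mu>] m by (auto simp: S0_def j_def)
  then have "f \<mu> = (c \<mu> * (y 0 ^ j * ymon z (tl \<mu>))) * y 0"
   by (simp add: f_def ac_simps)
  moreover have "c \<mu> * (y 0 ^ j * ymon z (tl \<mu>)) \<in> R"
   by (intro subrD(4,7)[OF R] cR Suc.prems(3) monz) (use m in blast)
  ultimately show "f \<mu> \<in> P 1"
   using idlD(4)[OF I1 _ y0(1)] by metis
 qed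
 moreover have "(\<Sum>\<mu>\<in>S. f \<mu>) = (\<Sum>\<mu>\<in>S - S0. f \<mu>) + (\<Sum>\<mu>\<in>S0. f \<mu>)"
  using sum.subset_diff[OF S0(2) Suc.prems(4)] by simp
 ultimately have "(\<Sum>\<mu>\<in>S0. f \<mu>) \<in> P 1"
  using idl_diff[OF R I1 s1] by (metis add_diff_cancel_left')
 also have "(\<Sum>\<mu>\<in>S0. f \<mu>) = (\<Sum>\<nu>\<in>tl ` S0. c (k # \<nu>) * ymon z \<nu>)"
 proof -
  have "inj_on tl S0"
  proof (rule inj_onI)
   fix \<mu> \<nu> assume a: "\<mu> \<in> S0" "\<nu> \<in> S0" "tl \<mu> = tl \<nu>"
   then have "length \<mu> = Suc r" "length \<nu> = Suc r" "hd \<mu> = hd \<nu>" using len by (auto simp: S0_def)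
   then have "\<mu> ~= []" "\<nu> ~= []" by auto
   then show "\<mu> = \<nu>" using a(3) \<open>hd \<mu> = hd \<nu>\<close> by (simp add: list.expand)
  qed
  moreover have "f \<mu> = c (k # tl \<mu>) * ymon z (tl \<mu>)" if "\<mu> \<in> S0" for \<mu>
   using that len[of \<mu>] by (cases \<mu>) (auto simp: S0_def f_def)
  ultimately show ?thesis by (simp add: sum.reindex)
 qed
 finally have fin: "(\<Sum>\<nu>\<in>tl ` S0. c (k # \<nu>) * ymon z \<nu>) \<in> P 1" .
 have kc: "k # \<nu> \<in> S" if nu: "\<nu> \<in> tl ` S0" for \<nu>
 proof -
  obtain \<mu> where "\<mu> \<in> S" "hd \<mu> = k" "\<nu> = tl \<mu>" using nu unfolding S0_def by blast
  then show ?thesis using len[of \<mu>] by (cases \<mu>) auto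
 qed
 show False
 proof (rule Suc.IH[where P = "\<lambda>i. P (Suc i)" and y = z and S = "tl ` S0" and c = "\<lambda>\<nu>. c (k # \<nu>)"])
  show "prm R (P (Suc i))" if "i \<le> r" for i using Suc.prems(1) that by simp
  show "P (Suc i) \<subseteq> P (Suc (Suc i)) \<and> z i \<in> P (Suc (Suc i)) - P (Suc i)" if "i < r" for i
   using Suc.prems(2)[of "Suc i"] that by (simp add: z_def)
  show "z i \<in> R" for i by (rule zR)
  show "finite (tl ` S0)" using S0 by simp
  show "tl ` S0 ~= {}" using \<open>k \<in> hd ` S\<close> by (auto simp: S0_def)
  show "length \<nu> = r \<and> c (k # \<nu>) \<in> R \<and> (\<exists>c'\<in>R. c (k # \<nu>) * c' = 1)" if "\<nu> \<in> tl ` S0" for \<nu>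
   using Suc.prems(6)[OF kc[OF that]] by simp
  show "(\<Sum>\<nu>\<in>tl ` S0. c (k # \<nu>) * ymon z \<nu>) \<in> P (Suc 0)" using fin by simp
 qed
qed

section \<open>Algebraic dependence by counting monomials\<close>

definition bdeg :: "'v set => nat => ('v, 'k::field) mpol => bool" where
 "bdeg F E p \<longleftrightarrow> (\<forall>m\<in>kys p. kys m \<subseteq> F \<and> (\<forall>v. lk m v \<le> E))"

lemma bdeg_mult: assumes "bdeg F E p" "bdeg F E' q" shows "bdeg F (E + E') (p * q)"
 unfolding bdeg_def
proof (intro ballI conjI allI)
 fix m assume "m \<in> kys (p * q)"
 then obtain a b where ab: "m = a + b" "a \<in> kys p" "b \<in> kys q" using keys_mult by blast
 show "kys m \<subseteq> F" using assms ab by (auto simp: bdeg_def keys_plus_nat')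
 show "lk m v \<le> E + E'" for v using assms ab by (simp add: bdeg_def lookup_add add_mono)
qed

lemma bdeg_1: "bdeg F 0 1" by (simp add: bdeg_def)

lemma bdeg_power: "bdeg F E p ==> bdeg F (k * E) (p ^ k)"
 by (induction k) (auto simp: bdeg_1 intro: bdeg_mult)

lemma bdeg_mono: "bdeg F E p ==> E \<le> E' ==> bdeg F E' p"
 unfolding bdeg_def by (meson order_trans)

lemma bdeg_mon: assumes "\<And>i. bdeg F D (y i)" "\<And>k. k \<in> set \<mu> ==> k \<le> B" shows "bdeg F (length \<mu> * (B * D)) (ymon y \<mu>)"
 using assms
proof (induction \<mu> arbitrary: y)
 case Nil
 then show ?case by (simp add: ymon_def bdeg_1)
next
 case (Cons k \<mu>)
 have "bdeg F (B * D) (y 0 ^ k)" by (rule bdeg_mono[OF bdeg_power[OF Cons.prems(1)]]) (use Cons.prems(2) in simp)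
 then show ?case using bdeg_mult[OF _ Cons.IH[of "\<lambda>i. y (Suc i)"]] Cons.prems by (simp add: ymon_Cons)
qed

text \<open>Products of the y i with exponents at most B number (B + 1) ^ r, while they lie in a
  space of dimension (r * B * D + 1) ^ card F, where D bounds the degrees of the y i. As card F < r,
  the first number is larger for large B.\<close>

lemma algebraic_dependence:
 fixes y :: "nat => ('v, 'k::field) mpol"
 assumes F: "finite F" "card F < r" and y: "\<And>i. y i \<in> SV F" "\<And>i. r \<le> i ==> y i = 0"
 shows "\<exists>S a. finite S \<and> S ~= {} \<and> (\<forall>\<mu>\<in>S. length \<mu> = r \<and> a \<mu> ~= 0) \<and> (\<Sum>\<mu>\<in>S. sngl 0 (a \<mu>) * ymon y \<mu>) = 0"
proof -
 have "\<exists>D. \<forall>i. bdeg F D (y i)"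
 proof -
  define Ex where "Ex = (\<Union>i<r. \<Union>m\<in>kys (y i). lk m ` kys m)"
  have fin: "finite Ex" by (auto simp: Ex_def)
  have "lk m v \<le> Max (insert 0 Ex)" if "m \<in> kys (y i)" for i m v
  proof (cases "lk m v = 0")
   case False
   have "i < r" using that y(2)[of i] by (cases "i < r") auto
   then have "lk m v \<in> Ex" unfolding Ex_def
    by (intro UN_I[of i] UN_I[of m] imageI) (use that False in \<open>simp_all add: in_keys_iff\<close>)
   then show ?thesis using fin by simp
  qed simp
  then show ?thesis using y(1) by (intro exI[of _ "Max (insert 0 Ex)"]) (auto simp: bdeg_def SV_def)
 qed
 then obtain D where D: "\<And>i. bdeg F D (y i)" by blast
 define f where "f = card F"
 \<comment> \<open>Chosen so that ((r * D + 1) * b) ^ f < b * b ^ f \<le> b ^ r; the exponents range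
   over b values each.\<close>
 define b where "b = (r * D + 1) ^ f + 1"
 define B where "B = b - 1"
 define I where "I = {\<mu>::nat list. set \<mu> \<subseteq> {..B} \<and> length \<mu> = r}"
 define E where "E = r * (B * D)"
 define M where "M = {m::'v \<Rightarrow>\<^sub>0 nat. kys m \<subseteq> F \<and> (\<forall>v. lk m v \<le> E)}"
 have finI: "finite I" and cardI: "card I = b ^ r"
  using finite_lists_length_eq[of "{..B}" r] card_lists_length_eq[of "{..B}" r] by (auto simp: I_def B_def b_def)
 have inj: "inj_on (\<lambda>m. restrict (lk m) F) M"
 proof (rule inj_onI, rule poly_mapping_eqI)
  fix m m' v assume m: "m \<in> M" "m' \<in> M" "restrict (lk m) F = restrict (lk m') F"
  show "lk m v = lk m' v"
  proof (cases "v \<in> F")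
   case True then show ?thesis using fun_cong[OF m(3), of v] by simp
  next
   case False
   then have "v \<notin> kys m" "v \<notin> kys m'" using m by (auto simp: M_def)
   then show ?thesis by (simp add: in_keys_iff)
  qed
 qed
 have img: "(\<lambda>m. restrict (lk m) F) ` M \<subseteq> (\<Pi>\<^sub>E v\<in>F. {..E})" by (auto simp: M_def)
 have finP: "finite (\<Pi>\<^sub>E v\<in>F. {..E})" using F(1) by (simp add: finite_PiE)
 have finM: "finite M" using inj img finP by (meson finite_subset finite_imageD)
 have "card M \<le> card (\<Pi>\<^sub>E v\<in>F. {..E})" using card_inj_on_le[OF inj img finP] .
 also have "\<dots> = (E + 1) ^ f" using F(1) by (simp add: card_PiE f_def)
 also have "\<dots> \<le> ((r * D + 1) * b) ^ f"
  by (rule power_mono) (auto simp: E_def B_def b_def algebra_simps)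
 also have "\<dots> = (r * D + 1) ^ f * b ^ f" by (rule power_mult_distrib)
 also have "\<dots> < b * b ^ f" by (rule mult_strict_right_mono) (auto simp: b_def)
 also have "\<dots> \<le> b ^ r" using power_increasing[of "Suc f" r b] F(2) by (simp add: f_def b_def)
 finally have "card M < card I" using cardI by simp
 from linear_dependence[OF finM finI this, of "\<lambda>\<mu> m. lk (ymon y \<mu>) m"]
 obtain a where a: "\<exists>\<mu>\<in>I. a \<mu> ~= 0" "\<forall>m\<in>M. (\<Sum>\<mu>\<in>I. a \<mu> * lk (ymon y \<mu>) m) = 0" by auto
 define S where "S = {\<mu> \<in> I. a \<mu> ~= 0}"
 have lc: "lk (sngl 0 c * p) m = c * lk p m" for c m and p :: "('v, 'k) mpol"
  using lookup_single_mult[of 0 c p m] by simp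
 have "(\<Sum>\<mu>\<in>I. a \<mu> * lk (ymon y \<mu>) m) = 0" for m
 proof (cases "m \<in> M")
  case False
  have "lk (ymon y \<mu>) m = 0" if "\<mu> \<in> I" for \<mu>
  proof (rule ccontr)
   assume "lk (ymon y \<mu>) m ~= 0"
   moreover have "bdeg F E (ymon y \<mu>)" using bdeg_mon[of F D y \<mu> B, OF D] that by (auto simp: I_def E_def)
   ultimately show False using False by (auto simp: bdeg_def M_def in_keys_iff)
  qed
  then show ?thesis by simp
 qed (use a(2) in simp)
 moreover have "(\<Sum>\<mu>\<in>I. a \<mu> * lk (ymon y \<mu>) m) = (\<Sum>\<mu>\<in>S. a \<mu> * lk (ymon y \<mu>) m)" for m
  by (rule sum.mono_neutral_right) (auto simp: S_def finI)
 ultimately have "(\<Sum>\<mu>\<in>S. sngl 0 (a \<mu>) * ymon y \<mu>) = 0"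
  by (intro poly_mapping_eqI) (simp add: lookup_sum lc)
 moreover have "finite S" unfolding S_def using finI by simp
 moreover have "S ~= {}" "\<forall>\<mu>\<in>S. length \<mu> = r \<and> a \<mu> ~= 0" using a(1) by (auto simp: S_def I_def)
 ultimately show ?thesis by blast
qed

text \<open>The variables outside the prime \<open>P 0\<close> span a face F, since the monomial of
  a non-face lies in \<open>P 0\<close> and a prime then contains one of its variables. Modulo
  \<open>P 0\<close> only the variables of F remain, so more than \<open>card F\<close> elements
  climbing the chain would be algebraically dependent, against
  \<open>chain_algebraic_independence\<close>.\<close>

lemma prime_chain_length:
 fixes P :: "nat => ('v, 'k::field) mpol set"
 assumes V: "finite V" and P: "\<And>i. i \<le> r ==> prm (SV V) (P i)" "\<And>i. i < r ==> P i \<subset> P (Suc i)"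
  and nonface: "\<And>F. F \<subseteq> V ==> F \<notin> \<Delta> ==> face_monomial F \<in> P 0"
  and dim: "\<And>F. F \<in> \<Delta> ==> card F \<le> e"
 shows "r \<le> e"
proof (rule ccontr)
 assume "\<not> r \<le> e"
 have P0: "prm (SV V) (P 0)" and I0: "idl (SV V) (P 0)" using P(1)[of 0] by (auto simp: prm_def)
 define F where "F = {v \<in> V. Xp v 1 \<notin> P 0}"
 have XV: "Xp v k \<in> SV V" if "v \<in> V" for v k unfolding Xp_def by (rule SV_single) (use that in \<open>auto split: if_splits\<close>)
 have fm: "face_monomial G \<in> P 0 ==> \<exists>v\<in>G. Xp v 1 \<in> P 0" if "finite G" "G \<subseteq> V" for G
  using that
 proof (induction G rule: finite_induct)
  case empty
  have "face_monomial {} = (1 :: ('v, 'k) mpol)" by (simp add: face_monomial_def)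
  then show ?case using P0 empty.prems by (simp add: prm_def)
 next
  case (insert v G)
  have "face_monomial (insert v G) = Xp v 1 * (face_monomial G :: ('v, 'k) mpol)"
   using insert.hyps by (simp add: face_monomial_def Xp_def mult_single)
  moreover have "face_monomial G \<in> SV V" unfolding face_monomial_def
  proof (rule SV_single)
   have "kys (\<Sum>v\<in>H. sngl v (1::nat)) \<subseteq> H" for H
    by (induction H rule: infinite_finite_induct) (auto simp: keys_plus_nat')
   then show "kys (\<Sum>v\<in>G. sngl v (1::nat)) \<subseteq> V" by (rule order_trans) (use insert.prems(2) in blast)
  qed
  ultimately have "Xp v 1 \<in> P 0 \<or> face_monomial G \<in> P 0"
   using P0 insert.prems XV[of v 1] unfolding prm_def by (metis insert_subset)
  then show ?case using insert by auto
 qed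
 have "F \<in> \<Delta>"
 proof (rule ccontr)
  assume "F \<notin> \<Delta>"
  then have "face_monomial F \<in> P 0" by (intro nonface) (auto simp: F_def)
  then show False using fm[of F] V by (auto simp: F_def)
 qed
 then have cF: "card F < r" using dim[of F] \<open>\<not> r \<le> e\<close> by simp
 have FV: "F \<subseteq> V" "finite F" using V by (auto simp: F_def)
 have "\<forall>i. \<exists>z. i < r --> z \<in> P (Suc i) - P i" using P(2) by blast
 then obtain z where z: "\<And>i. i < r ==> z i \<in> P (Suc i) - P i" by metis
 \<comment> \<open>The variables outside F are dropped from \<open>z i\<close>. The difference lies
   in \<open>P 0\<close>, so \<open>y i\<close> separates the same two primes.\<close>
 define y where "y i = (if i < r then flt (\<lambda>m. kys m \<subseteq> F) (z i) else 0)" for i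
 have inc: "P 0 \<subseteq> P i" if "i \<le> r" for i using that
 proof (induction i)
  case (Suc i)
  then show ?case using P(2)[of i] by auto
 qed simp
 have ySV: "y i \<in> SV F" for i by (auto simp: y_def SV_def keys_flt)
 have mono: "SV F \<subseteq> SV V" using FV(1) by (auto simp: SV_def)
 have diff: "z i - y i \<in> P 0" if i: "i < r" for i
 proof -
  have zV: "z i \<in> SV V" using z[OF i] P(1)[of "Suc i"] i by (auto simp: prm_def dest: idlD(1))
  have "z i - y i = flt (\<lambda>m. \<not> kys m \<subseteq> F) (z i)"
   by (rule poly_mapping_eqI) (use i in \<open>simp add: y_def lookup_flt lookup_minus\<close>)
  also have "\<dots> = (\<Sum>m\<in>kys (flt (\<lambda>m. \<not> kys m \<subseteq> F) (z i)). sngl m (lk (flt (\<lambda>m. \<not> kys m \<subseteq> F) (z i)) m))"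
   by (rule poly_mapping_sum_single)
  also have "\<dots> \<in> P 0"
  proof (rule idl_sum[OF I0])
   fix m assume "m \<in> kys (flt (\<lambda>m. \<not> kys m \<subseteq> F) (z i))"
   then have m: "m \<in> kys (z i)" "\<not> kys m \<subseteq> F" by (auto simp: keys_flt)
   then obtain v where v: "v \<in> kys m" "v \<notin> F" by blast
   have mV: "kys m \<subseteq> V" using zV m(1) by (auto simp: SV_def)
   then have "Xp v 1 \<in> P 0" using v by (auto simp: F_def)
   have "m = (m - sngl v 1) + sngl v 1"
    by (rule poly_mapping_eqI) (use v(1) in \<open>auto simp: lookup_add lookup_minus lookup_single when_def in_keys_iff\<close>)
   then have "sngl m c = sngl (m - sngl v 1) c * Xp v 1" for c :: 'k
    by (simp add: Xp_def mult_single)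
   moreover have "sngl (m - sngl v 1) c \<in> SV V" for c :: 'k
    by (rule SV_single) (use mV in \<open>auto simp: in_keys_iff lookup_minus\<close>)
   ultimately show "sngl m (lk (flt (\<lambda>m. \<not> kys m \<subseteq> F) (z i)) m) \<in> P 0"
    using idlD(4)[OF I0] \<open>Xp v 1 \<in> P 0\<close> by metis
  qed
  finally show ?thesis .
 qed
 obtain S a where S: "finite S" "S ~= {}" "\<forall>\<mu>\<in>S. length \<mu> = r \<and> a \<mu> ~= 0" "(\<Sum>\<mu>\<in>S. sngl 0 (a \<mu>) * ymon y \<mu>) = 0"
  using algebraic_dependence[of F r y, OF FV(2) cF ySV] by (auto simp: y_def)
 show False
 proof (rule chain_algebraic_independence[OF SV_subr P(1), where c = "\<lambda>\<mu>. sngl 0 (a \<mu>)" and S = S and y = y])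
  show "P i \<subseteq> P (Suc i) \<and> y i \<in> P (Suc i) - P i" if i: "i < r" for i
  proof -
   have I: "idl (SV V) (P i)" "idl (SV V) (P (Suc i))" using P(1)[of i] P(1)[of "Suc i"] i by (auto simp: prm_def)
   have d: "z i - y i \<in> P i" "z i - y i \<in> P (Suc i)" using diff[OF i] inc[of i] inc[of "Suc i"] i by auto
   have "y i \<in> P (Suc i)" using idl_diff[OF SV_subr I(2), of "z i" "z i - y i"] z[OF i] d by simp
   moreover have "y i \<notin> P i" using idlD(3)[OF I(1), of "y i" "z i - y i"] z[OF i] d by auto
   ultimately show ?thesis using P(2)[OF i] by blast
  qed
  show "length \<mu> = r \<and> sngl 0 (a \<mu>) \<in> SV V \<and> (\<exists>c'\<in>SV V. sngl 0 (a \<mu>) * c' = 1)" if "\<mu> \<in> S" for \<mu>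
   using S(3) that by (auto intro!: SV_single bexI[of _ "sngl 0 (1 / a \<mu>)"] simp: mult_single)
 qed (use S ySV mono idlD(2)[OF I0] in auto)
qed

section \<open>The localized face ring\<close>

lemma polynomial_ring_simps:
 "carrier (polynomial_ring K V) = SV V" "x \<otimes>\<^bsub>polynomial_ring K V\<^esub> y = x * y" "x \<oplus>\<^bsub>polynomial_ring K V\<^esub> y = x + y"
 "\<one>\<^bsub>polynomial_ring K V\<^esub> = 1" "\<zero>\<^bsub>polynomial_ring K V\<^esub> = 0"
 by (simp_all add: polynomial_ring_def SV_def)

lemma cring_polynomial_ring: "cring (polynomial_ring K V)"
proof (rule cringI)
 show "abelian_group (polynomial_ring K V)"
  by (rule abelian_groupI) (auto simp: polynomial_ring_simps subrD[OF SV_subr] ac_simps intro!: bexI[of _ "- x" for x])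
 show "comm_monoid (polynomial_ring K V)"
  by (rule comm_monoidI) (auto simp: polynomial_ring_simps subrD[OF SV_subr] ac_simps)
qed (auto simp: polynomial_ring_simps distrib_right)

locale sr_ring =
 fixes K :: "'k::field itself" and \<Delta> :: "'v set set"
 assumes complex: "simplicial_complex \<Delta>" and empty_face: "{} \<in> \<Delta>"
begin

abbreviation "V \<equiv> \<Union>\<Delta>"

lemma finite_V: "finite V" and down: "F \<in> \<Delta> ==> G \<subseteq> F ==> G \<in> \<Delta>"
 using complex by (auto simp: simplicial_complex_def)

definition S :: "('v, 'k) mpol set" where "S = SV V"
text \<open>Normal form modulo the Stanley-Reisner ideal, so that congruence of polynomials becomes
  equality; it is \<open>cpt {}\<close> of the Koszul part.\<close>

definition zr :: "('v, 'k) mpol => ('v, 'k) mpol" where "zr = flt (\<lambda>m. kys m \<in> \<Delta>)"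
definition IS where "IS = {p \<in> S. zr p = 0}"
definition US where "US = {u \<in> S. lk u 0 ~= 0}"

lemma S: "subr S" by (simp add: S_def SV_subr)
lemmas S_closed = subrD[OF S]

lemma zr_mult: "zr (s * zr p) = zr (s * p)"
 unfolding zr_def by (rule flt_mult) (metis keys_plus_nat' Un_upper2 down)
lemma zr_linear: "zr (p + q) = zr p + zr q" "zr (p - q) = zr p - zr q" "zr 0 = 0" "zr (- p) = - zr p"
 by (simp_all add: zr_def flt_add flt_diff flt_uminus)
lemma zr_cong: "zr p = zr q ==> zr (s * p) = zr (s * q)" by (metis zr_mult)
lemma zr_cong2: "zr p = zr q ==> zr p' = zr q' ==> zr (p * p') = zr (q * q')"
 by (metis zr_cong mult.commute)
lemma lk_zr: "lk (zr p) m = (if kys m \<in> \<Delta> then lk p m else 0)" by (simp add: zr_def lookup_flt)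

lemma IS_idl: "idl S IS"
 unfolding idl_def IS_def using S_closed
 by (auto simp: zr_linear) (metis zr_cong mult_zero_right zr_linear(3))

abbreviation R0 where "R0 \<equiv> polynomial_ring K V"

lemma lookup_indicator: "finite F ==> lk (\<Sum>v\<in>F. sngl v (1::nat)) w = (if w \<in> F then 1 else 0)"
 by (simp add: lookup_sum lookup_single when_def)

lemma keys_indicator: assumes "finite F" shows "kys (\<Sum>v\<in>F. sngl v (1::nat)) = F"
proof (rule Set.set_eqI)
 fix v show "v \<in> kys (\<Sum>v\<in>F. sngl v (1::nat)) \<longleftrightarrow> v \<in> F"
  unfolding in_keys_iff lookup_indicator[OF assms] by simp
qed

text \<open>A monomial whose support is not a face is a multiple of the squarefree monomial of its
  support, so the ideal is spanned by monomials and is the kernel of \<open>zr\<close>.\<close>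

lemma stanley_reisner_ideal: "stanley_reisner_ideal K \<Delta> = IS"
proof
 interpret R0: cring R0 by (rule cring_polynomial_ring)
 let ?G = "{face_monomial F :: ('v, 'k) mpol |F. F \<subseteq> V \<and> F \<notin> \<Delta>}"
 have G: "?G \<subseteq> IS"
 proof
  fix p :: "('v, 'k) mpol" assume "p \<in> ?G"
  then obtain F where F: "p = face_monomial F" "F \<subseteq> V" "F \<notin> \<Delta>" by blast
  have fF: "finite F" using F(2) finite_V finite_subset by blast
  have "p \<in> S" unfolding S_def F(1) face_monomial_def
   by (rule SV_single) (use F(2) keys_indicator[OF fF] in simp)
  moreover have "zr p = 0"
   by (rule poly_mapping_eqI) (use F keys_indicator[OF fF] in \<open>auto simp: lk_zr face_monomial_def lookup_single when_def\<close>)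
  ultimately show "p \<in> IS" by (simp add: IS_def)
 qed
 have "ideal IS R0"
 proof (rule idealI[OF R0.ring_axioms])
  show "subgroup IS (add_monoid R0)"
  proof (rule R0.add.subgroupI)
   show "IS \<subseteq> carrier R0" by (auto simp: polynomial_ring_simps IS_def S_def)
   show "IS ~= {}" using idlD(2)[OF IS_idl] by auto
   show "a \<oplus>\<^bsub>R0\<^esub> b \<in> IS" if "a \<in> IS" "b \<in> IS" for a b using idlD(3)[OF IS_idl] that by (simp add: polynomial_ring_simps)
   show "\<ominus>\<^bsub>R0\<^esub> a \<in> IS" if "a \<in> IS" for a
   proof -
    have "a \<in> S" "- a \<in> IS" using that S_closed by (auto simp: IS_def zr_linear)
    then have "\<ominus>\<^bsub>R0\<^esub> a = - a" by (intro R0.minus_equality) (auto simp: polynomial_ring_simps S_def IS_def)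
    then show ?thesis using \<open>- a \<in> IS\<close> by simp
   qed
  qed
  show "x \<otimes>\<^bsub>R0\<^esub> a \<in> IS" if "a \<in> IS" "x \<in> carrier R0" for a x
   using idlD(4)[OF IS_idl] that by (simp add: polynomial_ring_simps S_def)
  show "a \<otimes>\<^bsub>R0\<^esub> x \<in> IS" if "a \<in> IS" "x \<in> carrier R0" for a x
   using idlD(4)[OF IS_idl] that by (simp add: polynomial_ring_simps S_def mult.commute[of a x])
 qed
 then show "stanley_reisner_ideal K \<Delta> \<subseteq> IS" unfolding stanley_reisner_ideal_def using G by (rule R0.genideal_minimal)
 have GS: "?G \<subseteq> carrier R0" using G by (auto simp: polynomial_ring_simps IS_def S_def)
 interpret I: ideal "stanley_reisner_ideal K \<Delta>" R0 unfolding stanley_reisner_ideal_def by (rule R0.genideal_ideal[OF GS])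
 show "IS \<subseteq> stanley_reisner_ideal K \<Delta>"
 proof
  fix p assume p: "p \<in> IS"
  have sing: "sngl m (lk p m) \<in> stanley_reisner_ideal K \<Delta>" if m: "m \<in> kys p" for m
  proof -
   have mV: "kys m \<subseteq> V" using p m by (auto simp: IS_def S_def SV_def)
   have mD: "kys m \<notin> \<Delta>" using p m lk_zr[of p m] by (auto simp: IS_def in_keys_iff)
   define e where "e = (\<Sum>v\<in>kys m. sngl v (1::nat))"
   have me: "m = (m - e) + e"
    by (rule poly_mapping_eqI) (auto simp: e_def lookup_add lookup_minus lookup_indicator in_keys_iff simp del: One_nat_def)
   have "sngl m (lk p m) = sngl (m - e) (lk p m) * face_monomial (kys m)"
    unfolding face_monomial_def e_def[symmetric] mult_single mult_1_right
    by (rule arg_cong[of m, where f = "\<lambda>k. sngl k (lk p m)"]) (rule me)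
   moreover have "face_monomial (kys m) \<in> stanley_reisner_ideal K \<Delta>"
    using R0.genideal_self[OF GS] mV mD unfolding stanley_reisner_ideal_def by blast
   moreover have "sngl (m - e) (lk p m) \<in> carrier R0"
    unfolding polynomial_ring_simps by (rule SV_single) (use mV in \<open>auto simp: in_keys_iff lookup_minus\<close>)
   ultimately show ?thesis using I.I_l_closed by (simp add: polynomial_ring_simps)
  qed
  have "(\<Sum>m\<in>A. sngl m (lk p m)) \<in> stanley_reisner_ideal K \<Delta>" if "finite A" "A \<subseteq> kys p" for A
   using that
  proof (induction A rule: finite_induct)
   case empty
   then show ?case using I.zero_closed by (simp add: polynomial_ring_simps)
  next
   case (insert m A)
   then show ?case using sing[of m] I.a_closed[of "sngl m (lk p m)" "\<Sum>m\<in>A. sngl m (lk p m)"] by (simp add: polynomial_ring_simps)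
  qed
  then show "p \<in> stanley_reisner_ideal K \<Delta>" by (metis finite_keys order_refl poly_mapping_sum_single)
 qed
qed

sublocale R0: cring R0 by (rule cring_polynomial_ring)

lemma ideal_IS: "ideal IS R0"
proof -
 have "{face_monomial F :: ('v, 'k) mpol |F. F \<subseteq> V \<and> F \<notin> \<Delta>} \<subseteq> carrier R0"
 proof
  fix p :: "('v, 'k) mpol" assume "p \<in> {face_monomial F |F. F \<subseteq> V \<and> F \<notin> \<Delta>}"
  then obtain F where F: "p = face_monomial F" "F \<subseteq> V" by blast
  have fF: "finite F" using F(2) finite_V finite_subset by blast
  show "p \<in> carrier R0" unfolding polynomial_ring_simps F(1) face_monomial_def
   by (rule SV_single) (use F(2) keys_indicator[OF fF] in simp)
 qed
 from R0.genideal_ideal[OF this] show ?thesis using stanley_reisner_ideal unfolding stanley_reisner_ideal_def by simp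
qed

sublocale IS: ideal IS R0 by (rule ideal_IS)

definition cs :: "('v, 'k) mpol => ('v, 'k) mpol set" where "cs p = IS +>\<^bsub>R0\<^esub> p"
definition FR where "FR = face_ring K \<Delta>"

lemma FR_eq: "FR = R0 Quot IS" by (simp add: FR_def face_ring_def stanley_reisner_ideal)

lemma cs_eq_iff: "p \<in> S ==> q \<in> S ==> cs p = cs q \<longleftrightarrow> zr p = zr q"
proof -
 assume pq: "p \<in> S" "q \<in> S"
 have "cs r = {i + r | i. i \<in> IS}" for r by (auto simp: cs_def a_r_coset_def r_coset_def polynomial_ring_simps)
 moreover have "{i + p | i. i \<in> IS} = {i + q | i. i \<in> IS} \<longleftrightarrow> p - q \<in> IS"
 proof
  assume e: "{i + p | i. i \<in> IS} = {i + q | i. i \<in> IS}"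
  have "0 + p \<in> {i + p | i. i \<in> IS}" using idlD(2)[OF IS_idl] by blast
  then obtain i where "p = i + q" "i \<in> IS" unfolding e by auto
  then show "p - q \<in> IS" by simp
 next
  assume d: "p - q \<in> IS"
  show "{i + p | i. i \<in> IS} = {i + q | i. i \<in> IS}"
  proof (intro equalityI subsetI)
   fix z assume "z \<in> {i + p | i. i \<in> IS}"
   then obtain i where "i \<in> IS" "z = i + p" by blast
   then show "z \<in> {i + q | i. i \<in> IS}" using idlD(3)[OF IS_idl _ d, of i] by (intro CollectI exI[of _ "i + (p - q)"]) simp
  next
   fix z assume "z \<in> {i + q | i. i \<in> IS}"
   then obtain i where "i \<in> IS" "z = i + q" by blast
   then show "z \<in> {i + p | i. i \<in> IS}" using idl_diff[OF S IS_idl _ d, of i] by (intro CollectI exI[of _ "i - (p - q)"]) simp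
  qed
 qed
 ultimately show ?thesis using pq S_closed(3) by (simp add: IS_def zr_linear)
qed

lemma FR_simps:
 "carrier FR = cs ` S" "p \<in> S ==> q \<in> S ==> cs p \<otimes>\<^bsub>FR\<^esub> cs q = cs (p * q)" "p \<in> S ==> q \<in> S ==> cs p \<oplus>\<^bsub>FR\<^esub> cs q = cs (p + q)"
 "\<one>\<^bsub>FR\<^esub> = cs 1" "\<zero>\<^bsub>FR\<^esub> = cs 0"
proof -
 have "a_rcosets\<^bsub>R0\<^esub> IS = (\<Union>a\<in>carrier R0. {IS +>\<^bsub>R0\<^esub> a})"
  by (simp add: A_RCOSETS_def RCOSETS_def a_r_coset_def)
 then show "carrier FR = cs ` S" by (auto simp: FR_eq FactRing_def cs_def polynomial_ring_simps(1) S_def)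
 show "cs p \<otimes>\<^bsub>FR\<^esub> cs q = cs (p * q)" if "p \<in> S" "q \<in> S" for p q
  using IS.rcoset_mult_add[of p q] that by (simp add: FR_eq FactRing_def cs_def polynomial_ring_simps S_def)
 show "cs p \<oplus>\<^bsub>FR\<^esub> cs q = cs (p + q)" if "p \<in> S" "q \<in> S" for p q
  using IS.a_rcos_sum[of p q] that by (simp add: FR_eq FactRing_def cs_def polynomial_ring_simps S_def)
 show "\<one>\<^bsub>FR\<^esub> = cs 1" by (simp add: FR_eq FactRing_def cs_def polynomial_ring_simps)
 show "\<zero>\<^bsub>FR\<^esub> = cs 0" by (auto simp: FR_eq FactRing_def cs_def a_r_coset_def r_coset_def polynomial_ring_simps)
qed

sublocale FR: cring FR unfolding FR_eq by (rule IS.quotient_is_cring[OF R0.cring_axioms])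

section \<open>The localization at the irrelevant ideal\<close>

definition MI where "MI = irrelevant_ideal K \<Delta>"

lemma Xp_S: "v \<in> V ==> Xp v k \<in> S"
 unfolding Xp_def S_def by (rule SV_single) (auto split: if_splits)

lemma lk_Xp_0: "0 < k ==> lk (Xp v k) 0 = 0"
proof -
 assume "0 < k"
 then have "sngl v k ~= 0" by (metis lookup_single_eq lookup_zero less_irrefl)
 then show ?thesis by (simp add: Xp_def lookup_single when_def)
qed

lemma face_monomial_single: "face_monomial {v} = Xp v 1" by (simp add: face_monomial_def Xp_def)

lemma MI_eq: "MI = cs ` {p \<in> S. lk p 0 = 0}"
proof
 let ?G = "{cs (Xp v 1) |v. v \<in> V}"
 have MI: "MI = Idl\<^bsub>FR\<^esub> ?G"
  by (simp add: MI_def irrelevant_ideal_def FR_def[symmetric] stanley_reisner_ideal cs_def face_monomial_single)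
 have GS: "?G \<subseteq> carrier FR" using Xp_S by (auto simp: FR_simps)
 have i: "ideal (cs ` {p \<in> S. lk p 0 = 0}) FR"
 proof (rule idealI[OF FR.ring_axioms])
  show "subgroup (cs ` {p \<in> S. lk p 0 = 0}) (add_monoid FR)"
  proof (rule FR.add.subgroupI)
   show "cs ` {p \<in> S. lk p 0 = 0} \<subseteq> carrier FR" by (auto simp: FR_simps)
   show "cs ` {p \<in> S. lk p 0 = 0} ~= {}" using S_closed(2) by force
   show "a \<oplus>\<^bsub>FR\<^esub> b \<in> cs ` {p \<in> S. lk p 0 = 0}" if "a \<in> cs ` {p \<in> S. lk p 0 = 0}" "b \<in> cs ` {p \<in> S. lk p 0 = 0}" for a b
    using that S_closed(6) by (auto simp: FR_simps lookup_add)
   show "\<ominus>\<^bsub>FR\<^esub> a \<in> cs ` {p \<in> S. lk p 0 = 0}" if a: "a \<in> cs ` {p \<in> S. lk p 0 = 0}" for a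
   proof -
    obtain p where p: "p \<in> S" "lk p 0 = 0" "a = cs p" using a by blast
    have "\<ominus>\<^bsub>FR\<^esub> a = cs (- p)" by (rule FR.minus_equality) (use p S_closed(5) in \<open>auto simp: FR_simps\<close>)
    then show ?thesis using p S_closed(5) by (auto simp: lookup_uminus)
   qed
  qed
  show "x \<otimes>\<^bsub>FR\<^esub> a \<in> cs ` {p \<in> S. lk p 0 = 0}" "a \<otimes>\<^bsub>FR\<^esub> x \<in> cs ` {p \<in> S. lk p 0 = 0}"
   if "a \<in> cs ` {p \<in> S. lk p 0 = 0}" "x \<in> carrier FR" for a x
   using that S_closed(4) by (auto simp: FR_simps lookup_mult_0)
 qed
 have "?G \<subseteq> cs ` {p \<in> S. lk p 0 = 0}"
 proof
  fix z assume "z \<in> ?G"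
  then obtain v where v: "z = cs (Xp v 1)" "v \<in> V" by blast
  then have "Xp v 1 \<in> {p \<in> S. lk p 0 = 0}" using Xp_S[of v 1] by (simp add: lk_Xp_0)
  then show "z \<in> cs ` {p \<in> S. lk p 0 = 0}" unfolding v(1) by (rule imageI)
 qed
 then show "MI \<subseteq> cs ` {p \<in> S. lk p 0 = 0}" unfolding MI using FR.genideal_minimal[OF i] by blast
 interpret M: ideal MI FR unfolding MI by (rule FR.genideal_ideal[OF GS])
 show "cs ` {p \<in> S. lk p 0 = 0} \<subseteq> MI"
 proof clarify
  fix p assume p: "p \<in> S" "lk p 0 = 0"
  have sing: "cs (sngl m (lk p m)) \<in> MI \<and> sngl m (lk p m) \<in> S" if m: "m \<in> kys p" for m
  proof -
   have "m ~= 0" using p m by (auto simp: in_keys_iff)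
   then obtain v where v: "v \<in> kys m" by (metis all_not_in_conv keys_eq_empty)
   have mV: "kys m \<subseteq> V" using p m by (auto simp: S_def SV_def)
   have "m = (m - sngl v 1) + sngl v 1"
    by (rule poly_mapping_eqI) (use v in \<open>auto simp: lookup_add lookup_minus lookup_single when_def in_keys_iff\<close>)
   then have e: "sngl m (lk p m) = sngl (m - sngl v 1) (lk p m) * Xp v 1"
    unfolding Xp_def mult_single mult_1_right by (rule arg_cong[of m])
   have s: "sngl (m - sngl v 1) (lk p m) \<in> S"
    unfolding S_def by (rule SV_single) (use mV in \<open>auto simp: in_keys_iff lookup_minus\<close>)
   have vV: "v \<in> V" using v mV by blast
   then have "cs (Xp v 1) \<in> ?G" by blast
   then have x: "cs (Xp v 1) \<in> MI" "Xp v 1 \<in> S" using subsetD[OF FR.genideal_self[OF GS]] Xp_S[OF vV] unfolding MI by simp_all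
   have "cs (sngl (m - sngl v 1) (lk p m)) \<otimes>\<^bsub>FR\<^esub> cs (Xp v 1) \<in> MI"
    by (rule M.I_l_closed[OF x(1)]) (use s in \<open>simp add: FR_simps\<close>)
   then show ?thesis using e s x(2) S_closed(4) by (simp add: FR_simps)
  qed
  have "cs (\<Sum>m\<in>A. sngl m (lk p m)) \<in> MI \<and> (\<Sum>m\<in>A. sngl m (lk p m)) \<in> S" if "finite A" "A \<subseteq> kys p" for A
   using that
  proof (induction A rule: finite_induct)
   case empty
   then show ?case using M.zero_closed S_closed(2) by (simp add: FR_simps)
  next
   case (insert m A)
   then show ?case using sing[of m] M.a_closed[of "cs (sngl m (lk p m))" "cs (\<Sum>m\<in>A. sngl m (lk p m))"] S_closed(6) by (simp add: FR_simps)
  qed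
  then show "cs p \<in> MI" by (metis finite_keys order_refl poly_mapping_sum_single)
 qed
qed

lemma zr_lk0: "zr p = zr q ==> lk p 0 = lk q 0"
proof -
 assume "zr p = zr q"
 then have "lk (zr p) 0 = lk (zr q) 0" by simp
 then show ?thesis using empty_face by (simp add: lk_zr)
qed

lemma FR_minus_MI: "carrier FR - MI = cs ` US"
 by (auto simp: FR_simps MI_eq US_def cs_eq_iff dest: zr_lk0) (metis (mono_tags, lifting) cs_eq_iff zr_lk0)+

lemma US: "u \<in> US ==> u \<in> S" "1 \<in> US" "u \<in> US ==> w \<in> US ==> u * w \<in> US"
 using S_closed by (auto simp: US_def lookup_mult_0)

definition A where "A = localization FR MI"
definition fr where "fr p s = loc_frac FR MI (cs p) (cs s)"

text \<open>Equality of two fractions in terms of representing polynomials; the factor u is there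
  because the face ring has zero divisors.\<close>

definition frel :: "('v, 'k) mpol \<times> ('v, 'k) mpol => ('v, 'k) mpol \<times> ('v, 'k) mpol => bool" where
 "frel x y \<longleftrightarrow> (\<exists>u\<in>US. zr (u * (fst x * snd y)) = zr (u * (fst y * snd x)))"

lemma fr_set: "p \<in> S ==> s \<in> US ==> fr p s = {(cs q, cs t) | q t. q \<in> S \<and> t \<in> US \<and> frel (p, s) (q, t)}"
proof -
 assume ps: "p \<in> S" "s \<in> US"
 have eq: "(\<exists>u\<in>carrier FR - MI. u \<otimes>\<^bsub>FR\<^esub> (cs p \<otimes>\<^bsub>FR\<^esub> cs t) = u \<otimes>\<^bsub>FR\<^esub> (cs q \<otimes>\<^bsub>FR\<^esub> cs s)) \<longleftrightarrow> frel (p, s) (q, t)"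
  if "q \<in> S" "t \<in> US" for q t
  unfolding FR_minus_MI frel_def using ps that US(1) S_closed(4) by (auto simp: FR_simps cs_eq_iff)
 show ?thesis
 proof (intro equalityI subsetI)
  fix y assume "y \<in> fr p s"
  then obtain b t' where y: "y = (b, t')" "b \<in> carrier FR" "t' \<in> carrier FR - MI"
    "\<exists>u\<in>carrier FR - MI. u \<otimes>\<^bsub>FR\<^esub> (cs p \<otimes>\<^bsub>FR\<^esub> t') = u \<otimes>\<^bsub>FR\<^esub> (b \<otimes>\<^bsub>FR\<^esub> cs s)"
   unfolding fr_def loc_frac_def by auto
  obtain q where q: "q \<in> S" "b = cs q" using y(2) unfolding FR_simps(1) by auto
  obtain t where t: "t \<in> US" "t' = cs t" using y(3) unfolding FR_minus_MI by auto
  have "frel (p, s) (q, t)" using y(4) eq[OF q(1) t(1)] unfolding q(2) t(2) by simp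
  then show "y \<in> {(cs q, cs t) | q t. q \<in> S \<and> t \<in> US \<and> frel (p, s) (q, t)}" using y(1) q t by blast
 next
  fix y assume "y \<in> {(cs q, cs t) | q t. q \<in> S \<and> t \<in> US \<and> frel (p, s) (q, t)}"
  then obtain q t where y: "y = (cs q, cs t)" "q \<in> S" "t \<in> US" "frel (p, s) (q, t)" by blast
  moreover have "cs q \<in> carrier FR" using y(2) by (simp add: FR_simps(1))
  moreover have "cs t \<in> carrier FR - MI" unfolding FR_minus_MI by (rule imageI) (rule y(3))
  ultimately show "y \<in> fr p s" using eq[OF y(2,3)] unfolding fr_def loc_frac_def by simp
 qed
qed

lemma frel_refl: "frel x x" unfolding frel_def using US(2) by blast
lemma frel_sym: "frel x y ==> frel y x" unfolding frel_def by metis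
lemma frel_trans: assumes "frel (p, s) (q, t)" "frel (q, t) (r, w)" "t \<in> US" shows "frel (p, s) (r, w)"
proof -
 obtain u u' where u: "u \<in> US" "zr (u * (p * t)) = zr (u * (q * s))" and u': "u' \<in> US" "zr (u' * (q * w)) = zr (u' * (r * t))"
  using assms by (auto simp: frel_def)
 have "zr (u' * w * (u * (p * t))) = zr (u' * w * (u * (q * s)))" by (rule zr_cong[OF u(2)])
 also have "u' * w * (u * (q * s)) = u * s * (u' * (q * w))" by (simp add: ac_simps)
 also have "zr \<dots> = zr (u * s * (u' * (r * t)))" by (rule zr_cong[OF u'(2)])
 finally have "zr (u' * u * t * (p * w)) = zr (u' * u * t * (r * s))" by (simp add: ac_simps)
 then show ?thesis unfolding frel_def using US(3)[OF US(3)[OF u'(1) u(1)] assms(3)] by auto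
qed

lemma fr_eq_iff: "p \<in> S ==> s \<in> US ==> q \<in> S ==> t \<in> US ==> fr p s = fr q t \<longleftrightarrow> frel (p, s) (q, t)"
proof
 assume a: "p \<in> S" "s \<in> US" "q \<in> S" "t \<in> US"
 show "frel (p, s) (q, t)" if e: "fr p s = fr q t"
 proof -
  have "(cs q, cs t) \<in> fr q t" using a frel_refl by (auto simp: fr_set)
  then obtain q' t' where q': "cs q = cs q'" "cs t = cs t'" "q' \<in> S" "t' \<in> US" "frel (p, s) (q', t')"
   unfolding e[symmetric] using a by (auto simp: fr_set)
  then have z: "zr q = zr q'" "zr t = zr t'" using a US(1) by (auto simp: cs_eq_iff)
  obtain u where u: "u \<in> US" "zr (u * (p * t')) = zr (u * (q' * s))" using q'(5) by (auto simp: frel_def)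
  have "zr (u * (p * t)) = zr (u * (p * t'))" "zr (u * (q * s)) = zr (u * (q' * s))"
   using zr_cong2 z by blast+
  then show ?thesis using u by (auto simp: frel_def intro!: bexI[OF _ u(1)])
 qed
 show "fr p s = fr q t" if r: "frel (p, s) (q, t)"
 proof -
  have "frel (p, s) (r, w) \<longleftrightarrow> frel (q, t) (r, w)" for r w
   using frel_trans[OF r _ a(4)] frel_trans[OF frel_sym[OF r] _ a(2)] by blast
  then show ?thesis using a by (simp add: fr_set)
 qed
qed

lemma A_carrier: "carrier A = {fr p s | p s. p \<in> S \<and> s \<in> US}"
proof -
 have "carrier A = {loc_frac FR MI a s |a s. a \<in> carrier FR \<and> s \<in> carrier FR - MI}"
  by (simp add: A_def localization_def)
 then have c: "carrier A = {loc_frac FR MI a s |a s. a \<in> cs ` S \<and> s \<in> cs ` US}"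
  unfolding FR_minus_MI unfolding FR_simps(1) .
 show ?thesis
 proof (intro equalityI subsetI)
  fix y assume "y \<in> carrier A"
  then obtain a s where "y = loc_frac FR MI a s" "a \<in> cs ` S" "s \<in> cs ` US" unfolding c by blast
  then show "y \<in> {fr p s |p s. p \<in> S \<and> s \<in> US}" unfolding fr_def by auto
 qed (auto simp: c fr_def)
qed

lemma fr_in: "p \<in> S ==> s \<in> US ==> fr p s \<in> carrier A"
 unfolding A_carrier by blast

lemma UN_const: "X ~= {} ==> (\<And>x. x \<in> X ==> f x = c) ==> (\<Union>x\<in>X. f x) = c" by auto

text \<open>The operations of the localization are unions over all representatives; once the result
  is independent of the representatives, the union collapses to a single class.\<close>

lemma A_binop:
 assumes a: "p \<in> S" "s \<in> US" "q \<in> S" "t \<in> US"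
  and f: "\<And>p' s' q' t'. p' \<in> S ==> s' \<in> US ==> q' \<in> S ==> t' \<in> US ==> frel (p, s) (p', s') ==> frel (q, t) (q', t') ==>
   f (cs p', cs s') (cs q', cs t') = c"
 shows "(\<Union>x \<in> fr p s. \<Union>y \<in> fr q t. f x y) = c"
proof (intro UN_const)
 have "(cs p, cs s) \<in> fr p s" "(cs q, cs t) \<in> fr q t" using a frel_refl by (auto simp: fr_set)
 then show "fr p s ~= {}" "\<And>x. fr q t ~= {}" by auto
 show "f x y = c" if "x \<in> fr p s" "y \<in> fr q t" for x y
  using that f a by (auto simp: fr_set)
qed

lemma A_mult: assumes a: "p \<in> S" "s \<in> US" "q \<in> S" "t \<in> US" shows "fr p s \<otimes>\<^bsub>A\<^esub> fr q t = fr (p * q) (s * t)"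
proof -
 have "fr p s \<otimes>\<^bsub>A\<^esub> fr q t = (\<Union>x \<in> fr p s. \<Union>y \<in> fr q t. loc_frac FR MI (fst x \<otimes>\<^bsub>FR\<^esub> fst y) (snd x \<otimes>\<^bsub>FR\<^esub> snd y))"
  by (simp add: A_def localization_def case_prod_unfold)
 also have "\<dots> = fr (p * q) (s * t)"
 proof (rule A_binop[OF a])
  fix p' s' q' t' assume b: "p' \<in> S" "s' \<in> US" "q' \<in> S" "t' \<in> US" "frel (p, s) (p', s')" "frel (q, t) (q', t')"
  obtain u u' where u: "u \<in> US" "zr (u * (p * s')) = zr (u * (p' * s))" and u': "u' \<in> US" "zr (u' * (q * t')) = zr (u' * (q' * t))"
   using b by (auto simp: frel_def)
  have "zr ((u * (p * s')) * (u' * (q * t'))) = zr ((u * (p' * s)) * (u' * (q' * t)))" by (rule zr_cong2[OF u(2) u'(2)])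
  then have "zr (u * u' * (p' * q' * (s * t))) = zr (u * u' * (p * q * (s' * t')))" by (simp add: ac_simps)
  then have "frel (p' * q', s' * t') (p * q, s * t)" unfolding frel_def using US(3)[OF u(1) u'(1)] by auto
  then have "fr (p' * q') (s' * t') = fr (p * q) (s * t)"
   using a b(1-4) S_closed(4) US(3) by (simp add: fr_eq_iff)
  then show "loc_frac FR MI (fst (cs p', cs s') \<otimes>\<^bsub>FR\<^esub> fst (cs q', cs t')) (snd (cs p', cs s') \<otimes>\<^bsub>FR\<^esub> snd (cs q', cs t')) = fr (p * q) (s * t)"
   using b US(1) by (simp add: FR_simps fr_def)
 qed
 finally show ?thesis .
qed

lemma A_add: assumes a: "p \<in> S" "s \<in> US" "q \<in> S" "t \<in> US" shows "fr p s \<oplus>\<^bsub>A\<^esub> fr q t = fr (p * t + q * s) (s * t)"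
proof -
 have "fr p s \<oplus>\<^bsub>A\<^esub> fr q t = (\<Union>x \<in> fr p s. \<Union>y \<in> fr q t. loc_frac FR MI (fst x \<otimes>\<^bsub>FR\<^esub> snd y \<oplus>\<^bsub>FR\<^esub> fst y \<otimes>\<^bsub>FR\<^esub> snd x) (snd x \<otimes>\<^bsub>FR\<^esub> snd y))"
  by (simp add: A_def localization_def case_prod_unfold)
 also have "\<dots> = fr (p * t + q * s) (s * t)"
 proof (rule A_binop[OF a])
  fix p' s' q' t' assume b: "p' \<in> S" "s' \<in> US" "q' \<in> S" "t' \<in> US" "frel (p, s) (p', s')" "frel (q, t) (q', t')"
  obtain u u' where u: "u \<in> US" "zr (u * (p * s')) = zr (u * (p' * s))" and u': "u' \<in> US" "zr (u' * (q * t')) = zr (u' * (q' * t))"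
   using b by (auto simp: frel_def)
  have "zr (u' * (t * t') * (u * (p * s'))) = zr (u' * (t * t') * (u * (p' * s)))" "zr (u * (s * s') * (u' * (q * t'))) = zr (u * (s * s') * (u' * (q' * t)))"
   by (rule zr_cong, fact)+
  then have "zr (u' * (t * t') * (u * (p * s')) + u * (s * s') * (u' * (q * t'))) = zr (u' * (t * t') * (u * (p' * s)) + u * (s * s') * (u' * (q' * t)))"
   by (simp add: zr_linear)
  then have "zr (u * u' * ((p' * t' + q' * s') * (s * t))) = zr (u * u' * ((p * t + q * s) * (s' * t')))" by (simp add: algebra_simps)
  then have "frel (p' * t' + q' * s', s' * t') (p * t + q * s, s * t)" unfolding frel_def using US(3)[OF u(1) u'(1)] by auto
  then have "fr (p' * t' + q' * s') (s' * t') = fr (p * t + q * s) (s * t)"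
   using a b(1-4) S_closed(4,6) US by (simp add: fr_eq_iff)
  then show "loc_frac FR MI (fst (cs p', cs s') \<otimes>\<^bsub>FR\<^esub> snd (cs q', cs t') \<oplus>\<^bsub>FR\<^esub> fst (cs q', cs t') \<otimes>\<^bsub>FR\<^esub> snd (cs p', cs s')) (snd (cs p', cs s') \<otimes>\<^bsub>FR\<^esub> snd (cs q', cs t')) = fr (p * t + q * s) (s * t)"
   using b US(1) S_closed(4,6) by (simp add: FR_simps fr_def)
 qed
 finally show ?thesis .
qed

lemma A_one: "\<one>\<^bsub>A\<^esub> = fr 1 1" and A_zero: "\<zero>\<^bsub>A\<^esub> = fr 0 1"
 by (simp_all add: A_def localization_def fr_def FR_simps)

lemma fr_eqI: "p \<in> S ==> s \<in> US ==> q \<in> S ==> t \<in> US ==> p * t = q * s ==> fr p s = fr q t"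
 by (auto simp: fr_eq_iff frel_def intro!: bexI[OF _ US(2)])

lemmas SU_closed = S_closed(2,4,5,6) US

lemma A_cring: "cring A"
proof (rule cringI)
 show "abelian_group A"
 proof (rule abelian_groupI)
  fix x y z assume x: "x \<in> carrier A" and y: "y \<in> carrier A" and z: "z \<in> carrier A"
  obtain p s q t r w where e: "x = fr p s" "y = fr q t" "z = fr r w" and c: "p \<in> S" "s \<in> US" "q \<in> S" "t \<in> US" "r \<in> S" "w \<in> US"
   using x y z unfolding A_carrier by blast
  show "x \<oplus>\<^bsub>A\<^esub> y \<in> carrier A" using c SU_closed by (simp add: e A_add fr_in)
  show "x \<oplus>\<^bsub>A\<^esub> y = y \<oplus>\<^bsub>A\<^esub> x" using c by (simp add: e A_add add.commute mult.commute)
  show "x \<oplus>\<^bsub>A\<^esub> y \<oplus>\<^bsub>A\<^esub> z = x \<oplus>\<^bsub>A\<^esub> (y \<oplus>\<^bsub>A\<^esub> z)" using c SU_closed by (simp add: e A_add algebra_simps)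
  show "\<zero>\<^bsub>A\<^esub> \<oplus>\<^bsub>A\<^esub> x = x" using c SU_closed by (simp add: e A_add A_zero)
  have "fr (- p) s \<oplus>\<^bsub>A\<^esub> fr p s = \<zero>\<^bsub>A\<^esub>" unfolding A_add[OF SU_closed(3)[OF c(1)] c(2) c(1,2)] A_zero
   by (rule fr_eqI) (use c SU_closed in simp_all)
  then show "\<exists>y\<in>carrier A. y \<oplus>\<^bsub>A\<^esub> x = \<zero>\<^bsub>A\<^esub>" using fr_in[OF SU_closed(3)[OF c(1)] c(2)] unfolding e(1) by blast
 next
  show "\<zero>\<^bsub>A\<^esub> \<in> carrier A" using SU_closed by (simp add: A_zero fr_in)
 qed
 show "comm_monoid A"
 proof (rule comm_monoidI)
  fix x y z assume x: "x \<in> carrier A" and y: "y \<in> carrier A" and z: "z \<in> carrier A"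
  obtain p s q t r w where e: "x = fr p s" "y = fr q t" "z = fr r w" and c: "p \<in> S" "s \<in> US" "q \<in> S" "t \<in> US" "r \<in> S" "w \<in> US"
   using x y z unfolding A_carrier by blast
  show "x \<otimes>\<^bsub>A\<^esub> y \<in> carrier A" using c SU_closed by (simp add: e A_mult fr_in)
  show "x \<otimes>\<^bsub>A\<^esub> y = y \<otimes>\<^bsub>A\<^esub> x" using c by (simp add: e A_mult mult.commute)
  show "x \<otimes>\<^bsub>A\<^esub> y \<otimes>\<^bsub>A\<^esub> z = x \<otimes>\<^bsub>A\<^esub> (y \<otimes>\<^bsub>A\<^esub> z)" using c SU_closed by (simp add: e A_mult mult.assoc)
  show "\<one>\<^bsub>A\<^esub> \<otimes>\<^bsub>A\<^esub> x = x" using c SU_closed S_closed(1) by (simp add: e A_mult A_one)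
 next
  show "\<one>\<^bsub>A\<^esub> \<in> carrier A" using SU_closed S_closed(1) by (simp add: A_one fr_in)
 qed
 fix x y z assume x: "x \<in> carrier A" and y: "y \<in> carrier A" and z: "z \<in> carrier A"
 obtain p s q t r w where e: "x = fr p s" "y = fr q t" "z = fr r w" and c: "p \<in> S" "s \<in> US" "q \<in> S" "t \<in> US" "r \<in> S" "w \<in> US"
  using x y z unfolding A_carrier by blast
 show "(x \<oplus>\<^bsub>A\<^esub> y) \<otimes>\<^bsub>A\<^esub> z = x \<otimes>\<^bsub>A\<^esub> z \<oplus>\<^bsub>A\<^esub> y \<otimes>\<^bsub>A\<^esub> z"
 proof -
  have l: "(x \<oplus>\<^bsub>A\<^esub> y) \<otimes>\<^bsub>A\<^esub> z = fr ((p * t + q * s) * r) (s * t * w)" using c SU_closed by (simp add: e A_mult A_add)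
  have r: "x \<otimes>\<^bsub>A\<^esub> z \<oplus>\<^bsub>A\<^esub> y \<otimes>\<^bsub>A\<^esub> z = fr (p * r * (t * w) + q * r * (s * w)) (s * w * (t * w))" using c SU_closed by (simp add: e A_mult A_add)
  show ?thesis unfolding l r by (rule fr_eqI) (use c SU_closed in \<open>simp_all add: algebra_simps\<close>)
 qed
qed

end

section \<open>Ideals of the localization\<close>

context sr_ring
begin

interpretation A: cring A by (rule A_cring)

text \<open>The contraction to the polynomial ring. Denominators are units, so an ideal of the
  localization is recovered from its contraction (\<open>ideal_eq\<close>).\<close>

definition ctr :: "(('v, 'k) mpol set \<times> ('v, 'k) mpol set) set set => ('v, 'k) mpol set" where
 "ctr \<aa> = {p \<in> S. fr p 1 \<in> \<aa>}"

lemma fr_mem_iff: assumes "ideal \<aa> A" "p \<in> S" "s \<in> US" shows "fr p s \<in> \<aa> \<longleftrightarrow> p \<in> ctr \<aa>"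
proof -
 interpret I: ideal \<aa> A by fact
 have 1: "fr p 1 = fr p s \<otimes>\<^bsub>A\<^esub> fr s 1"
  using assms SU_closed by (simp add: A_mult) (rule fr_eqI, auto)
 have 2: "fr p s = fr p 1 \<otimes>\<^bsub>A\<^esub> fr 1 s"
  using assms SU_closed S_closed(1) by (simp add: A_mult)
 show ?thesis
 proof
  assume "fr p s \<in> \<aa>"
  then have "fr p s \<otimes>\<^bsub>A\<^esub> fr s 1 \<in> \<aa>" by (rule I.I_r_closed) (use assms SU_closed in \<open>simp add: fr_in\<close>)
  then show "p \<in> ctr \<aa>" using 1 assms(2) by (simp add: ctr_def)
 next
  assume "p \<in> ctr \<aa>"
  then have "fr p 1 \<otimes>\<^bsub>A\<^esub> fr 1 s \<in> \<aa>" by (intro I.I_r_closed) (use assms SU_closed S_closed(1) in \<open>auto simp: fr_in ctr_def\<close>)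
  then show "fr p s \<in> \<aa>" using 2 by simp
 qed
qed

lemma ideal_eq: assumes "ideal \<aa> A" shows "\<aa> = {fr p s | p s. p \<in> ctr \<aa> \<and> s \<in> US}"
proof -
 interpret I: ideal \<aa> A by fact
 show ?thesis
 proof (intro equalityI subsetI)
  fix y assume y: "y \<in> \<aa>"
  then obtain p s where "y = fr p s" "p \<in> S" "s \<in> US" using I.a_subset unfolding A_carrier by blast
  then show "y \<in> {fr p s | p s. p \<in> ctr \<aa> \<and> s \<in> US}" using fr_mem_iff[OF assms, of p s] y by blast
 next
  fix y assume "y \<in> {fr p s | p s. p \<in> ctr \<aa> \<and> s \<in> US}"
  then obtain p s where "y = fr p s" "p \<in> ctr \<aa>" "s \<in> US" by blast
  then show "y \<in> \<aa>" using fr_mem_iff[OF assms, of p s] by (simp add: ctr_def)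
 qed
qed

lemma ctr_idl: assumes "ideal \<aa> A" shows "idl S (ctr \<aa>)"
proof -
 interpret I: ideal \<aa> A by fact
 show ?thesis unfolding idl_def
 proof (intro conjI ballI)
  show "ctr \<aa> \<subseteq> S" by (auto simp: ctr_def)
  show "0 \<in> ctr \<aa>" using I.zero_closed S_closed(2) by (simp add: ctr_def A_zero)
  show "a + b \<in> ctr \<aa>" if "a \<in> ctr \<aa>" "b \<in> ctr \<aa>" for a b
   using that I.a_closed[of "fr a 1" "fr b 1"] SU_closed by (simp add: ctr_def A_add)
  show "r * a \<in> ctr \<aa>" if "r \<in> S" "a \<in> ctr \<aa>" for r a
   using that I.I_l_closed[of "fr a 1" "fr r 1"] SU_closed by (simp add: ctr_def A_mult fr_in)
 qed
qed

lemma ctr_zr: assumes "ideal \<aa> A" "p \<in> S" "u \<in> US" "zr (u * p) = zr q" "q \<in> ctr \<aa>" shows "p \<in> ctr \<aa>"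
proof -
 have q: "q \<in> S" "fr q 1 \<in> \<aa>" using assms(5) by (auto simp: ctr_def)
 have "fr p 1 = fr q u"
  using assms(2,3,4) q SU_closed by (auto simp: fr_eq_iff frel_def mult.commute intro!: bexI[OF _ US(2)])
 then show ?thesis using fr_mem_iff[OF assms(1) q(1) assms(3)] assms(2,5) by (simp add: ctr_def)
qed

text \<open>The contraction of the extension of J: J is enlarged by the Stanley-Reisner ideal and by
  everything that a multiplier carries into it.\<close>

definition satur :: "('v, 'k) mpol set => ('v, 'k) mpol set" where
 "satur J = {p \<in> S. \<exists>u\<in>US. \<exists>q\<in>J. zr (u * p) = zr q}"

lemma ideal_satur: assumes J: "idl S J" shows "ideal {fr p s | p s. p \<in> satur J \<and> s \<in> US} A"
proof (rule idealI[OF A.ring_axioms])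
 let ?I = "{fr p s | p s. p \<in> satur J \<and> s \<in> US}"
 show "subgroup ?I (add_monoid A)"
 proof (rule A.add.subgroupI)
  show "?I \<subseteq> carrier A" by (auto simp: satur_def fr_in)
  have "0 \<in> satur J" using idlD(2)[OF J] US(2) S_closed(2) by (auto simp: satur_def intro!: bexI[OF _ US(2)] bexI[of _ 0])
  then show "?I ~= {}" using US(2) by blast
  show "x \<oplus>\<^bsub>A\<^esub> y \<in> ?I" if xy: "x \<in> ?I" "y \<in> ?I" for x y
  proof -
   obtain p s q t where e: "x = fr p s" "y = fr q t" "p \<in> satur J" "q \<in> satur J" "s \<in> US" "t \<in> US" using xy by blast
   then obtain u j u' j' where u: "u \<in> US" "j \<in> J" "zr (u * p) = zr j" "u' \<in> US" "j' \<in> J" "zr (u' * q) = zr j'" "p \<in> S" "q \<in> S"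
    by (auto simp: satur_def)
   have "u * u' * (p * t + q * s) = (u' * t) * (u * p) + (u * s) * (u' * q)" by (simp add: algebra_simps)
   then have "zr (u * u' * (p * t + q * s)) = zr ((u' * t) * j + (u * s) * j')"
    using zr_cong[OF u(3), of "u' * t"] zr_cong[OF u(6), of "u * s"] by (simp add: zr_linear)
   moreover have "(u' * t) * j + (u * s) * j' \<in> J"
    using u e(5,6) SU_closed by (intro idlD(3)[OF J] idlD(4)[OF J]) auto
   moreover have "p * t + q * s \<in> S" using u e SU_closed by simp
   ultimately have "p * t + q * s \<in> satur J" using US(3)[OF u(1,4)] unfolding satur_def by blast
   moreover have "x \<oplus>\<^bsub>A\<^esub> y = fr (p * t + q * s) (s * t)" using e u by (simp add: A_add)
   ultimately show ?thesis using US(3)[OF e(5,6)] by blast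
  qed
  show "\<ominus>\<^bsub>A\<^esub> x \<in> ?I" if x: "x \<in> ?I" for x
  proof -
   obtain p s where e: "x = fr p s" "p \<in> satur J" "s \<in> US" using x by blast
   then obtain u j where u: "u \<in> US" "j \<in> J" "zr (u * p) = zr j" "p \<in> S" by (auto simp: satur_def)
   have "zr (u * (- p)) = zr ((- 1) * j)" using u(3) by (simp add: zr_linear)
   then have "- p \<in> satur J" using u idlD(4)[OF J S_closed(5)[OF S_closed(1)] u(2)] S_closed(5) unfolding satur_def by blast
   moreover have "\<ominus>\<^bsub>A\<^esub> x = fr (- p) s"
   proof (rule A.minus_equality)
    show "fr (- p) s \<oplus>\<^bsub>A\<^esub> x = \<zero>\<^bsub>A\<^esub>" unfolding e(1) A_add[OF SU_closed(3)[OF u(4)] e(3) u(4) e(3)] A_zero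
     by (rule fr_eqI) (use u e SU_closed in simp_all)
   qed (use e u SU_closed in \<open>auto simp: fr_in\<close>)
   ultimately show ?thesis using e(3) by blast
  qed
 qed
 have l: "x \<otimes>\<^bsub>A\<^esub> a \<in> ?I" if ax: "a \<in> ?I" "x \<in> carrier A" for a x
 proof -
  obtain p s where e: "a = fr p s" "p \<in> satur J" "s \<in> US" using ax by blast
  obtain q t where q: "x = fr q t" "q \<in> S" "t \<in> US" using ax(2) unfolding A_carrier by blast
  obtain u j where u: "u \<in> US" "j \<in> J" "zr (u * p) = zr j" "p \<in> S" using e by (auto simp: satur_def)
  have "zr (u * (q * p)) = zr (q * j)" using zr_cong[OF u(3), of q] by (simp add: ac_simps)
  then have "q * p \<in> satur J" using u q S_closed(4) idlD(4)[OF J q(2) u(2)] unfolding satur_def by blast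
  moreover have "x \<otimes>\<^bsub>A\<^esub> a = fr (q * p) (t * s)" using e q u by (simp add: A_mult)
  ultimately show ?thesis using US(3)[OF q(3) e(3)] by blast
 qed
 then show "x \<otimes>\<^bsub>A\<^esub> a \<in> ?I" "a \<otimes>\<^bsub>A\<^esub> x \<in> ?I" if "a \<in> ?I" "x \<in> carrier A" for a x
 proof -
  show "x \<otimes>\<^bsub>A\<^esub> a \<in> ?I" by (rule l) fact+
  have "?I \<subseteq> carrier A" by (auto simp: satur_def fr_in)
  then have "a \<otimes>\<^bsub>A\<^esub> x = x \<otimes>\<^bsub>A\<^esub> a" using that by (intro A.m_comm) auto
  then show "a \<otimes>\<^bsub>A\<^esub> x \<in> ?I" using l[OF that] by simp
 qed
qed

text \<open>The bridge between ideals of the localization and polynomials: membership in a finitely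
  generated ideal amounts to one polynomial identity after clearing denominators.\<close>

lemma Idl_fr:
 fixes p s :: "nat => ('v, 'k) mpol"
 assumes ps: "\<And>j. j < i ==> p j \<in> S" "\<And>j. j < i ==> s j \<in> US" and q: "q \<in> S" "t \<in> US"
 shows "fr q t \<in> Idl\<^bsub>A\<^esub> ((\<lambda>j. fr (p j) (s j)) ` {..<i}) \<longleftrightarrow>
  (\<exists>u\<in>US. \<exists>c. (\<forall>j<i. c j \<in> S) \<and> zr (u * q) = zr (\<Sum>j<i. c j * p j))"
proof -
 let ?X = "(\<lambda>j. fr (p j) (s j)) ` {..<i}"
 define J where "J = {(\<Sum>j<i. c j * p j) | c. \<forall>j<i. c j \<in> S}"
 have J: "idl S J"
  unfolding idl_def
 proof (intro conjI ballI)
  show "J \<subseteq> S" using ps(1) by (auto simp: J_def intro!: subr_sum[OF S] S_closed(4))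
  show "0 \<in> J" unfolding J_def by (rule CollectI, rule exI[of _ "\<lambda>_. 0"]) (simp add: S_closed)
  show "a + b \<in> J" if ab: "a \<in> J" "b \<in> J" for a b
  proof -
   obtain c c' where "a = (\<Sum>j<i. c j * p j)" "\<forall>j<i. c j \<in> S" "b = (\<Sum>j<i. c' j * p j)" "\<forall>j<i. c' j \<in> S" using ab unfolding J_def by blast
   then show ?thesis unfolding J_def
    by (intro CollectI exI[of _ "\<lambda>j. c j + c' j"]) (simp add: sum.distrib distrib_right S_closed)
  qed
  show "r * a \<in> J" if ra: "r \<in> S" "a \<in> J" for r a
  proof -
   obtain c where "a = (\<Sum>j<i. c j * p j)" "\<forall>j<i. c j \<in> S" using ra unfolding J_def by blast
   then show ?thesis unfolding J_def using ra(1)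
    by (intro CollectI exI[of _ "\<lambda>j. r * c j"]) (simp add: sum_distrib_left mult.assoc S_closed)
  qed
 qed
 have satJ: "r \<in> satur J \<longleftrightarrow> r \<in> S \<and> (\<exists>u\<in>US. \<exists>c. (\<forall>j<i. c j \<in> S) \<and> zr (u * r) = zr (\<Sum>j<i. c j * p j))" for r
  unfolding satur_def J_def by blast
 have XA: "?X \<subseteq> carrier A" using ps by (auto simp: fr_in)
 note iX = A.genideal_ideal[OF XA]
 have "\<forall>j<i. fr (p j) (s j) \<in> {fr p s | p s. p \<in> satur J \<and> s \<in> US}"
 proof (intro allI impI)
  fix j assume j: "j < i"
  have "p j = (\<Sum>l<i. (if l = j then 1 else 0) * p l)" using j by (simp add: if_distrib[of "\<lambda>c. c * _"] cong: if_cong)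
  then have "p j \<in> satur J" unfolding satJ using ps(1)[OF j]
   by (intro conjI bexI[OF _ US(2)] exI[of _ "\<lambda>l. if l = j then 1 else 0"]) (simp_all add: S_closed)
  then show "fr (p j) (s j) \<in> {fr p s | p s. p \<in> satur J \<and> s \<in> US}" using ps(2)[OF j] by blast
 qed
 then have "Idl\<^bsub>A\<^esub> ?X \<subseteq> {fr p s | p s. p \<in> satur J \<and> s \<in> US}"
  by (intro A.genideal_minimal ideal_satur[OF J]) auto
 moreover have "fr q t \<in> {fr p s | p s. p \<in> satur J \<and> s \<in> US} ==> q \<in> satur J"
 proof -
  assume "fr q t \<in> {fr p s | p s. p \<in> satur J \<and> s \<in> US}"
  then obtain r w where r: "fr q t = fr r w" "r \<in> satur J" "w \<in> US" by blast
  then have "frel (q, t) (r, w)" using q by (simp add: fr_eq_iff satJ)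
  then obtain u where u: "u \<in> US" "zr (u * (q * w)) = zr (u * (r * t))" by (auto simp: frel_def)
  obtain u' j where u': "u' \<in> US" "j \<in> J" "zr (u' * r) = zr j" using r(2) by (auto simp: satur_def)
  have "zr (u' * (u * (q * w))) = zr (u * t * (u' * r))" using zr_cong[OF u(2), of u'] by (simp add: ac_simps)
  also have "\<dots> = zr (u * t * j)" by (rule zr_cong[OF u'(3)])
  finally have "zr (u' * u * w * q) = zr (u * t * j)" by (simp add: ac_simps)
  moreover have "u * t * j \<in> J" "u' * u * w \<in> US" using u u' q r idlD(4)[OF J] SU_closed by auto
  ultimately show "q \<in> satur J" using q(1) unfolding satur_def by blast
 qed
 ultimately have "fr q t \<in> Idl\<^bsub>A\<^esub> ?X ==> q \<in> satur J" by blast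
 moreover have "q \<in> satur J ==> fr q t \<in> Idl\<^bsub>A\<^esub> ?X"
 proof -
  assume "q \<in> satur J"
  then obtain u c where u: "u \<in> US" "\<forall>j<i. c j \<in> S" "zr (u * q) = zr (\<Sum>j<i. c j * p j)" unfolding satJ by blast
  have "p j \<in> ctr (Idl\<^bsub>A\<^esub> ?X)" if "j < i" for j
   using fr_mem_iff[OF iX ps(1)[OF that] ps(2)[OF that]] A.genideal_self[OF XA] that by blast
  then have "(\<Sum>j<i. c j * p j) \<in> ctr (Idl\<^bsub>A\<^esub> ?X)"
   using u(2) by (intro idl_sum[OF ctr_idl[OF iX]] idlD(4)[OF ctr_idl[OF iX]]) auto
  then have "q \<in> ctr (Idl\<^bsub>A\<^esub> ?X)" by (rule ctr_zr[OF iX q(1) u(1) u(3)])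
  then show "fr q t \<in> Idl\<^bsub>A\<^esub> ?X" using fr_mem_iff[OF iX q] by blast
 qed
 ultimately show ?thesis unfolding satJ using q(1) by blast
qed

lemma A_noetherian: "noetherian_ring A"
proof (intro noetherian_ring.intro noetherian_ring_axioms.intro A.ring_axioms)
 fix \<aa> assume \<aa>: "ideal \<aa> A"
 interpret I: ideal \<aa> A by fact
 obtain X where X: "finite X" "X \<subseteq> ctr \<aa>" "ctr \<aa> \<subseteq> lin S X"
  using SV_noeth[OF finite_V] ctr_idl[OF \<aa>] unfolding noeth_def S_def by meson
 define Y where "Y = (\<lambda>p. fr p 1) ` X"
 have XS: "X \<subseteq> S" using X(2) by (auto simp: ctr_def)
 have YA: "Y \<subseteq> carrier A" using XS US(2) by (auto simp: Y_def fr_in)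
 have Ya: "Y \<subseteq> \<aa>" using X(2) by (auto simp: Y_def ctr_def)
 note iY = A.genideal_ideal[OF YA]
 have "X \<subseteq> ctr (Idl\<^bsub>A\<^esub> Y)" using A.genideal_self[OF YA] XS by (auto simp: ctr_def Y_def)
 then have "ctr \<aa> \<subseteq> ctr (Idl\<^bsub>A\<^esub> Y)" using lin_subset[OF ctr_idl[OF iY]] X(3) by blast
 then have "\<aa> \<subseteq> Idl\<^bsub>A\<^esub> Y" by (subst ideal_eq[OF \<aa>], subst ideal_eq[OF iY]) blast
 moreover have "Idl\<^bsub>A\<^esub> Y \<subseteq> \<aa>" by (rule A.genideal_minimal[OF \<aa> Ya])
 ultimately show "\<exists>Z\<subseteq>carrier A. finite Z \<and> \<aa> = Idl\<^bsub>A\<^esub> Z" using X(1) YA by (intro exI[of _ Y]) (auto simp: Y_def)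
qed

definition mm where "mm = {fr p s | p s. p \<in> S \<and> lk p 0 = 0 \<and> s \<in> US}"

lemma ideal_unit: assumes "ideal \<aa> A" "p \<in> ctr \<aa>" "lk p 0 ~= 0" shows "\<aa> = carrier A"
proof -
 interpret I: ideal \<aa> A by fact
 have p: "p \<in> US" "fr p 1 \<in> \<aa>" using assms by (auto simp: US_def ctr_def)
 have "fr p 1 \<otimes>\<^bsub>A\<^esub> fr 1 p \<in> \<aa>" by (rule I.I_r_closed[OF p(2)]) (use p SU_closed S_closed(1) in \<open>simp add: fr_in\<close>)
 moreover have "fr p 1 \<otimes>\<^bsub>A\<^esub> fr 1 p = \<one>\<^bsub>A\<^esub>" using p SU_closed S_closed(1) by (simp add: A_mult A_one) (rule fr_eqI, auto)
 ultimately show ?thesis using I.one_imp_carrier by simp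
qed

lemma zr_unit: "zr (u * p) = zr q ==> u \<in> US ==> lk q 0 = 0 ==> lk p 0 = 0"
 using zr_lk0[of "u * p" q] by (simp add: US_def lookup_mult_0)

lemma m_idl: "idl S {p \<in> S. lk p 0 = 0}"
 unfolding idl_def using S_closed by (auto simp: lookup_add lookup_mult_0)

lemma satur_m: "satur {p \<in> S. lk p 0 = 0} = {p \<in> S. lk p 0 = 0}"
 unfolding satur_def using zr_unit by (auto intro!: bexI[OF _ US(2)])

lemma mm_ideal: "ideal mm A"
 using ideal_satur[OF m_idl] by (simp add: satur_m mm_def conj_assoc)

lemma fr_mm_iff: "p \<in> S ==> s \<in> US ==> fr p s \<in> mm \<longleftrightarrow> lk p 0 = 0"
proof
 assume a: "p \<in> S" "s \<in> US" "fr p s \<in> mm"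
 then obtain q t where q: "fr p s = fr q t" "q \<in> S" "lk q 0 = 0" "t \<in> US" by (auto simp: mm_def)
 then obtain u where u: "u \<in> US" "zr (u * (p * t)) = zr (u * (q * s))" using a by (auto simp: fr_eq_iff frel_def)
 then show "lk p 0 = 0" using zr_lk0[OF u(2)] q u(1) by (auto simp: lookup_mult_0 US_def)
qed (auto simp: mm_def)

lemma maximal_ideals: "{\<aa>. maximalideal \<aa> A} = {mm}"
proof -
 have one: "\<one>\<^bsub>A\<^esub> \<notin> mm" using fr_mm_iff[OF S_closed(1) US(2)] by (simp add: A_one)
 have proper: "\<aa> \<subseteq> mm" if id: "ideal \<aa> A" and ne: "\<aa> ~= carrier A" for \<aa>
 proof
  fix y assume "y \<in> \<aa>"
  then obtain p s where y: "y = fr p s" "p \<in> ctr \<aa>" "s \<in> US" using ideal_eq[OF id] by blast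
  then show "y \<in> mm" using ideal_unit[OF id y(2)] ne by (auto simp: mm_def ctr_def)
 qed
 have "maximalideal mm A"
 proof (rule maximalidealI[OF mm_ideal])
  show "carrier A ~= mm" using one by auto
  show "J = mm \<or> J = carrier A" if "ideal J A" "mm \<subseteq> J" "J \<subseteq> carrier A" for J
   using proper[OF that(1)] that(2) by blast
 qed
 moreover have "\<aa> = mm" if "maximalideal \<aa> A" for \<aa>
 proof -
  interpret M: maximalideal \<aa> A by fact
  have "\<aa> \<subseteq> mm" using proper[OF M.is_ideal] M.I_notcarr by simp
  moreover have "mm \<subseteq> carrier A" by (auto simp: mm_def fr_in)
  ultimately have "mm = \<aa> \<or> mm = carrier A" using M.I_maximal[OF mm_ideal] by simp
  then show ?thesis using one A.one_closed by auto
 qed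
 ultimately show ?thesis by blast
qed

text \<open>Contraction keeps chains of primes strict, and each contracted prime contains the
  monomials of the non-faces; so the bound for chains in the polynomial ring applies.\<close>

lemma krull_dim_le:
 assumes dim: "\<And>F. F \<in> \<Delta> ==> card F \<le> e"
 shows "krull_dim A \<le> enat e"
 unfolding krull_dim_def
proof (rule SUP_least, clarify)
 fix r :: nat and P assume P: "\<forall>i\<le>r. primeideal (P i) A" "\<forall>i<r. P i \<subset> P (Suc i)"
 have id: "ideal (P i) A" if "i \<le> r" for i using P(1) that by (simp add: primeideal_def)
 have "r \<le> e"
 proof (rule prime_chain_length[OF finite_V, where P = "\<lambda>i. ctr (P i)" and \<Delta> = \<Delta>])
  show "prm (SV V) (ctr (P i))" if i: "i \<le> r" for i
  proof -
   interpret Q: primeideal "P i" A using P(1) i by blast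
   have "1 \<notin> ctr (P i)" using ideal_unit[OF id[OF i], of 1] Q.I_notcarr by auto
   moreover have "a \<in> ctr (P i) \<or> b \<in> ctr (P i)" if ab: "a \<in> S" "b \<in> S" "a * b \<in> ctr (P i)" for a b
   proof -
    have "fr a 1 \<otimes>\<^bsub>A\<^esub> fr b 1 \<in> P i" using ab US(2) by (simp add: A_mult ctr_def)
    then show ?thesis using Q.I_prime[of "fr a 1" "fr b 1"] ab US(2) by (auto simp: fr_in ctr_def)
   qed
   ultimately show ?thesis using ctr_idl[OF id[OF i]] unfolding prm_def S_def by blast
  qed
  show "ctr (P i) \<subset> ctr (P (Suc i))" if i: "i < r" for i
  proof -
   have "P i \<subset> P (Suc i)" using P(2) i by blast
   moreover have "P i = {fr p s | p s. p \<in> ctr (P i) \<and> s \<in> US}" "P (Suc i) = {fr p s | p s. p \<in> ctr (P (Suc i)) \<and> s \<in> US}"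
    using ideal_eq id i by auto
   moreover have "ctr (P i) \<subseteq> ctr (P (Suc i))" using calculation(1) by (auto simp: ctr_def)
   ultimately show ?thesis by (metis psubsetI psubset_eq)
  qed
  show "face_monomial F \<in> ctr (P 0)" if F: "F \<subseteq> V" "F \<notin> \<Delta>" for F
  proof -
   have fF: "finite F" using F(1) finite_V finite_subset by blast
   have s: "face_monomial F \<in> S" unfolding S_def face_monomial_def
    by (rule SV_single) (use F(1) keys_indicator[OF fF] in simp)
   have "zr (1 * face_monomial F) = zr 0"
    by (rule poly_mapping_eqI) (use F keys_indicator[OF fF] in \<open>auto simp: lk_zr face_monomial_def lookup_single when_def\<close>)
   then show ?thesis using ctr_zr[OF id[of 0] s US(2)] idlD(2)[OF ctr_idl[OF id[of 0]]] by blast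
  qed
 qed (rule dim)
 then show "enat r \<le> enat e" by simp
qed

section \<open>From Koszul annihilation to weak sequences\<close>

lemma radical_add:
 fixes G :: "'r::comm_ring_1 set"
 assumes G: "idl UNIV G" and a: "a ^ k \<in> G" and b: "b ^ l \<in> G"
 shows "(a + b) ^ (k + l) \<in> G"
 unfolding binomial_ring
proof (rule idl_sum[OF G])
 fix i assume i: "i \<in> {..k + l}"
 show "of_nat (k + l choose i) * a ^ i * b ^ (k + l - i) \<in> G"
 proof (cases "k \<le> i")
  case True
  then have "a ^ i = a ^ (i - k) * a ^ k" by (simp add: power_add[symmetric])
  then have "of_nat (k + l choose i) * a ^ i * b ^ (k + l - i) = (of_nat (k + l choose i) * a ^ (i - k) * b ^ (k + l - i)) * a ^ k"
   by (simp add: ac_simps)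
  then show ?thesis using idlD(4)[OF G UNIV_I a] by simp
 next
  case False
  then have "b ^ (k + l - i) = b ^ (k - i) * b ^ l" by (simp add: power_add[symmetric])
  then have "of_nat (k + l choose i) * a ^ i * b ^ (k + l - i) = (of_nat (k + l choose i) * a ^ i * b ^ (k - i)) * b ^ l"
   by (simp add: ac_simps)
  then show ?thesis using idlD(4)[OF G UNIV_I b] by simp
 qed
qed

lemma radical_sum:
 fixes G :: "'r::comm_ring_1 set" and n :: nat
 assumes G: "idl UNIV G" and p: "\<And>j. j < n ==> \<exists>k. p j ^ k \<in> G"
 shows "\<exists>k. (\<Sum>j<n. c j * p j) ^ k \<in> G"
 using p
proof (induction n)
 case 0
 then show ?case using idlD(2)[OF G] by (intro exI[of _ 1]) simp
next
 case (Suc n)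
 then obtain k l where kl: "(\<Sum>j<n. c j * p j) ^ k \<in> G" "p n ^ l \<in> G" by (meson lessI less_SucI)
 have "(c n * p n) ^ l \<in> G" using idlD(4)[OF G UNIV_I kl(2), of "c n ^ l"] by (simp add: power_mult_distrib)
 then show ?case using radical_add[OF G kl(1)] by (auto simp only: sum.lessThan_Suc)
qed

lemma zr_power: "zr a = zr b ==> zr (a ^ k) = zr (b ^ k)"
 by (induction k) (auto intro: zr_cong2)

text \<open>Koszul arguments run in all variables of the type and may return polynomials involving
  variables outside V; these are dropped without changing normal form or constant term.\<close>

definition fV :: "('v, 'k) mpol => ('v, 'k) mpol" where "fV = flt (\<lambda>m. kys m \<subseteq> V)"

lemma fV: "fV p \<in> S" "zr (fV p) = zr p" "lk (fV p) 0 = lk p 0"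
proof -
 show "fV p \<in> S" by (auto simp: fV_def S_def SV_def keys_flt)
 show "zr (fV p) = zr p" by (rule poly_mapping_eqI) (auto simp: lk_zr fV_def lookup_flt)
 show "lk (fV p) 0 = lk p 0" by (simp add: fV_def lookup_flt)
qed

lemma zr_sum: "zr (\<Sum>j\<in>J. f j) = (\<Sum>j\<in>J. zr (f j))"
 by (simp add: zr_def flt_sum)

lemma Xp_power: "Xp v k ^ l = (Xp v (k * l) :: ('v, 'k) mpol)"
proof (induction l)
 case 0
 then show ?case by (simp add: Xp_def)
next
 case (Suc l)
 then show ?case by (simp add: Xp_def mult_single single_add[symmetric] del: power_Suc add: power_Suc)
qed

text \<open>If a * x i lies in the ideal of the earlier parameters and b in the maximal ideal, this
  is a relation between the parameters that survives raising the later ones to the power N.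
  Annihilation by b puts the product of a and b, up to a multiplier, into the ideal of the earlier
  parameters and the N-th powers of the later ones, for every N; Krull's theorem then drops the
  powers. The length of a system of parameters is at most e because the Krull dimension is.\<close>

theorem buchsbaum_if_acyclic:
 fixes vs :: "'v list" and e :: nat
 assumes vs: "distinct vs" "set vs = V"
  and dim: "\<And>F. F \<in> \<Delta> ==> card F \<le> e"
  and ac: "\<And>F p f. F \<in> \<Delta> ==> F ~= {} ==> p < int e ==>
   (\<And>G. f G ~= (0::'k) ==> G \<in> \<Delta> \<and> F \<subseteq> G \<and> int (card G) = p) ==> (\<And>G. G \<in> \<Delta> ==> cob vs f G = 0) ==>
   \<exists>g. (\<forall>G. g G ~= 0 --> G \<in> \<Delta> \<and> F \<subseteq> G \<and> int (card G) = p - 1) \<and> (\<forall>G\<in>\<Delta>. cob vs g G = f G)"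
 shows "buchsbaum K \<Delta>"
proof -
 have weak: "weak_sequence A mm xs" if sop: "system_of_parameters A mm xs" for xs
 proof -
  define n where "n = length xs"
  have xm: "set xs \<subseteq> mm" and rad: "\<And>a. a \<in> mm ==> \<exists>k::nat. a [^]\<^bsub>A\<^esub> k \<in> Idl\<^bsub>A\<^esub> (set xs)"
   using sop by (auto simp: system_of_parameters_def)
  have "enat n = krull_dim A" using sop by (simp add: system_of_parameters_def n_def)
  then have "enat n \<le> enat e" using krull_dim_le[OF dim] by simp
  then have ne: "n \<le> e" by simp
  have "\<forall>j. \<exists>p s. j < n --> xs ! j = fr p s \<and> p \<in> S \<and> lk p 0 = 0 \<and> s \<in> US"
   using xm unfolding mm_def n_def by (force simp: subset_iff)
  then obtain p s where ps: "\<And>j. j < n ==> xs ! j = fr (p j) (s j) \<and> p j \<in> S \<and> lk (p j) 0 = 0 \<and> s j \<in> US" by metis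
  have tk: "set (take i xs) = (\<lambda>j. fr (p j) (s j)) ` {..<i}" if "i \<le> n" for i
  proof -
   have "set (take i xs) = (\<lambda>j. xs ! j) ` {..<i}"
    using that by (auto simp: n_def set_conv_nth image_iff) (metis nth_take)+
   then show ?thesis using ps that by auto
  qed
  have par: "\<exists>k. \<exists>u\<in>US. \<exists>c. zr (u * Xp v k) = zr (\<Sum>j<n. c j * p j)" if v: "v \<in> V" for v
  proof -
   have "fr (Xp v 1) 1 \<in> mm" using Xp_S[OF v] US(2) by (simp add: fr_mm_iff lk_Xp_0)
   then obtain k :: nat where k: "fr (Xp v 1) 1 [^]\<^bsub>A\<^esub> k \<in> Idl\<^bsub>A\<^esub> (set xs)" using rad by blast
   have "fr (Xp v 1) 1 [^]\<^bsub>A\<^esub> k = fr (Xp v 1 ^ k) 1"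
    by (induction k) (use Xp_S[OF v] US(2) S_closed(7) in \<open>simp_all add: A_one A_mult mult.commute\<close>)
   then have "fr (Xp v k) 1 \<in> Idl\<^bsub>A\<^esub> ((\<lambda>j. fr (p j) (s j)) ` {..<n})"
    using k tk[of n] Xp_power[of v 1 k] by (simp add: n_def)
   then show ?thesis using Idl_fr[of n p s "Xp v k" 1] ps Xp_S[OF v] US(2) by auto
  qed
  show ?thesis
   unfolding weak_sequence_def
  proof (intro allI impI ballI)
   fix i a b assume i: "i < length xs" and a: "a \<in> carrier A" and ax: "a \<otimes>\<^bsub>A\<^esub> xs ! i \<in> Idl\<^bsub>A\<^esub> (set (take i xs))" and b: "b \<in> mm"
   have i: "i < n" using i by (simp add: n_def)
   obtain q t where q: "a = fr q t" "q \<in> S" "t \<in> US" using a unfolding A_carrier by blast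
   obtain r w where r: "b = fr r w" "r \<in> S" "lk r 0 = 0" "w \<in> US" using b unfolding mm_def by blast
   have "fr (q * p i) (t * s i) \<in> Idl\<^bsub>A\<^esub> ((\<lambda>j. fr (p j) (s j)) ` {..<i})"
    using ax ps[OF i] q tk[of i] i by (simp add: A_mult)
   then obtain u0 c0 where u0: "u0 \<in> US" "\<And>j. j < i ==> c0 j \<in> S" "zr (u0 * (q * p i)) = zr (\<Sum>j<i. c0 j * p j)"
    using Idl_fr[of i p s "q * p i" "t * s i"] ps i q SU_closed by auto
   \<comment> \<open>The numerator of the product of b and a, with the multiplier of the given
     relation included; Krull's theorem is applied to this element.\<close>
   define a0 where "a0 = r * (u0 * q)"
   have a0S: "a0 \<in> S" using r q u0 SU_closed by (simp add: a0_def)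
   define J where "J = {z \<in> S. \<exists>c. (\<forall>j<i. c j \<in> S) \<and> zr z = zr (\<Sum>j<i. c j * p j)}"
   have J: "idl S J"
    unfolding idl_def
   proof (intro conjI ballI)
    show "J \<subseteq> S" by (auto simp: J_def)
    show "0 \<in> J" unfolding J_def using S_closed(2) by (intro CollectI conjI exI[of _ "\<lambda>_. 0"]) simp_all
    show "x + y \<in> J" if xy: "x \<in> J" "y \<in> J" for x y
    proof -
     obtain c c' where "x \<in> S" "y \<in> S" "zr x = zr (\<Sum>j<i. c j * p j)" "\<forall>j<i. c j \<in> S" "zr y = zr (\<Sum>j<i. c' j * p j)" "\<forall>j<i. c' j \<in> S"
      using xy unfolding J_def by blast
     then show ?thesis unfolding J_def
      by (intro CollectI conjI exI[of _ "\<lambda>j. c j + c' j"]) (simp_all add: sum.distrib distrib_right S_closed zr_linear)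
    qed
    show "x * y \<in> J" if xy: "x \<in> S" "y \<in> J" for x y
    proof -
     obtain c where c: "y \<in> S" "zr y = zr (\<Sum>j<i. c j * p j)" "\<forall>j<i. c j \<in> S" using xy unfolding J_def by blast
     then show ?thesis unfolding J_def using xy(1) zr_cong[OF c(2), of x]
      by (intro CollectI conjI exI[of _ "\<lambda>j. x * c j"]) (simp_all add: sum_distrib_left mult.assoc S_closed)
    qed
   qed
   have "\<exists>u\<in>US. u * a0 \<in> J"
   proof (rule krull_intersection[where R = S and M = "{z \<in> S. lk z 0 = 0}" and Y = "p ` {i<..<n}"])
    show "subr S" by (rule S)
    show "noeth S" unfolding S_def by (rule SV_noeth[OF finite_V])
    show "idl S J" by fact
    show "a0 \<in> S" by fact
    show "idl S {z \<in> S. lk z 0 = 0}" by (rule m_idl)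
    show "US \<subseteq> S" by (auto simp: US_def)
    show "u - \<mu> \<in> US" if "u \<in> US" "\<mu> \<in> {z \<in> S. lk z 0 = 0}" for u \<mu>
     using that S_closed(3) by (simp add: US_def lookup_minus)
    show "finite (p ` {i<..<n})" by simp
    show "p ` {i<..<n} \<subseteq> {z \<in> S. lk z 0 = 0}" using ps by auto
    fix N
    \<comment> \<open>Only the parameters after i are raised to the power N, so the given relation
      at i stays literally the same.\<close>
    define y where "y j = (if j \<le> i then p j else p j ^ N)" for j
    interpret FM: face_modules \<Delta> vs n y
     by unfold_locales (use vs down in auto)
    have cpt: "FM.cpt {} = zr" by (simp add: FM.cpt_def zr_def)
    \<comment> \<open>The ideal of the y j up to multipliers. Its radical contains every p j, and
      therefore the y j are parameters again.\<close>
    define G where "G = {z. \<exists>u\<in>FM.U. \<exists>c. zr (u * z) = zr (\<Sum>j<n. c j * y j)}"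
    have G: "idl UNIV G"
     unfolding idl_def
    proof (intro conjI ballI)
     show "G \<subseteq> UNIV" by simp
     show "0 \<in> G" unfolding G_def by (intro CollectI bexI[OF _ FM.U_1] exI[of _ "\<lambda>_. 0"]) simp
     show "g + h \<in> G" if gh: "g \<in> G" "h \<in> G" for g h
     proof -
      obtain u c u' c' where u: "u \<in> FM.U" "zr (u * g) = zr (\<Sum>j<n. c j * y j)" "u' \<in> FM.U" "zr (u' * h) = zr (\<Sum>j<n. c' j * y j)"
       using gh unfolding G_def by blast
      have "zr (u * u' * (g + h)) = zr (u' * (u * g)) + zr (u * (u' * h))" by (simp add: zr_linear[symmetric] algebra_simps)
      also have "\<dots> = zr (u' * (\<Sum>j<n. c j * y j)) + zr (u * (\<Sum>j<n. c' j * y j))" by (simp only: zr_cong[OF u(2)] zr_cong[OF u(4)])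
      also have "\<dots> = zr (\<Sum>j<n. (u' * c j + u * c' j) * y j)"
       by (simp add: zr_linear[symmetric] sum_distrib_left sum.distrib distrib_right mult.assoc)
      finally show ?thesis unfolding G_def
       by (intro CollectI bexI[OF _ FM.U_mult[OF u(1,3)]] exI[of _ "\<lambda>j. u' * c j + u * c' j"])
     qed
     show "g * h \<in> G" if h: "h \<in> G" for g h
     proof -
      obtain u c where u: "u \<in> FM.U" "zr (u * h) = zr (\<Sum>j<n. c j * y j)" using h unfolding G_def by blast
      have "zr (u * (g * h)) = zr (g * (u * h))" by (simp add: ac_simps)
      also have "\<dots> = zr (g * (\<Sum>j<n. c j * y j))" by (rule zr_cong[OF u(2)])
      also have "\<dots> = zr (\<Sum>j<n. (g * c j) * y j)" by (simp add: sum_distrib_left mult.assoc)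
      finally show ?thesis unfolding G_def
       by (intro CollectI bexI[OF _ u(1)] exI[of _ "\<lambda>j. g * c j"])
     qed
    qed
    have yG: "y j \<in> G" if j: "j < n" for j
    proof -
     have "y j = (\<Sum>l<n. (if l = j then 1 else 0) * y l)" using j by (simp add: if_distrib[of "\<lambda>c. c * _"] cong: if_cong)
     then show ?thesis unfolding G_def by (intro CollectI bexI[OF _ FM.U_1] exI[of _ "\<lambda>l. if l = j then 1 else 0"]) simp
    qed
    have pG: "\<exists>k. p j ^ k \<in> G" if "j < n" for j
     using yG[OF that] by (cases "j \<le> i") (auto simp: y_def intro: exI[of _ 1] exI[of _ N])
    have par: "FM.parameters"
     unfolding FM.parameters_def cpt
    proof
     fix v assume "v \<in> set vs"
     then have v: "v \<in> V" using vs(2) by simp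
     obtain k u c where u: "u \<in> US" "zr (u * Xp v k) = zr (\<Sum>j<n. c j * p j)" using par[OF v] by blast
     obtain l where l: "(\<Sum>j<n. c j * p j) ^ l \<in> G" using radical_sum[of G n p c, OF G pG] by blast
     then obtain u' c' where u': "u' \<in> FM.U" "zr (u' * (\<Sum>j<n. c j * p j) ^ l) = zr (\<Sum>j<n. c' j * y j)" unfolding G_def by blast
     have "zr (u' * u ^ l * Xp v (k * l)) = zr (u' * (u * Xp v k) ^ l)" by (simp add: power_mult_distrib Xp_power mult.assoc)
     also have "\<dots> = zr (u' * (\<Sum>j<n. c j * p j) ^ l)" by (rule zr_cong[OF zr_power[OF u(2)]])
     also have "\<dots> = zr (\<Sum>j<n. c' j * y j)" by (rule u')
     finally have "zr (u' * u ^ l * Xp v (k * l)) = zr (\<Sum>j<n. c' j * y j)" .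
     note z = this
     have ul: "u ^ l \<in> FM.U" by (induction l) (use u(1) FM.U_1 FM.U_mult in \<open>auto simp: FM.U_def US_def\<close>)
     show "\<exists>N. \<exists>u\<in>FM.U. \<exists>c. zr (u * Xp v N) = zr (\<Sum>j<n. c j * y j)"
      by (rule exI[of _ "k * l"], rule bexI[OF _ FM.U_mult[OF u'(1) ul]], rule exI[of _ c'], rule z)
    qed
    have acl: "FM.acyclic_links e"
     unfolding FM.acyclic_links_def by (intro ballI allI impI, rule ac) auto
    \<comment> \<open>The given relation, read as a Koszul cycle: coefficients beyond i are
      0.\<close>
    define al where "al j = (if j = i then u0 * q else if j < i then - c0 j else 0)" for j
    have rel: "zr (\<Sum>j<n. y j * al j) = 0"
    proof -
     have "(\<Sum>j<n. y j * al j) = (\<Sum>j<Suc i. y j * al j)"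
      by (rule sum.mono_neutral_right) (use i in \<open>auto simp: al_def\<close>)
     also have "\<dots> = u0 * (q * p i) - (\<Sum>j<i. c0 j * p j)"
      by (simp add: al_def y_def sum_negf mult.commute mult.left_commute)
     finally show ?thesis using u0(3) by (simp add: zr_linear)
    qed
    have "\<exists>u\<in>FM.U. \<exists>c. zr (u * (r * al i)) = zr (\<Sum>j\<in>{..<n} - {i}. c j * y j)"
     using FM.koszul_annihilated[of e r al i, OF par acl ne dim empty_face r(3) _ i] rel unfolding cpt by blast
    then obtain u c where u: "u \<in> FM.U" "zr (u * (r * al i)) = zr (\<Sum>j\<in>{..<n} - {i}. c j * y j)" by blast
    define c' where "c' j = fV (c j)" for j
    have c'S: "c' j \<in> S" for j by (simp add: c'_def fV)
    \<comment> \<open>Krull's theorem is stated for a set of generators, and several later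
      parameters may coincide; their coefficients are collected by value.\<close>
    define g where "g z = (\<Sum>j\<in>{j \<in> {i<..<n}. p j = z}. c' j)" for z
    define R where "R = (\<Sum>z\<in>p ` {i<..<n}. g z * z ^ N)"
    have gS: "g z \<in> S" for z unfolding g_def by (rule subr_sum[OF S c'S])
    have RS: "R \<in> S" unfolding R_def by (intro subr_sum[OF S] S_closed(4,7) gS) (use ps in auto)
    have R: "(\<Sum>j\<in>{i<..<n}. c' j * y j) = R"
    proof -
     have "(\<Sum>j\<in>{i<..<n}. c' j * y j) = (\<Sum>j\<in>{i<..<n}. c' j * p j ^ N)" by (rule sum.cong) (auto simp: y_def)
     also have "\<dots> = (\<Sum>z\<in>p ` {i<..<n}. \<Sum>j\<in>{j \<in> {i<..<n}. p j = z}. c' j * p j ^ N)"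
      by (rule sum.image_gen) simp
     also have "\<dots> = R" unfolding R_def g_def sum_distrib_right by (intro sum.cong refl) auto
     finally show ?thesis .
    qed
    have "zr (fV u * a0) = zr (u * a0)" by (intro zr_cong2 fV refl)
    also have "\<dots> = zr (\<Sum>j\<in>{..<n} - {i}. c j * y j)" using u(2) by (simp add: a0_def al_def)
    also have "\<dots> = zr (\<Sum>j\<in>{..<n} - {i}. c' j * y j)"
     unfolding zr_sum by (intro sum.cong refl zr_cong2) (simp_all add: c'_def fV)
    also have "{..<n} - {i} = {..<i} \<union> {i<..<n}" using i by auto
    also have "(\<Sum>j\<in>\<dots>. c' j * y j) = (\<Sum>j<i. c' j * y j) + R"
     by (subst sum.union_disjoint) (auto simp: R)
    also have "(\<Sum>j<i. c' j * y j) = (\<Sum>j<i. c' j * p j)" by (rule sum.cong) (auto simp: y_def)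
    finally have e: "zr (fV u * a0) = zr ((\<Sum>j<i. c' j * p j) + R)" .
    have "fV u * a0 - R \<in> J" unfolding J_def
     using e a0S RS fV(1) c'S by (intro CollectI conjI exI[of _ c']) (simp_all add: S_closed zr_linear)
    moreover have "fV u \<in> US" using u(1) fV by (simp add: US_def FM.U_def)
    moreover have "fV u * a0 = (fV u * a0 - R) + R" by simp
    ultimately show "\<exists>u\<in>US. \<exists>j\<in>J. \<exists>c. (\<forall>y\<in>p ` {i<..<n}. c y \<in> S) \<and> u * a0 = j + (\<Sum>y\<in>p ` {i<..<n}. c y * y ^ N)"
     using gS unfolding R_def by blast
   qed
   then obtain u c where u: "u \<in> US" "\<And>j. j < i ==> c j \<in> S" "zr (u * a0) = zr (\<Sum>j<i. c j * p j)" unfolding J_def by blast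
   have "zr (u * u0 * (r * q)) = zr (\<Sum>j<i. c j * p j)" using u(3) by (simp add: a0_def ac_simps)
   then have "fr (r * q) (w * t) \<in> Idl\<^bsub>A\<^esub> ((\<lambda>j. fr (p j) (s j)) ` {..<i})"
    using Idl_fr[of i p s "r * q" "w * t"] ps i r q u(2) US(3)[OF u(1) u0(1)] SU_closed by auto
   then show "b \<otimes>\<^bsub>A\<^esub> a \<in> Idl\<^bsub>A\<^esub> (set (take i xs))" using tk[of i] i r q by (simp add: A_mult)
  qed
 qed
 then show ?thesis
  using A_cring A_noetherian maximal_ideals
  unfolding buchsbaum_def buchsbaum_local_ring_def A_def FR_def MI_def by blast
qed

end

section \<open>Linear extension of maps between chains\<close>

definition sc :: "'k::field => ('x \<Rightarrow>\<^sub>0 'k) => ('x \<Rightarrow>\<^sub>0 'k)" where "sc a c = Poly_Mapping.map ((*) a) c"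

lemma lookup_sc [simp]: "lk (sc a c) x = a * lk c x"
 by (simp add: sc_def Poly_Mapping.map.rep_eq when_def)

definition ext :: "('x => 'y \<Rightarrow>\<^sub>0 'k::field) => ('x \<Rightarrow>\<^sub>0 'k) => ('y \<Rightarrow>\<^sub>0 'k)" where
 "ext h c = (\<Sum>x\<in>kys c. sc (lk c x) (h x))"

lemma lookup_ext:
 assumes "finite S" "kys c \<subseteq> S"
 shows "lk (ext h c) y = (\<Sum>x\<in>S. lk c x * lk (h x) y)"
 unfolding ext_def lookup_sum lookup_sc
 by (rule sum.mono_neutral_left) (use assms in \<open>auto simp: in_keys_iff\<close>)

lemma sc_simps [simp]: "sc a 0 = 0" "sc 0 c = 0" "sc 1 c = c" "sc a (sc b c) = sc (a * b) c"
 by (rule poly_mapping_eqI, simp add: mult.assoc)+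

lemma sc_add: "sc a (c + d) = sc a c + sc a d" by (rule poly_mapping_eqI) (simp add: lookup_add distrib_left)
lemma sc_diff: "sc a (c - d) = sc a c - sc a d" by (rule poly_mapping_eqI) (simp add: lookup_minus right_diff_distrib)
lemma sc_uminus: "sc (- 1) c = - c" by (rule poly_mapping_eqI) simp
lemma sc_single [simp]: "sc a (sngl x b) = sngl x (a * b)"
 by (rule poly_mapping_eqI) (simp add: lookup_single when_def)
lemma sc_sum: "sc a (\<Sum>i\<in>I. f i) = (\<Sum>i\<in>I. sc a (f i))"
 by (rule poly_mapping_eqI) (simp add: lookup_sum sum_distrib_left)

lemma ext_single [simp]: "ext h (sngl x a) = sc a (h x)"
 by (rule poly_mapping_eqI) (subst lookup_ext[of "{x}"], auto)

lemma ext_0 [simp]: "ext h 0 = 0" by (simp add: ext_def)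

lemma ext_add: "ext h (c + d) = ext h c + ext h d"
proof (rule poly_mapping_eqI)
 fix y
 let ?S = "kys c \<union> kys d"
 have "kys (c + d) \<subseteq> ?S" by (rule keys_add)
 then show "lk (ext h (c + d)) y = lk (ext h c + ext h d) y"
  by (simp add: lookup_add lookup_ext[of ?S] distrib_right sum.distrib)
qed

lemma ext_sc: "ext h (sc a c) = sc a (ext h c)"
proof (rule poly_mapping_eqI)
 fix y
 have "kys (sc a c) \<subseteq> kys c" by (auto simp: in_keys_iff)
 then show "lk (ext h (sc a c)) y = lk (sc a (ext h c)) y"
  by (simp add: lookup_ext[of "kys c"] sum_distrib_left mult.assoc)
qed

lemma ext_uminus: "ext h (- c) = - ext h c"
 using ext_sc[of h "- 1" c] by (simp add: sc_uminus)
lemma ext_diff: "ext h (c - d) = ext h c - ext h d"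
 using ext_add[of h c "- d"] by (simp add: ext_uminus)
lemma ext_sum: "ext h (\<Sum>i\<in>I. f i) = (\<Sum>i\<in>I. ext h (f i))"
 by (rule additive_sum) (simp_all add: ext_add)

lemma ext_cong: "(\<And>x. x \<in> kys c ==> g x = h x) ==> ext g c = ext h c"
 unfolding ext_def by (rule sum.cong) auto

lemma ext_ext: "ext g (ext h c) = ext (\<lambda>x. ext g (h x)) c"
proof -
 have "ext g (ext h c) = (\<Sum>x\<in>kys c. ext g (sc (lk c x) (h x)))" by (simp only: ext_def[of h] ext_sum)
 then show ?thesis by (simp only: ext_sc) (simp only: ext_def[of "\<lambda>x. ext g (h x)"])
qed

lemma ext_fun_add: "ext (\<lambda>x. g x + h x) c = ext g c + ext h c"
 by (simp add: ext_def sc_add sum.distrib)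
lemma ext_fun_diff: "ext (\<lambda>x. g x - h x) c = ext g c - ext h c"
 by (simp add: ext_def sc_diff sum_subtractf)

lemma ext_id: "ext (\<lambda>x. sngl x 1) c = c"
proof -
 have "ext (\<lambda>x. sngl x 1) c = (\<Sum>m\<in>kys c. sngl m (lk c m))" by (simp add: ext_def)
 then show ?thesis using poly_mapping_sum_single[of c] by simp
qed

lemma keys_ext: "kys (ext h c) \<subseteq> (\<Union>x\<in>kys c. kys (h x))"
proof
 fix y assume "y \<in> kys (ext h c)"
 then have "(\<Sum>x\<in>kys c. lk c x * lk (h x) y) ~= 0"
  using lookup_ext[OF finite_keys[of c] subset_refl, of h y] by (simp add: in_keys_iff)
 then obtain x where "x \<in> kys c" "lk c x * lk (h x) y ~= 0" by (meson sum.neutral)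
 then show "y \<in> (\<Union>x\<in>kys c. kys (h x))" by (auto simp: in_keys_iff)
qed

section \<open>Augmented ordered chains\<close>

abbreviation sg1 :: "'x => ('x \<Rightarrow>\<^sub>0 'k::field)" where "sg1 x \<equiv> sngl x 1"

definition cone :: "'b => ('b list \<Rightarrow>\<^sub>0 'k::field) => ('b list \<Rightarrow>\<^sub>0 'k)" where
 "cone v = ext (\<lambda>l. sg1 (v # l))"

text \<open>The alternating sum of deletions, written recursively. The empty list is a generator and
  bounds from single vertices, so the complex is augmented and every cone is a contraction without
  exception.\<close>

primrec bd :: "'b list => ('b list \<Rightarrow>\<^sub>0 'k::field)" where
 "bd [] = 0"
| "bd (v # l) = sg1 l - cone v (bd l)"

definition del_at :: "nat => 'b list => 'b list" where "del_at j l = take j l @ drop (Suc j) l"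

lemma cone_simps: "cone v (sg1 l) = sg1 (v # l)" "cone v (c + d) = cone v c + cone v d" "cone v (c - d) = cone v c - cone v d" "cone v 0 = 0"
 by (simp_all add: cone_def ext_add ext_diff)

lemma BD_cone: "ext bd (cone v c) = c - cone v (ext bd c)"
proof -
 have "ext bd (cone v c) = ext (\<lambda>l. sg1 l - cone v (bd l)) c" by (simp add: cone_def ext_ext)
 also have "\<dots> = c - cone v (ext bd c)" by (simp add: ext_fun_diff ext_id) (simp add: cone_def ext_ext)
 finally show ?thesis .
qed

lemma BD_bd: "ext bd (bd l) = 0"
 by (induction l) (simp_all add: ext_diff BD_cone cone_simps)

lemma bd_formula: "(bd l :: 'b list \<Rightarrow>\<^sub>0 'k::field) = (\<Sum>j<length l. sngl (del_at j l) ((-1) ^ j))"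
proof (induction l)
 case (Cons v l)
 have "cone v (bd l :: 'b list \<Rightarrow>\<^sub>0 'k) = (\<Sum>j<length l. sngl (v # del_at j l) ((-1) ^ j))"
  unfolding Cons.IH by (simp add: cone_def ext_sum)
 also have "\<dots> = - (\<Sum>j<length l. sngl (del_at (Suc j) (v # l)) ((-1) ^ Suc j))"
  by (simp add: del_at_def sum_negf[symmetric] single_uminus[symmetric])
 finally have eq: "cone v (bd l :: 'b list \<Rightarrow>\<^sub>0 'k) = - (\<Sum>j<length l. sngl (del_at (Suc j) (v # l)) ((-1) ^ Suc j))" .
 show ?case unfolding bd.simps eq length_Cons sum.lessThan_Suc_shift by (simp add: del_at_def)
qed simp

lemma keys_bd: "l' \<in> kys (bd l :: 'b list \<Rightarrow>\<^sub>0 'k::field) ==> set l' \<subseteq> set l \<and> Suc (length l') = length l"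
proof -
 assume "l' \<in> kys (bd l :: 'b list \<Rightarrow>\<^sub>0 'k::field)"
 then obtain j where j: "j < length l" "l' \<in> kys (sngl (del_at j l) ((-1) ^ j :: 'k))"
  unfolding bd_formula
  using subsetD[OF keys_sum[of "\<lambda>j. sngl (del_at j l) ((-1) ^ j :: 'k)" "{..<length l}"]] by auto
 then have "l' = del_at j l" by (auto split: if_splits)
 then show ?thesis using j(1) by (auto simp: del_at_def dest: in_set_takeD in_set_dropD)
qed

definition lmap :: "('b => 'c) => ('b list \<Rightarrow>\<^sub>0 'k::field) => ('c list \<Rightarrow>\<^sub>0 'k)" where
 "lmap g = ext (\<lambda>l. sg1 (map g l))"

lemma lmap_cone: "lmap g (cone v c) = cone (g v) (lmap g c)"
 by (simp add: lmap_def cone_def ext_ext)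

lemma lmap_bd: "lmap g (bd l) = bd (map g l)"
proof (induction l)
 case (Cons v l)
 then show ?case by (simp add: lmap_def ext_diff) (simp add: Cons lmap_def[symmetric] lmap_cone)
qed (simp add: lmap_def)

lemma lmap_BD: "lmap g (ext bd c) = ext bd (lmap g c)"
 by (simp add: lmap_def ext_ext) (simp add: lmap_def[symmetric] lmap_bd)

text \<open>Unfolds to the alternating sum of the lists that run along \<open>lo\<close> up to some
  vertex and continue along \<open>hi\<close> from the same vertex: the usual triangulation of a
  prism.\<close>

primrec prism :: "('b => 'c) => ('b => 'c) => 'b list => ('c list \<Rightarrow>\<^sub>0 'k::field)" where
 "prism lo hi [] = 0"
| "prism lo hi (v # l) = sg1 (lo v # hi v # map hi l) - cone (lo v) (prism lo hi l)"

lemma prism_cone: "ext (prism lo hi) (cone v c) = cone (lo v) (cone (hi v) (lmap hi c)) - cone (lo v) (ext (prism lo hi) c)"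
proof -
 have "ext (prism lo hi) (cone v c) = ext (\<lambda>l. sg1 (lo v # hi v # map hi l) - cone (lo v) (prism lo hi l)) c"
  by (simp add: cone_def[of v] ext_ext)
 then show ?thesis by (simp add: ext_fun_diff) (simp add: cone_def lmap_def ext_ext)
qed

lemma prism_boundary: "ext bd (prism lo hi l :: 'c list \<Rightarrow>\<^sub>0 'k::field) + ext (prism lo hi) (bd l) = sg1 (map hi l) - sg1 (map lo l)"
proof (induction l)
 case (Cons v l)
 have IH: "ext bd (prism lo hi l :: 'c list \<Rightarrow>\<^sub>0 'k) = sg1 (map hi l) - sg1 (map lo l) - ext (prism lo hi) (bd l)" using Cons by (metis add_diff_cancel_right')
 have 1: "ext bd (prism lo hi (v # l) :: 'c list \<Rightarrow>\<^sub>0 'k) = sg1 (map hi (v # l)) - (cone (lo v) (sg1 (map hi l)) - cone (lo v) (cone (hi v) (lmap hi (bd l))))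
   - (prism lo hi l - cone (lo v) (ext bd (prism lo hi l)))"
  by (simp add: ext_diff BD_cone lmap_bd cone_simps)
 have 2: "(ext (prism lo hi) (bd (v # l)) :: 'c list \<Rightarrow>\<^sub>0 'k) = prism lo hi l - (cone (lo v) (cone (hi v) (lmap hi (bd l))) - cone (lo v) (ext (prism lo hi) (bd l)))"
  by (simp add: ext_diff prism_cone)
 show ?case unfolding 1 2 IH by (simp add: cone_simps)
qed simp

lemma prism_map:
 assumes "\<And>v. lo (g v) = g' (lo' v)" "\<And>v. hi (g v) = g' (hi' v)"
 shows "(prism lo hi (map g l) :: 'c list \<Rightarrow>\<^sub>0 'k::field) = lmap g' (prism lo' hi' l)"
proof (induction l)
 case (Cons v l)
 have "(lmap g' (prism lo' hi' (v # l)) :: 'c list \<Rightarrow>\<^sub>0 'k) = sg1 (map g' (lo' v # hi' v # map hi' l)) - lmap g' (cone (lo' v) (prism lo' hi' l))"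
  by (simp add: lmap_def ext_diff)
 then show ?case by (simp add: Cons lmap_cone assms o_def)
qed (simp add: lmap_def)

lemma keys_cone: "m \<in> kys (cone v c) ==> \<exists>l\<in>kys c. m = v # l"
 unfolding cone_def by (drule subsetD[OF keys_ext]) auto

lemma keys_diff': "x \<in> kys (a - b :: 'x \<Rightarrow>\<^sub>0 'k::field) ==> x \<in> kys a \<or> x \<in> kys b"
 by (auto simp: in_keys_iff lookup_minus)

lemma keys_prism: "m \<in> kys (prism lo hi l :: 'c list \<Rightarrow>\<^sub>0 'k::field) ==> length m = Suc (length l) \<and> set m \<subseteq> lo ` set l \<union> hi ` set l"
proof (induction l arbitrary: m)
 case (Cons v l)
 have "m = lo v # hi v # map hi l \<or> m \<in> kys (cone (lo v) (prism lo hi l :: 'c list \<Rightarrow>\<^sub>0 'k))"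
  using keys_diff'[of m "sg1 (lo v # hi v # map hi l)" "cone (lo v) (prism lo hi l :: 'c list \<Rightarrow>\<^sub>0 'k)"] Cons.prems by auto
 then show ?case
 proof
  assume "m \<in> kys (cone (lo v) (prism lo hi l :: 'c list \<Rightarrow>\<^sub>0 'k))"
  from keys_cone[OF this] obtain l' where "l' \<in> kys (prism lo hi l :: 'c list \<Rightarrow>\<^sub>0 'k)" "m = lo v # l'" by auto
  then show ?thesis using Cons.IH[of l'] by auto
 qed auto
qed simp

section \<open>Realization of lists of points\<close>

lemma singular_simplex_iff:
 fixes X :: "'a::topological_space set"
 shows "singular_simplex p (top_of_set X) f \<longleftrightarrow>
  continuous_on (standard_simplex p) f \<and> f ` standard_simplex p \<subseteq> X \<and> f \<in> extensional (standard_simplex p)"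
 by (auto simp: singular_simplex_def euclidean_product_topology continuous_map_in_subtopology)

definition comb :: "('i => real) list => (nat => real) => 'i => real" where
 "comb l s i = (\<Sum>j<length l. s j * (l ! j) i)"

text \<open>The affine simplex with corners l, followed by H. The restriction is required because
  singular simplices are extensional functions.\<close>

definition push :: "(('i => real) => 'a) => ('i => real) list => (nat => real) => 'a" where
 "push H l = restrict (\<lambda>s. H (comb l s)) (standard_simplex (length l - 1))"

lemma standard_simplex_face: "s \<in> standard_simplex (p - 1) ==> 1 \<le> p ==> k \<le> p ==> simplical_face k s \<in> standard_simplex p"
 using simplical_face_in_standard_simplex[of p k s] by simp

lemma comb_face:
 assumes "length l = Suc p" "1 \<le> p" "k \<le> p" "s \<in> standard_simplex (p - 1)"
 shows "comb l (simplical_face k s) = comb (del_at k l) s"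
proof
 fix i
 have "comb l (simplical_face k s) i = (\<Sum>j\<in>{..<Suc p} - {k}. simplical_face k s j * (l ! j) i)"
  unfolding comb_def assms(1) by (rule sum.mono_neutral_right) (auto simp: simplical_face_def)
 also have "\<dots> = (\<Sum>j<p. s j * (del_at k l ! j) i)"
 proof (rule sum.reindex_bij_witness[of _ "\<lambda>j. if j < k then j else Suc j" "\<lambda>j. if j < k then j else j - 1"])
  fix j assume "j \<in> {..<Suc p} - {k}"
  then show "s (if j < k then j else j - 1) * (del_at k l ! (if j < k then j else j - 1)) i = simplical_face k s j * (l ! j) i"
   using assms by (auto simp: simplical_face_def del_at_def nth_append)
 qed (use assms(3) in auto)
 also have "p = length (del_at k l)" using assms by (simp add: del_at_def)
 finally show "comb l (simplical_face k s) i = comb (del_at k l) s i" by (simp add: comb_def)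
qed

lemma singular_face_push:
 assumes "length l = Suc p" "1 \<le> p" "k \<le> p"
 shows "singular_face p k (push H l) = push H (del_at k l)"
proof -
 have "length (del_at k l) - 1 = p - Suc 0" using assms by (simp add: del_at_def)
 then show ?thesis
  using comb_face[OF assms] standard_simplex_face[of _ p k] assms
  by (auto simp: singular_face_def push_def intro!: restrict_ext)
qed

definition bq :: "nat => ((nat => real) => 'a) => ('a, 'k::field) kchain" where
 "bq p f = (\<Sum>j\<le>p. sngl (singular_face p j f) ((-1) ^ j))"

lemma bdry_eq: "bdry n c = (if n \<le> 0 then 0 else ext (bq (nat n)) c)"
 unfolding bdry_def ext_def bq_def sc_sum sc_single by (simp add: mult.commute)

text \<open>Singular chains are not augmented, so the empty list is sent to 0; this is what makes
  the boundary formula hold in degree 0.\<close>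

definition QQ :: "(('i => real) => 'a) => (('i => real) list \<Rightarrow>\<^sub>0 'k::field) => ('a, 'k) kchain" where
 "QQ H = ext (\<lambda>l. if l = [] then 0 else sg1 (push H l))"

lemma bq_push:
 assumes "length l = Suc p" "1 \<le> p"
 shows "bq p (push H l) = QQ H (bd l)"
proof -
 have "del_at j l ~= []" if "j < length l" for j using that assms by (auto simp: del_at_def)
 then have "QQ H (bd l) = (\<Sum>j<Suc p. sngl (push H (del_at j l)) ((-1) ^ j))"
  unfolding bd_formula QQ_def ext_sum ext_single using assms(1) by (intro sum.cong) auto
 also have "\<dots> = (\<Sum>j<Suc p. sngl (singular_face p j (push H l)) ((-1) ^ j))"
  by (intro sum.cong refl) (simp add: singular_face_push[OF assms])
 finally show ?thesis unfolding bq_def lessThan_Suc_atMost ..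
qed

lemma bdry_QQ:
 assumes "\<And>l. l \<in> kys c ==> length l = Suc p"
 shows "bdry (int p) (QQ H c) = QQ H (ext bd c)"
proof (cases "p = 0")
 case True
 have "QQ H (ext bd c) = 0"
 proof -
  have "QQ H (bd l) = 0" if "l \<in> kys c" for l
  proof -
   have "length l = Suc 0" using assms[OF that] True by simp
   then obtain v where "l = [v]" by (cases l) auto
   then show ?thesis by (simp add: QQ_def cone_simps)
  qed
  then have "ext (\<lambda>l. QQ H (bd l)) c = ext (\<lambda>l. 0) c" by (intro ext_cong) auto
  then show ?thesis by (simp add: QQ_def ext_ext) (simp add: ext_def)
 qed
 then show ?thesis by (simp add: bdry_eq True)
next
 case False
 have "ext (bq p) (QQ H c) = ext (\<lambda>l. QQ H (bd l)) c"
  unfolding QQ_def ext_ext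
 proof (rule ext_cong)
  fix l assume "l \<in> kys c"
  then have l: "length l = Suc p" by (rule assms)
  then have ne: "l ~= []" by auto
  have "1 \<le> p" using False by simp
  from bq_push[OF l this, of H] show "ext (bq p) (if l = [] then 0 else sg1 (push H l)) = ext (\<lambda>l. if l = [] then 0 else sg1 (push H l)) (bd l)"
   using ne by (simp add: QQ_def)
 qed
 then show ?thesis using False by (simp add: bdry_eq) (simp add: QQ_def ext_ext)
qed

definition ep :: "nat => nat => real" where "ep i = (\<lambda>j. if j = i then 1 else 0)"
definition EE :: "nat => (nat => real) list" where "EE p = map ep [0..<Suc p]"

lemma length_EE [simp]: "length (EE p) = Suc p" by (simp add: EE_def)
lemma nth_EE [simp]: "i \<le> p ==> EE p ! i = ep i" by (simp add: EE_def del: upt_Suc)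
lemma ep_in: "i \<le> p ==> ep i \<in> standard_simplex p"
 by (auto simp: ep_def standard_simplex_def)
lemma set_EE: "set (EE p) \<subseteq> standard_simplex p" by (auto simp: EE_def ep_in simp del: upt_Suc)

lemma face_ep: "simplical_face j (ep i) = ep (if i < j then i else Suc i)"
 by (auto simp: simplical_face_def ep_def fun_eq_iff)

lemma del_at_EE: assumes "1 \<le> p" "j \<le> p" shows "del_at j (EE p) = map (simplical_face j) (EE (p - 1))"
proof (rule nth_equalityI)
 show "length (del_at j (EE p)) = length (map (simplical_face j) (EE (p - 1)))" using assms by (simp add: del_at_def)
 fix i assume "i < length (del_at j (EE p))"
 then have "i < p" using assms by (simp add: del_at_def)
 then show "del_at j (EE p) ! i = map (simplical_face j) (EE (p - 1)) ! i"
  using assms by (auto simp: del_at_def nth_append face_ep)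
qed

lemma comb_EE: "s \<in> standard_simplex p ==> comb (EE p) s = s"
proof
 fix i assume s: "s \<in> standard_simplex p"
 have "comb (EE p) s i = (\<Sum>j<Suc p. if j = i then s i else 0)"
  unfolding comb_def length_EE by (rule sum.cong) (auto simp: ep_def)
 also have "\<dots> = s i" using s by (auto simp: standard_simplex_def)
 finally show "comb (EE p) s i = s i" .
qed

text \<open>A point of the prism over a simplex is a sequence whose entry 0 is the time and whose
  tail is a point of the simplex: \<open>lo\<close> and \<open>hi\<close> are the two ends, and
  \<open>ff k\<close> is the k-th face inclusion at constant time.\<close>

definition lo :: "(nat => real) => nat => real" where "lo s = case_nat 0 s"
definition hi :: "(nat => real) => nat => real" where "hi s = case_nat 1 s"
definition ff :: "nat => (nat => real) => nat => real" where "ff k z = case_nat (z 0) (simplical_face k (z \<circ> Suc))"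

lemma comb_lo: "comb (map lo l) s = lo (comb l s)"
 by (auto simp: comb_def lo_def fun_eq_iff split: nat.split)
lemma comb_hi: "(\<Sum>j<length l. s j) = 1 ==> comb (map hi l) s = hi (comb l s)"
 by (auto simp: comb_def hi_def fun_eq_iff split: nat.split)
lemma comb_ff: "comb (map (ff k) l) s = ff k (comb l s)"
 by (auto simp: comb_def ff_def fun_eq_iff simplical_face_def split: nat.split)

lemma lo_hi_ff: "lo (simplical_face k s) = ff k (lo s)" "hi (simplical_face k s) = ff k (hi s)"
 by (auto simp: lo_def hi_def ff_def fun_eq_iff o_def split: nat.split)

definition Wc :: "nat => (nat => real) set" where
 "Wc p = {z. 0 \<le> z 0 \<and> z 0 \<le> 1 \<and> z \<circ> Suc \<in> standard_simplex p}"

lemma comb_in_standard_simplex: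
 assumes l: "set l \<subseteq> standard_simplex p" "length l = Suc q" and s: "s \<in> standard_simplex q"
 shows "comb l s \<in> standard_simplex p"
proof -
 have s: "0 \<le> s j" "s j \<le> 1" "(\<Sum>j<Suc q. s j) = 1" for j using s by (auto simp: standard_simplex_def lessThan_Suc_atMost)
 have l': "l ! j \<in> standard_simplex p" if "j < Suc q" for j using l that by (metis nth_mem subsetD)
 have 0: "0 \<le> comb l s i" for i unfolding comb_def l(2)
  by (rule sum_nonneg) (use s(1) l' in \<open>auto simp: standard_simplex_def\<close>)
 have le: "comb l s i \<le> 1" for i
 proof -
  have "comb l s i \<le> (\<Sum>j<Suc q. s j * 1)" unfolding comb_def l(2)
   by (intro sum_mono mult_left_mono) (use s(1) l' in \<open>auto simp: standard_simplex_def\<close>)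
  then show ?thesis using s(3) by simp
 qed
 have z: "comb l s i = 0" if "p < i" for i unfolding comb_def l(2)
  by (rule sum.neutral) (use l' that in \<open>auto simp: standard_simplex_def\<close>)
 have "(\<Sum>i\<le>p. comb l s i) = (\<Sum>j<Suc q. s j * (\<Sum>i\<le>p. (l ! j) i))"
  unfolding comb_def l(2) by (subst sum.swap) (simp add: sum_distrib_left)
 also have "\<dots> = (\<Sum>j<Suc q. s j * 1)"
  by (intro sum.cong refl arg_cong2[where f = "(*)"]) (use l' in \<open>auto simp: standard_simplex_def\<close>)
 finally have "(\<Sum>i\<le>p. comb l s i) = 1" using s(3) by simp
 then show ?thesis using 0 le z by (auto simp: standard_simplex_def)
qed

lemma comb_in_Wc:
 assumes l: "set l \<subseteq> Wc p" "length l = Suc q" and s: "s \<in> standard_simplex q"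
 shows "comb l s \<in> Wc p"
proof -
 have eq: "comb l s \<circ> Suc = comb (map (\<lambda>z. z \<circ> Suc) l) s" by (auto simp: comb_def fun_eq_iff)
 have 1: "comb l s \<circ> Suc \<in> standard_simplex p" unfolding eq
  by (rule comb_in_standard_simplex[OF _ _ s]) (use l in \<open>auto simp: Wc_def\<close>)
 have s': "0 \<le> s j" "(\<Sum>j<Suc q. s j) = 1" for j using s by (auto simp: standard_simplex_def lessThan_Suc_atMost)
 have l': "l ! j \<in> Wc p" if "j < Suc q" for j using l that by (metis nth_mem subsetD)
 have "0 \<le> comb l s 0" unfolding comb_def l(2) by (rule sum_nonneg) (use s'(1) l' in \<open>auto simp: Wc_def\<close>)
 moreover have "comb l s 0 \<le> (\<Sum>j<Suc q. s j * 1)" unfolding comb_def l(2)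
  by (intro sum_mono mult_left_mono) (use s'(1) l' in \<open>auto simp: Wc_def\<close>)
 ultimately show ?thesis using 1 s'(2) by (simp add: Wc_def)
qed

lemma continuous_on_comb: "continuous_on S (comb l)"
 by (rule continuous_on_coordinatewise_then_product)
  (auto simp: comb_def intro!: continuous_intros continuous_on_product_coordinates[THEN continuous_on_subset])

lemma push_simplex:
 fixes H :: "(nat => real) => 'a::topological_space"
 assumes l: "set l \<subseteq> Wc p" "length l = Suc q" and H: "continuous_on (Wc p) H" "H ` Wc p \<subseteq> X"
 shows "singular_simplex q (top_of_set X) (push H l)"
 unfolding singular_simplex_iff
proof (intro conjI)
 have c: "continuous_on (standard_simplex q) (\<lambda>s. H (comb l s))"
  by (rule continuous_on_compose2[OF H(1) continuous_on_comb]) (use comb_in_Wc[OF l] in auto)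
 then show "continuous_on (standard_simplex q) (push H l)"
  by (rule continuous_on_eq) (simp add: push_def l(2))
 show "push H l ` standard_simplex q \<subseteq> X" using comb_in_Wc[OF l] H(2) by (auto simp: push_def l(2))
qed (simp add: push_def l(2))

section \<open>Ordered lists and oriented simplicial chains\<close>

text \<open>The oriented chain of a list as an iterated exterior product, hence zero on lists with a
  repeated vertex.\<close>

primrec alt :: "'v list => 'v list => 'v set => 'k::field" where
 "alt vs [] = (\<lambda>G. if G = {} then 1 else 0)"
| "alt vs (v # l) = wd vs v (alt vs l)"

definition AA :: "'v list => ('v list \<Rightarrow>\<^sub>0 'k::field) => 'v set => 'k" where
 "AA vs d G = (\<Sum>l\<in>kys d. lk d l * alt vs l G)"

definition srt :: "'v list => 'v set => 'v list" where "srt vs G = filter (\<lambda>v. v \<in> G) vs"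

text \<open>Embeds oriented chains by listing each face in the order of \<open>vs\<close>.
  Antisymmetrization by \<open>AA\<close> undoes this exactly (\<open>alt_srt\<close>); the other
  composition is only homotopic to the identity (\<open>dh_boundary\<close>).\<close>

definition BB :: "'v list => ('v set => 'k::field) => 'v list \<Rightarrow>\<^sub>0 'k" where
 "BB vs f = (\<Sum>G\<in>Pow (set vs). sngl (srt vs G) (f G))"

definition altp :: "'v list => 'v list => 'v set \<Rightarrow>\<^sub>0 'k::field" where
 "altp vs l = sngl (set l) (alt vs l (set l))"

lemma alt_supp: "alt vs l G ~= (0::'k::field) ==> G = set l \<and> card G = length l"
proof (induction l arbitrary: G)
 case (Cons v l)
 then have "v \<in> G" "alt vs l (G - {v}) ~= (0::'k)" by (auto simp: wd_def split: if_splits)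
 with Cons.IH[OF this(2)] show ?case by (metis List.finite_set card_Suc_Diff1 finite_Diff2 finite.emptyI finite_insert insert_Diff length_Cons list.simps(15))
qed (auto split: if_splits)

lemma lookup_altp: "lk (altp vs l) G = alt vs l G"
 using alt_supp[of vs l G] by (auto simp: altp_def lookup_single when_def)

lemma AA_altp: "AA vs d G = lk (ext (altp vs) d) G"
 by (simp add: AA_def lookup_ext[OF finite_keys subset_refl] lookup_altp)

lemma AA_simps:
 "AA vs (c + d) G = AA vs c G + AA vs d G" "AA vs (c - d) G = AA vs c G - AA vs d G"
 "AA vs (sc a d) G = a * AA vs d G" "AA vs (sngl l a) G = a * alt vs l G" "AA vs 0 G = 0" "AA vs (- d) G = - AA vs d G"
 by (simp_all add: AA_altp ext_add ext_diff ext_sc ext_uminus lookup_add lookup_minus lookup_altp)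

lemma AA_ext: "AA vs (ext h d) G = (\<Sum>x\<in>kys d. lk d x * AA vs (h x) G)"
 unfolding AA_altp ext_ext by (simp add: lookup_ext[OF finite_keys subset_refl])

lemma AA_nonzero: "AA vs d G ~= (0::'k::field) ==> \<exists>l\<in>kys d. G = set l \<and> card G = length l"
proof -
 assume "AA vs d G ~= 0"
 then obtain l where "l \<in> kys d" "lk d l * alt vs l G ~= 0" unfolding AA_def by (meson sum.neutral)
 then show ?thesis using alt_supp[of vs l G] by auto
qed

lemma AA_cone: "AA vs (cone v d) G = wd vs v (AA vs d) G"
proof -
 have "wd vs v (AA vs d) G = (\<Sum>l\<in>kys d. lk d l * wd vs v (alt vs l) G)"
  by (simp add: wd_def AA_def sum_distrib_left mult.left_commute)
 then show ?thesis by (simp add: cone_def AA_ext AA_simps)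
qed

lemma bnd_AA:
 fixes d :: "'v list \<Rightarrow>\<^sub>0 'k::field"
 shows "bnd vs (AA vs d) G = (\<Sum>l\<in>kys d. lk d l * bnd vs (alt vs l) G)"
proof -
 have "ct vs v (AA vs d) G = (\<Sum>l\<in>kys d. lk d l * ct vs v (alt vs l) G)" for v
  by (simp add: ct_def AA_def sum_distrib_left mult.left_commute)
 then have "bnd vs (AA vs d) G = (\<Sum>v\<in>set vs. \<Sum>l\<in>kys d. lk d l * ct vs v (alt vs l) G)" by (simp add: bnd_def)
 then show ?thesis by (simp add: bnd_def sum_distrib_left) (rule sum.swap)
qed

lemma bnd_alt:
 assumes "distinct vs" "set l \<subseteq> set vs"
 shows "bnd vs (alt vs l) G = (AA vs (bd l) G :: 'k::field)"
 using assms(2)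
proof (induction l arbitrary: G)
 case Nil
 have "ct vs v (alt vs []) G = (0::'k)" for v by (simp add: ct_def)
 then show ?case by (simp add: bnd_def AA_simps del: alt.simps)
next
 case (Cons v l)
 have "bnd vs (wd vs v (alt vs l)) G + wd vs v (bnd vs (alt vs l)) G = (alt vs l G :: 'k)"
  by (rule bnd_wd) (use assms Cons.prems in auto)
 moreover have "wd vs v (bnd vs (alt vs l)) G = (wd vs v (AA vs (bd l)) G :: 'k)"
  using Cons by (simp add: wd_def)
 ultimately have "bnd vs (wd vs v (alt vs l)) G = (alt vs l G :: 'k) - wd vs v (AA vs (bd l)) G" by (metis add_diff_cancel_right')
 then show ?case by (simp add: AA_simps AA_cone)
qed

lemma bnd_AA_bd:
 assumes "distinct vs" "\<And>l. l \<in> kys d ==> set l \<subseteq> set vs"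
 shows "bnd vs (AA vs d) G = (AA vs (ext bd d) G :: 'k::field)"
 unfolding bnd_AA AA_ext by (rule sum.cong) (simp_all add: bnd_alt assms)

lemma srt_set: "G \<subseteq> set vs ==> set (srt vs G) = G" by (auto simp: srt_def)
lemma length_srt: "distinct vs ==> G \<subseteq> set vs ==> length (srt vs G) = card G"
 using distinct_card[of "srt vs G"] srt_set[of G vs] by (simp add: srt_def)

text \<open>Generalized over a prefix of the vertex list, since signs are always taken in the whole
  list; the prefix has no vertex in G and does not affect the sign.\<close>

lemma alt_srt_aux: "distinct (pre @ l) ==> G \<subseteq> set l ==> alt (pre @ l) (srt l G) G = (1::'k::field)"
proof (induction l arbitrary: pre G)
 case (Cons v l)
 show ?case
 proof (cases "v \<in> G")
  case True
  have s: "set pre \<inter> G = {} ==> sg (pre @ v # l) v G = (1::'k)"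
   using Cons.prems(1) by (induction pre) auto
  have e: "srt l G = srt l (G - {v})" using Cons.prems(1) by (auto simp: srt_def intro!: filter_cong)
  have "alt ((pre @ [v]) @ l) (srt l (G - {v})) (G - {v}) = (1::'k)" by (rule Cons.IH) (use Cons.prems in auto)
  moreover have "set pre \<inter> G = {}" using Cons.prems by auto
  ultimately show ?thesis using True s e by (simp add: wd_def) (simp add: srt_def wd_def)
 next
  case False
  have "alt ((pre @ [v]) @ l) (srt l G) G = (1::'k)" by (rule Cons.IH) (use Cons.prems False in auto)
  then show ?thesis using False by (simp add: srt_def)
 qed
qed (simp add: srt_def)

lemma alt_srt: "distinct vs ==> G \<subseteq> set vs ==> alt vs (srt vs G) H = (if H = G then 1 else (0::'k::field))"
 using alt_srt_aux[of "[]" vs G, where 'k='k] alt_supp[of vs "srt vs G" H, where 'k='k] srt_set[of G vs] by auto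

lemma AA_sum: "AA vs (sum h I) G = (\<Sum>i\<in>I. AA vs (h i) G)"
 unfolding AA_altp ext_sum lookup_sum ..

lemma BB_simps:
 "BB vs (\<lambda>G. f G + g G) = BB vs f + BB vs g" "BB vs (\<lambda>G. f G - g G) = BB vs f - BB vs g" "BB vs (\<lambda>G. a * f G) = sc a (BB vs f)" "BB vs (\<lambda>G. 0) = 0"
 by (simp_all add: BB_def single_add single_diff sum.distrib sum_subtractf sc_sum)

lemma BB_cong: "(\<And>G. f G = g G) ==> BB vs f = BB vs g" by (simp add: BB_def)

lemma BB_AA: "BB vs (AA vs d) = ext (\<lambda>l. BB vs (alt vs l)) d"
proof -
 have "BB vs (AA vs d) = (\<Sum>G\<in>Pow (set vs). \<Sum>l\<in>kys d. sngl (srt vs G) (lk d l * alt vs l G))"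
  unfolding BB_def AA_def by (intro sum.cong refl) (rule additive_sum[of "sngl _"], simp_all add: single_add)
 then show ?thesis by (simp add: ext_def BB_def sc_sum) (rule sum.swap)
qed

lemma keys_BB: "l \<in> kys (BB vs f) ==> \<exists>G\<subseteq>set vs. f G ~= 0 \<and> l = srt vs G"
proof -
 assume "l \<in> kys (BB vs f)"
 from subsetD[OF keys_sum this[unfolded BB_def]]
 obtain G where "G \<subseteq> set vs" "l \<in> kys (sngl (srt vs G) (f G))" by blast
 then show ?thesis by (auto split: if_splits)
qed

lemma bd_filter:
 assumes "distinct l"
 shows "bd (srt l G) = (\<Sum>w\<in>G \<inter> set l. sngl (srt l (G - {w})) (sg l w G) :: 'v list \<Rightarrow>\<^sub>0 'k::field)"
 using assms
proof (induction l)
 case (Cons v l)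
 have ne: "\<And>w. w \<in> G \<inter> set l ==> v ~= w" using Cons.prems by auto
 show ?case
 proof (cases "v \<in> G")
  case True
  have e: "srt l (G - {v}) = srt l G" using Cons.prems by (auto simp: srt_def intro!: filter_cong)
  have IH: "bd (srt l G) = (\<Sum>w\<in>G \<inter> set l. sngl (srt l (G - {w})) (sg l w G) :: 'v list \<Rightarrow>\<^sub>0 'k)" using Cons by simp
  have i: "G \<inter> set (v # l) = insert v (G \<inter> set l)" "v \<notin> G \<inter> set l" using True Cons.prems by auto
  have s: "srt (v # l) (G - {v}) = srt l G" using e by (simp add: srt_def)
  have "cone v (bd (srt l G)) = (\<Sum>w\<in>G \<inter> set l. sngl (v # srt l (G - {w})) (sg l w G) :: 'v list \<Rightarrow>\<^sub>0 'k)"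
   unfolding IH cone_def ext_sum by simp
  also have "\<dots> = (\<Sum>w\<in>G \<inter> set l. - sngl (srt (v # l) (G - {w})) (sg (v # l) w G))"
   by (rule sum.cong) (use ne True in \<open>auto simp: srt_def single_uminus\<close>)
  finally have "cone v (bd (srt l G)) = - (\<Sum>w\<in>G \<inter> set l. sngl (srt (v # l) (G - {w})) (sg (v # l) w G) :: 'v list \<Rightarrow>\<^sub>0 'k)"
   by (simp add: sum_negf)
  moreover have "srt (v # l) G = v # srt l G" using True by (simp add: srt_def)
  ultimately show ?thesis unfolding i(1) using i(2) s by simp
 next
  case False
  have "srt (v # l) (G - X) = srt l (G - X)" for X using False by (simp add: srt_def)
  moreover have "srt (v # l) G = srt l G" using False by (simp add: srt_def)
  moreover have "G \<inter> set (v # l) = G \<inter> set l" using False by auto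
  moreover have "(\<Sum>w\<in>G \<inter> set l. sngl (srt l (G - {w})) (sg (v # l) w G)) = (\<Sum>w\<in>G \<inter> set l. sngl (srt l (G - {w})) (sg l w G) :: 'v list \<Rightarrow>\<^sub>0 'k)"
   by (rule sum.cong) (use ne False in auto)
  ultimately show ?thesis using Cons by simp
 qed
qed (simp add: srt_def)

lemma BB_bnd:
 fixes f :: "'v set => 'k::field"
 assumes "distinct vs"
 shows "BB vs (bnd vs f) = ext bd (BB vs f)"
proof -
 have s: "sngl l (sum h I) = (\<Sum>i\<in>I. sngl l (h i))" for l :: "'v list" and h :: "'v => 'k" and I
  by (rule additive_sum) (simp_all add: single_add)
 have "BB vs (bnd vs f) = (\<Sum>G\<in>Pow (set vs). \<Sum>w\<in>set vs. if w \<notin> G then sngl (srt vs G) (sg vs w (insert w G) * f (insert w G)) else 0)"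
  unfolding BB_def bnd_def s by (intro sum.cong refl) (simp add: ct_def)
 also have "\<dots> = (\<Sum>(G,w)\<in>(SIGMA G:Pow (set vs). set vs). if w \<notin> G then sngl (srt vs G) (sg vs w (insert w G) * f (insert w G)) else 0)"
  by (rule sum.Sigma) auto
 also have "\<dots> = (\<Sum>(G,w)\<in>(SIGMA G:Pow (set vs). set vs - G). sngl (srt vs G) (sg vs w (insert w G) * f (insert w G)))"
  by (rule sum.mono_neutral_cong_right) (auto intro: finite_subset)
 also have "\<dots> = (\<Sum>(G,w)\<in>(SIGMA G:Pow (set vs). G). sngl (srt vs (G - {w})) (f G * sg vs w G))"
  by (rule sum.reindex_bij_witness[of _ "\<lambda>(G,w). (G - {w}, w)" "\<lambda>(G,w). (insert w G, w)"]) (auto simp: insert_absorb mult.commute)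
 also have "\<dots> = (\<Sum>G\<in>Pow (set vs). \<Sum>w\<in>G. sngl (srt vs (G - {w})) (f G * sg vs w G))"
  by (rule sum.Sigma[symmetric]) (auto intro: finite_subset)
 also have "\<dots> = (\<Sum>G\<in>Pow (set vs). sc (f G) (bd (srt vs G)))"
  by (intro sum.cong refl) (simp add: bd_filter assms sc_sum Int_absorb2)
 also have "\<dots> = ext bd (BB vs f)" by (simp add: BB_def ext_sum)
 finally show ?thesis .
qed

section \<open>Ordered versus oriented chains\<close>

text \<open>The homotopy from the identity to antisymmetrization followed by sorting, built by coning from the first vertex.\<close>

primrec dh :: "'v list => nat => 'v list => 'v list \<Rightarrow>\<^sub>0 'k::field" where
 "dh vs 0 l = 0"
| "dh vs (Suc p) l = cone (hd l) (sg1 l - BB vs (alt vs l) - ext (dh vs p) (bd l))"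

lemma keys_BB_alt: "set l \<subseteq> set vs ==> distinct vs ==> m \<in> kys (BB vs (alt vs l) :: 'v list \<Rightarrow>\<^sub>0 'k::field) ==> set m = set l \<and> length m = length l"
 using keys_BB[of m vs "alt vs l :: 'v set => 'k"] alt_supp[of vs l _, where 'k='k] srt_set[of _ vs] length_srt[of vs] by fastforce

lemma keys_dh:
 assumes "distinct vs"
 shows "set l \<subseteq> set vs ==> length l = n ==> m \<in> kys (dh vs n l :: 'v list \<Rightarrow>\<^sub>0 'k::field) ==> set m \<subseteq> set l \<and> length m = Suc n"
proof (induction n arbitrary: l m)
 case (Suc n)
 let ?a = "sg1 l - BB vs (alt vs l) - ext (dh vs n) (bd l) :: 'v list \<Rightarrow>\<^sub>0 'k"
 obtain l' where l': "l' \<in> kys ?a" "m = hd l # l'" using keys_cone[of m "hd l" ?a] Suc.prems(3) by auto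
 have hd: "hd l \<in> set l" using Suc.prems(2) by (cases l) auto
 from l'(1) consider "l' = l" | "l' \<in> kys (BB vs (alt vs l) :: 'v list \<Rightarrow>\<^sub>0 'k)" | "l' \<in> kys (ext (dh vs n) (bd l) :: 'v list \<Rightarrow>\<^sub>0 'k)"
  by (auto dest!: keys_diff' split: if_splits)
 then show ?case
 proof cases
  case 1 then show ?thesis using l'(2) hd Suc.prems by auto
 next
  case 2 then show ?thesis using keys_BB_alt[OF Suc.prems(1) assms 2] l'(2) hd Suc.prems by auto
 next
  case 3
  then obtain k where k: "k \<in> kys (bd l :: 'v list \<Rightarrow>\<^sub>0 'k)" "l' \<in> kys (dh vs n k :: 'v list \<Rightarrow>\<^sub>0 'k)" using subsetD[OF keys_ext 3] by auto
  have k': "set k \<subseteq> set l" "length k = n" using keys_bd[OF k(1)] Suc.prems by auto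
  have "set l' \<subseteq> set k \<and> length l' = Suc n" by (rule Suc.IH[OF _ k'(2) k(2)]) (use k' Suc.prems in auto)
  then show ?thesis using l'(2) hd k' by auto
 qed
qed simp

text \<open>The method of acyclic models: the chain u to be bounded uses only vertices of l and is a
  cycle by the induction hypothesis, so coning from any vertex of l inverts the boundary on
  it.\<close>

lemma dh_boundary:
 assumes "distinct vs"
 shows "set l \<subseteq> set vs ==> length l = n ==> ext bd (dh vs n l) + ext (dh vs (n - 1)) (bd l) = sg1 l - (BB vs (alt vs l) :: 'v list \<Rightarrow>\<^sub>0 'k::field)"
proof (induction n arbitrary: l)
 case 0
 have "alt vs l G = (if G = {} then 1 else 0 :: 'k)" for G using 0 by simp
 then have "BB vs (alt vs l) = (\<Sum>G\<in>Pow (set vs). if G = {} then sngl (srt vs {}) 1 else 0 :: 'v list \<Rightarrow>\<^sub>0 'k)"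
  unfolding BB_def by (intro sum.cong) auto
 then show ?case using 0 by (simp add: srt_def)
next
 case (Suc n)
 let ?B = "\<lambda>l. BB vs (alt vs l) :: 'v list \<Rightarrow>\<^sub>0 'k"
 define u where "u = sg1 l - ?B l - ext (dh vs n) (bd l)"
 have B: "ext bd (?B l) = ext ?B (bd l)"
 proof -
  have "ext bd (?B l) = BB vs (bnd vs (alt vs l))" by (simp add: BB_bnd assms)
  also have "\<dots> = BB vs (AA vs (bd l))" by (rule BB_cong) (rule bnd_alt[OF assms Suc.prems(1)])
  finally show ?thesis by (simp add: BB_AA)
 qed
 have kb: "set k \<subseteq> set vs \<and> length k = n" if "k \<in> kys (bd l :: 'v list \<Rightarrow>\<^sub>0 'k)" for k
  using keys_bd[OF that] Suc.prems by auto
 have "ext bd (ext (dh vs n) (bd l)) = ext (\<lambda>k. sg1 k - ?B k - ext (dh vs (n - 1)) (bd k)) (bd l)"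
  unfolding ext_ext
 proof (rule ext_cong)
  fix k assume "k \<in> kys (bd l :: 'v list \<Rightarrow>\<^sub>0 'k)"
  with kb Suc.IH[of k] show "ext bd (dh vs n k) = sg1 k - ?B k - ext (dh vs (n - 1)) (bd k)" by (metis add_diff_cancel_right')
 qed
 also have "\<dots> = bd l - ext ?B (bd l) - ext (dh vs (n - 1)) (ext bd (bd l))"
  by (simp add: ext_fun_diff ext_id ext_ext)
 finally have z: "ext bd u = 0" by (simp add: u_def ext_diff BD_bd B)
 have "ext bd (dh vs (Suc n) l) = u" by (simp add: BD_cone u_def[symmetric] z cone_simps)
 then show ?case by (simp add: u_def)
qed

section \<open>Iterated subdivision with field coefficients\<close>

text \<open>Change of coefficients from the integers to the field. Subdivision and its chain
  homotopy are taken from the integral theory on single simplices and extended linearly.\<close>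

definition iot :: "('x \<Rightarrow>\<^sub>0 int) => ('x \<Rightarrow>\<^sub>0 'k::field)" where "iot c = Poly_Mapping.map of_int c"

lemma lookup_iot [simp]: "lk (iot c) x = of_int (lk c x)"
 by (simp add: iot_def Poly_Mapping.map.rep_eq when_def)

lemma iot_simps: "iot 0 = 0" "iot (a - b) = iot a - iot b" "iot (a + b) = iot a + iot b" "iot (frag_of x) = sg1 x"
  "iot (frag_cmul z a) = sc (of_int z) (iot a)"
 by (rule poly_mapping_eqI, simp add: lookup_minus lookup_add lookup_single when_def)+

lemma iot_sum: "iot (\<Sum>i\<in>I. f i) = (\<Sum>i\<in>I. iot (f i))"
 by (rule additive_sum) (simp_all add: iot_simps)

lemma keys_iot: "kys (iot c) \<subseteq> kys c"
 by (auto simp: in_keys_iff)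

lemma iot_additive:
 assumes "S 0 = 0" "\<And>a b. S (a - b) = S a - S b"
 shows "(iot (S a) :: 'y \<Rightarrow>\<^sub>0 'k::field) = ext (\<lambda>f. iot (S (frag_of f))) (iot a)"
 using subset_UNIV[of "kys a"]
 by (induction a rule: frag_induction) (simp_all add: assms iot_simps ext_diff)

abbreviation SS :: "nat => 'a::topological_space set => ((nat => real) => 'a) set" where
 "SS p X \<equiv> {f. singular_simplex p (top_of_set X) f}"

definition bk :: "nat => ('a, 'k::field) kchain => ('a, 'k) kchain" where
 "bk p c = (if p = 0 then 0 else ext (bq p) c)"

lemma bdry_bk: "bdry (int p) c = bk p c" by (simp add: bdry_eq bk_def)
lemma bk_simps: "bk p 0 = 0" "bk p (c + d) = bk p c + bk p d" "bk p (c - d) = bk p c - bk p d" "bk p (- c) = - bk p c"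
 by (simp_all add: bk_def ext_add ext_diff ext_uminus)

lemma chains_SS: "chains (int p) X = {c. kys c \<subseteq> SS p X}" by (auto simp: chains_def)
lemma chains_neg: "n < 0 ==> chains n X = {0}" by (auto simp: chains_def)

lemma iot_boundary:
 assumes "1 \<le> p" shows "(iot (chain_boundary p a) :: ('a, 'k::field) kchain) = ext (bq p) (iot a)"
proof -
 have "(iot (chain_boundary p (frag_of f)) :: ('a, 'k) kchain) = bq p f" for f
  using assms by (simp add: chain_boundary_of iot_sum iot_simps bq_def)
 then show ?thesis using iot_additive[of "chain_boundary p" a, where 'k='k] by (simp add: chain_boundary_diff)
qed

definition sdk :: "nat => nat => ((nat => real) => 'a::topological_space) => ('a, 'k::field) kchain" where
 "sdk N p f = iot ((singular_subdivision p ^^ N) (frag_of f))"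

lemma singular_chain_sd: "singular_chain p X c ==> singular_chain p X ((singular_subdivision p ^^ N) c)"
 by (induction N) (auto intro: singular_chain_singular_subdivision)

lemma boundary_sd: "singular_chain p X c ==> chain_boundary p ((singular_subdivision p ^^ N) c) = (singular_subdivision (p - Suc 0) ^^ N) (chain_boundary p c)"
proof (induction N)
 case (Suc N)
 then show ?case using chain_boundary_singular_subdivision[OF singular_chain_sd[OF Suc.prems, of N]] by simp
qed simp

lemma iot_sd: "(iot ((singular_subdivision p ^^ N) a) :: ('a::topological_space, 'k::field) kchain) = ext (sdk N p) (iot a)"
 using iot_additive[of "singular_subdivision p ^^ N" a, where 'k='k] by (simp add: singular_subdivision_power_diff sdk_def[abs_def])

lemma keys_sdk: "f \<in> SS p X ==> g \<in> kys (sdk N p f :: ('a::topological_space, 'k::field) kchain) ==> g \<in> SS p X"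
proof -
 assume f: "f \<in> SS p X" and g: "g \<in> kys (sdk N p f :: ('a, 'k) kchain)"
 have "singular_chain p (top_of_set X) ((singular_subdivision p ^^ N) (frag_of f))"
  by (rule singular_chain_sd) (use f in \<open>simp add: singular_chain_of\<close>)
 with g show ?thesis using keys_iot[of "(singular_subdivision p ^^ N) (frag_of f)"] unfolding sdk_def singular_chain_def by auto
qed

lemma bq_sdk:
 assumes "f \<in> SS p X" "1 \<le> p"
 shows "ext (bq p) (sdk N p f) = (ext (sdk N (p - 1)) (bq p f) :: ('a::topological_space, 'k::field) kchain)"
proof -
 have c: "singular_chain p (top_of_set X) (frag_of f)" using assms by (simp add: singular_chain_of)
 have "ext (bq p) (sdk N p f) = (iot (chain_boundary p ((singular_subdivision p ^^ N) (frag_of f))) :: ('a, 'k) kchain)"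
  unfolding sdk_def by (rule iot_boundary[OF assms(2), symmetric])
 also have "\<dots> = ext (sdk N (p - 1)) (iot (chain_boundary p (frag_of f)))"
  unfolding boundary_sd[OF c] iot_sd by simp
 finally show ?thesis by (simp add: iot_boundary[OF assms(2)] iot_simps)
qed

lemma sdk_0: "f \<in> SS 0 X ==> sdk N 0 f = sg1 f"
proof -
 assume "f \<in> SS 0 X"
 then have c: "singular_chain 0 (top_of_set X) (frag_of f)" by (simp add: singular_chain_of)
 have "(singular_subdivision 0 ^^ N) (frag_of f) = frag_of f"
  by (induction N) (auto simp: singular_subdivision_zero[OF c])
 then show ?thesis by (simp add: sdk_def iot_simps)
qed

lemma bk_sdk:
 assumes "kys c \<subseteq> SS p X"
 shows "bk p (ext (sdk N p) c) = (ext (sdk N (p - 1)) (bk p c) :: ('a::topological_space, 'k::field) kchain)"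
proof (cases "p = 0")
 case False
 have "ext (\<lambda>f. ext (bq p) (sdk N p f)) c = ext (\<lambda>f. ext (sdk N (p - 1)) (bq p f)) c"
  by (rule ext_cong, rule bq_sdk) (use assms False in auto)
 then show ?thesis using False by (simp add: bk_def ext_ext)
qed (simp add: bk_def)

lemma sdk_homotopy:
 obtains h :: "nat => ((nat => real) => 'a::topological_space) => ('a, 'k::field) kchain"
 where "\<And>p X f. f \<in> SS p X ==> kys (h p f) \<subseteq> SS (Suc p) X"
  "\<And>p X c. kys c \<subseteq> SS p X ==> bk (Suc p) (ext (h p) c) + ext (h (p - 1)) (bk p c) = ext (sdk N p) c - c"
proof -
 obtain h :: "nat => 'a chain => 'a chain" where h: "\<And>p. h p 0 = 0" "\<And>p c1 c2. h p (c1-c2) = h p c1 - h p c2"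
   "\<And>p X c. singular_chain p X c ==> singular_chain (Suc p) X (h p c)"
   "\<And>p X c. singular_chain p X c ==> chain_boundary (Suc p) (h p c) + h (p - Suc 0) (chain_boundary p c) = (singular_subdivision p ^^ N) c - c"
 proof (rule chain_homotopic_iterated_singular_subdivision[of N])
  fix h :: "nat => 'a chain => 'a chain"
  assume "\<And>p. h p 0 = 0" "\<And>p c1 c2. h p (c1-c2) = h p c1 - h p c2"
   "\<And>p X c. singular_chain p X c ==> singular_chain (Suc p) X (h p c)"
   "\<And>p X c. singular_chain p X c ==> chain_boundary (Suc p) (h p c) + h (p - Suc 0) (chain_boundary p c) = (singular_subdivision p ^^ N) c - c"
  then show thesis by (rule that[of h])
 qed
 define k where "k p f = (iot (h p (frag_of f)) :: ('a, 'k) kchain)" for p f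
 show thesis
 proof
  fix p and X :: "'a set" and f assume f: "f \<in> SS p X"
  have "singular_chain (Suc p) (top_of_set X) (h p (frag_of f))" by (rule h(3)) (use f in \<open>simp add: singular_chain_of\<close>)
  then show "kys (k p f) \<subseteq> SS (Suc p) X"
   using keys_iot[of "h p (frag_of f)"] by (auto simp: k_def singular_chain_def)
 next
  fix p and X :: "'a set" and c :: "('a, 'k) kchain" assume c: "kys c \<subseteq> SS p X"
  \<comment> \<open>In degree 0 the second term is dropped, since the boundary there is 0 and
    \<open>p - 1\<close> would be 0 again.\<close>
  have "ext (bq (Suc p)) (k p f) + (if p = 0 then 0 else ext (k (p - 1)) (bq p f)) = sdk N p f - sg1 f" if f: "f \<in> SS p X" for f
  proof -
   have sc: "singular_chain p (top_of_set X) (frag_of f)" using f by (simp add: singular_chain_of)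
   have "(iot (chain_boundary (Suc p) (h p (frag_of f)) + h (p - Suc 0) (chain_boundary p (frag_of f))) :: ('a, 'k) kchain) = sdk N p f - sg1 f"
    unfolding h(4)[OF sc] by (simp add: iot_simps sdk_def)
   moreover have "(iot (h (p - Suc 0) (chain_boundary p (frag_of f))) :: ('a, 'k) kchain) = (if p = 0 then 0 else ext (k (p - 1)) (bq p f))"
    using iot_additive[of "h (p - Suc 0)" "chain_boundary p (frag_of f)", OF h(1,2), folded k_def, where 'k='k]
     iot_boundary[of p "frag_of f", where 'k='k] h(1)
    by (cases "p = 0") (simp_all add: k_def[symmetric] iot_simps chain_boundary_def del: lookup_iot)
   ultimately show ?thesis by (simp add: iot_simps iot_boundary k_def)
  qed
  then have "ext (\<lambda>f. ext (bq (Suc p)) (k p f) + (if p = 0 then 0 else ext (k (p - 1)) (bq p f))) c = ext (\<lambda>f. sdk N p f - sg1 f) c"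
   using c by (intro ext_cong) auto
  then show "bk (Suc p) (ext (k p) c) + ext (k (p - 1)) (bk p c) = ext (sdk N p) c - c"
   by (cases "p = 0") (simp_all add: bk_def ext_ext ext_fun_add ext_fun_diff ext_id)
 qed
qed

definition sml :: "'v list => real => ('v => real) set => bool" where
 "sml vs e T \<longleftrightarrow> (\<forall>y\<in>T. \<forall>z\<in>T. \<forall>v\<in>set vs. \<bar>y v - z v\<bar> < e)"

lemma open_box: "open {y :: 'v => real. \<forall>v\<in>set vs. \<bar>y v - x v\<bar> < e}"
proof -
 have "open {y :: 'v => real. \<bar>y v - x v\<bar> < e}" for v
  by (intro open_Collect_less continuous_intros continuous_on_product_coordinates)
 moreover have "{y :: 'v => real. \<forall>v\<in>set vs. \<bar>y v - x v\<bar> < e} = (\<Inter>v\<in>set vs. {y. \<bar>y v - x v\<bar> < e})" by auto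
 ultimately show ?thesis by (simp add: open_INT)
qed

lemma small_subdivision:
 fixes X :: "('v => real) set"
 assumes F: "finite F" "F \<subseteq> SS p X" and e: "e > 0"
 shows "\<exists>N. \<forall>m\<ge>N. \<forall>f\<in>F. \<forall>g\<in>kys (sdk m p f :: ('v => real, 'k::field) kchain). sml vs e (g ` standard_simplex p)"
proof -
 \<comment> \<open>Boxes of half-width e / 2: two points of the same box differ by less than e in
   every coordinate of \<open>vs\<close>.\<close>
 let ?C = "(\<lambda>x. X \<inter> {y. \<forall>v\<in>set vs. \<bar>y v - x v\<bar> < e / 2}) ` X"
 have "\<exists>n. \<forall>m\<ge>n. \<forall>g\<in>kys (sdk m p f :: ('v => real, 'k) kchain). sml vs e (g ` standard_simplex p)" if f: "f \<in> F" for f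
 proof -
  have 1: "openin (top_of_set X) U" if "U \<in> ?C" for U using that openin_open_Int[OF open_box] by (elim imageE) (simp only:)
  have 2: "topspace (top_of_set X) \<subseteq> \<Union>?C" using e by auto
  have 3: "singular_chain p (top_of_set X) (frag_of f)" using f F by (auto simp: singular_chain_of)
  obtain n where n: "\<And>m f'. \<lbrakk>n \<le> m; f' \<in> kys ((singular_subdivision p ^^ m) (frag_of f))\<rbrakk> \<Longrightarrow> \<exists>V \<in> ?C. f' \<in> standard_simplex p \<rightarrow> V"
  proof (rule sufficient_iterated_singular_subdivision_exists[OF _ 2 3])
   fix n assume "\<And>m f'. \<lbrakk>n \<le> m; f' \<in> kys ((singular_subdivision p ^^ m) (frag_of f))\<rbrakk> \<Longrightarrow> \<exists>V \<in> ?C. f' \<in> standard_simplex p \<rightarrow> V"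
   then show thesis by (rule that)
  qed (rule 1)
  have "sml vs e (g ` standard_simplex p)" if m: "n \<le> m" and g: "g \<in> kys (sdk m p f :: ('v => real, 'k) kchain)" for m g
  proof -
   have "g \<in> kys ((singular_subdivision p ^^ m) (frag_of f))" using g keys_iot[of "(singular_subdivision p ^^ m) (frag_of f)"] unfolding sdk_def by auto
   from n[OF m this] obtain x where "g \<in> standard_simplex p \<rightarrow> X \<inter> {y. \<forall>v\<in>set vs. \<bar>y v - x v\<bar> < e / 2}" by (elim bexE imageE) (simp only:)
   then have "\<bar>g s v - x v\<bar> < e / 2" if "s \<in> standard_simplex p" "v \<in> set vs" for s v using that by auto
   then have "\<bar>g s v - g t v\<bar> < e" if "s \<in> standard_simplex p" "t \<in> standard_simplex p" "v \<in> set vs" for s t v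
    using that by (smt (verit) field_sum_of_halves)
   then show ?thesis by (auto simp: sml_def)
  qed
  then show ?thesis by blast
 qed
 then obtain n where n: "\<And>f m g. f \<in> F ==> n f \<le> m ==> g \<in> kys (sdk m p f :: ('v => real, 'k) kchain) ==> sml vs e (g ` standard_simplex p)" by metis
 have "n f \<le> Max (n ` F)" if "f \<in> F" for f using that F by simp
 then show ?thesis using n by (meson order_trans)
qed

section \<open>Realization of vertex lists and straight-line prisms\<close>

definition ev :: "'v => 'v => real" where "ev v = (\<lambda>w. if w = v then 1 else 0)"

definition lord :: "'v list => ('v => real, 'k::field) kchain" where
 "lord l = (if l = [] then 0 else sg1 (push id (map ev l)))"

text \<open>Simplicial approximation of one singular simplex: the vertices that \<phi> selects at
  its corners, possibly with repetitions, which ordered lists allow.\<close>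

definition tord :: "(('v => real) => 'v) => nat => ((nat => real) => 'v => real) => ('v list \<Rightarrow>\<^sub>0 'k::field)" where
 "tord \<phi> p f = sg1 (map (\<phi> \<circ> f) (EE p))"

text \<open>The straight-line homotopy, with time in entry 0, from f to the affine simplex on the
  vertices selected at the corners of f.\<close>

definition Hh :: "(('v => real) => 'v) => nat => ((nat => real) => 'v => real) => (nat => real) => 'v => real" where
 "Hh \<phi> p f z = (\<lambda>i. (1 - z 0) * f (z \<circ> Suc) i + z 0 * comb (map (ev \<circ> \<phi> \<circ> f) (EE p)) (z \<circ> Suc) i)"

definition Pr :: "(('v => real) => 'v) => nat => ((nat => real) => 'v => real) => ('v => real, 'k::field) kchain" where
 "Pr \<phi> p f = QQ (Hh \<phi> p f) (prism lo hi (EE p))"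

lemma lord_QQ: "ext lord d = QQ id (lmap ev d)"
 unfolding QQ_def lmap_def ext_ext by (rule ext_cong) (simp add: lord_def)

lemma bk_lord:
 assumes "\<And>l. l \<in> kys d ==> length l = Suc p"
 shows "bk p (ext lord d) = ext lord (ext bd d)"
proof -
 have "length l = Suc p" if "l \<in> kys (lmap ev d)" for l
  using subsetD[OF keys_ext that[unfolded lmap_def]] assms by auto
 then have "bdry (int p) (QQ id (lmap ev d)) = QQ id (ext bd (lmap ev d))" by (rule bdry_QQ)
 then show ?thesis by (simp add: lord_QQ bdry_bk lmap_BD)
qed

lemma bd_EE_formula: "bd (map g (EE p)) = (\<Sum>j\<le>p. sngl (map g (del_at j (EE p))) ((-1) ^ j) :: 'c list \<Rightarrow>\<^sub>0 'k::field)"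
 unfolding bd_formula by (simp add: lessThan_Suc_atMost del_at_def take_map drop_map)

lemma tord_boundary:
 assumes "1 \<le> p"
 shows "ext bd (tord \<phi> p f) = (ext (tord \<phi> (p - 1)) (bq p f) :: 'v list \<Rightarrow>\<^sub>0 'k::field)"
proof -
 have "map (\<phi> \<circ> f) (del_at j (EE p)) = map (\<phi> \<circ> singular_face p j f) (EE (p - 1))" if "j \<le> p" for j
 proof -
  have "singular_face p j f s = f (simplical_face j s)" if "s \<in> set (EE (p - 1))" for s
   using that set_EE by (auto simp: singular_face_def)
  then show ?thesis using del_at_EE[OF assms that] by simp
 qed
 then show ?thesis by (simp add: tord_def bd_EE_formula bq_def ext_sum)
qed

lemma QQ_diff: "QQ H (c - d) = QQ H c - QQ H d" by (simp add: QQ_def ext_diff)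

lemma lo_Wc: "s \<in> standard_simplex p ==> lo s \<in> Wc p" "s \<in> standard_simplex p ==> hi s \<in> Wc p"
 by (simp_all add: lo_def hi_def Wc_def o_def)

lemma keys_prism_EE: "m \<in> kys (prism lo hi (EE p) :: (nat => real) list \<Rightarrow>\<^sub>0 'k::field) ==> length m = Suc (Suc p) \<and> set m \<subseteq> Wc p"
proof -
 assume "m \<in> kys (prism lo hi (EE p) :: (nat => real) list \<Rightarrow>\<^sub>0 'k)"
 from keys_prism[OF this] have "length m = Suc (Suc p)" "set m \<subseteq> lo ` set (EE p) \<union> hi ` set (EE p)" by simp_all
 moreover have "lo ` set (EE p) \<union> hi ` set (EE p) \<subseteq> Wc p" using set_EE[of p] lo_Wc by blast
 ultimately show ?thesis by auto
qed

lemma QQ_cong: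
 assumes "\<And>l. l \<in> kys c ==> l ~= [] \<and> set l \<subseteq> Wc p" "\<And>z. z \<in> Wc p ==> H z = H' z"
 shows "QQ H c = QQ H' c"
 unfolding QQ_def
proof (rule ext_cong)
 fix l assume l: "l \<in> kys c"
 have "comb l s \<in> Wc p" if "s \<in> standard_simplex (length l - 1)" for s
  by (rule comb_in_Wc[OF _ _ that]) (use assms(1)[OF l] in auto)
 then have "push H l = push H' l" unfolding push_def using assms(2) by (intro restrict_ext) auto
 then show "(if l = [] then 0 else sg1 (push H l)) = (if l = [] then 0 else sg1 (push H' l))" by simp
qed

lemma QQ_ff: "QQ H (lmap (ff k) c) = QQ (H \<circ> ff k) c"
proof -
 have "push H (map (ff k) l) = push (H \<circ> ff k) l" for l by (simp add: push_def comb_ff)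
 then show ?thesis unfolding QQ_def lmap_def ext_ext by (intro ext_cong) simp
qed

text \<open>Corners of a face are corners of the simplex, so the homotopy of a face is the
  restriction of the homotopy. Hence the side walls of the prism are the prisms of the
  faces.\<close>

lemma Hh_ff:
 assumes "1 \<le> p" "j \<le> p" "z \<in> Wc (p - 1)"
 shows "Hh \<phi> p f (ff j z) = Hh \<phi> (p - 1) (singular_face p j f) z"
proof -
 have z: "z \<circ> Suc \<in> standard_simplex (p - 1)" using assms by (simp add: Wc_def)
 have ff: "ff j z \<circ> Suc = simplical_face j (z \<circ> Suc)" "ff j z 0 = z 0" by (auto simp: ff_def)
 have "map (ev \<circ> \<phi> \<circ> f) (del_at j (EE p)) = map (ev \<circ> \<phi> \<circ> singular_face p j f) (EE (p - 1))"
 proof -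
  have "singular_face p j f s = f (simplical_face j s)" if "s \<in> set (EE (p - 1))" for s
   using that set_EE by (auto simp: singular_face_def)
  then show ?thesis using del_at_EE[OF assms(1,2)] by simp
 qed
 moreover have "del_at j (map (ev \<circ> \<phi> \<circ> f) (EE p)) = map (ev \<circ> \<phi> \<circ> f) (del_at j (EE p))" by (simp add: del_at_def take_map drop_map)
 moreover have "comb (map (ev \<circ> \<phi> \<circ> f) (EE p)) (simplical_face j (z \<circ> Suc)) = comb (del_at j (map (ev \<circ> \<phi> \<circ> f) (EE p))) (z \<circ> Suc)"
  by (rule comb_face) (use assms z in auto)
 moreover have "singular_face p j f (z \<circ> Suc) = f (simplical_face j (z \<circ> Suc))" using z by (simp add: singular_face_def)
 ultimately show ?thesis by (simp add: Hh_def ff)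
qed

text \<open>The prism formula for the identity simplex \<open>EE p\<close>, pushed forward by the
  homotopy: the upper end is the affine simplex, the lower end is f, and the side walls are the
  prisms of the faces.\<close>

lemma Pr_boundary:
 fixes f :: "(nat => real) => 'v => real"
 assumes f: "f \<in> SS p X"
 shows "ext (bq (Suc p)) (Pr \<phi> p f) + (if p = 0 then 0 else ext (Pr \<phi> (p - 1)) (bq p f)) = (ext lord (tord \<phi> p f) - sg1 f :: ('v => real, 'k::field) kchain)"
proof -
 let ?H = "Hh \<phi> p f" and ?P = "prism lo hi :: _ => (nat => real) list \<Rightarrow>\<^sub>0 'k"
 have "bdry (int (Suc p)) (QQ ?H (?P (EE p))) = QQ ?H (ext bd (?P (EE p)))"
  by (rule bdry_QQ) (use keys_prism_EE in auto)
 then have "ext (bq (Suc p)) (Pr \<phi> p f) = QQ ?H (ext bd (?P (EE p)))" unfolding bdry_bk by (simp add: Pr_def bk_def)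
 moreover have "ext bd (?P (EE p)) = sg1 (map hi (EE p)) - sg1 (map lo (EE p)) - ext ?P (bd (EE p))"
  using prism_boundary[of lo hi "EE p", where 'k='k] by (metis add_diff_cancel_right')
 ultimately have 1: "ext (bq (Suc p)) (Pr \<phi> p f) = QQ ?H (sg1 (map hi (EE p))) - QQ ?H (sg1 (map lo (EE p))) - QQ ?H (ext ?P (bd (EE p)))"
  by (simp only: QQ_diff)
 have s1: "(\<Sum>j<Suc p. s j) = 1" if "s \<in> standard_simplex p" for s using that by (simp add: standard_simplex_def lessThan_Suc_atMost)
 have hi: "comb (map hi (EE p)) s = hi s" if "s \<in> standard_simplex p" for s
  using comb_hi[of s "EE p"] s1[OF that] comb_EE[OF that] by (simp del: sum.lessThan_Suc)
 have "push ?H (map hi (EE p)) = push id (map ev (map (\<phi> \<circ> f) (EE p)))"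
  unfolding push_def by (simp, intro restrict_ext) (simp add: hi, simp add: Hh_def hi_def o_def)
 then have 2: "QQ ?H (sg1 (map hi (EE p))) = (ext lord (tord \<phi> p f) :: ('v => real, 'k) kchain)"
  by (auto simp: QQ_def tord_def lord_def EE_def)
 have "push ?H (map lo (EE p)) = restrict f (standard_simplex p)"
  unfolding push_def by (simp, intro restrict_ext) (simp add: comb_lo comb_EE Hh_def lo_def o_def)
 then have 3: "QQ ?H (sg1 (map lo (EE p))) = (sg1 f :: ('v => real, 'k) kchain)"
  using f by (auto simp: QQ_def EE_def singular_simplex_iff extensional_restrict)
 have 4: "QQ ?H (ext ?P (bd (EE p))) = (if p = 0 then 0 else ext (Pr \<phi> (p - 1)) (bq p f))"
 proof (cases "p = 0")
  case True
  then show ?thesis by (simp add: EE_def QQ_def cone_simps)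
 next
  case False
  then have p: "1 \<le> p" by simp
  have "QQ ?H (?P (del_at j (EE p))) = Pr \<phi> (p - 1) (singular_face p j f)" if j: "j \<le> p" for j
  proof -
   have "?P (del_at j (EE p)) = lmap (ff j) (?P (EE (p - 1)))"
    unfolding del_at_EE[OF p j] by (rule prism_map) (simp_all add: lo_hi_ff)
   then have "QQ ?H (?P (del_at j (EE p))) = QQ (?H \<circ> ff j) (?P (EE (p - 1)))" by (simp add: QQ_ff)
   also have "\<dots> = QQ (Hh \<phi> (p - 1) (singular_face p j f)) (?P (EE (p - 1)))"
    by (rule QQ_cong[where p = "p - 1"]) (use keys_prism_EE Hh_ff[OF p j] in fastforce)+
   finally show ?thesis by (simp add: Pr_def)
  qed
  moreover have "QQ ?H (ext ?P (bd (EE p))) = (\<Sum>j\<le>p. sc ((-1) ^ j) (QQ ?H (?P (del_at j (EE p)))))"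
   using bd_EE_formula[of id p, where 'k='k] by (simp add: ext_sum QQ_def ext_sc)
  ultimately show ?thesis using False by (simp add: bq_def ext_sum)
 qed
 show ?thesis unfolding 1 2 3 4 by simp
qed

lemma Pr_homotopy:
 assumes c: "kys c \<subseteq> SS p X"
 shows "bk (Suc p) (ext (Pr \<phi> p) c) + ext (Pr \<phi> (p - 1)) (bk p c) = ext lord (ext (tord \<phi> p) c) - c"
proof -
 have "ext (\<lambda>f. ext (bq (Suc p)) (Pr \<phi> p f) + (if p = 0 then 0 else ext (Pr \<phi> (p - 1)) (bq p f))) c = ext (\<lambda>f. ext lord (tord \<phi> p f) - sg1 f) c"
  using c by (intro ext_cong Pr_boundary) auto
 then show ?thesis
  by (cases "p = 0") (simp_all add: bk_def ext_ext ext_fun_add ext_fun_diff ext_id)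
qed

lemma geom_mono: "\<Gamma> \<subseteq> \<Gamma>' ==> geom \<Gamma> \<subseteq> geom \<Gamma>'" by (auto simp: geom_def)

lemma comb_geom:
 assumes "length l = Suc q" "s \<in> standard_simplex q"
 shows "comb (map ev l) s \<in> geom (Pow (set l))"
proof -
 let ?x = "comb (map ev l) s"
 have s: "\<And>j. 0 \<le> s j" "(\<Sum>j<Suc q. s j) = 1" using assms(2) by (auto simp: standard_simplex_def lessThan_Suc_atMost)
 have x: "?x v = (\<Sum>j<Suc q. if v = l ! j then s j else 0)" for v
  unfolding comb_def using assms(1) by (auto intro!: sum.cong simp: ev_def)
 have supp: "{v. ?x v ~= 0} \<subseteq> set l"
 proof
  fix v assume "v \<in> {v. ?x v ~= 0}"
  then obtain j where "j < Suc q" "v = l ! j" unfolding mem_Collect_eq x by (elim sum.not_neutral_contains_not_neutral) (simp only: lessThan_iff split: if_splits)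
  then show "v \<in> set l" using assms(1) by simp
 qed
 have "(\<Sum>v\<in>{v. ?x v ~= 0}. ?x v) = (\<Sum>v\<in>set l. ?x v)" by (rule sum.mono_neutral_left) (use supp in auto)
 also have "\<dots> = (\<Sum>j<Suc q. \<Sum>v\<in>set l. if v = l ! j then s j else 0)" unfolding x by (rule sum.swap)
 also have "\<dots> = (\<Sum>j<Suc q. s j)" by (rule sum.cong) (use assms(1) in auto)
 finally have "(\<Sum>v\<in>{v. ?x v ~= 0}. ?x v) = 1" using s by simp
 moreover have "0 \<le> ?x v" for v unfolding x by (rule sum_nonneg) (simp add: s(1))
 ultimately show ?thesis using supp by (simp add: geom_def)
qed

lemma keys_lord: "length l = Suc p ==> (\<And>H. H \<subseteq> set l ==> H \<in> \<Gamma>) ==> kys (lord l :: ('v => real, 'k::field) kchain) \<subseteq> SS p (geom \<Gamma>)"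
proof -
 assume l: "length l = Suc p" and G: "\<And>H. H \<subseteq> set l ==> H \<in> \<Gamma>"
 have "comb (map ev l) s \<in> geom \<Gamma>" if "s \<in> standard_simplex p" for s
  using comb_geom[OF l that] geom_mono[of "Pow (set l)" \<Gamma>] G by blast
 moreover have "continuous_on (standard_simplex p) (push id (map ev l))"
  by (rule continuous_on_eq[OF continuous_on_comb[of _ "map ev l"]]) (simp add: push_def l)
 ultimately have "push id (map ev l) \<in> SS p (geom \<Gamma>)" by (auto simp: singular_simplex_iff push_def l)
 then show ?thesis using l by (auto simp: lord_def)
qed

text \<open>Here S is the image of a small singular simplex: its straight-line homotopy to the simplex spanned by the chosen vertices must stay in A.\<close>

definition tgt :: "'v set set => ('v => real) set => (('v => real) => 'v) => ('v => real) set => bool" where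
 "tgt \<Gamma> A \<phi> S \<longleftrightarrow> \<phi> ` S \<in> \<Gamma> \<and> (\<forall>y\<in>S. \<forall>z\<in>geom (Pow (\<phi> ` S)). \<forall>t\<in>{0..1}. (\<lambda>v. (1 - t) * y v + t * z v) \<in> A)"

lemma continuous_on_shift: "continuous_on S (\<lambda>z. z \<circ> Suc)" for S :: "(nat => real) set"
 by (rule continuous_on_coordinatewise_then_product) (auto intro!: continuous_on_product_coordinates[THEN continuous_on_subset])

lemma keys_Pr:
 assumes f: "f \<in> SS p X" and t: "tgt \<Gamma> A \<phi> (f ` standard_simplex p)"
 shows "kys (Pr \<phi> p f :: ('v => real, 'k::field) kchain) \<subseteq> SS (Suc p) A"
proof
 fix g assume g: "g \<in> kys (Pr \<phi> p f :: ('v => real, 'k) kchain)"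
 obtain l where l: "l \<in> kys (prism lo hi (EE p) :: (nat => real) list \<Rightarrow>\<^sub>0 'k)" "g \<in> kys (if l = [] then 0 else sg1 (push (Hh \<phi> p f) l) :: ('v => real, 'k) kchain)"
  using subsetD[OF keys_ext g[unfolded Pr_def QQ_def]] by blast
 have l': "set l \<subseteq> Wc p" "length l = Suc (Suc p)" using keys_prism_EE[OF l(1)] by auto
 have gl: "g = push (Hh \<phi> p f) l" using l(2) by (simp split: if_splits)
 let ?E = "map (ev \<circ> \<phi> \<circ> f) (EE p)"
 have fc: "continuous_on (standard_simplex p) f" using f by (simp add: singular_simplex_iff)
 have c1: "continuous_on (Wc p) (\<lambda>z. f (z \<circ> Suc))"
  by (rule continuous_on_compose2[OF fc continuous_on_shift]) (auto simp: Wc_def)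
 have c2: "continuous_on (Wc p) (\<lambda>z. comb ?E (z \<circ> Suc))"
  by (rule continuous_on_compose2[OF continuous_on_comb continuous_on_shift]) (rule subset_UNIV)
 have c: "continuous_on (Wc p) (Hh \<phi> p f)"
  unfolding Hh_def
  by (rule continuous_on_coordinatewise_then_product)
   (intro continuous_intros continuous_on_product_then_coordinatewise[OF c1] continuous_on_product_then_coordinatewise[OF c2]
     continuous_on_product_coordinates[THEN continuous_on_subset] subset_UNIV)
 have "Hh \<phi> p f z \<in> A" if z: "z \<in> Wc p" for z
 proof -
  have z': "z \<circ> Suc \<in> standard_simplex p" "z 0 \<in> {0..1}" using z by (auto simp: Wc_def)
  have "comb (map ev (map (\<phi> \<circ> f) (EE p))) (z \<circ> Suc) \<in> geom (Pow (set (map (\<phi> \<circ> f) (EE p))))"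
   by (rule comb_geom[OF _ z'(1)]) simp
  moreover have "Pow (set (map (\<phi> \<circ> f) (EE p))) \<subseteq> Pow (\<phi> ` f ` standard_simplex p)" using image_mono[OF set_EE[of p], of "\<phi> \<circ> f"] by (simp add: image_comp Pow_mono)
  moreover have "map ev (map (\<phi> \<circ> f) (EE p)) = ?E" by simp
  ultimately have "comb ?E (z \<circ> Suc) \<in> geom (Pow (\<phi> ` f ` standard_simplex p))" using geom_mono by (metis subsetD)
  then show ?thesis using t z' unfolding tgt_def Hh_def by blast
 qed
 then show "g \<in> SS (Suc p) A" unfolding gl mem_Collect_eq by (intro push_simplex[OF l' c]) auto
qed

definition spt :: "nat => 'v set set => ('v set => 'k::field) => bool" where
 "spt p \<Gamma> f \<longleftrightarrow> (\<forall>G. f G ~= 0 --> G \<in> \<Gamma> \<and> card G = p)"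

definition LL :: "'v list => ('v set => 'k::field) => ('v => real, 'k) kchain" where
 "LL vs f = ext lord (BB vs f)"

lemma keys_ext_sub: "(\<And>x. x \<in> kys c ==> kys (h x) \<subseteq> S) ==> kys (ext h c) \<subseteq> S"
 using keys_ext[of h c] by blast

lemma bk_bk_LL:
 fixes f :: "'v set => 'k::field"
 assumes "distinct vs" "spt (Suc p) \<Gamma> f"
 shows "bk p (LL vs f) = LL vs (bnd vs f)"
proof -
 have "length l = Suc p" if l: "l \<in> kys (BB vs f)" for l
  using keys_BB[OF l] length_srt[OF assms(1)] assms(2) by (auto simp: spt_def)
 then show ?thesis unfolding LL_def by (simp add: bk_lord BB_bnd[OF assms(1)])
qed

lemma LL_simps: "LL vs (\<lambda>G. f G + g G) = LL vs f + LL vs g" "LL vs (\<lambda>G. f G - g G) = LL vs f - LL vs g"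
 "LL vs (\<lambda>G. a * f G) = sc a (LL vs f)" "LL vs (\<lambda>G. 0) = 0"
 by (simp_all add: LL_def BB_simps ext_add ext_diff ext_sc)

lemma geom_single: "x \<in> geom (Pow {v}) ==> x = ev v"
proof
 fix w assume x: "x \<in> geom (Pow {v})"
 then have s: "{w. x w ~= 0} \<subseteq> {v}" "(\<Sum>w\<in>{w. x w ~= 0}. x w) = 1" by (auto simp: geom_def)
 then have "{w. x w ~= 0} = {v}" by (metis subset_singletonD sum.empty zero_neq_one)
 with s show "x w = ev v w" by (auto simp: ev_def)
qed

lemma tord_keys: "l \<in> kys (tord \<phi> p g :: 'v list \<Rightarrow>\<^sub>0 'k::field) ==> length l = Suc p \<and> set l \<subseteq> \<phi> ` g ` standard_simplex p"
 using set_EE[of p] by (auto simp: tord_def)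

section \<open>Singular and simplicial homology of a pair\<close>

text \<open>The choice of vertices may depend on a compact set K, since a finite chain only meets a compact part of A.\<close>

locale apx =
 fixes vs :: "'v list" and \<Gamma> \<Gamma>' :: "'v set set" and A :: "('v => real) set"
 assumes dv: "distinct vs" and fv: "\<And>G. G \<in> \<Gamma> ==> G \<subseteq> set vs"
  and dn: "\<And>G H. G \<in> \<Gamma> ==> H \<subseteq> G ==> H \<in> \<Gamma>" and dn': "\<And>G H. G \<in> \<Gamma>' ==> H \<subseteq> G ==> H \<in> \<Gamma>'"
  and sub: "\<Gamma>' \<subseteq> \<Gamma>" and gA: "geom \<Gamma>' \<subseteq> A" and AX: "A \<subseteq> geom \<Gamma>"
  and ap: "\<And>K. compact K ==> K \<subseteq> A ==> \<exists>\<phi>. \<exists>e>0. (\<forall>x\<in>geom \<Gamma>. x (\<phi> x) ~= 0) \<and>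
   (\<forall>S. S ~= {} --> S \<subseteq> geom \<Gamma> --> sml vs e S --> tgt \<Gamma> (geom \<Gamma>) \<phi> S) \<and>
   (\<forall>S. S ~= {} --> S \<subseteq> K --> sml vs e S --> tgt \<Gamma>' A \<phi> S)"
begin

text \<open>A single choice of vertices and a single number of subdivisions serve a chain of the
  whole space and a chain of A at once; the compact set for the choice is the union of the images of
  the second chain.\<close>

lemma common_choice:
 fixes c a :: "('v => real, 'k::field) kchain"
 assumes c: "kys c \<subseteq> SS p (geom \<Gamma>)" and a: "kys a \<subseteq> SS q A"
 obtains \<phi> N where "\<And>x. x \<in> geom \<Gamma> ==> x (\<phi> x) ~= 0"
  "\<And>g. g \<in> kys (ext (sdk N p) c) ==> g \<in> SS p (geom \<Gamma>) \<and> tgt \<Gamma> (geom \<Gamma>) \<phi> (g ` standard_simplex p)"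
  "\<And>g. g \<in> kys (ext (sdk N q) a) ==> g \<in> SS q A \<and> tgt \<Gamma>' A \<phi> (g ` standard_simplex q)"
proof -
 define K where "K = (\<Union>f\<in>kys a. f ` standard_simplex q)"
 have cs: "compact (standard_simplex q)"
  using compactin_standard_simplex[of q] by (simp add: euclidean_product_topology)
 have aA: "f ` standard_simplex q \<subseteq> A" "continuous_on (standard_simplex q) f" "f \<in> extensional (standard_simplex q)" if "f \<in> kys a" for f
  using that a by (auto simp: singular_simplex_iff)
 have cK: "compact K" unfolding K_def by (intro compact_UN finite_keys compact_continuous_image aA cs)
 have KA: "K \<subseteq> A" unfolding K_def using aA by blast
 from ap[OF cK KA] obtain \<phi> e where e: "e > 0" and ph0: "\<forall>x\<in>geom \<Gamma>. x (\<phi> x) ~= 0"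
   "\<forall>S. S ~= {} --> S \<subseteq> geom \<Gamma> --> sml vs e S --> tgt \<Gamma> (geom \<Gamma>) \<phi> S"
   "\<forall>S. S ~= {} --> S \<subseteq> K --> sml vs e S --> tgt \<Gamma>' A \<phi> S" by (elim exE conjE)
 have ph: "\<And>x. x\<in>geom \<Gamma> ==> x (\<phi> x) ~= 0"
  and t: "\<And>S. S ~= {} ==> S \<subseteq> geom \<Gamma> ==> sml vs e S ==> tgt \<Gamma> (geom \<Gamma>) \<phi> S"
  and t': "\<And>S. S ~= {} ==> S \<subseteq> K ==> sml vs e S ==> tgt \<Gamma>' A \<phi> S"
  using ph0 by auto
 have aK: "kys a \<subseteq> SS q K" using aA by (auto simp: singular_simplex_iff K_def)
 obtain N1 where N1: "\<And>m f g. N1 \<le> m ==> f \<in> kys c ==> g \<in> kys (sdk m p f :: ('v => real, 'k) kchain) ==> sml vs e (g ` standard_simplex p)"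
  using small_subdivision[OF finite_keys c e, where 'k='k] by metis
 obtain N2 where N2: "\<And>m f g. N2 \<le> m ==> f \<in> kys a ==> g \<in> kys (sdk m q f :: ('v => real, 'k) kchain) ==> sml vs e (g ` standard_simplex q)"
  using small_subdivision[OF finite_keys aK e, where 'k='k] by metis
 let ?N = "max N1 N2"
 show thesis
 proof (rule that[of \<phi> ?N])
  show "\<And>x. x \<in> geom \<Gamma> ==> x (\<phi> x) ~= 0" by (rule ph)
  fix g assume "g \<in> kys (ext (sdk ?N p) c)"
  then obtain f where f: "f \<in> kys c" "g \<in> kys (sdk ?N p f :: ('v => real, 'k) kchain)" using keys_ext by fastforce
  have g: "g \<in> SS p (geom \<Gamma>)" using keys_sdk[OF _ f(2)] c f(1) by blast
  have "tgt \<Gamma> (geom \<Gamma>) \<phi> (g ` standard_simplex p)"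
   by (rule t) (use g N1[OF _ f] in \<open>auto simp: singular_simplex_iff nonempty_standard_simplex\<close>)
  with g show "g \<in> SS p (geom \<Gamma>) \<and> tgt \<Gamma> (geom \<Gamma>) \<phi> (g ` standard_simplex p)" by blast
 next
  fix g assume "g \<in> kys (ext (sdk ?N q) a)"
  then obtain f where f: "f \<in> kys a" "g \<in> kys (sdk ?N q f :: ('v => real, 'k) kchain)" using keys_ext by fastforce
  have g: "g \<in> SS q K" using keys_sdk[OF _ f(2)] aK f(1) by blast
  have "tgt \<Gamma>' A \<phi> (g ` standard_simplex q)"
   by (rule t') (use g N2[OF _ f] in \<open>auto simp: singular_simplex_iff nonempty_standard_simplex\<close>)
  moreover have "g \<in> SS q A" using g KA by (auto simp: singular_simplex_iff)
  ultimately show "g \<in> SS q A \<and> tgt \<Gamma>' A \<phi> (g ` standard_simplex q)" by blast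
 qed
qed

lemma tord_in:
 assumes "\<And>g. g \<in> kys c ==> tgt T B \<phi> (g ` standard_simplex p)" "\<And>G H. G \<in> T ==> H \<subseteq> G ==> H \<in> T"
  "l \<in> kys (ext (tord \<phi> p) c :: 'v list \<Rightarrow>\<^sub>0 'k::field)"
 shows "length l = Suc p \<and> set l \<in> T"
proof -
 obtain g where g: "g \<in> kys c" "l \<in> kys (tord \<phi> p g :: 'v list \<Rightarrow>\<^sub>0 'k)"
  using subsetD[OF keys_ext assms(3)] by blast
 have "\<phi> ` g ` standard_simplex p \<in> T" using assms(1)[OF g(1)] by (simp add: tgt_def)
 then show ?thesis using tord_keys[OF g(2)] assms(2) by blast
qed

lemma bd_tord:
 assumes "1 \<le> p"
 shows "ext bd (ext (tord \<phi> p) c) = (ext (tord \<phi> (p - 1)) (bk p c) :: 'v list \<Rightarrow>\<^sub>0 'k::field)"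
proof -
 have "ext (\<lambda>f. ext bd (tord \<phi> p f)) c = (ext (\<lambda>f. ext (tord \<phi> (p - 1)) (bq p f)) c :: 'v list \<Rightarrow>\<^sub>0 'k)"
  by (rule ext_cong) (rule tord_boundary[OF assms])
 then have "ext bd (ext (tord \<phi> p) c) = (ext (tord \<phi> (p - 1)) (ext (bq p) c) :: 'v list \<Rightarrow>\<^sub>0 'k)"
  unfolding ext_ext .
 moreover have "bk p c = ext (bq p) c" using assms by (simp add: bk_def)
 ultimately show ?thesis by (simp only:)
qed

lemma LL_keys:
 fixes c :: "'v set => 'k::field"
 assumes "spt (Suc p) T c" "T \<subseteq> \<Gamma>" "\<And>G H. G \<in> T ==> H \<subseteq> G ==> H \<in> T"
 shows "kys (LL vs c) \<subseteq> SS p (geom T)"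
 unfolding LL_def
proof (rule keys_ext_sub)
 fix l assume "l \<in> kys (BB vs c)"
 then obtain G where G: "G \<subseteq> set vs" "c G ~= 0" "l = srt vs G" using keys_BB by metis
 then have "G \<in> T" "card G = Suc p" using assms(1) by (auto simp: spt_def)
 then show "kys (lord l :: ('v => real, 'k) kchain) \<subseteq> SS p (geom T)"
  using G assms(3) srt_set[OF G(1)] length_srt[OF dv G(1)] by (intro keys_lord) auto
qed

text \<open>The chain c is the antisymmetrized approximation of the subdivision of z. Three
  homotopies connect z with the realization of c: subdivision, straight-line prisms, and the one
  from ordered to oriented chains. Applied to z they give a chain E, and applied to its boundary,
  which lies in A, a chain R in A, such that the difference is the boundary of E plus R.\<close>

theorem surj:
 fixes z :: "('v => real, 'k::field) kchain"
 assumes z: "z \<in> rel_cycles (int p) (geom \<Gamma>) A"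
 shows "\<exists>c. spt (Suc p) \<Gamma> c \<and> (\<forall>G. bnd vs c G ~= 0 --> G ~= {} --> G \<in> \<Gamma>') \<and> z - LL vs c \<in> rel_boundaries (int p) (geom \<Gamma>) A"
proof -
 let ?X = "geom \<Gamma>"
 have zc: "kys z \<subseteq> SS p ?X" using z by (simp add: rel_cycles_def chains_SS)
 define a where "a = bk p z"
 have ac: "kys a \<subseteq> SS (p - 1) A"
 proof (cases "p = 0")
  case False
  then obtain q where q: "p = Suc q" by (cases p) auto
  have "bdry (int p) z \<in> chains (int q) A" using z by (simp add: rel_cycles_def q)
  then show ?thesis unfolding bdry_bk chains_SS a_def q by simp
 qed (simp add: a_def bk_def)
 obtain \<phi> N where ph: "\<And>x. x \<in> ?X ==> x (\<phi> x) ~= 0"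
  and t: "\<And>g. g \<in> kys (ext (sdk N p) z) ==> g \<in> SS p ?X \<and> tgt \<Gamma> ?X \<phi> (g ` standard_simplex p)"
  and t': "\<And>g. g \<in> kys (ext (sdk N (p - 1)) a) ==> g \<in> SS (p - 1) A \<and> tgt \<Gamma>' A \<phi> (g ` standard_simplex (p - 1))"
  by (rule common_choice[OF zc ac]) blast
 obtain h :: "nat => ((nat => real) => 'v => real) => ('v => real, 'k) kchain"
  where h: "\<And>p X f. f \<in> SS p X ==> kys (h p f) \<subseteq> SS (Suc p) X"
   "\<And>p X c. kys c \<subseteq> SS p X ==> bk (Suc p) (ext (h p) c) + ext (h (p - 1)) (bk p c) = ext (sdk N p) c - c"
  by (rule sdk_homotopy[of N, where 'k='k]) blast
 define z1 where "z1 = ext (sdk N p) z"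
 define a1 where "a1 = ext (sdk N (p - 1)) a"
 define \<tau> where "\<tau> = (ext (tord \<phi> p) z1 :: 'v list \<Rightarrow>\<^sub>0 'k)"
 define c where "c = AA vs \<tau>"
 have z1c: "kys z1 \<subseteq> SS p ?X" using t by (auto simp: z1_def)
 have bz1: "bk p z1 = a1" unfolding z1_def a1_def a_def by (rule bk_sdk[OF zc])
 have tau: "length l = Suc p \<and> set l \<in> \<Gamma>" if "l \<in> kys \<tau>" for l
  using tord_in[of z1 \<Gamma> ?X \<phi> p l, OF _ dn] that t by (auto simp: \<tau>_def z1_def)
 have tauv: "set l \<subseteq> set vs" if "l \<in> kys \<tau>" for l using tau[OF that] fv by blast
 define b where "b = ext bd \<tau>"
 \<comment> \<open>In degree 0 the list boundary is the augmentation, a multiple of the empty list,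
   which need not vanish; the homotopy \<open>dh vs 0\<close> is 0 and ignores it.\<close>
 have b0: "p = 0 ==> ext (dh vs p) b = 0" by (simp add: ext_def)
 have bb: "length l = p \<and> set l \<in> \<Gamma>'" if "l \<in> kys b" "p ~= 0" for l
 proof -
  have "b = ext (tord \<phi> (p - 1)) a1" using bd_tord[of p \<phi> z1] that by (simp add: b_def \<tau>_def bz1)
  then show ?thesis using tord_in[of a1 \<Gamma>' A \<phi> "p - 1" l, OF _ dn'] that t' by (auto simp: a1_def)
 qed
 have bl: "length l = p" if lb: "l \<in> kys b" for l
 proof -
  obtain m where m: "m \<in> kys \<tau>" "l \<in> kys (bd m :: 'v list \<Rightarrow>\<^sub>0 'k)" using subsetD[OF keys_ext lb[unfolded b_def]] by blast
  show ?thesis using tau[OF m(1)] keys_bd[OF m(2)] by simp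
 qed
 have c1: "spt (Suc p) \<Gamma> c" unfolding spt_def c_def using AA_nonzero[of vs \<tau>] tau by metis
 have bc: "bnd vs c G = AA vs b G" for G unfolding c_def b_def by (rule bnd_AA_bd[OF dv tauv])
 have c2: "G \<in> \<Gamma>'" if G: "bnd vs c G ~= 0" "G ~= {}" for G
 proof -
  obtain l where l: "l \<in> kys b" "G = set l" using G(1) unfolding bc by (metis AA_nonzero)
  with bb[OF l(1)] bl[OF l(1)] G(2) show ?thesis by auto
 qed
 have e1: "bk (Suc p) (ext (h p) z) + ext (h (p - 1)) a = z1 - z" unfolding a_def z1_def by (rule h(2)[OF zc])
 have e2: "bk (Suc p) (ext (Pr \<phi> p) z1) + ext (Pr \<phi> (p - 1)) a1 = ext lord \<tau> - z1" using Pr_homotopy[OF z1c, of \<phi>] by (simp add: \<tau>_def bz1)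
 have dhk: "length m = Suc (Suc p) \<and> set m \<in> \<Gamma>" if m: "m \<in> kys (ext (dh vs (Suc p)) \<tau> :: 'v list \<Rightarrow>\<^sub>0 'k)" for m
 proof -
  obtain l where l: "l \<in> kys \<tau>" "m \<in> kys (dh vs (Suc p) l :: 'v list \<Rightarrow>\<^sub>0 'k)" using subsetD[OF keys_ext m] by blast
  then show ?thesis using keys_dh[OF dv tauv[OF l(1)] _ l(2)] tau[OF l(1)] dn by blast
 qed
 have dhk': "length m = Suc p \<and> set m \<in> \<Gamma>'" if m: "m \<in> kys (ext (dh vs p) b :: 'v list \<Rightarrow>\<^sub>0 'k)" for m
 proof -
  have p: "p ~= 0"
  proof
   assume "p = 0"
   then have "ext (dh vs p) b = 0" by (rule b0)
   then show False using m by (metis empty_iff keys_zero)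
  qed
  obtain l where l: "l \<in> kys b" "m \<in> kys (dh vs p l :: 'v list \<Rightarrow>\<^sub>0 'k)" using subsetD[OF keys_ext m] by blast
  have "set l \<subseteq> set vs" using bb[OF l(1) p] sub fv by blast
  from keys_dh[OF dv this _ l(2)] show ?thesis using bb[OF l(1) p] dn' by blast
 qed
 have "ext (\<lambda>l. ext bd (dh vs (Suc p) l) + ext (dh vs p) (bd l)) \<tau> = ext (\<lambda>l. sg1 l - BB vs (alt vs l)) \<tau>"
 proof (rule ext_cong)
  fix l assume "l \<in> kys \<tau>"
  then show "ext bd (dh vs (Suc p) l) + ext (dh vs p) (bd l) = sg1 l - (BB vs (alt vs l) :: 'v list \<Rightarrow>\<^sub>0 'k)"
   using dh_boundary[OF dv tauv, of l "Suc p"] tau by simp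
 qed
 then have "ext bd (ext (dh vs (Suc p)) \<tau>) + ext (dh vs p) b = \<tau> - BB vs c"
  by (simp add: ext_fun_add ext_fun_diff ext_id b_def c_def BB_AA) (simp add: ext_ext)
 then have "ext lord (ext bd (ext (dh vs (Suc p)) \<tau>)) + ext lord (ext (dh vs p) b) = ext lord \<tau> - (LL vs c :: ('v => real, 'k) kchain)"
  by (metis LL_def ext_add ext_diff)
 moreover have "bk (Suc p) (ext lord (ext (dh vs (Suc p)) \<tau>)) = (ext lord (ext bd (ext (dh vs (Suc p)) \<tau>)) :: ('v => real, 'k) kchain)"
  by (rule bk_lord) (use dhk in auto)
 ultimately have e3: "bk (Suc p) (ext lord (ext (dh vs (Suc p)) \<tau>)) + ext lord (ext (dh vs p) b) = ext lord \<tau> - (LL vs c :: ('v => real, 'k) kchain)" by simp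
 define E where "E = ext lord (ext (dh vs (Suc p)) \<tau>) - ext (h p) z - ext (Pr \<phi> p) z1"
 define R where "R = ext lord (ext (dh vs p) b) - ext (h (p - 1)) a - ext (Pr \<phi> (p - 1)) a1"
 have eq: "z - LL vs c = bk (Suc p) E + R"
 proof -
  have "z - LL vs c = (ext lord \<tau> - LL vs c) - (z1 - z) - (ext lord \<tau> - z1) + (z - z)" by simp
  also have "\<dots> = bk (Suc p) E + R" unfolding e1[symmetric] e2[symmetric] e3[symmetric] E_def R_def bk_simps by simp
  finally show ?thesis .
 qed
 have kd: "kys (u - v - w) \<subseteq> S" if "kys u \<subseteq> S" "kys v \<subseteq> S" "kys w \<subseteq> S" for u v w :: "('v => real, 'k) kchain" and S
  using that keys_diff'[of _ "u - v" w] keys_diff'[of _ u v] by blast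
 have EX: "kys E \<subseteq> SS (Suc p) ?X" unfolding E_def
 proof (rule kd; rule keys_ext_sub)
  show "kys (lord x :: ('v => real, 'k) kchain) \<subseteq> SS (Suc p) ?X" if "x \<in> kys (ext (dh vs (Suc p)) \<tau>)" for x
   by (rule keys_lord) (use dhk[OF that] dn in auto)
  show "kys (h p x) \<subseteq> SS (Suc p) ?X" if "x \<in> kys z" for x by (rule h(1)) (use that zc in auto)
  show "kys (Pr \<phi> p x :: ('v => real, 'k) kchain) \<subseteq> SS (Suc p) ?X" if "x \<in> kys z1" for x
   by (rule keys_Pr) (use that t in \<open>auto simp: z1_def\<close>)
 qed
 have RA: "kys R \<subseteq> SS p A"
 proof (cases "p = 0")
  case True
  have "a = 0" using True by (simp add: a_def bk_def)
  then show ?thesis using True b0 by (simp add: R_def a1_def)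
 next
  case False
  then obtain q where q: "p = Suc q" by (cases p) auto
  show ?thesis unfolding R_def
  proof (rule kd; rule keys_ext_sub)
   show "kys (lord x :: ('v => real, 'k) kchain) \<subseteq> SS p A" if "x \<in> kys (ext (dh vs p) b)" for x
   proof -
    have "kys (lord x :: ('v => real, 'k) kchain) \<subseteq> SS p (geom \<Gamma>')" by (rule keys_lord) (use dhk'[OF that] dn' in auto)
    then show ?thesis using gA by (auto simp: singular_simplex_iff)
   qed
   show "kys (h (p - 1) x) \<subseteq> SS p A" if "x \<in> kys a" for x using h(1)[of x q A] that ac unfolding q by auto
   show "kys (Pr \<phi> (p - 1) x :: ('v => real, 'k) kchain) \<subseteq> SS p A" if "x \<in> kys a1" for x
    using keys_Pr[of x q A \<Gamma>' A \<phi>, where 'k='k] that t' q by (auto simp: a1_def)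
  qed
 qed
 have Lc: "kys (z - LL vs c) \<subseteq> SS p ?X" using keys_diff'[of _ z "LL vs c"] zc LL_keys[OF c1 subset_refl] dn by blast
 have "z - LL vs c \<in> rel_boundaries (int p) ?X A"
  unfolding rel_boundaries_def mem_Collect_eq
 proof (intro conjI bexI)
  show "z - LL vs c \<in> chains (int p) ?X" using Lc by (simp add: chains_SS)
  show "E \<in> chains (int p + 1) ?X" using EX chains_SS[of "Suc p"] by (auto simp: add.commute)
  show "z - LL vs c - bdry (int p + 1) E \<in> chains (int p) A" using RA bdry_bk[of "Suc p" E] by (simp add: eq chains_SS add.commute)
 qed
 with c1 c2 show ?thesis by blast
qed

text \<open>Subdividing and approximating an affine simplex gives back that simplex exactly, not
  merely up to homology. It cannot leave the simplex because chosen vertices have nonzero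
  coordinate, and its coefficient is found from the boundary by induction on the dimension.\<close>

lemma carried_identity:
 assumes ph: "\<And>x. x \<in> geom \<Gamma> ==> x (\<phi> x) ~= 0"
 shows "G \<in> \<Gamma> ==> card G = Suc p ==>
  AA vs (ext (tord \<phi> p) (ext (sdk N p) (lord (srt vs G) :: ('v => real, 'k::field) kchain))) H = (if H = G then 1 else 0)"
proof (induction p arbitrary: G H)
 have sup: "H = G" if nz: "AA vs (ext (tord \<phi> p) (ext (sdk N p) (lord (srt vs G) :: ('v => real, 'k) kchain))) H ~= 0"
  and G: "G \<in> \<Gamma>" "card G = Suc p" for p G H
 proof -
  obtain l where l: "l \<in> kys (ext (tord \<phi> p) (ext (sdk N p) (lord (srt vs G) :: ('v => real, 'k) kchain)))" "H = set l" "card H = length l"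
   using AA_nonzero[OF nz] by blast
  obtain g where g: "g \<in> kys (ext (sdk N p) (lord (srt vs G) :: ('v => real, 'k) kchain))" "l \<in> kys (tord \<phi> p g :: 'v list \<Rightarrow>\<^sub>0 'k)"
   using subsetD[OF keys_ext l(1)] by blast
  obtain f where f: "f \<in> kys (lord (srt vs G) :: ('v => real, 'k) kchain)" "g \<in> kys (sdk N p f :: ('v => real, 'k) kchain)"
   using subsetD[OF keys_ext g(1)] by blast
  have "f \<in> SS p (geom (Pow G))"
   using keys_lord[of "srt vs G" p "Pow G", where 'k='k] f(1) G(2) length_srt[OF dv fv[OF G(1)]] srt_set[OF fv[OF G(1)]] by auto
  then have gG: "g \<in> SS p (geom (Pow G))" using keys_sdk f(2) by blast
  \<comment> \<open>Points of the closed simplex on G have their nonzero coordinates in G, and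
    \<phi> picks one of these.\<close>
  have "\<phi> x \<in> G" if "x \<in> g ` standard_simplex p" for x
  proof -
   have "x \<in> geom (Pow G)" using that gG by (auto simp: singular_simplex_iff)
   moreover have "geom (Pow G) \<subseteq> geom \<Gamma>" by (rule geom_mono) (use dn G in auto)
   ultimately show ?thesis using ph[of x] by (auto simp: geom_def)
  qed
  then have "set l \<subseteq> G" "length l = Suc p" using tord_keys[OF g(2)] by auto
  then show "H = G" using l(2,3) G by (metis card_subset_eq card.infinite nat.simps(3))
 qed
 {
  case 0
  obtain v where v: "G = {v}" using 0(2) by (metis One_nat_def card_1_singletonE)
  have vv: "v \<in> set vs" using fv[OF 0(1)] v by auto
  have sv: "srt vs G = [v]"
  proof -
   have "set (srt vs G) = {v}" "length (srt vs G) = 1" using srt_set[OF fv[OF 0(1)]] length_srt[OF dv fv[OF 0(1)]] v by auto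
   then show ?thesis by (metis One_nat_def length_0_conv length_Suc_conv list.set_intros(1) singletonD)
  qed
  define f where "f = push id (map ev [v])"
  have f: "f \<in> SS 0 (geom (Pow {v}))" using keys_lord[of "[v]" 0 "Pow {v}", where 'k='k] by (auto simp: lord_def f_def)
  then have "f (ep 0) \<in> geom (Pow {v})" using ep_in[of 0 0] by (auto simp: singular_simplex_iff)
  then have fe: "f (ep 0) = ev v" by (rule geom_single)
  have "ev v \<in> geom \<Gamma>" using \<open>f (ep 0) \<in> geom (Pow {v})\<close> fe geom_mono[of "Pow {v}" \<Gamma>] dn[OF 0(1)] v by auto
  then have "\<phi> (ev v) = v" using ph[of "ev v"] by (auto simp: ev_def split: if_splits)
  then have "tord \<phi> 0 f = (sg1 (srt vs G) :: 'v list \<Rightarrow>\<^sub>0 'k)" by (simp add: tord_def EE_def fe sv)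
  moreover have "lord (srt vs G) = (sg1 f :: ('v => real, 'k) kchain)" by (simp add: sv lord_def f_def)
  moreover have "sdk N 0 f = (sg1 f :: ('v => real, 'k) kchain)" by (rule sdk_0[OF f])
  ultimately show ?case by (simp add: AA_simps alt_srt[OF dv fv[OF 0(1)]] del: alt.simps)
 next
  case (Suc p)
  let ?l = "lord :: 'v list => ('v => real, 'k) kchain"
  let ?t = "\<lambda>p G. ext (tord \<phi> p) (ext (sdk N p) (?l (srt vs G)))"
  note V = fv[OF Suc.prems(1)]
  \<comment> \<open>The result is a multiple of G; comparing the coefficients of the boundary at the
    single face \<open>G - {w}\<close> forces \<mu> to be 1.\<close>
  define \<mu> where "\<mu> = AA vs (?t (Suc p) G) G"
  have t: "AA vs (?t (Suc p) G) = (\<lambda>H. if H = G then \<mu> else 0)" 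
  proof (rule HOL.ext)
   fix H show "AA vs (?t (Suc p) G) H = (if H = G then \<mu> else 0)" using sup[OF _ Suc.prems, of H] by (auto simp: \<mu>_def)
  qed
  obtain w where w: "w \<in> G" using Suc.prems(2) by (metis card.empty ex_in_conv nat.simps(3))
  have fin: "finite G" using Suc.prems(2) by (metis card.infinite nat.simps(3))
  have lk: "kys (?l (srt vs G)) \<subseteq> SS (Suc p) (geom \<Gamma>)"
   by (rule keys_lord) (use length_srt[OF dv V] srt_set[OF V] Suc.prems dn in auto)
  have "ext bd (?t (Suc p) G) = ext (tord \<phi> p) (bk (Suc p) (ext (sdk N (Suc p)) (?l (srt vs G))))"
   using bd_tord[of "Suc p"] by simp
  also have "\<dots> = ext (tord \<phi> p) (ext (sdk N p) (bk (Suc p) (?l (srt vs G))))" using bk_sdk[OF lk] by simp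
  also have "bk (Suc p) (?l (srt vs G)) = ext lord (bd (srt vs G))"
   using bk_lord[of "sg1 (srt vs G)" "Suc p"] length_srt[OF dv V] Suc.prems by simp
  also have "\<dots> = (\<Sum>w\<in>G. sc (sg vs w G) (?l (srt vs (G - {w}))))"
   using V by (simp add: bd_filter[OF dv] ext_sum Int_absorb2)
  finally have bt: "ext bd (?t (Suc p) G) = (\<Sum>w\<in>G. sc (sg vs w G) (?t p (G - {w})))"
   by (simp only: ext_sum ext_sc)
  have "AA vs (ext bd (?t (Suc p) G)) (G - {w}) = (\<Sum>x\<in>G. sg vs x G * AA vs (?t p (G - {x})) (G - {w}))"
   unfolding bt AA_sum AA_simps ..
  also have "\<dots> = (\<Sum>x\<in>G. if x = w then sg vs w G else 0)"
  proof (rule sum.cong[OF refl])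
   fix x assume x: "x \<in> G"
   have "AA vs (?t p (G - {x})) (G - {w}) = (if G - {w} = G - {x} then 1 else 0)"
    by (rule Suc.IH) (use x Suc.prems fin dn in auto)
   moreover have "G - {w} = G - {x} \<longleftrightarrow> x = w" using x w by auto
   ultimately show "sg vs x G * AA vs (?t p (G - {x})) (G - {w}) = (if x = w then sg vs w G else 0)" by simp
  qed
  finally have 1: "AA vs (ext bd (?t (Suc p) G)) (G - {w}) = sg vs w G" using w fin by simp
  have "set l \<subseteq> set vs" if l: "l \<in> kys (?t (Suc p) G)" for l
  proof -
   obtain g where g: "g \<in> kys (ext (sdk N (Suc p)) (?l (srt vs G)))" "l \<in> kys (tord \<phi> (Suc p) g :: 'v list \<Rightarrow>\<^sub>0 'k)"
    using subsetD[OF keys_ext l(1)] by blast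
   obtain f where f: "f \<in> kys (?l (srt vs G))" "g \<in> kys (sdk N (Suc p) f :: ('v => real, 'k) kchain)"
    using subsetD[OF keys_ext g(1)] by blast
   have gg: "g \<in> SS (Suc p) (geom \<Gamma>)" using keys_sdk[OF _ f(2)] lk f(1) by blast
   have "\<phi> x \<in> set vs" if x: "x \<in> g ` standard_simplex (Suc p)" for x
   proof -
    have "x \<in> geom \<Gamma>" using x gg by (auto simp: singular_simplex_iff)
    then show ?thesis using ph[of x] fv[of "{v. x v ~= 0}"] by (auto simp: geom_def)
   qed
   then show ?thesis using tord_keys[OF g(2)] by auto
  qed
  then have "AA vs (ext bd (?t (Suc p) G)) (G - {w}) = bnd vs (\<lambda>H. if H = G then \<mu> else 0) (G - {w})"
   unfolding t[symmetric] by (intro bnd_AA_bd[OF dv, symmetric]) 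
  also have "\<dots> = (\<Sum>v\<in>set vs. if v = w then sg vs w G * \<mu> else 0)"
   unfolding bnd_def
  proof (rule sum.cong[OF refl])
   fix v
   have "insert v (G - {w}) = G \<longleftrightarrow> v = w" if "v \<notin> G - {w}" using that w by auto
   then show "ct vs v (\<lambda>H. if H = G then \<mu> else 0) (G - {w}) = (if v = w then sg vs w G * \<mu> else 0)"
    using w by (auto simp: ct_def insert_absorb)
  qed
  also have "\<dots> = sg vs w G * \<mu>" using w V by auto
  finally have "sg vs w G * \<mu> = sg vs w G * 1" using 1 by simp
  then have "\<mu> = 1" by (metis sg_square_left)
  then show ?case using t by simp
 }
qed

lemma identity:
 fixes c :: "'v set => 'k::field"
 assumes ph: "\<And>x. x \<in> geom \<Gamma> ==> x (\<phi> x) ~= 0" and c: "spt (Suc p) \<Gamma> c"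
 shows "AA vs (ext (tord \<phi> p) (ext (sdk N p) (LL vs c))) H = c H"
proof -
 have "AA vs (ext (tord \<phi> p) (ext (sdk N p) (LL vs c))) H = (\<Sum>G\<in>Pow (set vs). c G * AA vs (ext (tord \<phi> p) (ext (sdk N p) (lord (srt vs G) :: ('v => real, 'k) kchain))) H)"
  unfolding LL_def BB_def ext_sum AA_sum ext_single ext_sc AA_simps ..
 also have "\<dots> = (\<Sum>G\<in>Pow (set vs). if G = H then c H else 0)"
 proof (rule sum.cong[OF refl])
  fix G
  show "c G * AA vs (ext (tord \<phi> p) (ext (sdk N p) (lord (srt vs G) :: ('v => real, 'k) kchain))) H = (if G = H then c H else 0)"
  proof (cases "c G = 0")
   case False
   then have "G \<in> \<Gamma>" "card G = Suc p" using c by (auto simp: spt_def)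
   then have "AA vs (ext (tord \<phi> p) (ext (sdk N p) (lord (srt vs G) :: ('v => real, 'k) kchain))) H = (if H = G then 1 else 0)"
    by (intro carried_identity) (use ph in auto)
   then show ?thesis by simp
  qed auto
 qed
 also have "\<dots> = c H" using c fv by (auto simp: spt_def)
 finally show ?thesis .
qed

text \<open>The approximation of a singular chain bounding \<open>LL vs c\<close> bounds c itself
  modulo the subcomplex, because approximation returns c unchanged by \<open>identity\<close> and
  carries the part in A into the subcomplex.\<close>

theorem inj:
 fixes c :: "'v set => 'k::field"
 assumes c: "spt (Suc p) \<Gamma> c" and rb: "LL vs c \<in> rel_boundaries (int p) (geom \<Gamma>) A"
 shows "\<exists>e. spt (Suc (Suc p)) \<Gamma> e \<and> spt (Suc p) \<Gamma>' (\<lambda>G. c G - bnd vs e G)"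
proof -
 obtain e0 where e0: "e0 \<in> chains (int p + 1) (geom \<Gamma>)" "LL vs c - bdry (int p + 1) e0 \<in> chains (int p) A"
  using rb by (auto simp: rel_boundaries_def)
 define a where "a = LL vs c - bk (Suc p) e0"
 have ip: "int p + 1 = int (Suc p)" by simp
 have e: "kys e0 \<subseteq> SS (Suc p) (geom \<Gamma>)" using e0(1) unfolding ip chains_SS by simp
 have ac: "kys a \<subseteq> SS p A" using e0(2) unfolding ip bdry_bk chains_SS by (simp add: a_def)
 obtain \<phi> N where ph: "\<And>x. x \<in> geom \<Gamma> ==> x (\<phi> x) ~= 0"
  and t: "\<And>g. g \<in> kys (ext (sdk N (Suc p)) e0) ==> g \<in> SS (Suc p) (geom \<Gamma>) \<and> tgt \<Gamma> (geom \<Gamma>) \<phi> (g ` standard_simplex (Suc p))"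
  and t': "\<And>g. g \<in> kys (ext (sdk N p) a) ==> g \<in> SS p A \<and> tgt \<Gamma>' A \<phi> (g ` standard_simplex p)"
  by (rule common_choice[OF e ac]) blast
 define \<tau> where "\<tau> = (ext (tord \<phi> (Suc p)) (ext (sdk N (Suc p)) e0) :: 'v list \<Rightarrow>\<^sub>0 'k)"
 have tau: "length l = Suc (Suc p) \<and> set l \<in> \<Gamma>" if "l \<in> kys \<tau>" for l
  using tord_in[of "ext (sdk N (Suc p)) e0" \<Gamma> "geom \<Gamma>" \<phi> "Suc p" l, OF _ dn] that t by (auto simp: \<tau>_def)
 have tauv: "set l \<subseteq> set vs" if "l \<in> kys \<tau>" for l using tau[OF that] fv by blast
 define E where "E = AA vs \<tau>"
 have 1: "spt (Suc (Suc p)) \<Gamma> E" unfolding spt_def E_def using AA_nonzero[of vs \<tau>] tau by metis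
 have bE: "bnd vs E G = AA vs (ext (tord \<phi> p) (ext (sdk N p) (bk (Suc p) e0))) G" for G
 proof -
  have "bnd vs E G = AA vs (ext bd \<tau>) G" unfolding E_def by (rule bnd_AA_bd[OF dv tauv])
  also have "ext bd \<tau> = ext (tord \<phi> p) (bk (Suc p) (ext (sdk N (Suc p)) e0))" unfolding \<tau>_def using bd_tord[of "Suc p"] by simp
  also have "\<dots> = ext (tord \<phi> p) (ext (sdk N p) (bk (Suc p) e0))" using bk_sdk[OF e] by simp
  finally show ?thesis .
 qed
 have "c G - bnd vs E G = AA vs (ext (tord \<phi> p) (ext (sdk N p) a)) G" for G
 proof -
  have "AA vs (ext (tord \<phi> p) (ext (sdk N p) (LL vs c))) G = c G" by (rule identity) (use ph c in auto)
  then show ?thesis by (simp add: bE a_def ext_diff AA_simps)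
 qed
 moreover have "spt (Suc p) \<Gamma>' (AA vs (ext (tord \<phi> p) (ext (sdk N p) a)))"
  unfolding spt_def
 proof (intro allI impI)
  fix G assume "AA vs (ext (tord \<phi> p) (ext (sdk N p) a)) G ~= 0"
  then obtain l where l: "l \<in> kys (ext (tord \<phi> p) (ext (sdk N p) a) :: 'v list \<Rightarrow>\<^sub>0 'k)" "G = set l" "card G = length l" using AA_nonzero by blast
  from tord_in[of "ext (sdk N p) a" \<Gamma>' A \<phi> p l, OF _ dn' l(1)] t' l show "G \<in> \<Gamma>' \<and> card G = Suc p" by auto
 qed
 ultimately show ?thesis using 1 by (intro exI[of _ E]) simp
qed

end

section \<open>Choice of vertices for subcomplexes and for complements of points\<close>

lemma geom_sum: "x \<in> geom \<Gamma> ==> (\<And>G. G \<in> \<Gamma> ==> G \<subseteq> set vs) ==> (\<Sum>v\<in>set vs. x v) = 1"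
 by (subst sum.mono_neutral_right[of _ "{v. x v ~= 0}"]) (auto simp: geom_def)

text \<open>Since z uses only vertices at which y is positive, the segment stays in the closed
  simplex carrying y.\<close>

lemma seg_geom:
 assumes dn: "\<And>G H. G \<in> T ==> H \<subseteq> G ==> H \<in> T" and fv: "\<And>G. G \<in> T ==> G \<subseteq> set vs"
  and y: "y \<in> geom T" and z: "z \<in> geom (Pow P)" "P \<subseteq> {v. y v ~= 0}" and t: "0 \<le> t" "t \<le> 1"
 shows "(\<lambda>v. (1 - t) * y v + t * z v) \<in> geom T"
proof -
 let ?w = "\<lambda>v. (1 - t) * y v + t * z v"
 have yT: "{v. y v ~= 0} \<in> T" "\<And>v. 0 \<le> y v" using y by (auto simp: geom_def)
 have zP: "{v. z v ~= 0} \<subseteq> P" "\<And>v. 0 \<le> z v" using z(1) by (auto simp: geom_def)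
 have s: "{v. ?w v ~= 0} \<subseteq> {v. y v ~= 0}" using zP(1) z(2) by auto
 then have "{v. ?w v ~= 0} \<in> T" using dn yT(1) by blast
 moreover have "0 \<le> ?w v" for v using yT zP t by simp
 moreover have "(\<Sum>v\<in>{v. ?w v ~= 0}. ?w v) = (\<Sum>v\<in>set vs. ?w v)"
  by (rule sum.mono_neutral_left) (use s fv[OF yT(1)] in auto)
 moreover have "(\<Sum>v\<in>set vs. ?w v) = (1 - t) * (\<Sum>v\<in>set vs. y v) + t * (\<Sum>v\<in>set vs. z v)"
  by (simp add: sum.distrib sum_distrib_left)
 moreover have "(\<Sum>v\<in>set vs. y v) = 1" by (rule geom_sum[OF y fv])
 moreover have "(\<Sum>v\<in>set vs. z v) = 1" by (rule geom_sum[OF z(1)]) (use z(2) fv[OF yT(1)] in auto)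
 ultimately show ?thesis by (simp add: geom_def)
qed

text \<open>The vertex chosen for x is one where x v - c * p v is at least average; hence a vertex chosen near y satisfies y v > c * p v, which keeps the homotopy away from p.\<close>

lemma vertex_choice:
 fixes p :: "'v => real"
 assumes dn: "\<And>G H. G \<in> \<Gamma> ==> H \<subseteq> G ==> H \<in> \<Gamma>" and fv: "\<And>G. G \<in> \<Gamma> ==> G \<subseteq> set vs"
  and p: "\<And>v. 0 \<le> p v" "(\<Sum>v\<in>set vs. p v) \<le> 1" and c: "0 \<le> c" "c < 1"
 obtains \<phi> e where "e > 0" "\<And>x. x \<in> geom \<Gamma> ==> x (\<phi> x) ~= 0"
  "\<And>S y v. S \<subseteq> geom \<Gamma> ==> sml vs e S ==> y \<in> S ==> v \<in> \<phi> ` S ==> c * p v < y v"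
  "\<And>S. S ~= {} ==> S \<subseteq> geom \<Gamma> ==> sml vs e S ==> tgt \<Gamma> (geom \<Gamma>) \<phi> S"
proof -
 \<comment> \<open>If all differences were below e, their sum would be at most
   \<open>card (set vs) * e\<close> < 1 - c; but it is 1 minus c times a sum that is at most
   1.\<close>
 define e where "e = (1 - c) / (real (card (set vs)) + 1)"
 have e0: "0 < e" using c by (simp add: e_def)
 have eN: "real (card (set vs)) * e < 1 - c" using c e0 by (simp add: e_def field_simps)
 have "\<exists>v\<in>set vs. e \<le> x v - c * p v" if x: "x \<in> geom \<Gamma>" for x
 proof (rule ccontr)
  assume "\<not> ?thesis"
  then have "(\<Sum>v\<in>set vs. x v - c * p v) \<le> (\<Sum>v\<in>set vs. e)" by (intro sum_mono) auto
  moreover have "(\<Sum>v\<in>set vs. x v - c * p v) = 1 - c * (\<Sum>v\<in>set vs. p v)"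
   using geom_sum[OF x fv] by (simp add: sum_subtractf sum_distrib_left)
  moreover have "c * (\<Sum>v\<in>set vs. p v) \<le> c * 1" by (rule mult_left_mono) (use p c in auto)
  ultimately show False using eN by simp
 qed
 then obtain \<phi> where \<phi>: "\<And>x. x \<in> geom \<Gamma> ==> \<phi> x \<in> set vs \<and> e \<le> x (\<phi> x) - c * p (\<phi> x)" by metis
 have gt: "c * p v < y v" if h: "S \<subseteq> geom \<Gamma>" "sml vs e S" "y \<in> S" "v \<in> \<phi> ` S" for S y v
 proof -
  obtain z where z: "z \<in> S" "v = \<phi> z" using h by auto
  then have "\<phi> z \<in> set vs" "e \<le> z v - c * p v" using \<phi> h by auto
  moreover have "\<bar>y v - z v\<bar> < e" using h z calculation by (auto simp: sml_def)
  ultimately show ?thesis by linarith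
 qed
 have nn: "0 \<le> c * p v" for v using c p by simp
 show thesis
 proof
  show "e > 0" by (rule e0)
  show "\<And>x. x \<in> geom \<Gamma> ==> x (\<phi> x) ~= 0" using \<phi> nn e0 by (smt (verit))
  show "\<And>S y v. S \<subseteq> geom \<Gamma> ==> sml vs e S ==> y \<in> S ==> v \<in> \<phi> ` S ==> c * p v < y v" by (rule gt)
  fix S assume S: "S ~= {}" "S \<subseteq> geom \<Gamma>" "sml vs e S"
  have sup: "\<phi> ` S \<subseteq> {v. y v ~= 0}" if y: "y \<in> S" for y
  proof
   fix v assume "v \<in> \<phi> ` S"
   then show "v \<in> {v. y v ~= 0}" using gt[OF S(2,3) y] nn[of v] by (metis less_le_not_le mem_Collect_eq)
  qed
  show "tgt \<Gamma> (geom \<Gamma>) \<phi> S"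
   unfolding tgt_def
  proof (intro conjI ballI)
   obtain y where y: "y \<in> S" using S by blast
   then have "{v. y v ~= 0} \<in> \<Gamma>" using S(2) by (auto simp: geom_def)
   then show "\<phi> ` S \<in> \<Gamma>" using sup[OF y] dn by blast
   fix y z t assume h: "y \<in> S" "z \<in> geom (Pow (\<phi> ` S))" "t \<in> {0..1::real}"
   show "(\<lambda>v. (1 - t) * y v + t * z v) \<in> geom \<Gamma>"
    by (rule seg_geom[OF dn fv _ h(2) sup[OF h(1)]]) (use h S in auto)
  qed
 qed
qed

lemma apx_closed:
 assumes dv: "distinct vs" and fv: "\<And>G. G \<in> \<Gamma> ==> G \<subseteq> set vs"
  and dn: "\<And>G H. G \<in> \<Gamma> ==> H \<subseteq> G ==> H \<in> \<Gamma>" and dn': "\<And>G H. G \<in> \<Gamma>' ==> H \<subseteq> G ==> H \<in> \<Gamma>'" and sub: "\<Gamma>' \<subseteq> \<Gamma>"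
 shows "apx vs \<Gamma> \<Gamma>' (geom \<Gamma>')"
proof (unfold_locales, fact dv, erule fv, erule (1) dn, erule (1) dn', rule sub, rule subset_refl, rule geom_mono[OF sub])
 fix K :: "('a => real) set" assume K: "compact K" "K \<subseteq> geom \<Gamma>'"
 have fv': "\<And>G. G \<in> \<Gamma>' ==> G \<subseteq> set vs" using fv sub by blast
 \<comment> \<open>With p and c both 0, the choice only has to pick, for a small set S, vertices at
   which all points of S are positive; this keeps S inside any subcomplex that contains it.\<close>
 obtain \<phi> e where e: "e > 0" and ph: "\<And>x. x \<in> geom \<Gamma> ==> x (\<phi> x) ~= 0"
  and gt: "\<And>S y v. S \<subseteq> geom \<Gamma> ==> sml vs e S ==> y \<in> S ==> v \<in> \<phi> ` S ==> 0 * (0::real) < y v"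
  and t: "\<And>S. S ~= {} ==> S \<subseteq> geom \<Gamma> ==> sml vs e S ==> tgt \<Gamma> (geom \<Gamma>) \<phi> S"
  by (rule vertex_choice[of \<Gamma> vs "\<lambda>_. 0" 0, OF dn fv]) auto
 have "tgt \<Gamma>' (geom \<Gamma>') \<phi> S" if S: "S ~= {}" "S \<subseteq> K" "sml vs e S" for S
  unfolding tgt_def
 proof (intro conjI ballI)
  have SG: "S \<subseteq> geom \<Gamma>" "S \<subseteq> geom \<Gamma>'" using S K geom_mono[OF sub] by auto
  have sup: "\<phi> ` S \<subseteq> {v. y v ~= 0}" if y: "y \<in> S" for y using gt[OF SG(1) S(3) y] by force
  obtain y where y: "y \<in> S" using S by blast
  then have "{v. y v ~= 0} \<in> \<Gamma>'" using SG by (auto simp: geom_def)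
  then show "\<phi> ` S \<in> \<Gamma>'" using sup[OF y] dn' by blast
  fix y z t assume h: "y \<in> S" "z \<in> geom (Pow (\<phi> ` S))" "t \<in> {0..1::real}"
  show "(\<lambda>v. (1 - t) * y v + t * z v) \<in> geom \<Gamma>'"
   by (rule seg_geom[OF dn' fv' _ h(2) sup[OF h(1)]]) (use h SG in auto)
 qed
 with e ph t show "\<exists>\<phi>. \<exists>e>0. (\<forall>x\<in>geom \<Gamma>. x (\<phi> x) ~= 0) \<and>
   (\<forall>S. S ~= {} --> S \<subseteq> geom \<Gamma> --> sml vs e S --> tgt \<Gamma> (geom \<Gamma>) \<phi> S) \<and>
   (\<forall>S. S ~= {} --> S \<subseteq> K --> sml vs e S --> tgt \<Gamma>' (geom \<Gamma>') \<phi> S)"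
  by (intro exI[of _ \<phi>] exI[of _ e]) simp
qed

text \<open>Coordinates of points sum to 1, so a point other than p is strictly below p in some
  coordinate. The total deficit on the vertices of p is continuous and attains a positive minimum on
  the compact set, which makes the gap uniform.\<close>

lemma point_gap:
 assumes fv: "\<And>G. G \<in> \<Gamma> ==> G \<subseteq> set vs" and p: "p \<in> geom \<Gamma>" and K: "compact K" "K \<subseteq> geom \<Gamma> - {p}"
 obtains c where "0 \<le> c" "c < 1" "\<And>y. y \<in> K ==> \<exists>v. p v ~= 0 \<and> y v < c * p v"
proof (cases "K = {}")
 case True
 show thesis by (rule that[of 0]) (use True in auto)
next
 case False
 let ?F = "{v. p v ~= 0}"
 have F: "?F \<subseteq> set vs" "\<And>v. 0 \<le> p v" "(\<Sum>v\<in>?F. p v) = 1" using p fv by (auto simp: geom_def)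
 have fF: "finite ?F" using F(1) finite_subset by blast
 have p1: "p v \<le> 1" for v
 proof (cases "p v = 0")
  case False
  then have "p v \<le> (\<Sum>v\<in>?F. p v)" using fF F(2) by (intro member_le_sum) auto
  then show ?thesis using F(3) by simp
 qed simp
 define g where "g y = (\<Sum>v\<in>?F. max 0 (p v - y v))" for y
 have cg: "continuous_on K g" unfolding g_def
  by (intro continuous_intros continuous_on_product_coordinates[THEN continuous_on_subset] subset_UNIV)
 obtain y0 where y0: "y0 \<in> K" "\<And>y. y \<in> K ==> g y0 \<le> g y" using continuous_attains_inf[OF K(1) False cg] by blast
 have g_pos: "0 < g y" if y: "y \<in> K" for y
 proof (rule ccontr)
  assume n: "\<not> 0 < g y"
  have nn: "0 \<le> max 0 (p v - y v)" for v by simp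
  have "0 \<le> g y" unfolding g_def by (rule sum_nonneg) simp
  then have "(\<Sum>v\<in>?F. max 0 (p v - y v)) = 0" using n by (simp add: g_def)
  then have "\<forall>v\<in>?F. max 0 (p v - y v) = 0" using sum_nonneg_eq_0_iff[OF fF, of "\<lambda>v. max 0 (p v - y v)"] nn by auto
  then have le: "p v \<le> y v" if "p v ~= 0" for v using that by (smt (verit) mem_Collect_eq)
  have yg: "y \<in> geom \<Gamma>" "y ~= p" using y K by auto
  then have y0: "\<And>v. 0 \<le> y v" by (simp add: geom_def)
  have le': "p v \<le> y v" for v using le[of v] y0[of v] by (cases "p v = 0") auto
  have "(\<Sum>v\<in>set vs. y v - p v) = 0" using geom_sum[OF yg(1) fv] geom_sum[OF p fv] by (simp add: sum_subtractf)
  then have "\<forall>v\<in>set vs. y v - p v = 0" using sum_nonneg_eq_0_iff[of "set vs" "\<lambda>v. y v - p v"] le' by auto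
  moreover have "y v = 0 \<and> p v = 0" if "v \<notin> set vs" for v using that F(1) yg(1) fv by (auto simp: geom_def)
  ultimately have "y v = p v" for v by (metis eq_iff_diff_eq_0)
  then show False using yg(2) by auto
 qed
 have Fne: "?F ~= {}" using F(3) by (metis sum.empty zero_neq_one)
 \<comment> \<open>The average deficit, capped at 1. Coordinates of p are at most 1, so a deficit of
   \<eta> in the coordinate v is more than the fraction \<eta> / 2 of \<open>p v\<close>.\<close>
 define \<eta> where "\<eta> = min 1 (g y0 / real (card ?F))"
 have cF: "0 < real (card ?F)" using fF Fne by (simp add: card_gt_0_iff)
 have eta: "0 < \<eta>" "\<eta> \<le> 1" "\<eta> \<le> g y0 / real (card ?F)" using g_pos[OF y0(1)] cF by (auto simp: \<eta>_def)
 show thesis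
 proof (rule that[of "1 - \<eta> / 2"])
  show "0 \<le> 1 - \<eta> / 2" "1 - \<eta> / 2 < 1" using eta by auto
  fix y assume y: "y \<in> K"
  have "\<exists>v\<in>?F. \<eta> \<le> max 0 (p v - y v)"
  proof (rule ccontr)
   assume "\<not> ?thesis"
   then have "g y < (\<Sum>v\<in>?F. \<eta>)" unfolding g_def by (intro sum_strict_mono fF Fne) auto
   also have "\<dots> = real (card ?F) * \<eta>" by simp
   also have "\<dots> \<le> g y0" using eta(3) cF by (simp add: pos_le_divide_eq mult.commute)
   finally show False using y0(2)[OF y] by simp
  qed
  then obtain v where v: "p v ~= 0" "\<eta> \<le> max 0 (p v - y v)" by auto
  then have "\<eta> \<le> p v - y v" using eta(1) by (auto simp: max_def split: if_splits)
  moreover have "\<eta> / 2 * p v \<le> \<eta> / 2 * 1" by (rule mult_left_mono) (use p1 eta in auto)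
  moreover have "(1 - \<eta> / 2) * p v = p v - \<eta> / 2 * p v" by (simp add: left_diff_distrib)
  ultimately have "y v < (1 - \<eta> / 2) * p v" using eta(1) by linarith
  with v(1) show "\<exists>v. p v ~= 0 \<and> y v < (1 - \<eta> / 2) * p v" by blast
 qed
qed

text \<open>The contrastar of F, the combinatorial stand-in for the complement of a point in the
  interior of F.\<close>

definition cost :: "'v set => 'v set set => 'v set set" where "cost F \<Gamma> = {G \<in> \<Gamma>. \<not> F \<subseteq> G}"

lemma apx_point:
 assumes dv: "distinct vs" and fv: "\<And>G. G \<in> \<Gamma> ==> G \<subseteq> set vs"
  and dn: "\<And>G H. G \<in> \<Gamma> ==> H \<subseteq> G ==> H \<in> \<Gamma>" and p: "p \<in> geom \<Gamma>"
 shows "apx vs \<Gamma> (cost {v. p v ~= 0} \<Gamma>) (geom \<Gamma> - {p})"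
proof (unfold_locales, fact dv, erule fv, erule (1) dn)
 let ?F = "{v. p v ~= 0}"
 let ?C = "cost ?F \<Gamma>"
 show "\<And>G H. G \<in> ?C ==> H \<subseteq> G ==> H \<in> ?C" using dn by (auto simp: cost_def)
 show CG: "?C \<subseteq> \<Gamma>" by (auto simp: cost_def)
 show "geom ?C \<subseteq> geom \<Gamma> - {p}" using geom_mono[OF CG] by (auto simp: geom_def cost_def)
 show "geom \<Gamma> - {p} \<subseteq> geom \<Gamma>" by blast
 fix K :: "('a => real) set" assume K: "compact K" "K \<subseteq> geom \<Gamma> - {p}"
 obtain c where c: "0 \<le> c" "c < 1" and lt: "\<And>y. y \<in> K ==> \<exists>v. p v ~= 0 \<and> y v < c * p v"
 proof (rule point_gap[OF _ p K])
  fix c assume "0 \<le> c" "c < 1" "\<And>y. y \<in> K ==> \<exists>v. p v ~= 0 \<and> y v < c * p v"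
  then show thesis by (rule that)
 qed (rule fv)
 have p0: "\<And>v. 0 \<le> p v" using p by (simp add: geom_def)
 have p1: "(\<Sum>v\<in>set vs. p v) \<le> 1" using geom_sum[OF p fv] by simp
 obtain \<phi> e where e: "e > 0" and ph: "\<And>x. x \<in> geom \<Gamma> ==> x (\<phi> x) ~= 0"
  and gt: "\<And>S y v. S \<subseteq> geom \<Gamma> ==> sml vs e S ==> y \<in> S ==> v \<in> \<phi> ` S ==> c * p v < y v"
  and t: "\<And>S. S ~= {} ==> S \<subseteq> geom \<Gamma> ==> sml vs e S ==> tgt \<Gamma> (geom \<Gamma>) \<phi> S"
  by (rule vertex_choice[OF dn fv p0 p1 c]) auto
 have "tgt ?C (geom \<Gamma> - {p}) \<phi> S" if S: "S ~= {}" "S \<subseteq> K" "sml vs e S" for S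
  unfolding tgt_def
 proof (intro conjI ballI)
  have SG: "S \<subseteq> geom \<Gamma>" using S K by auto
  note tS = t[OF S(1) SG S(3)]
  \<comment> \<open>A vertex chosen on S has coordinate above \<open>c * p v\<close> everywhere on
    S, so the deficient coordinate of y belongs to no chosen vertex: the chosen vertices miss part
    of the carrier of p.\<close>
  have out: "\<exists>v. p v ~= 0 \<and> y v < c * p v \<and> v \<notin> \<phi> ` S" if y: "y \<in> S" for y
   using lt[of y] gt[OF SG S(3) y] y S(2) by (metis less_asym subsetD)
  obtain y where y: "y \<in> S" using S by blast
  show "\<phi> ` S \<in> ?C" using tS out[OF y] by (auto simp: tgt_def cost_def)
  fix y z s assume h: "y \<in> S" "z \<in> geom (Pow (\<phi> ` S))" "s \<in> {0..1::real}"
  let ?w = "\<lambda>v. (1 - s) * y v + s * z v"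
  have "?w \<in> geom \<Gamma>" using tS h by (simp add: tgt_def)
  \<comment> \<open>Along the segment the deficient coordinate only decreases, as z vanishes there,
    so it never reaches \<open>p v\<close>.\<close>
  moreover have "?w ~= p"
  proof
   assume eq: "?w = p"
   obtain v where v: "p v ~= 0" "y v < c * p v" "v \<notin> \<phi> ` S" using out[OF h(1)] by blast
   have "z v = 0" using h(2) v(3) by (auto simp: geom_def)
   then have "p v = (1 - s) * y v" using fun_cong[OF eq, of v] by simp
   also have "\<dots> \<le> 1 * y v" by (rule mult_right_mono) (use h SG in \<open>auto simp: geom_def\<close>)
   also have "\<dots> < c * p v" using v by simp
   also have "\<dots> \<le> 1 * p v" by (rule mult_right_mono) (use c p0 in auto)
   finally show False by simp
  qed
  ultimately show "?w \<in> geom \<Gamma> - {p}" by blast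
 qed
 with e ph t show "\<exists>\<phi>. \<exists>e>0. (\<forall>x\<in>geom \<Gamma>. x (\<phi> x) ~= 0) \<and>
   (\<forall>S. S ~= {} --> S \<subseteq> geom \<Gamma> --> sml vs e S --> tgt \<Gamma> (geom \<Gamma>) \<phi> S) \<and>
   (\<forall>S. S ~= {} --> S \<subseteq> K --> sml vs e S --> tgt ?C (geom \<Gamma> - {p}) \<phi> S)"
  by (intro exI[of _ \<phi>] exI[of _ e]) simp
qed

section \<open>Homology dimensions in terms of simplicial chains\<close>

lemma chains_lin: "0 \<in> chains n X" "c \<in> chains n X ==> d \<in> chains n X ==> c + d \<in> chains n X" "c \<in> chains n X ==> sc a c \<in> chains n X"
 "c \<in> chains n X ==> d \<in> chains n X ==> c - d \<in> chains n X"
 subgoal by (simp add: chains_def)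
 subgoal using keys_add[of c d] unfolding chains_def by blast
 subgoal by (auto simp: chains_def in_keys_iff)
 subgoal using keys_diff'[of _ c d] unfolding chains_def by blast
 done

lemma chains_mono: "X \<subseteq> Y ==> chains n X \<subseteq> chains n Y"
 by (auto simp: chains_def singular_simplex_iff)

lemma bdry_lin: "bdry n 0 = 0" "bdry n (c + d) = bdry n c + bdry n d" "bdry n (sc a c) = sc a (bdry n c)" "bdry n (c - d) = bdry n c - bdry n d"
 by (simp_all add: bdry_eq ext_add ext_sc ext_diff)

definition aug :: "('a, 'k::field) kchain => 'k" where "aug c = (\<Sum>f\<in>kys c. lk c f)"

lemma aug_ext: "aug c = lk (ext (\<lambda>f. sg1 ()) c) ()"
 by (simp add: aug_def lookup_ext[OF finite_keys subset_refl])

lemma aug_lin: "aug 0 = 0" "aug (c + d) = aug c + aug d" "aug (sc a c) = a * aug c" "aug (c - d) = aug c - aug d"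
 by (simp_all add: aug_ext ext_add ext_sc ext_diff lookup_add lookup_minus)

text \<open>The two endpoints of a path have opposite signs.\<close>

lemma aug_bdry: fixes c :: "('a::topological_space, 'k::field) kchain" shows "aug (bdry 1 c) = 0"
proof -
 have "aug (bq 1 f :: ('a, 'k) kchain) = 0" for f by (simp add: bq_def aug_lin) (simp add: aug_ext)
 then have "ext (\<lambda>f. ext (\<lambda>f. sg1 ()) (bq 1 f :: ('a, 'k) kchain)) c = (ext (\<lambda>f. 0) c :: unit \<Rightarrow>\<^sub>0 'k)"
  by (intro ext_cong poly_mapping_eqI) (simp add: aug_ext)
 then have "ext (\<lambda>f. sg1 ()) (ext (bq 1) c) = 0" unfolding ext_ext by (simp add: ext_def[of "\<lambda>f. 0"])
 then show ?thesis by (simp add: aug_ext bdry_eq)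
qed

lemma rel_boundaries_lin: "0 \<in> rel_boundaries n X A" "c \<in> rel_boundaries n X A ==> d \<in> rel_boundaries n X A ==> c + d \<in> rel_boundaries n X A"
 "c \<in> rel_boundaries n X A ==> sc a c \<in> rel_boundaries n X A"
proof -
 show "0 \<in> rel_boundaries n X A" unfolding rel_boundaries_def mem_Collect_eq
  by (intro conjI bexI[of _ 0]) (simp_all add: chains_lin(1) bdry_lin(1))
 show "c + d \<in> rel_boundaries n X A" if h: "c \<in> rel_boundaries n X A" "d \<in> rel_boundaries n X A"
 proof -
  obtain e1 e2 where e: "e1 \<in> chains (n + 1) X" "e2 \<in> chains (n + 1) X" "c - bdry (n + 1) e1 \<in> chains n A" "d - bdry (n + 1) e2 \<in> chains n A"
   using h by (auto simp: rel_boundaries_def)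
  have "c + d - bdry (n + 1) (e1 + e2) = (c - bdry (n + 1) e1) + (d - bdry (n + 1) e2)" by (simp add: bdry_lin)
  then have "c + d - bdry (n + 1) (e1 + e2) \<in> chains n A" using chains_lin(2)[OF e(3,4)] by (simp only:)
  then show ?thesis using h chains_lin(2)[OF e(1,2)] chains_lin(2) unfolding rel_boundaries_def by blast
 qed
 show "sc a c \<in> rel_boundaries n X A" if h: "c \<in> rel_boundaries n X A"
 proof -
  obtain e1 where e: "e1 \<in> chains (n + 1) X" "c - bdry (n + 1) e1 \<in> chains n A"
   using h by (auto simp: rel_boundaries_def)
  have "sc a c - bdry (n + 1) (sc a e1) = sc a (c - bdry (n + 1) e1)" by (simp add: bdry_lin sc_diff)
  then have "sc a c - bdry (n + 1) (sc a e1) \<in> chains n A" using chains_lin(3)[OF e(2)] by (simp only:)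
  then show ?thesis using h chains_lin(3)[OF e(1)] chains_lin(3) unfolding rel_boundaries_def by blast
 qed
qed

lemma sum_mem: "0 \<in> B ==> (\<And>c d. c \<in> B ==> d \<in> B ==> c + d \<in> B) ==> (\<And>s. s \<in> S ==> h s \<in> B) ==> (\<Sum>s\<in>S. h s) \<in> (B :: 'a::comm_monoid_add set)"
 by (induction S rule: infinite_finite_induct) auto

lemma quot_dim_ge: "finite S ==> S \<subseteq> Z ==> independent_mod B S ==> enat (card S) \<le> quot_dim Z B"
 unfolding quot_dim_def by (rule SUP_upper) auto

lemma independent_mod_sc: "independent_mod B S \<longleftrightarrow> (\<forall>a. (\<Sum>s\<in>S. sc (a s) s) \<in> B --> (\<forall>s\<in>S. a s = 0))"
 by (simp add: independent_mod_def sc_def)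

lemma quot_dim_eq_0:
 assumes "\<And>c a. c \<in> B ==> sc a c \<in> B" "0 \<in> B"
 shows "quot_dim Z B = 0 \<longleftrightarrow> Z \<subseteq> B"
proof
 assume q: "quot_dim Z B = 0"
 show "Z \<subseteq> B"
 proof
  fix z assume z: "z \<in> Z"
  show "z \<in> B"
  proof (rule ccontr)
   assume n: "z \<notin> B"
   have "independent_mod B {z}" unfolding independent_mod_sc
   proof (intro allI impI ballI)
    fix a s assume "(\<Sum>s\<in>{z}. sc (a s) s) \<in> B" "s \<in> {z}"
    then have h: "sc (a z) z \<in> B" "s = z" by auto
    show "a s = 0"
    proof (rule ccontr)
     assume "a s ~= 0"
     then have "sc (1 / a z) (sc (a z) z) = z" using h by simp
     then show False using assms(1)[OF h(1), of "1 / a z"] n by simp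
    qed
   qed
   with quot_dim_ge[of "{z}" Z B] z q show False by (simp add: zero_enat_def one_enat_def)
  qed
 qed
next
 assume ZB: "Z \<subseteq> B"
 have "card S = 0" if S: "finite S" "S \<subseteq> Z" "independent_mod B S" for S
 proof -
  have "s \<notin> S" for s
  proof
   assume s: "s \<in> S"
   have "(\<Sum>t\<in>S. sc (if t = s then 1 else 0) t) = (\<Sum>t\<in>S. if t = s then s else 0)" by (rule sum.cong) auto
   also have "\<dots> = s" using s S by simp
   finally have "(\<Sum>t\<in>S. sc (if t = s then 1 else 0) t) \<in> B" using ZB S(2) s by auto
   then have "\<forall>t\<in>S. (if t = s then 1 else (0::'b)) = 0" using S(3) unfolding independent_mod_sc by (elim allE impE)
   then show False using s by auto
  qed
  then have "S = {}" by blast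
  then show ?thesis by simp
 qed
 then have "quot_dim Z B \<le> 0" unfolding quot_dim_def by (intro SUP_least) (simp add: zero_enat_def)
 then show "quot_dim Z B = 0" by simp
qed

lemma quot_dim_1:
 assumes "quot_dim Z B = 1" "y \<in> Z" "z \<in> Z" "y ~= z"
 obtains a b where "a ~= 0 \<or> b ~= 0" "sc a y + sc b z \<in> B"
proof -
 have "\<not> independent_mod B {y, z}"
 proof
  assume "independent_mod B {y, z}"
  then have "enat (card {y, z}) \<le> 1" using quot_dim_ge[of "{y, z}" Z B] assms by auto
  then show False using assms(4) by (simp add: one_enat_def)
 qed
 then obtain a where "(\<Sum>s\<in>{y, z}. sc (a s) s) \<in> B" "\<not> (\<forall>s\<in>{y, z}. a s = 0)" unfolding independent_mod_sc by blast
 then show thesis using that[of "a y" "a z"] assms(4) by auto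
qed

text \<open>The inclusion induces an isomorphism of the quotients:
  \<open>B2 \<inter> Z1 \<subseteq> B1\<close> gives injectivity and \<open>onto\<close>
  surjectivity. Independent sets are carried one way as they are and the other way by choosing
  representatives.\<close>

lemma quot_dim_cong:
 assumes Z: "Z1 \<subseteq> Z2" and B: "B1 \<subseteq> B2" "B2 \<inter> Z1 \<subseteq> B1" and onto: "\<And>z. z \<in> Z2 ==> \<exists>y\<in>Z1. z - y \<in> B2"
  and lin1: "0 \<in> Z1" "\<And>c d. c \<in> Z1 ==> d \<in> Z1 ==> c + d \<in> Z1" "\<And>c a. c \<in> Z1 ==> sc a c \<in> Z1"
  and lin2: "0 \<in> B2" "\<And>c d. c \<in> B2 ==> d \<in> B2 ==> c + d \<in> B2" "\<And>c a. c \<in> B2 ==> sc a c \<in> B2"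
 shows "quot_dim Z1 B1 = quot_dim Z2 B2"
proof (rule antisym)
 show "quot_dim Z1 B1 \<le> quot_dim Z2 B2"
  unfolding quot_dim_def[of Z1]
 proof (rule SUP_least)
  fix S assume "S \<in> {S. finite S \<and> S \<subseteq> Z1 \<and> independent_mod B1 S}"
  then have S: "finite S" "S \<subseteq> Z1" "independent_mod B1 S" by auto
  have "(\<Sum>s\<in>S. sc (a s) s) \<in> Z1" for a by (rule sum_mem) (use lin1 S in auto)
  then have "independent_mod B2 S" using S(3) B(2) unfolding independent_mod_sc by blast
  then show "enat (card S) \<le> quot_dim Z2 B2" using S Z by (intro quot_dim_ge) auto
 qed
 show "quot_dim Z2 B2 \<le> quot_dim Z1 B1"
  unfolding quot_dim_def[of Z2]
 proof (rule SUP_least)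
  fix S assume "S \<in> {S. finite S \<and> S \<subseteq> Z2 \<and> independent_mod B2 S}"
  then have S: "finite S" "S \<subseteq> Z2" "independent_mod B2 S" by auto
  obtain r where r: "\<And>z. z \<in> Z2 ==> r z \<in> Z1 \<and> z - r z \<in> B2" using onto by metis
  have key: "\<forall>s\<in>S. a s = 0" if a: "(\<Sum>s\<in>S. sc (a s) (r s)) \<in> B2" for a
  proof -
   have "(\<Sum>s\<in>S. sc (a s) s) = (\<Sum>s\<in>S. sc (a s) (r s)) + (\<Sum>s\<in>S. sc (a s) (s - r s))"
    by (simp add: sum.distrib[symmetric] sc_diff)
   moreover have "(\<Sum>s\<in>S. sc (a s) (s - r s)) \<in> B2" by (rule sum_mem) (use lin2 r S in auto)
   ultimately have "(\<Sum>s\<in>S. sc (a s) s) \<in> B2" using lin2(2)[OF a] by simp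
   then show ?thesis using S(3) unfolding independent_mod_sc by blast
  qed
  have inj: "inj_on r S"
  proof (rule inj_onI, rule ccontr)
   fix s t assume st: "s \<in> S" "t \<in> S" "r s = r t" "s ~= t"
   \<comment> \<open>Equal representatives would make 1 and -1 the coefficients of a relation; so
     choosing representatives does not shrink an independent set.\<close>
   define a where "a u = (if u = s then 1 else if u = t then -1 else 0 :: 'b)" for u
   have "(\<Sum>u\<in>S. sc (a u) (r u)) = (\<Sum>u\<in>{s, t}. sc (a u) (r u))"
    by (rule sum.mono_neutral_right) (use S st in \<open>auto simp: a_def\<close>)
   also have "\<dots> = 0" using st by (simp add: a_def sc_uminus)
   finally have "\<forall>s\<in>S. a s = 0" using key lin2(1) by simp
   then show False using st(1) by (auto simp: a_def)
  qed
  have "independent_mod B1 (r ` S)" unfolding independent_mod_sc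
  proof (intro allI impI)
   fix a assume "(\<Sum>s\<in>r ` S. sc (a s) s) \<in> B1"
   then have "(\<Sum>s\<in>S. sc (a (r s)) (r s)) \<in> B2" using B(1) by (simp add: sum.reindex[OF inj] subsetD)
   then show "\<forall>s\<in>r ` S. a s = 0" using key[of "\<lambda>s. a (r s)"] by simp
  qed
  then have "enat (card (r ` S)) \<le> quot_dim Z1 B1" by (intro quot_dim_ge) (use S r in auto)
  then show "enat (card S) \<le> quot_dim Z1 B1" by (simp add: card_image[OF inj])
 qed
qed

section \<open>Chains relative to the faces not containing F, and local homology\<close>

definition cx :: "'v list => 'v set set => bool" where
 "cx vs \<Gamma> \<longleftrightarrow> distinct vs \<and> (\<forall>G\<in>\<Gamma>. G \<subseteq> set vs) \<and> (\<forall>G\<in>\<Gamma>. \<forall>H\<subseteq>G. H \<in> \<Gamma>)"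

text \<open>Simplicial chains are functions on faces, and p counts vertices, so it is the degree plus 1; chains relative to the faces not containing F are compared only on the faces containing F.\<close>

definition rc :: "'v list => 'v set set => 'v set => nat => ('v set => 'k::field) => bool" where
 "rc vs \<Gamma> F p c \<longleftrightarrow> spt p \<Gamma> c \<and> (\<forall>G. F \<subseteq> G --> bnd vs c G = 0)"

text \<open>Vanishing of the homology relative to the contrastar of F, that is, of the local
  homology at an interior point of F, in degree p - 1.\<close>

definition van :: "'k::field itself => 'v list => 'v set set => 'v set => nat => bool" where
 "van K vs \<Gamma> F p \<longleftrightarrow> (\<forall>c :: 'v set => 'k. rc vs \<Gamma> F p c --> (\<exists>e. spt (Suc p) \<Gamma> e \<and> (\<forall>G. F \<subseteq> G --> c G = bnd vs e G)))"

definition bary :: "'v set => 'v => real" where "bary F v = (if v \<in> F then 1 / real (card F) else 0)"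

lemma bary_supp: "finite F ==> F ~= {} ==> {v. bary F v ~= 0} = F"
 by (auto simp: bary_def card_gt_0_iff)

lemma bary_geom: "finite F ==> F ~= {} ==> F \<in> \<Gamma> ==> bary F \<in> geom \<Gamma>"
 using bary_supp[of F] by (auto simp: geom_def bary_def)

lemma cxD: "cx vs \<Gamma> ==> distinct vs" "cx vs \<Gamma> ==> G \<in> \<Gamma> ==> G \<subseteq> set vs" "cx vs \<Gamma> ==> G \<in> \<Gamma> ==> H \<subseteq> G ==> H \<in> \<Gamma>"
 "cx vs \<Gamma> ==> G \<in> \<Gamma> ==> finite G"
 by (auto simp: cx_def intro: finite_subset)

lemma bnd_supp: "bnd vs c G ~= 0 ==> \<exists>v\<in>set vs. v \<notin> G \<and> c (insert v G) ~= (0::'k::field)"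
 unfolding bnd_def by (erule sum.not_neutral_contains_not_neutral) (auto simp: ct_def split: if_splits)

lemma bnd_spt: "cx vs \<Gamma> ==> spt (Suc p) \<Gamma> c ==> spt p \<Gamma> (bnd vs c :: 'v set => 'k::field)"
 unfolding spt_def
proof (intro allI impI)
 fix G assume h: "cx vs \<Gamma>" "\<forall>G. c G ~= 0 --> G \<in> \<Gamma> \<and> card G = Suc p" "bnd vs c G ~= 0"
 obtain v where v: "v \<notin> G" "c (insert v G) ~= 0" using bnd_supp[OF h(3)] by blast
 then have i: "insert v G \<in> \<Gamma>" "card (insert v G) = Suc p" using h(2) by auto
 then have "finite G" using cxD(4)[OF h(1)] by fastforce
 with i v(1) cxD(3)[OF h(1) i(1)] show "G \<in> \<Gamma> \<and> card G = p" by auto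
qed

lemma bnd_cong_above: "(\<And>H. F \<subseteq> H ==> c H = e H) ==> F \<subseteq> G ==> bnd vs c G = bnd vs e G"
 unfolding bnd_def ct_def by (intro sum.cong refl) (simp add: subset_insertI2)

context
 fixes K :: "'k::field itself" and vs :: "'v list" and \<Gamma> :: "'v set set" and x :: "'v => real" and F :: "'v set"
 assumes cx: "cx vs \<Gamma>" and x: "x \<in> geom \<Gamma>" and F: "F = {v. x v ~= 0}"
begin

interpretation pt: apx vs \<Gamma> "cost F \<Gamma>" "geom \<Gamma> - {x}"
 unfolding F by (rule apx_point) (use cx x in \<open>auto dest: cxD\<close>)

lemma F_ne: "F ~= {}" using x F by (auto simp: geom_def)

lemma rc_LL:
 assumes "rc vs \<Gamma> F (Suc p) (c :: 'v set => 'k)"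
 shows "LL vs c \<in> rel_cycles (int p) (geom \<Gamma>) (geom \<Gamma> - {x})"
proof -
 have c: "spt (Suc p) \<Gamma> c" "\<And>G. F \<subseteq> G ==> bnd vs c G = 0" using assms by (auto simp: rc_def)
 have 1: "LL vs c \<in> chains (int p) (geom \<Gamma>)" unfolding chains_SS using pt.LL_keys[OF c(1)] pt.dn by blast
 have "bdry (int p) (LL vs c) \<in> chains (int p - 1) (geom \<Gamma> - {x})"
 proof (cases p)
  case 0
  then show ?thesis by (simp add: bdry_eq chains_lin)
 next
  case (Suc q)
  have "spt (Suc q) (cost F \<Gamma>) (bnd vs c)"
   using bnd_spt[OF cx c(1)] c(2) by (auto simp: spt_def cost_def Suc)
  then have "kys (LL vs (bnd vs c)) \<subseteq> SS q (geom (cost F \<Gamma>))"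
   by (rule pt.LL_keys) (use pt.sub pt.dn' in blast)+
  then have "kys (LL vs (bnd vs c)) \<subseteq> SS q (geom \<Gamma> - {x})" using pt.gA by (auto simp: singular_simplex_iff)
  moreover have "bdry (int p) (LL vs c) = LL vs (bnd vs c)" unfolding bdry_bk by (rule bk_bk_LL[OF cxD(1)[OF cx] c(1)])
  ultimately show ?thesis by (simp add: Suc chains_SS)
 qed
 with 1 show ?thesis by (simp add: rel_cycles_def)
qed

lemma rb_LL:
 assumes "spt (Suc p) \<Gamma> (c :: 'v set => 'k)" "LL vs c \<in> rel_boundaries (int p) (geom \<Gamma>) (geom \<Gamma> - {x})"
 shows "\<exists>e. spt (Suc (Suc p)) \<Gamma> e \<and> (\<forall>G. F \<subseteq> G --> c G = bnd vs e G)"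
proof -
 obtain e where e: "spt (Suc (Suc p)) \<Gamma> e" "spt (Suc p) (cost F \<Gamma>) (\<lambda>G. c G - bnd vs e G)" using pt.inj[OF assms] by blast
 then have "c G = bnd vs e G" if "F \<subseteq> G" for G using that unfolding spt_def cost_def by (metis (mono_tags, lifting) mem_Collect_eq eq_iff_diff_eq_0)
 with e(1) show ?thesis by blast
qed

lemma cost_LL: "spt (Suc p) \<Gamma> (c :: 'v set => 'k) ==> (\<And>G. F \<subseteq> G ==> c G = 0) ==> LL vs c \<in> chains (int p) (geom \<Gamma> - {x})"
proof -
 assume "spt (Suc p) \<Gamma> c" "\<And>G. F \<subseteq> G ==> c G = 0"
 then have "spt (Suc p) (cost F \<Gamma>) c" by (auto simp: spt_def cost_def)
 then have "kys (LL vs c) \<subseteq> SS p (geom (cost F \<Gamma>))"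
  by (rule pt.LL_keys) (use pt.sub pt.dn' in blast)+
 then show ?thesis using pt.gA by (auto simp: chains_SS singular_simplex_iff)
qed

lemma chain_rb: "c \<in> chains n A ==> A \<subseteq> X ==> c \<in> rel_boundaries n X A"
 unfolding rel_boundaries_def mem_Collect_eq
 by (intro conjI bexI[of _ 0]) (use chains_mono[of A X n] in \<open>auto simp: chains_lin(1) bdry_lin(1)\<close>)

lemma rc_surj:
 fixes z :: "('v => real, 'k) kchain"
 assumes "z \<in> rel_cycles (int p) (geom \<Gamma>) (geom \<Gamma> - {x})"
 shows "\<exists>c. rc vs \<Gamma> F (Suc p) c \<and> z - LL vs c \<in> rel_boundaries (int p) (geom \<Gamma>) (geom \<Gamma> - {x})"
proof -
 obtain c where c: "spt (Suc p) \<Gamma> c" "\<forall>G. bnd vs c G ~= 0 --> G ~= {} --> G \<in> cost F \<Gamma>" "z - LL vs c \<in> rel_boundaries (int p) (geom \<Gamma>) (geom \<Gamma> - {x})"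
  using pt.surj[OF assms] by blast
 have "bnd vs c G = 0" if "F \<subseteq> G" for G using c(2) that F_ne by (auto simp: cost_def)
 with c(1,3) show ?thesis by (auto simp: rc_def)
qed

lemma van_from_dim:
 assumes "homology_dim K (int p) (geom \<Gamma>) (geom \<Gamma> - {x}) = 0"
 shows "van K vs \<Gamma> F (Suc p)"
 unfolding van_def
proof (intro allI impI)
 fix c :: "'v set => 'k" assume c: "rc vs \<Gamma> F (Suc p) c"
 have "(rel_cycles (int p) (geom \<Gamma>) (geom \<Gamma> - {x}) :: ('v => real, 'k) kchain set) \<subseteq> rel_boundaries (int p) (geom \<Gamma>) (geom \<Gamma> - {x})"
  using assms unfolding homology_dim_def by (subst (asm) quot_dim_eq_0) (auto intro: rel_boundaries_lin)
 then show "\<exists>e. spt (Suc (Suc p)) \<Gamma> e \<and> (\<forall>G. F \<subseteq> G --> c G = bnd vs e G)"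
  using rb_LL rc_LL[OF c] c by (auto simp: rc_def)
qed

context
 fixes p :: nat assumes top: "\<And>G. G \<in> \<Gamma> ==> card G \<le> Suc p"
begin

text \<open>There are no faces with one more vertex, hence no boundaries on the star of F: in the
  top degree local homology classes are determined by their values on the faces containing
  F.\<close>

lemma top_rb:
 assumes "spt (Suc p) \<Gamma> (c :: 'v set => 'k)" "LL vs c \<in> rel_boundaries (int p) (geom \<Gamma>) (geom \<Gamma> - {x})" "F \<subseteq> G"
 shows "c G = 0"
proof -
 obtain e where e: "spt (Suc (Suc p)) \<Gamma> e" "\<forall>G. F \<subseteq> G --> c G = bnd vs e G" using rb_LL[OF assms(1,2)] by blast
 have "e H = 0" for H using e(1) top by (fastforce simp: spt_def)
 then have "bnd vs e G = 0" using bnd_supp by blast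
 then show ?thesis using e(2) assms(3) by simp
qed

lemma top_dim_0: "homology_dim K (int p) (geom \<Gamma>) (geom \<Gamma> - {x}) = 0 \<longleftrightarrow> (\<forall>c :: 'v set => 'k. rc vs \<Gamma> F (Suc p) c --> (\<forall>G. F \<subseteq> G --> c G = 0))"
proof -
 let ?Z = "rel_cycles (int p) (geom \<Gamma>) (geom \<Gamma> - {x}) :: ('v => real, 'k) kchain set" and ?B = "rel_boundaries (int p) (geom \<Gamma>) (geom \<Gamma> - {x}) :: ('v => real, 'k) kchain set"
 have "?Z \<subseteq> ?B \<longleftrightarrow> (\<forall>c :: 'v set => 'k. rc vs \<Gamma> F (Suc p) c --> (\<forall>G. F \<subseteq> G --> c G = 0))"
 proof
  assume "?Z \<subseteq> ?B"
  then show "\<forall>c :: 'v set => 'k. rc vs \<Gamma> F (Suc p) c --> (\<forall>G. F \<subseteq> G --> c G = 0)"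
  proof (intro allI impI)
   fix c :: "'v set => 'k" and G assume h: "?Z \<subseteq> ?B" "rc vs \<Gamma> F (Suc p) c" "F \<subseteq> G"
   have "spt (Suc p) \<Gamma> c" using h(2) by (simp add: rc_def)
   moreover have "LL vs c \<in> ?B" using h(1) rc_LL[OF h(2)] by blast
   ultimately show "c G = 0" using h(3) by (rule top_rb)
  qed
 next
  assume h: "\<forall>c :: 'v set => 'k. rc vs \<Gamma> F (Suc p) c --> (\<forall>G. F \<subseteq> G --> c G = 0)"
  show "?Z \<subseteq> ?B"
  proof
   fix z assume "z \<in> ?Z"
   then obtain c where c: "rc vs \<Gamma> F (Suc p) c" "z - LL vs c \<in> ?B" using rc_surj by blast
   have "LL vs c \<in> chains (int p) (geom \<Gamma> - {x})" by (rule cost_LL) (use c(1) h in \<open>auto simp: rc_def\<close>)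
   then have "LL vs c \<in> ?B" by (intro chain_rb) auto
   with c(2) have "z - LL vs c + LL vs c \<in> ?B" by (rule rel_boundaries_lin(2))
   then show "z \<in> ?B" by simp
  qed
 qed
 moreover have "quot_dim ?Z ?B = 0 \<longleftrightarrow> ?Z \<subseteq> ?B" by (rule quot_dim_eq_0) (auto intro: rel_boundaries_lin)
 ultimately show ?thesis by (simp add: homology_dim_def)
qed

lemma top_dim_1:
 fixes c w :: "'v set => 'k"
 assumes "homology_dim K (int p) (geom \<Gamma>) (geom \<Gamma> - {x}) = 1"
  and c: "rc vs \<Gamma> F (Suc p) c" and w: "rc vs \<Gamma> F (Suc p) w" "F \<subseteq> H" "w H ~= 0"
 shows "\<exists>\<mu>. \<forall>G. F \<subseteq> G --> c G = \<mu> * w G"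
proof -
 let ?B = "rel_boundaries (int p) (geom \<Gamma>) (geom \<Gamma> - {x}) :: ('v => real, 'k) kchain set"
 have "\<exists>a b. (a ~= 0 \<or> b ~= 0) \<and> sc a (LL vs c) + sc b (LL vs w) \<in> ?B"
 proof (cases "LL vs c = LL vs w")
  case True
  have "sc 1 (LL vs c) + sc (- 1) (LL vs w) = 0" by (simp add: True sc_uminus)
  then show ?thesis using rel_boundaries_lin(1) by (metis zero_neq_one)
 next
  case False
  show ?thesis
   by (rule quot_dim_1[OF assms(1)[unfolded homology_dim_def] rc_LL[OF c] rc_LL[OF w(1)] False]) blast
 qed
 then obtain a b where ab: "a ~= 0 \<or> b ~= 0" "sc a (LL vs c) + sc b (LL vs w) \<in> ?B" by blast
 have "LL vs (\<lambda>G. a * c G + b * w G) = sc a (LL vs c) + sc b (LL vs w)" by (simp add: LL_simps)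
 moreover have "spt (Suc p) \<Gamma> (\<lambda>G. a * c G + b * w G)" using c w(1) unfolding spt_def rc_def by (metis add_0 mult_zero_right)
 ultimately have z: "a * c G + b * w G = 0" if "F \<subseteq> G" for G using top_rb[of "\<lambda>G. a * c G + b * w G" G] ab(2) that by simp
 have "a ~= 0"
 proof
  assume "a = 0"
  with ab(1) z[OF w(2)] have "b ~= 0" "b * w H = 0" by simp_all
  then show False using w(3) by simp
 qed
 have "c G = (- b / a) * w G" if "F \<subseteq> G" for G
 proof -
  have "a * c G = - (b * w G)" using z[OF that] by (simp add: eq_neg_iff_add_eq_0)
  then have "c G = - (b * w G) / a" using \<open>a ~= 0\<close> by (metis nonzero_mult_div_cancel_left)
  then show ?thesis by simp
 qed
 then show ?thesis by blast
qed

end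

end

section \<open>Simplicial consequences of the local conditions\<close>

text \<open>T0 and T1: the local homology at F in the top degree has dimension 0, respectively 1.\<close>

definition T0 :: "'k::field itself => 'v list => 'v set set => nat => 'v set => bool" where
 "T0 K vs M d F \<longleftrightarrow> (\<forall>c :: 'v set => 'k. rc vs M F d c --> (\<forall>G. F \<subseteq> G --> c G = 0))"

definition T1 :: "'k::field itself => 'v list => 'v set set => nat => 'v set => bool" where
 "T1 K vs M d F \<longleftrightarrow> (\<exists>w :: 'v set => 'k. rc vs M F d w \<and> (\<exists>H. F \<subseteq> H \<and> w H ~= 0)) \<and>
  (\<forall>(c :: 'v set => 'k) w H. rc vs M F d c --> rc vs M F d w --> F \<subseteq> H --> w H ~= 0 --> (\<exists>\<mu>. \<forall>G. F \<subseteq> G --> c G = \<mu> * w G))"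

text \<open>Connectedness of the link of F in terms of its edge graph: a vertex set closed under
  adjacency that meets the link contains all its vertices.\<close>

definition lk_conn :: "'v set set => 'v set => bool" where
 "lk_conn M F \<longleftrightarrow> (\<forall>A. (\<forall>a b. a \<in> A --> a \<notin> F --> b \<notin> F --> insert a (insert b F) \<in> M --> b \<in> A) -->
  (\<forall>a b. a \<in> A --> a \<notin> F --> b \<notin> F --> insert a F \<in> M --> insert b F \<in> M --> b \<in> A))"

text \<open>The difference of the two faces through F, with signs for which the contributions to the
  boundary at F cancel.\<close>

definition dip :: "'v list => 'v set => 'v => 'v => 'v set => 'k::field" where
 "dip vs F a b = (\<lambda>G. if G = insert a F then sg vs a F else if G = insert b F then - sg vs b F else 0)"

lemma bnd_at: "F \<subseteq> set vs ==> bnd vs c F = (\<Sum>v\<in>set vs - F. sg vs v F * c (insert v F))"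
 unfolding bnd_def ct_def by (rule sum.mono_neutral_cong_right) auto

lemma insert_eq_insert: "v \<notin> F ==> a \<notin> F ==> insert v F = insert a F \<longleftrightarrow> v = a" by auto

lemma rc_dip:
 assumes M: "cx vs M" and ab: "a \<notin> F" "b \<notin> F" "a ~= b" "insert a F \<in> M" "insert b F \<in> M" "Suc (card F) = p"
 shows "rc vs M F p (dip vs F a b :: 'v set => 'k::field)"
proof -
 let ?c = "dip vs F a b :: 'v set => 'k"
 have fin: "finite F" using cxD(4)[OF M ab(4)] by simp
 have sup: "G = insert a F \<or> G = insert b F" if "?c G ~= 0" for G using that by (auto simp: dip_def split: if_splits)
 have spt: "spt p M ?c" unfolding spt_def using sup ab fin by fastforce
 have "bnd vs ?c G = 0" if G: "F \<subseteq> G" for G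
 proof (cases "G = F")
  case True
  have V: "F \<subseteq> set vs" "a \<in> set vs" "b \<in> set vs" using cxD(2)[OF M ab(4)] cxD(2)[OF M ab(5)] by auto
  have "bnd vs ?c F = (\<Sum>v\<in>set vs - F. (if v = a then 1 else 0) - (if v = b then 1 else 0))"
   unfolding bnd_at[OF V(1)] by (rule sum.cong) (use ab(1-3) in \<open>auto simp: dip_def insert_eq_insert\<close>)
  also have "\<dots> = 0" using V ab by (simp add: sum_subtractf)
  finally show ?thesis using True by simp
 next
  case False
  show ?thesis
  proof (rule ccontr)
   assume "bnd vs ?c G ~= 0"
   then obtain v where v: "v \<notin> G" "?c (insert v G) ~= 0" using bnd_supp by blast
   from sup[OF v(2)] have c: "card (insert v G) = Suc (card F)" "finite (insert v G)" using ab(1,2) fin by (elim disjE; simp)+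
   then have f: "finite G" by simp
   then have "card G = card F" using v(1) c(1) by simp
   then have "F = G" using card_subset_eq[OF f G] by simp
   then show False using False by simp
  qed
 qed
 with spt show ?thesis by (simp add: rc_def)
qed

text \<open>If the link were disconnected with a and b on different sides, the dipole of a and b
  would be a relative boundary of some e. The part of e on the side of a has only the single term at
  a in its boundary near F, and the boundary of that is not 0.\<close>

lemma lk_conn_van:
 fixes K :: "'k::field itself" and vs :: "'v list"
 assumes M: "cx vs M" and van: "van K vs M F (Suc (card F))"
 shows "lk_conn M F"
 unfolding lk_conn_def
proof (intro allI impI, rule ccontr)
 fix A a b assume cl: "\<forall>a b. a \<in> A --> a \<notin> F --> b \<notin> F --> insert a (insert b F) \<in> M --> b \<in> A"
  and h: "a \<in> A" "a \<notin> F" "b \<notin> F" "insert a F \<in> M" "insert b F \<in> M" "b \<notin> A"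
 let ?c = "dip vs F a b :: 'v set => 'k"
 have V: "F \<subseteq> set vs" "a \<in> set vs" using cxD(2)[OF M h(4)] by auto
 have "rc vs M F (Suc (card F)) ?c" by (rule rc_dip[OF M]) (use h in auto)
 then obtain e where e: "spt (Suc (Suc (card F))) M e" "\<And>G. F \<subseteq> G ==> ?c G = bnd vs e G" using van unfolding van_def by blast
 \<comment> \<open>The faces of e on the side of A. As A is closed under adjacency, a face
   \<open>insert w (insert v F)\<close> has either both extra vertices in A or neither.\<close>
 define eA where "eA G = (if F \<subseteq> G \<and> (G - F) \<inter> A ~= {} then e G else 0)" for G
 have val: "bnd vs eA (insert v F) = (if v = a then sg vs a F else 0)" if v: "v \<in> set vs - F" for v
 proof -
  have vF: "insert v F \<subseteq> set vs" using V v by auto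
  have "eA (insert w (insert v F)) = (if v \<in> A then e (insert w (insert v F)) else 0)" if w: "w \<notin> insert v F" for w
  proof (cases "e (insert w (insert v F)) = 0")
   case False
   then have "insert w (insert v F) \<in> M" using e(1) by (auto simp: spt_def)
   then have "w \<in> A \<longleftrightarrow> v \<in> A" using cl w v by (metis Diff_iff insertCI insert_commute)
   then show ?thesis using w v by (auto simp: eA_def)
  qed (simp add: eA_def)
  then have "bnd vs eA (insert v F) = (if v \<in> A then bnd vs e (insert v F) else 0)"
   unfolding bnd_at[OF vF] by (auto intro: sum.cong)
  also have "bnd vs e (insert v F) = ?c (insert v F)" by (rule e(2)[symmetric]) auto
  also have "(if v \<in> A then ?c (insert v F) else 0) = (if v = a then sg vs a F else 0)" using h v by (auto simp: dip_def insert_eq_insert)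
  finally show ?thesis .
 qed
 have "bnd vs (bnd vs eA) F = (\<Sum>v\<in>set vs - F. if v = a then 1 else 0)"
  unfolding bnd_at[OF V(1)] by (rule sum.cong) (auto simp: val)
 also have "\<dots> = 1" using V h by simp
 finally show False using bnd_bnd[OF cxD(1)[OF M]] by (metis zero_neq_one)
qed

text \<open>Points with a positive coordinate in A, and those with one outside A, form two open sets
  covering the realization; a point in both would provide an edge leaving A.\<close>

lemma lk_conn_connected:
 assumes M: "cx vs M" and conn: "connected (geom M)"
 shows "lk_conn M {}"
 unfolding lk_conn_def
proof (intro allI impI, rule ccontr)
 fix A a b assume cl: "\<forall>a b. a \<in> A --> a \<notin> {} --> b \<notin> {} --> insert a (insert b {}) \<in> M --> b \<in> A"
  and h: "a \<in> A" "{a} \<in> M" "{b} \<in> M" "b \<notin> A"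
 have op: "open (\<Union>v\<in>B. {x :: 'a => real. 0 < x v})" for B
  by (intro open_UN ballI open_Collect_less continuous_intros continuous_on_product_coordinates)
 let ?U = "\<lambda>B. \<Union>v\<in>B. {x :: 'a => real. 0 < x v}"
 have disj: "?U A \<inter> ?U (- A) \<inter> geom M = {}"
 proof (rule ccontr)
  assume "\<not> ?thesis"
  then obtain x v w where x: "x \<in> geom M" "v \<in> A" "w \<notin> A" "0 < x v" "0 < x w" by auto
  then have "{v, w} \<subseteq> {v. x v ~= 0}" "{v. x v ~= 0} \<in> M" by (auto simp: geom_def)
  then have "{v, w} \<in> M" using cxD(3)[OF M] by blast
  then show False using cl x by blast
 qed
 have cov: "geom M \<subseteq> ?U A \<union> ?U (- A)"
 proof
  fix x assume x: "x \<in> geom M"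
  then have s: "(\<Sum>v\<in>{v. x v ~= 0}. x v) = 1" "\<And>v. 0 \<le> x v" by (auto simp: geom_def)
  have "{v. x v ~= 0} ~= {}" using s(1) by (metis sum.empty zero_neq_one)
  then obtain v where "x v ~= 0" by blast
  then have "0 < x v" using s(2)[of v] by simp
  then show "x \<in> ?U A \<union> ?U (- A)" by auto
 qed
 have "bary {v} \<in> ?U B \<inter> geom M" if "v \<in> B" "{v} \<in> M" for v B
  using bary_geom[of "{v}" M] that by (auto simp: bary_def)
 then have "?U A \<inter> geom M ~= {}" "?U (- A) \<inter> geom M ~= {}" using h by blast+
 then show False using connectedD[OF conn op op disj cov] by blast
qed

section \<open>Strong connectivity and fundamental chains\<close>

text \<open>What closed pieces, pieces with boundary and the boundaries themselves have in common:
  vanishing of local homology below the top degree, with no condition on the top degree.\<close>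

locale pman =
 fixes K :: "'k::field itself" and vs :: "'v list" and M :: "'v set set" and d :: nat
 assumes cx: "cx vs M" and top: "\<And>G. G \<in> M ==> card G \<le> d"
  and van: "\<And>F p. F \<in> M ==> F ~= {} ==> p < d ==> van K vs M F p"
begin

text \<open>The indicator of F is a relative cycle at F. Below the top degree it must bound, which
  needs a face with one more vertex.\<close>

lemma pure: "F \<in> M ==> F ~= {} ==> \<exists>G\<in>M. F \<subseteq> G \<and> card G = d"
proof (induction "d - card F" arbitrary: F rule: less_induct)
 case less
 show ?case
 proof (cases "card F = d")
  case False
  then have lt: "card F < d" using top[OF less.prems(1)] by simp
  define c where "c = (\<lambda>G. if G = F then 1 else 0 :: 'k)"
  have "bnd vs c G = 0" if "F \<subseteq> G" for G
  proof (rule ccontr)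
   assume "bnd vs c G ~= 0"
   then obtain v where "v \<notin> G" "c (insert v G) ~= 0" using bnd_supp by blast
   then show False using that by (auto simp: c_def split: if_splits)
  qed
  then have "rc vs M F (card F) c" using less.prems by (auto simp: rc_def spt_def c_def)
  then obtain e :: "'v set => 'k" where e: "spt (Suc (card F)) M e" "\<forall>G. F \<subseteq> G --> c G = bnd vs e G"
   using van[OF less.prems lt] unfolding van_def by blast
  have "bnd vs e F = c F" using e(2) by simp
  then have "bnd vs e F ~= 0" by (simp add: c_def)
  then obtain v where v: "v \<notin> F" "e (insert v F) ~= 0" using bnd_supp by blast
  then have i: "insert v F \<in> M" using e(1) by (auto simp: spt_def)
  have "card (insert v F) = Suc (card F)" using v cxD(4)[OF cx less.prems(1)] by simp
  then have "\<exists>G\<in>M. insert v F \<subseteq> G \<and> card G = d" using less.hyps[of "insert v F"] lt i by auto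
  then show ?thesis by auto
 qed (use less.prems in auto)
qed

abbreviation facet where "facet G \<equiv> G \<in> M \<and> card G = d"

text \<open>Let A consist of the vertices v such that some facet through \<open>insert v F\<close>
  satisfies P. By the assumption for these larger faces, P then holds on all facets through them, so
  A is closed under adjacency in the connected link of F.\<close>

lemma sc_step:
 assumes F: "F \<in> M" "card F < d" and lk: "lk_conn M F"
  and IH: "\<And>v G G'. v \<notin> F ==> insert v F \<in> M ==> facet G ==> facet G' ==> insert v F \<subseteq> G ==> insert v F \<subseteq> G' ==> P G ==> P G'"
  and G: "facet G" "facet G'" "F \<subseteq> G" "F \<subseteq> G'" "P G"
 shows "P G'"
proof -
 define A where "A = {v. \<exists>H. facet H \<and> insert v F \<subseteq> H \<and> P H}"
 have ex: "\<exists>v. v \<in> H \<and> v \<notin> F" if "facet H" for H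
 proof (rule ccontr)
  assume "\<not> ?thesis"
  then have "H \<subseteq> F" by auto
  then have "card H \<le> card F" using cxD(4)[OF cx F(1)] by (rule card_mono[rotated])
  then show False using that F(2) by simp
 qed
 have cl: "b \<in> A" if h: "a \<in> A" "a \<notin> F" "b \<notin> F" "insert a (insert b F) \<in> M" for a b
 proof -
  obtain H where H: "facet H" "insert a (insert b F) \<subseteq> H" using pure[OF h(4)] by blast
  obtain H0 where H0: "facet H0" "insert a F \<subseteq> H0" "P H0" using h(1) by (auto simp: A_def)
  have "insert a F \<in> M" using cxD(3)[OF cx h(4)] by auto
  then have "P H" using IH[of a H0 H] h H H0 by auto
  then show ?thesis using H by (auto simp: A_def)
 qed
 obtain a where a: "a \<in> G" "a \<notin> F" using ex[OF G(1)] by blast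
 obtain b where b: "b \<in> G'" "b \<notin> F" using ex[OF G(2)] by blast
 have aA: "a \<in> A" using a G by (auto simp: A_def)
 have aM: "insert a F \<in> M" by (rule cxD(3)[OF cx, of G]) (use a G in auto)
 have bM: "insert b F \<in> M" by (rule cxD(3)[OF cx, of G']) (use b G in auto)
 have "b \<in> A" using lk[unfolded lk_conn_def, rule_format, of A a b] cl aA a(2) b(2) aM bM by blast
 then obtain H where H: "facet H" "insert b F \<subseteq> H" "P H" by (auto simp: A_def)
 show ?thesis by (rule IH[of b H G']) (use H b G bM in auto)
qed

text \<open>The star of a face is strongly connected: any two of its facets are joined by steps
  across faces with d - 1 vertices that contain F. The induction is on the codimension of F, with
  connected links supplied by the vanishing of local homology.\<close>

lemma sc:
 assumes adj: "\<And>E G G'. E \<in> M ==> E ~= {} ==> F \<subseteq> E ==> Suc (card E) = d ==> facet G ==> facet G' ==> E \<subseteq> G ==> E \<subseteq> G' ==> P G ==> P G'"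
 shows "F \<in> M ==> F ~= {} ==> facet G ==> facet G' ==> F \<subseteq> G ==> F \<subseteq> G' ==> P G ==> P G'"
 using adj
proof (induction "d - card F" arbitrary: F G G' rule: less_induct)
 case less
 have fin: "finite G" "finite G'" "finite F" using less.prems cxD(4)[OF cx] by auto
 consider "card F = d" | "Suc (card F) = d" | "Suc (card F) < d" using top[OF less.prems(1)] by linarith
 then show ?case
 proof cases
  case 1
  have "F = G" by (rule card_subset_eq[OF fin(1) less.prems(5)]) (use 1 less.prems(3) in simp)
  moreover have "F = G'" by (rule card_subset_eq[OF fin(2) less.prems(6)]) (use 1 less.prems(4) in simp)
  ultimately show ?thesis using less.prems(7) by simp
 next
  case 2
  show ?thesis by (rule less.prems(8)[OF less.prems(1,2) subset_refl 2 less.prems(3-7)])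
 next
  case 3
  have lk: "lk_conn M F" by (rule lk_conn_van[OF cx, of K]) (rule van[OF less.prems(1,2) 3])
  have st: "P G'" if v: "v \<notin> F" "insert v F \<in> M" "facet G" "facet G'" "insert v F \<subseteq> G" "insert v F \<subseteq> G'" "P G" for v G G'
  proof (rule less.hyps[of "insert v F" G G'])
   show "d - card (insert v F) < d - card F" using 3 v(1) fin by simp
   show "P H'" if "E \<in> M" "E ~= {}" "insert v F \<subseteq> E" "Suc (card E) = d" "facet H" "facet H'" "E \<subseteq> H" "E \<subseteq> H'" "P H" for E H H'
    by (rule less.prems(8)[of E H H']) (use that in auto)
  qed (use v in auto)
  have lt: "card F < d" using 3 by simp
  show ?thesis by (rule sc_step[where P = P and F = F and G = G and G' = G', OF less.prems(1) lt lk st less.prems(3-7)])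
 qed
qed

lemma sc_global:
 assumes adj: "\<And>E G G'. E \<in> M ==> E ~= {} ==> Suc (card E) = d ==> facet G ==> facet G' ==> E \<subseteq> G ==> E \<subseteq> G' ==> P G ==> P G'"
  and conn: "connected (geom M)" and d: "0 < d" and G: "facet G" "facet G'" "P G"
 shows "P G'"
proof (rule sc_step[of "{}" P G G'])
 show "{} \<in> M" using cxD(3)[OF cx, of G "{}"] G by auto
 show "lk_conn M {}" by (rule lk_conn_connected[OF cx conn])
 show "P H'" if "v \<notin> {}" "insert v {} \<in> M" "facet H" "facet H'" "insert v {} \<subseteq> H" "insert v {} \<subseteq> H'" "P H" for v H H'

 proof (rule sc[where F = "{v}" and P = P and G = H])
  fix E G G' assume "E \<in> M" "E ~= {}" "Suc (card E) = d" "facet G" "facet G'" "E \<subseteq> G" "E \<subseteq> G'" "P G"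
  then show "P G'" by (rule adj)
 qed (use that in simp_all)
qed (use d G in auto)

lemma rc_below:
 fixes c :: "'v set => 'k"
 assumes c: "spt d M c" and E: "Suc (card E) = d" "E \<in> M" "bnd vs c E = 0"
 shows "rc vs M E d c"
 unfolding rc_def
proof (intro conjI c allI impI)
 fix G assume G: "E \<subseteq> G"
 show "bnd vs c G = 0"
 proof (rule ccontr)
  assume n: "bnd vs c G ~= 0"
  then obtain v where "v \<notin> G" "c (insert v G) ~= 0" using bnd_supp by blast
  then have "card (insert v G) = d" "insert v G \<in> M" "v \<notin> G" using c by (auto simp: spt_def)
  then have "finite G" "card G = card E" using E(1) cxD(4)[OF cx] by force+
  then have "E = G" using G by (simp add: card_subset_eq)
  then show False using n E(3) by simp
 qed
qed

lemma facet_pair: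
 assumes E: "Suc (card E) = d" "E \<in> M" and G: "facet G" "facet G'" "E \<subseteq> G" "E \<subseteq> G'" "G ~= G'"
 obtains c :: "'v set => 'k" where "rc vs M E d c" "c G ~= 0" "c G' ~= 0"
proof -
 have ex: "\<exists>v. v \<notin> E \<and> H = insert v E" if H: "facet H" "E \<subseteq> H" for H
 proof -
  have "card (H - E) = 1" using H E cxD(4)[OF cx] by (subst card_Diff_subset) auto
  then obtain v where "H - E = {v}" by (rule card_1_singletonE)
  then show ?thesis using H by blast
 qed
 obtain a b where ab: "a \<notin> E" "G = insert a E" "b \<notin> E" "G' = insert b E" using ex G by metis
 have "a ~= b" using ab G by auto
 moreover have "insert b E ~= insert a E" using ab \<open>a ~= b\<close> by auto
 ultimately show thesis using that[of "dip vs E a b"] rc_dip[OF cx, of a E b d, where 'k='k] ab G E by (simp add: dip_def)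
qed

text \<open>Two different facets through E would give a dipole, a relative cycle that is not
  zero.\<close>

lemma T0_unique: "Suc (card E) = d ==> E \<in> M ==> T0 K vs M d E ==> facet G ==> facet G' ==> E \<subseteq> G ==> E \<subseteq> G' ==> G = G'"
 using facet_pair[of E G G'] unfolding T0_def by metis

text \<open>Near E both z and the dipole of the two facets are relative cycles. By
  one-dimensionality the dipole is a multiple of z, so z cannot vanish on either facet.\<close>

lemma T1_transfer:
 fixes z :: "'v set => 'k"
 assumes E: "Suc (card E) = d" "E \<in> M" "T1 K vs M d E" and z: "spt d M z" "bnd vs z E = 0"
  and G: "facet G" "facet G'" "E \<subseteq> G" "E \<subseteq> G'" "z G ~= 0"
 shows "z G' ~= 0"
proof (cases "G = G'")
 case False
 obtain c :: "'v set => 'k" where c: "rc vs M E d c" "c G ~= 0" "c G' ~= 0" by (rule facet_pair[OF E(1,2) G(1-4) False])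
 have "rc vs M E d z" by (rule rc_below[OF z(1) E(1,2) z(2)])
 then obtain \<mu> where "\<forall>G. E \<subseteq> G --> c G = \<mu> * z G" using E(3) c G unfolding T1_def by blast
 then show ?thesis using c G by auto
qed (use G in simp)

text \<open>A local cycle at F that is not zero on some facet is nonzero on every facet of the star,
  by propagation across faces with d - 1 vertices; so it remains a nonzero local cycle at every
  larger face. This lets interior faces be recognized from one interior point.\<close>

lemma T1_up:
 assumes T: "\<And>F. F \<in> M ==> F ~= {} ==> T0 K vs M d F \<or> T1 K vs M d F"
  and F: "F \<in> M" "F ~= {}" "T1 K vs M d F" and G: "G \<in> M" "F \<subseteq> G"
 shows "\<not> T0 K vs M d G"
proof -
 obtain w :: "'v set => 'k" and H where w: "rc vs M F d w" "F \<subseteq> H" "w H ~= 0" using F(3) unfolding T1_def by blast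
 have ws: "spt d M w" "\<And>E. F \<subseteq> E ==> bnd vs w E = 0" using w(1) by (auto simp: rc_def)
 have H: "facet H" using w ws by (auto simp: spt_def)
 have "G ~= {}" using F G by auto
 then obtain H' where H': "facet H'" "G \<subseteq> H'" using pure[OF G(1)] by blast
 have "w H' ~= 0"
 proof (rule sc[where F = F and P = "\<lambda>G. w G ~= 0" and G = H])
  fix E G1 G2 assume h: "E \<in> M" "E ~= {}" "F \<subseteq> E" "Suc (card E) = d" "facet G1" "facet G2" "E \<subseteq> G1" "E \<subseteq> G2" "w G1 ~= 0"
  from T[OF h(1,2)] show "w G2 ~= 0"
  proof
   assume "T0 K vs M d E"
   then have "G1 = G2" by (rule T0_unique[OF h(4,1)]) (use h in auto)
   then show ?thesis using h by simp
  next
   assume t: "T1 K vs M d E"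
   show ?thesis by (rule T1_transfer[OF h(4,1) t ws(1) ws(2)[OF h(3)] h(5-9)])
  qed
 qed (use F H w H' G in auto)
 moreover have "rc vs M G d w" using w(1) G(2) by (auto simp: rc_def)
 ultimately show ?thesis using H' unfolding T0_def by blast
qed

text \<open>Propagation through the whole connected piece: at a face with d - 1 vertices either
  there is one facet only, or the local homology is one-dimensional and the chain has no boundary
  there.\<close>

lemma fundamental_nonzero:
 fixes c :: "'v set => 'k"
 assumes T: "\<And>F. F \<in> M ==> F ~= {} ==> T0 K vs M d F \<or> (T1 K vs M d F \<and> F \<notin> N)" and d: "0 < d"
  and conn: "connected (geom M)" and c: "spt d M c" "\<And>G. G ~= {} ==> G \<notin> N ==> bnd vs c G = 0" and nz: "c H ~= 0" and G: "facet G"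
 shows "c G ~= 0"
proof (rule sc_global[where P = "\<lambda>G. c G ~= 0" and G = H])
 fix E G1 G2 assume h: "E \<in> M" "E ~= {}" "Suc (card E) = d" "facet G1" "facet G2" "E \<subseteq> G1" "E \<subseteq> G2" "c G1 ~= 0"
 from T[OF h(1,2)] show "c G2 ~= 0"
 proof
  assume "T0 K vs M d E"
  then have "G1 = G2" by (rule T0_unique[OF h(3,1)]) (use h in auto)
  then show ?thesis using h by simp
 next
  assume t: "T1 K vs M d E \<and> E \<notin> N"
  then have "bnd vs c E = 0" using c(2) h(2) by blast
  with t show ?thesis using T1_transfer[OF h(3,1) _ c(1) _ h(4-8)] by blast
 qed
qed (use d conn nz c(1) G in \<open>auto simp: spt_def\<close>)

end

section \<open>Gluing a manifold along its boundary\<close>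

text \<open>Every relative top cycle at F agrees near F with an absolute cycle; the boundary at the empty face is the augmentation and is not required to vanish.\<close>

definition absc :: "'k::field itself => 'v list => 'v set set => nat => 'v set => bool" where
 "absc K vs \<Gamma> d F \<longleftrightarrow> (\<forall>c :: 'v set => 'k. rc vs \<Gamma> F d c -->
  (\<exists>z. spt d \<Gamma> z \<and> (\<forall>G. G ~= {} --> bnd vs z G = 0) \<and> (\<forall>G. F \<subseteq> G --> z G = c G)))"

definition cut :: "'v set => ('v set => 'k::field) => 'v set => 'k" where
 "cut F c = (\<lambda>G. if F \<subseteq> G then c G else 0)"

lemma spt_lin: "spt p \<Gamma> f ==> spt p \<Gamma> g ==> spt p \<Gamma> (\<lambda>G. f G + a * g G)"
 unfolding spt_def by (metis add_0 mult_zero_right)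

lemma spt_mono: "spt p \<Gamma> f ==> \<Gamma> \<subseteq> \<Gamma>' ==> spt p \<Gamma>' f" by (auto simp: spt_def)

lemma bnd_lin: "bnd vs (\<lambda>G. f G + a * g G) G = bnd vs f G + a * bnd vs g G" by (simp add: bnd_linear)

lemma bnd_cut: "F \<subseteq> G ==> bnd vs (cut F c) G = bnd vs c G"
 by (rule bnd_cong_above[of F]) (auto simp: cut_def)

lemma rc_cut:
 assumes "rc vs X F p c" "\<And>G. F \<subseteq> G ==> G \<in> X ==> G \<in> Y"
 shows "rc vs Y F p (cut F c)"
 unfolding rc_def
proof (intro conjI allI impI)
 show "spt p Y (cut F c)" using assms by (auto simp: rc_def spt_def cut_def)
 show "bnd vs (cut F c) G = 0" if "F \<subseteq> G" for G using assms(1) that by (simp add: bnd_cut rc_def)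
qed

text \<open>The condition involves the faces containing F only, so it may be tested in any complex
  with the same star.\<close>

lemma van_star:
 assumes star: "\<And>G. F \<subseteq> G ==> G \<in> X \<longleftrightarrow> G \<in> Y" and van: "van K vs X F p"
 shows "van K vs Y F p"
 unfolding van_def
proof (intro allI impI)
 fix c :: "'a set => 'b" assume c: "rc vs Y F p c"
 have "rc vs X F p (cut F c)" by (rule rc_cut[OF c]) (use star in blast)
 then obtain e :: "'a set => 'b" where e: "spt (Suc p) X e" "\<forall>G. F \<subseteq> G --> cut F c G = bnd vs e G" using van unfolding van_def by blast
 have "spt (Suc p) Y (cut F e)" using e(1) star by (auto simp: spt_def cut_def)
 moreover have "c G = bnd vs (cut F e) G" if "F \<subseteq> G" for G using e(2) that by (simp add: bnd_cut) (simp add: cut_def)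
 ultimately show "\<exists>e. spt (Suc p) Y e \<and> (\<forall>G. F \<subseteq> G --> c G = bnd vs e G)" by blast
qed

lemma T1_star:
 assumes star: "\<And>G. F \<subseteq> G ==> G \<in> X \<longleftrightarrow> G \<in> Y" and T: "T1 K vs X d F"
 shows "T1 K vs Y d F"
 unfolding T1_def
proof (intro conjI allI impI)
 obtain w :: "'a set => 'b" and H where w: "rc vs X F d w" "F \<subseteq> H" "w H ~= 0" using T unfolding T1_def by blast
 have "rc vs Y F d (cut F w)" by (rule rc_cut[OF w(1)]) (use star in blast)
 then show "\<exists>w :: 'a set => 'b. rc vs Y F d w \<and> (\<exists>H. F \<subseteq> H \<and> w H ~= 0)" using w by (intro exI[of _ "cut F w"]) (auto simp: cut_def)
next
 fix c w :: "'a set => 'b" and H assume h: "rc vs Y F d c" "rc vs Y F d w" "F \<subseteq> H" "w H ~= 0"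
 have "rc vs X F d (cut F c)" "rc vs X F d (cut F w)" by (rule rc_cut, rule h, use star in blast)+
 moreover have "cut F w H ~= 0" using h by (simp add: cut_def)
 ultimately obtain \<mu> where "\<forall>G. F \<subseteq> G --> cut F c G = \<mu> * cut F w G" using T h(3) unfolding T1_def by blast
 then show "\<exists>\<mu>. \<forall>G. F \<subseteq> G --> c G = \<mu> * w G" by (auto simp: cut_def)
qed

lemma van_0: assumes "cx vs \<Gamma>" "F ~= {}" shows "van K vs \<Gamma> F 0"
 unfolding van_def
proof (intro allI impI exI conjI)
 fix c :: "'a set => 'b" assume c: "rc vs \<Gamma> F 0 c"
 show "spt (Suc 0) \<Gamma> (\<lambda>G. 0 :: 'b)" by (simp add: spt_def)
 fix G assume G: "F \<subseteq> G"
 have "c G = 0"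
 proof (rule ccontr)
  assume "c G ~= 0"
  then have "G \<in> \<Gamma>" "card G = 0" using c by (auto simp: rc_def spt_def)
  then show False using cxD(4)[OF assms(1)] G assms(2) by auto
 qed
 then show "c G = bnd vs (\<lambda>G. 0) G" by (simp add: bnd_linear)
qed

text \<open>Here c is a fundamental chain of M, and x bounds its boundary in X, so that c - x is a new top cycle of the union.\<close>

locale glue =
 fixes K :: "'k::field itself" and vs :: "'v list" and X M :: "'v set set" and q :: nat and c x :: "'v set => 'k"
 assumes cxX: "cx vs X" and M: "pman K vs M (Suc q)" and topX: "\<And>G. G \<in> X ==> card G \<le> Suc q"
  and vanX: "\<And>F p. F \<in> X ==> F ~= {} ==> p < Suc q ==> van K vs X F p"
  and absX: "\<And>F. F \<in> X ==> F ~= {} ==> absc K vs X (Suc q) F"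
  and vanN: "\<And>F p. F \<in> M \<inter> X ==> F ~= {} ==> p < q ==> van K vs (M \<inter> X) F p"
  and TN: "\<And>F. F \<in> M \<inter> X ==> F ~= {} ==> T1 K vs (M \<inter> X) q F"
  and T0M: "\<And>F. F \<in> M \<inter> X ==> F ~= {} ==> T0 K vs M (Suc q) F"
  and T1M: "\<And>F. F \<in> M ==> F \<notin> X ==> F ~= {} ==> T1 K vs M (Suc q) F"
  and c: "spt (Suc q) M c" "\<And>G. G ~= {} ==> bnd vs c G ~= 0 ==> G \<in> M \<inter> X" "\<And>G. G \<in> M ==> card G = Suc q ==> c G ~= 0"
  and x: "spt (Suc q) X x" "\<And>G. G ~= {} ==> bnd vs x G = bnd vs c G"
begin

lemma cxM: "cx vs M" by (rule pman.cx[OF M])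
lemma cxY: "cx vs (X \<union> M)" using cxX cxM by (auto simp: cx_def)
text \<open>A relative chain at F is split into its parts on the old and the new piece; faces common
  to both are counted with X.\<close>

definition uX where "uX F u = (\<lambda>G. if F \<subseteq> G \<and> G \<in> X then u G else 0 :: 'k)"
definition uM where "uM F u = (\<lambda>G. if F \<subseteq> G \<and> G \<notin> X then u G else 0 :: 'k)"

text \<open>The Mayer-Vietoris connecting map on chains: the boundary of one half is minus the
  boundary of the other, so it is supported on the common faces and is a relative cycle
  there.\<close>

lemma split:
 assumes u: "rc vs (X \<union> M) F (Suc p) u" and F: "F ~= {}"
 shows "spt (Suc p) X (uX F u)" "spt (Suc p) M (uM F u)" "F \<subseteq> G ==> u G = uX F u G + uM F u G"
  "F \<subseteq> G ==> bnd vs (uM F u) G = - bnd vs (uX F u) G" "rc vs (M \<inter> X) F p (cut F (bnd vs (uX F u)))"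
proof -
 have us: "spt (Suc p) (X \<union> M) u" "\<And>G. F \<subseteq> G ==> bnd vs u G = 0" using u by (auto simp: rc_def)
 show 1: "spt (Suc p) X (uX F u)" using us(1) by (auto simp: spt_def uX_def)
 show 2: "spt (Suc p) M (uM F u)" using us(1) by (auto simp: spt_def uM_def)
 show 3: "u G = uX F u G + uM F u G" if "F \<subseteq> G" for G using that by (simp add: uX_def uM_def)
 show 4: "bnd vs (uM F u) G = - bnd vs (uX F u) G" if G: "F \<subseteq> G" for G
 proof -
  have "bnd vs u G = bnd vs (\<lambda>G. uX F u G + uM F u G) G" by (rule bnd_cong_above[of F]) (use 3 G in auto)
  then have "bnd vs (uX F u) G + bnd vs (uM F u) G = 0" using us(2)[OF G] by (simp add: bnd_linear)
  then show ?thesis by (simp add: eq_neg_iff_add_eq_0 add.commute)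
 qed
 have "spt p (M \<inter> X) (cut F (bnd vs (uX F u)))" unfolding spt_def
 proof (intro allI impI)
  fix G assume "cut F (bnd vs (uX F u)) G ~= 0"
  then have h: "F \<subseteq> G" "bnd vs (uX F u) G ~= 0" by (auto simp: cut_def split: if_splits)
  then have "bnd vs (uM F u) G ~= 0" using 4 by simp
  then show "G \<in> M \<inter> X \<and> card G = p" using bnd_spt[OF cxX 1] bnd_spt[OF cxM 2] h(2) by (auto simp: spt_def)
 qed
 then show "rc vs (M \<inter> X) F p (cut F (bnd vs (uX F u)))" using cxD(1)[OF cxX] by (simp add: rc_def bnd_cut bnd_bnd)
qed

lemma vanY:
 assumes F: "F \<in> X \<union> M" "F ~= {}" and p: "p < Suc q"
 shows "van K vs (X \<union> M) F p"
proof -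
 consider "F \<notin> M" | "F \<notin> X" | "F \<in> M \<inter> X" by blast
 then show ?thesis
 proof cases
  case 1
  then have "\<And>G. F \<subseteq> G ==> G \<notin> M" using cxD(3)[OF cxM] by blast
  then show ?thesis by (intro van_star[OF _ vanX[of F p]]) (use 1 F p in auto)
 next
  case 2
  then have "\<And>G. F \<subseteq> G ==> G \<notin> X" using cxD(3)[OF cxX] by blast
  then show ?thesis by (intro van_star[OF _ pman.van[OF M, of F p]]) (use 2 F p in auto)
 next
  case 3
  show ?thesis
  proof (cases p)
   case 0
   then show ?thesis using van_0[OF cxY F(2)] by simp
  next
   case (Suc r)
   show ?thesis unfolding van_def
   proof (intro allI impI)
    fix u :: "'v set => 'k" assume "rc vs (X \<union> M) F p u"
    then have u: "rc vs (X \<union> M) F (Suc r) u" by (simp add: Suc)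
    note s = split[OF u F(2)]
    \<comment> \<open>The connecting cycle bounds some y in the common boundary; subtracting y from
      the old half and adding it to the new half makes both of them relative cycles.\<close>
    have "van K vs (M \<inter> X) F r" by (rule vanN) (use 3 F p Suc in auto)
    with s(5) obtain y :: "'v set => 'k" where y0: "spt (Suc r) (M \<inter> X) y" "\<forall>G. F \<subseteq> G --> cut F (bnd vs (uX F u)) G = bnd vs y G"
     unfolding van_def by blast
    then have y: "spt (Suc r) (M \<inter> X) y" "\<And>G. F \<subseteq> G ==> bnd vs (uX F u) G = bnd vs y G" by (auto simp: cut_def)
    have yX: "spt (Suc r) X y" "spt (Suc r) M y" using y(1) by (auto simp: spt_def)
    have "rc vs X F p (\<lambda>G. uX F u G + (- 1) * y G)" unfolding rc_def bnd_lin Suc by (intro conjI spt_lin s(1) yX(1)) (simp add: y(2))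
    then obtain e1 :: "'v set => 'k" where e1: "spt (Suc p) X e1" "\<And>G. F \<subseteq> G ==> uX F u G + (- 1) * y G = bnd vs e1 G"
     using vanX[of F p] 3 F p unfolding van_def by blast
    have "rc vs M F p (\<lambda>G. uM F u G + 1 * y G)" unfolding rc_def bnd_lin Suc by (intro conjI spt_lin s(2) yX(2)) (simp add: y(2) s(4))
    then obtain e2 :: "'v set => 'k" where e2: "spt (Suc p) M e2" "\<And>G. F \<subseteq> G ==> uM F u G + 1 * y G = bnd vs e2 G"
     using pman.van[OF M, of F p] 3 F p unfolding van_def by blast
    have "spt (Suc p) (X \<union> M) (\<lambda>G. e1 G + 1 * e2 G)" by (rule spt_lin) (use e1 e2 in \<open>auto elim: spt_mono\<close>)
    moreover have "u G = bnd vs (\<lambda>G. e1 G + 1 * e2 G) G" if G: "F \<subseteq> G" for G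
     unfolding bnd_lin e1(2)[OF G, symmetric] e2(2)[OF G, symmetric] using s(3)[OF G] by simp
    ultimately show "\<exists>e. spt (Suc p) (X \<union> M) e \<and> (\<forall>G. F \<subseteq> G --> u G = bnd vs e G)" by blast
   qed
  qed
 qed
qed

text \<open>A boundary face H with q vertices lies in exactly one facet of M, so the boundary of c
  at H is a single nonzero term.\<close>

lemma fund_boundary_nonzero:
 assumes H: "H \<in> M \<inter> X" "card H = q" "H ~= {}"
 shows "bnd vs c H ~= 0"
proof -
 obtain G where G: "G \<in> M" "H \<subseteq> G" "card G = Suc q" using pman.pure[OF M, of H] H by auto
 have fin: "finite G" using cxD(4)[OF cxM G(1)] .
 have "card (G - H) = 1" using G H fin by (subst card_Diff_subset) (auto intro: finite_subset)
 then obtain v where v: "G - H = {v}" by (rule card_1_singletonE)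
 then have vG: "G = insert v H" "v \<notin> H" using G by auto
 have V: "H \<subseteq> set vs" "v \<in> set vs" using cxD(2)[OF cxM G(1)] vG by auto
 have "c (insert w H) = 0" if w: "w \<in> set vs - H" "w ~= v" for w
 proof (rule ccontr)
  assume "c (insert w H) ~= 0"
  then have i: "insert w H \<in> M" "card (insert w H) = Suc q" using c(1) by (auto simp: spt_def)
  have "insert w H = G" by (rule pman.T0_unique[OF M _ _ T0M, of H]) (use H G i in auto)
  then show False using w vG by auto
 qed
 then have "bnd vs c H = (\<Sum>w\<in>set vs - H. if w = v then sg vs v H * c G else 0)"
  unfolding bnd_at[OF V(1)] using vG by (intro sum.cong) auto
 also have "\<dots> = sg vs v H * c G" using V vG by simp
 finally show ?thesis using c(3)[OF G(1,3)] by simp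
qed

text \<open>At a face of X alone nothing changes, and at a face of M alone a local cycle is a
  multiple of c, hence agrees with a multiple of the absolute cycle c - x. At a common face the
  connecting cycle of u is a multiple \<mu> of the boundary of c, which determines how much of c - x
  to use; the rest lives in X and is extended there.\<close>

lemma absY:
 assumes F: "F \<in> X \<union> M" "F ~= {}"
 shows "absc K vs (X \<union> M) (Suc q) F"
 unfolding absc_def
proof (intro allI impI)
 fix u :: "'v set => 'k" assume u: "rc vs (X \<union> M) F (Suc q) u"
 let ?goal = "\<exists>z. spt (Suc q) (X \<union> M) z \<and> (\<forall>G. G ~= {} --> bnd vs z G = 0) \<and> (\<forall>G. F \<subseteq> G --> z G = u G)"
 have cY: "spt (Suc q) (X \<union> M) c" "spt (Suc q) (X \<union> M) x" using c(1) x(1) by (auto elim: spt_mono)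
 have cx0: "spt (Suc q) (X \<union> M) (\<lambda>G. c G + (- 1) * x G)" by (rule spt_lin[OF cY])
 have bz: "bnd vs (\<lambda>G. c G + (- 1) * x G) G = 0" if "G ~= {}" for G unfolding bnd_lin using x(2)[OF that] by simp
 consider "F \<notin> M" | "F \<notin> X" | "F \<in> M \<inter> X" by blast
 then show ?goal
 proof cases
  case 1
  then have s: "\<And>G. F \<subseteq> G ==> G \<notin> M" using cxD(3)[OF cxM] by blast
  have "rc vs X F (Suc q) (cut F u)" by (rule rc_cut[OF u]) (use s in auto)
  then obtain z where z: "spt (Suc q) X z" "\<forall>G. G ~= {} --> bnd vs z G = 0" "\<forall>G. F \<subseteq> G --> z G = cut F u G"
   using absX[of F] F 1 unfolding absc_def by blast
  then show ?goal by (intro exI[of _ z]) (auto elim: spt_mono simp: cut_def)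
 next
  case 2
  then have s: "\<And>G. F \<subseteq> G ==> G \<notin> X" using cxD(3)[OF cxX] by blast
  have FM: "F \<in> M" using F 2 by blast
  have 1: "rc vs M F (Suc q) (cut F u)" by (rule rc_cut[OF u]) (use s in auto)
  have "bnd vs c G = 0" if "F \<subseteq> G" for G using c(2)[of G] s[OF that] F(2) that by blast
  then have 2: "rc vs M F (Suc q) c" using c(1) by (simp add: rc_def)
  obtain H where H: "H \<in> M" "F \<subseteq> H" "card H = Suc q" using pman.pure[OF M FM F(2)] by blast
  obtain \<mu> where mu: "\<forall>G. F \<subseteq> G --> cut F u G = \<mu> * c G" using T1M[OF FM \<open>F \<notin> X\<close> F(2)] 1 2 H(2) c(3)[OF H(1,3)] unfolding T1_def by blast
  have x0: "x G = 0" if "F \<subseteq> G" for G using x(1) s[OF that] by (auto simp: spt_def)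
  show ?goal
  proof (intro exI[of _ "\<lambda>G. 0 + \<mu> * (c G + (- 1) * x G)"] conjI allI impI)
   show "spt (Suc q) (X \<union> M) (\<lambda>G. 0 + \<mu> * (c G + (- 1) * x G))" by (rule spt_lin[OF _ cx0]) (simp add: spt_def)
   show "bnd vs (\<lambda>G. 0 + \<mu> * (c G + (- 1) * x G)) G = 0" if "G ~= {}" for G unfolding bnd_lin[of vs "\<lambda>_. 0"] bz[OF that] by (simp add: bnd_linear)
   show "0 + \<mu> * (c G + (- 1) * x G) = u G" if "F \<subseteq> G" for G using mu x0 that by (simp add: cut_def)
  qed
 next
  case 3
  note s = split[OF u F(2)]
  let ?N = "M \<inter> X"
  have ne: "G ~= {}" if "F \<subseteq> G" for G using F(2) that by auto
  have z0: "rc vs ?N F q (cut F (bnd vs c))"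
  proof -
   have "spt q ?N (cut F (bnd vs c))" unfolding spt_def cut_def using bnd_spt[OF cxM c(1)] c(2) ne by (simp add: spt_def)
   then show ?thesis using cxD(1)[OF cxX] by (simp add: rc_def bnd_cut bnd_bnd)
  qed
  \<comment> \<open>The chain w supplies a boundary facet H containing F, where the boundary of c is
    nonzero; this boundary can therefore serve as a generator of the local homology.\<close>
  obtain w :: "'v set => 'k" and H where w: "rc vs ?N F q w" "F \<subseteq> H" "w H ~= 0" using TN[OF 3 F(2)] unfolding T1_def by blast
  then have H: "H \<in> ?N" "card H = q" by (auto simp: rc_def spt_def)
  have "cut F (bnd vs c) H ~= 0" using fund_boundary_nonzero[OF H ne[OF w(2)]] w(2) by (simp add: cut_def)
  then obtain \<mu> where mu0: "\<forall>G. F \<subseteq> G --> cut F (bnd vs (uX F u)) G = \<mu> * cut F (bnd vs c) G"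
   using TN[OF 3 F(2)] s(5) z0 w(2) unfolding T1_def by blast
  then have mu: "bnd vs (uX F u) G = \<mu> * bnd vs c G" if "F \<subseteq> G" for G using that by (simp add: cut_def)
  have "rc vs M F (Suc q) (\<lambda>G. uM F u G + \<mu> * c G)" unfolding rc_def bnd_lin by (intro conjI spt_lin s(2) c(1)) (simp add: mu s(4))
  \<comment> \<open>Local homology of M at its boundary is zero, so the new half is exactly - \<mu>
    times c on the star of F.\<close>
  then have uM0: "uM F u G + \<mu> * c G = 0" if "F \<subseteq> G" for G using T0M[OF 3 F(2)] that unfolding T0_def by blast
  \<comment> \<open>As x has the same boundary as c at nonempty faces, subtracting \<mu> times x
    closes the old half.\<close>
  have "rc vs X F (Suc q) (\<lambda>G. uX F u G + (- \<mu>) * x G)" unfolding rc_def bnd_lin by (intro conjI spt_lin s(1) x(1)) (simp add: mu x(2) ne)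
  then obtain z where z: "spt (Suc q) X z" "\<forall>G. G ~= {} --> bnd vs z G = 0" "\<forall>G. F \<subseteq> G --> z G = uX F u G + (- \<mu>) * x G"
   using absX[of F] F 3 unfolding absc_def by blast
  show ?goal
  proof (intro exI[of _ "\<lambda>G. z G + (- \<mu>) * (c G + (- 1) * x G)"] conjI allI impI)
   show "spt (Suc q) (X \<union> M) (\<lambda>G. z G + (- \<mu>) * (c G + (- 1) * x G))" by (rule spt_lin[OF _ cx0]) (use z(1) in \<open>auto elim: spt_mono\<close>)
   show "bnd vs (\<lambda>G. z G + (- \<mu>) * (c G + (- 1) * x G)) G = 0" if "G ~= {}" for G unfolding bnd_lin[of vs z] bz[OF that] using z(2) that by simp
   show "z G + (- \<mu>) * (c G + (- 1) * x G) = u G" if G: "F \<subseteq> G" for G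
   proof -
    have "uM F u G = - (\<mu> * c G)" using uM0[OF G] by (simp add: eq_neg_iff_add_eq_0)
    then show ?thesis using z(3) s(3)[OF G] G by (simp add: algebra_simps)
   qed
  qed
 qed
qed

end

section \<open>Passing to cohomology\<close>

text \<open>A functional that vanishes on the common kernel of finitely many functionals is their
  linear combination. If the new functional is not already zero on the kernel of the others, a
  vector \<open>c0\<close> dual to it reduces to fewer functionals.\<close>

lemma fredholm:
 fixes a :: "'r => 'u => 'k::field"
 assumes "finite R" "finite U" "\<And>c. (\<And>H. H \<in> R ==> (\<Sum>G\<in>U. a H G * c G) = 0) ==> (\<Sum>G\<in>U. f G * c G) = 0"
 shows "\<exists>g. \<forall>G\<in>U. f G = (\<Sum>H\<in>R. g H * a H G)"
 using assms(1,3)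
proof (induction R arbitrary: f rule: finite_induct)
 case empty
 have "f G = 0" if G: "G \<in> U" for G
 proof -
  have "(\<Sum>H\<in>U. f H * (if H = G then 1 else 0)) = (\<Sum>H\<in>U. if H = G then f G else 0)" by (rule sum.cong) auto
  then show ?thesis using empty[of "\<lambda>H. if H = G then 1 else 0"] G assms(2) by simp
 qed
 then show ?case by simp
next
 case (insert h R)
 let ?dot = "\<lambda>f c. \<Sum>G\<in>U. f G * c G :: 'k"
 show ?case
 proof (cases "\<exists>c0. (\<forall>H\<in>R. ?dot (a H) c0 = 0) \<and> ?dot (a h) c0 ~= 0")
  case False
  have "\<exists>g. \<forall>G\<in>U. f G = (\<Sum>H\<in>R. g H * a H G)"
   by (rule insert.IH) (use insert.prems False in blast)
  then obtain g where g: "\<forall>G\<in>U. f G = (\<Sum>H\<in>R. g H * a H G)" by blast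
  have "(\<Sum>H\<in>insert h R. (g(h := 0)) H * a H G) = (\<Sum>H\<in>R. g H * a H G)" for G
   using insert.hyps by (simp, intro sum.cong) auto
  then show ?thesis using g by (intro exI[of _ "g(h := 0)"]) simp
 next
  case True
  then obtain c1 where c1: "\<forall>H\<in>R. ?dot (a H) c1 = 0" "?dot (a h) c1 ~= 0" by blast
  define c0 where "c0 G = c1 G / ?dot (a h) c1" for G
  have d0: "?dot b c0 = ?dot b c1 / ?dot (a h) c1" for b by (simp add: c0_def sum_divide_distrib)
  have c0: "?dot (a h) c0 = 1" "\<And>H. H \<in> R ==> ?dot (a H) c0 = 0" using c1 by (simp_all add: d0)
  define t where "t = ?dot f c0"
  have "\<exists>g. \<forall>G\<in>U. f G - t * a h G = (\<Sum>H\<in>R. g H * a H G)"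
  proof (rule insert.IH)
   fix c assume c: "\<And>H. H \<in> R ==> ?dot (a H) c = 0"
   define s where "s = ?dot (a h) c"
   have lin: "?dot b (\<lambda>G. c G - s * c0 G) = ?dot b c - s * ?dot b c0" for b
    by (simp add: right_diff_distrib sum_subtractf sum_distrib_left mult.left_commute)
   have "?dot f (\<lambda>G. c G - s * c0 G) = 0"
    by (rule insert.prems) (use c c0 lin in \<open>auto simp: s_def\<close>)
   then have "?dot f c = s * t" unfolding lin by (simp add: t_def)
   moreover have "?dot (\<lambda>G. f G - t * a h G) c = ?dot f c - t * s"
    by (simp add: left_diff_distrib sum_subtractf sum_distrib_left mult.assoc s_def)
   ultimately show "?dot (\<lambda>G. f G - t * a h G) c = 0" by simp
  qed
  then obtain g where g: "\<forall>G\<in>U. f G - t * a h G = (\<Sum>H\<in>R. g H * a H G)" by blast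
  have "(\<Sum>H\<in>insert h R. (g(h := t)) H * a H G) = t * a h G + (\<Sum>H\<in>R. g H * a H G)" for G
   using insert.hyps by (simp, intro sum.cong) auto
  then show ?thesis using g by (intro exI[of _ "g(h := t)"]) (auto simp: algebra_simps)
 qed
qed

lemma bnd_cob_adjoint:
 "(\<Sum>G\<in>Pow (set vs). f G * bnd vs e G) = (\<Sum>G\<in>Pow (set vs). cob vs f G * (e G :: 'k::field))"
proof -
 have "(\<Sum>G\<in>Pow (set vs). f G * ct vs v e G) = (\<Sum>G\<in>Pow (set vs). wd vs v f G * e G)" if v: "v \<in> set vs" for v
 proof -
  have "(\<Sum>G\<in>Pow (set vs). f G * ct vs v e G) = (\<Sum>G\<in>{G \<in> Pow (set vs). v \<notin> G}. f G * (sg vs v G * e (insert v G)))"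
   by (rule sum.mono_neutral_cong_right) (auto simp: ct_def)
  also have "\<dots> = (\<Sum>G\<in>{G \<in> Pow (set vs). v \<in> G}. sg vs v G * f (G - {v}) * e G)"
   by (rule sum.reindex_bij_witness[of _ "\<lambda>G. G - {v}" "\<lambda>G. insert v G"]) (use v in \<open>auto simp: insert_absorb\<close>)
  also have "\<dots> = (\<Sum>G\<in>Pow (set vs). wd vs v f G * e G)"
   by (rule sum.mono_neutral_cong_left) (auto simp: wd_def)
  finally show ?thesis .
 qed
 then have "(\<Sum>v\<in>set vs. \<Sum>G\<in>Pow (set vs). f G * ct vs v e G) = (\<Sum>v\<in>set vs. \<Sum>G\<in>Pow (set vs). wd vs v f G * e G)" by (rule sum.cong[OF refl])
 then show ?thesis unfolding bnd_def cob_def sum_distrib_left sum_distrib_right by (subst (1 2) sum.swap)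
qed

text \<open>A cocycle pairs to zero with relative boundaries, hence by the vanishing of homology
  with all relative cycles; \<open>fredholm\<close> then writes it as a coboundary. The pairing runs
  over all vertex sets, where boundary and coboundary are adjoint.\<close>

lemma cohomology_van:
 fixes f :: "'v set => 'k::field" and K :: "'k itself"
 assumes cx: "cx vs \<Delta>" and van: "van K vs \<Delta> F (Suc p)"
  and f: "\<And>G. f G ~= 0 ==> G \<in> \<Delta> \<and> F \<subseteq> G \<and> card G = Suc p" and cf: "\<And>G. G \<in> \<Delta> ==> cob vs f G = 0"
 shows "\<exists>g. (\<forall>G. g G ~= 0 --> G \<in> \<Delta> \<and> F \<subseteq> G \<and> card G = p) \<and> (\<forall>G\<in>\<Delta>. cob vs g G = f G)"
proof -
 let ?V = "Pow (set vs)"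
 define U where "U = {G \<in> \<Delta>. F \<subseteq> G \<and> card G = Suc p}"
 define R where "R = {G \<in> \<Delta>. F \<subseteq> G \<and> card G = p}"
 have sub: "U \<subseteq> ?V" "R \<subseteq> ?V" using cxD(2)[OF cx] by (auto simp: U_def R_def)
 then have fin: "finite U" "finite R" by (auto intro: finite_subset)
 define ind where "ind G = (\<lambda>H. if H = G then 1 else 0 :: 'k)" for G :: "'v set"
 have bl: "bnd vs c H = (\<Sum>G\<in>U. bnd vs (ind G) H * c G)" if c: "\<And>G. c G ~= 0 ==> G \<in> U" for c H
 proof -
  have cexp: "(\<Sum>G\<in>U. ind G G' * c G) = c G'" for G'
  proof -
   have "(\<Sum>G\<in>U. ind G G' * c G) = (\<Sum>G\<in>U. if G = G' then c G' else 0)" by (rule sum.cong) (auto simp: ind_def)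
   then show ?thesis using c[of G'] fin by auto
  qed
  have "ct vs v c H = (\<Sum>G\<in>U. ct vs v (ind G) H * c G)" for v
   by (cases "v \<in> H") (simp_all add: ct_def mult.assoc sum_distrib_left[symmetric] cexp)
  then have "bnd vs c H = (\<Sum>v\<in>set vs. \<Sum>G\<in>U. ct vs v (ind G) H * c G)" by (simp add: bnd_def)
  also have "\<dots> = (\<Sum>G\<in>U. bnd vs (ind G) H * c G)" unfolding bnd_def sum_distrib_right by (rule sum.swap)
  finally show ?thesis .
 qed
 have "\<exists>g. \<forall>G\<in>U. f G = (\<Sum>H\<in>R. g H * bnd vs (ind G) H)"
 proof (rule fredholm[OF fin(2,1)])
  fix c assume h: "\<And>H. H \<in> R ==> (\<Sum>G\<in>U. bnd vs (ind G) H * c G) = 0"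
  define c' where "c' G = (if G \<in> U then c G else 0)" for G
  have c'U: "\<And>G. c' G ~= 0 ==> G \<in> U" by (auto simp: c'_def split: if_splits)
  have sp: "spt (Suc p) \<Delta> c'" using c'U by (auto simp: spt_def U_def)
  have "bnd vs c' G = 0" if G: "F \<subseteq> G" for G
  proof (rule ccontr)
   assume n: "bnd vs c' G ~= 0"
   then have "G \<in> R" using bnd_spt[OF cx sp] G by (auto simp: spt_def R_def)
   then have "(\<Sum>Ga\<in>U. bnd vs (ind Ga) G * c' Ga) = 0" using h[of G] by (simp add: c'_def)
   then show False using n bl[of c' G] c'U by simp
  qed
  then have "rc vs \<Delta> F (Suc p) c'" using sp by (simp add: rc_def)
  then obtain e where e: "spt (Suc (Suc p)) \<Delta> e" "\<And>G. F \<subseteq> G ==> c' G = bnd vs e G" using van unfolding van_def by blast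
  have "(\<Sum>G\<in>U. f G * c G) = (\<Sum>G\<in>?V. f G * bnd vs e G)"
  proof (rule sum.mono_neutral_cong_left)
   show "\<forall>i\<in>?V - U. f i * bnd vs e i = 0" using f by (auto simp: U_def)
   show "f G * c G = f G * bnd vs e G" if "G \<in> U" for G using e(2)[of G] that by (simp add: c'_def) (auto simp: U_def)
  qed (use sub in auto)
  also have "\<dots> = (\<Sum>G\<in>?V. cob vs f G * e G)" by (rule bnd_cob_adjoint)
  also have "\<dots> = 0" by (rule sum.neutral) (use cf e(1) in \<open>auto simp: spt_def\<close>)
  finally show "(\<Sum>G\<in>U. f G * c G) = 0" .
 qed
 then obtain g0 where g0: "\<And>G. G \<in> U ==> f G = (\<Sum>H\<in>R. g0 H * bnd vs (ind G) H)" by blast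
 define g where "g H = (if H \<in> R then g0 H else 0)" for H
 have "cob vs g G = f G" if G: "G \<in> \<Delta>" for G
 proof (cases "G \<in> U")
  case True
  have "cob vs g G = (\<Sum>H\<in>?V. cob vs g H * ind G H)"
  proof -
   have "(\<Sum>H\<in>?V. cob vs g H * ind G H) = (\<Sum>H\<in>?V. if H = G then cob vs g G else 0)" by (rule sum.cong) (auto simp: ind_def)
   then show ?thesis using True sub by auto
  qed
  also have "\<dots> = (\<Sum>H\<in>?V. g H * bnd vs (ind G) H)" by (rule bnd_cob_adjoint[symmetric])
  also have "\<dots> = (\<Sum>H\<in>R. g0 H * bnd vs (ind G) H)" by (rule sum.mono_neutral_cong_right) (use sub in \<open>auto simp: g_def\<close>)
  finally show ?thesis using g0[OF True] by simp
 next
  case False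
  have "wd vs v g G = 0" if "v \<in> set vs" for v
  proof (rule ccontr)
   assume "wd vs v g G ~= 0"
   then have h: "v \<in> G" "G - {v} \<in> R" by (auto simp: wd_def g_def split: if_splits)
   then have "card G = Suc p" "F \<subseteq> G" using cxD(4)[OF cx G] by (auto simp: R_def card_Diff_singleton_if) (metis Suc_pred card_gt_0_iff empty_iff)
   then show False using False G by (simp add: U_def)
  qed
  then have "cob vs g G = 0" by (simp add: cob_def)
  then show ?thesis using f[of G] False G by (auto simp: U_def)
 qed
 then show ?thesis by (intro exI[of _ g]) (auto simp: g_def R_def)
qed

section \<open>From homology manifolds to simplicial conditions\<close>

lemma pman_of_dims:
 assumes cx: "cx vs M" and top: "\<And>G. G \<in> M ==> card G \<le> Suc n"
  and dims: "\<And>x i. x \<in> geom M ==> i ~= int n ==> homology_dim K i (geom M) (geom M - {x}) = 0"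
 shows "pman K vs M (Suc n)"
proof
 fix F p assume F: "F \<in> M" "F ~= {}" "p < Suc n"
 have fin: "finite F" by (rule cxD(4)[OF cx F(1)])
 show "van K vs M F p"
 proof (cases p)
  case 0
  then show ?thesis using van_0[OF cx F(2)] by simp
 next
  case (Suc r)
  have "van K vs M F (Suc r)"
   by (rule van_from_dim[OF cx bary_geom[OF fin F(2,1)] bary_supp[OF fin F(2), symmetric] dims]) (use bary_geom[OF fin F(2,1)] F(3) Suc in auto)
  then show ?thesis by (simp add: Suc)
 qed
qed (fact cx, fact top)

lemma T_of_dims:
 assumes cx: "cx vs M" and x: "x \<in> geom M" and F: "F = {v. x v ~= 0}" and top: "\<And>G. G \<in> M ==> card G \<le> Suc n"
 shows "homology_dim K (int n) (geom M) (geom M - {x}) = 0 \<longleftrightarrow> T0 K vs M (Suc n) F"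
  and "homology_dim K (int n) (geom M) (geom M - {x}) = 1 ==> T1 K vs M (Suc n) F"
proof -
 show 0: "homology_dim K (int n) (geom M) (geom M - {x}) = 0 \<longleftrightarrow> T0 K vs M (Suc n) F"
  unfolding T0_def by (rule top_dim_0[OF cx x F top])
 assume 1: "homology_dim K (int n) (geom M) (geom M - {x}) = 1"
 have "\<not> T0 K vs M (Suc n) F" using 0 1 by simp
 then show "T1 K vs M (Suc n) F" unfolding T1_def T0_def using top_dim_1[OF cx x F top 1] by blast
qed

lemma T1_not_T0: "T1 K vs M d F ==> \<not> T0 K vs M d F" unfolding T1_def T0_def by blast

lemma geom_empty: "geom {} = {}" by (simp add: geom_def)

lemma geom_supp: "x \<in> geom \<Gamma> ==> {v. x v ~= 0} \<in> \<Gamma>" "x \<in> geom \<Gamma> ==> {v. x v ~= 0} ~= {}"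
proof -
 show "x \<in> geom \<Gamma> ==> {v. x v ~= 0} \<in> \<Gamma>" by (simp add: geom_def)
 assume "x \<in> geom \<Gamma>"
 then have "(\<Sum>v\<in>{v. x v ~= 0}. x v) = 1" by (simp add: geom_def)
 then show "{v. x v ~= 0} ~= {}" by (metis sum.empty zero_neq_one)
qed

lemma fundamental_exists:
 fixes K :: "'k::field itself" and M :: "'v set set"
 assumes cx: "cx vs M" and N: "N \<subseteq> M" "cx vs N" and dim: "homology_dim K (int p) (geom M) (geom N) ~= 0"
 shows "\<exists>c :: 'v set => 'k. spt (Suc p) M c \<and> (\<forall>G. bnd vs c G ~= 0 --> G ~= {} --> G \<in> N) \<and> (\<exists>H. c H ~= 0)"
proof -
 interpret apx vs M N "geom N"
  by (rule apx_closed) (use cx N in \<open>auto simp: cx_def\<close>)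
 let ?B = "rel_boundaries (int p) (geom M) (geom N) :: ('v => real, 'k) kchain set"
 have "\<not> (rel_cycles (int p) (geom M) (geom N) :: ('v => real, 'k) kchain set) \<subseteq> ?B"
  using dim unfolding homology_dim_def by (subst (asm) quot_dim_eq_0) (auto intro: rel_boundaries_lin)
 then obtain z where z: "z \<in> rel_cycles (int p) (geom M) (geom N)" "z \<notin> ?B" by blast
 obtain c where c: "spt (Suc p) M c" "\<forall>G. bnd vs c G ~= 0 --> G ~= {} --> G \<in> N" "z - LL vs c \<in> ?B" using surj[OF z(1)] by blast
 have "\<exists>H. c H ~= 0"
 proof (rule ccontr)
  assume "\<not> ?thesis"
  then have "c = (\<lambda>G. 0)" by auto
  then have "LL vs c = 0" using LL_simps(4) by simp
  then show False using c(3) z(2) by simp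
 qed
 then show ?thesis using c by blast
qed

section \<open>Components as subcomplexes\<close>

lemma geom_Pow_segment:
 assumes "finite G" "x \<in> geom (Pow G)" "y \<in> geom (Pow G)" "0 \<le> t" "t \<le> 1"
 shows "(\<lambda>v. (1 - t) * x v + t * y v) \<in> geom (Pow G)"
proof -
 obtain vs where vs: "set vs = G" using finite_list[OF assms(1)] by blast
 let ?w = "\<lambda>v. (1 - t) * x v + t * y v"
 have s: "(\<Sum>v\<in>set vs. x v) = 1" "(\<Sum>v\<in>set vs. y v) = 1" using geom_sum[OF assms(2), of vs] geom_sum[OF assms(3), of vs] vs by auto
 have "x v = 0 \<and> y v = 0" if "v \<notin> G" for v using assms(2,3) that by (auto simp: geom_def)
 then have sup: "{v. ?w v ~= 0} \<subseteq> G" by force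
 have "(\<Sum>v\<in>{v. ?w v ~= 0}. ?w v) = (\<Sum>v\<in>set vs. ?w v)" by (rule sum.mono_neutral_left) (use sup vs in auto)
 also have "\<dots> = (1 - t) * (\<Sum>v\<in>set vs. x v) + t * (\<Sum>v\<in>set vs. y v)" by (simp add: sum.distrib sum_distrib_left)
 finally show ?thesis using sup s assms by (simp add: geom_def)
qed

lemma simplex_connected:
 assumes "finite G" "x \<in> geom (Pow G)" "y \<in> geom (Pow G)" "geom (Pow G) \<subseteq> S"
 shows "connected_component S x y"
proof -
 let ?f = "\<lambda>t v. (1 - t) * x v + t * y v"
 have c: "continuous_on {0..1::real} ?f"
  by (rule continuous_on_coordinatewise_then_product) (intro continuous_intros)
 have "?f ` {0..1} \<subseteq> S" using geom_Pow_segment[OF assms(1-3)] assms(4) by auto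
 moreover have "x \<in> ?f ` {0..1}" by (rule image_eqI[of _ _ 0]) auto
 moreover have "y \<in> ?f ` {0..1}" by (rule image_eqI[of _ _ 1]) auto
 moreover have "connected (?f ` {0..1})" by (rule connected_continuous_image[OF c]) simp
 ultimately show ?thesis unfolding connected_component_def by blast
qed

text \<open>Closed simplices are connected, so a component is a union of them. It contains the star
  of each of its nonempty faces, and hence inherits all local conditions.\<close>

lemma component_complex:
 assumes cx: "cx vs M" and x: "x \<in> geom M"
 defines "C \<equiv> connected_component_set (geom M) x"
 defines "\<Gamma> \<equiv> {G \<in> M. geom (Pow G) \<subseteq> C}"
 shows "cx vs \<Gamma>" "geom \<Gamma> = C" "\<And>G H. G \<in> \<Gamma> ==> G ~= {} ==> G \<subseteq> H ==> H \<in> M ==> H \<in> \<Gamma>" "{v. x v ~= 0} \<in> \<Gamma>"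
proof -
 have key: "geom (Pow H) \<subseteq> C" if H: "H \<in> M" "y \<in> C" "y \<in> geom (Pow H)" for H y
 proof
  fix z assume z: "z \<in> geom (Pow H)"
  have "geom (Pow H) \<subseteq> geom M" by (rule geom_mono) (use H cxD(3)[OF cx] in auto)
  then have "connected_component (geom M) y z" by (rule simplex_connected[OF cxD(4)[OF cx H(1)] H(3) z])
  then show "z \<in> C" using H(2) unfolding C_def by (metis connected_component_trans mem_Collect_eq)
 qed
 have own: "y \<in> geom (Pow {v. y v ~= 0})" "{v. y v ~= 0} \<in> M" if "y \<in> geom M" for y using that by (auto simp: geom_def)
 have xC: "x \<in> C" using x by (simp add: C_def)
 show "cx vs \<Gamma>"
  unfolding cx_def
 proof (intro conjI ballI allI impI)
  fix G H assume "G \<in> \<Gamma>" "H \<subseteq> G"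
  then show "H \<in> \<Gamma>" using cxD(3)[OF cx, of G H] geom_mono[of "Pow H" "Pow G"] by (auto simp: \<Gamma>_def)
 qed (use cx in \<open>auto simp: cx_def \<Gamma>_def\<close>)
 show "geom \<Gamma> = C"
 proof
  show "geom \<Gamma> \<subseteq> C"
  proof
   fix y assume y: "y \<in> geom \<Gamma>"
   then have "{v. y v ~= 0} \<in> \<Gamma>" "y \<in> geom (Pow {v. y v ~= 0})" by (auto simp: geom_def)
   then show "y \<in> C" by (auto simp: \<Gamma>_def)
  qed
  show "C \<subseteq> geom \<Gamma>"
  proof
   fix y assume y: "y \<in> C"
   then have yM: "y \<in> geom M" using connected_component_subset unfolding C_def by fast
   have "{v. y v ~= 0} \<in> \<Gamma>" using key[OF own(2)[OF yM] y own(1)[OF yM]] own(2)[OF yM] by (simp add: \<Gamma>_def)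
   then show "y \<in> geom \<Gamma>" using yM by (simp add: geom_def)
  qed
 qed
 show "{v. x v ~= 0} \<in> \<Gamma>" using key[OF own(2)[OF x] xC own(1)[OF x]] own(2)[OF x] by (simp add: \<Gamma>_def)
 fix G H assume h: "G \<in> \<Gamma>" "G ~= {}" "G \<subseteq> H" "H \<in> M"
 then have GM: "G \<in> M" "geom (Pow G) \<subseteq> C" by (auto simp: \<Gamma>_def)
 have b: "bary G \<in> geom (Pow G)" by (rule bary_geom[OF cxD(4)[OF cx GM(1)] h(2)]) simp
 moreover have "geom (Pow G) \<subseteq> geom (Pow H)" by (rule geom_mono) (use h in auto)
 ultimately have "geom (Pow H) \<subseteq> C" using key[OF h(4), of "bary G"] GM(2) by blast
 then show "H \<in> \<Gamma>" using h(4) by (simp add: \<Gamma>_def)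
qed

text \<open>The invariant of the gluing induction.\<close>

definition inv_cx :: "'k::field itself => 'v list => nat => 'v set set => bool" where
 "inv_cx K vs d X \<longleftrightarrow> cx vs X \<and> (\<forall>G\<in>X. card G \<le> d) \<and> (\<forall>F\<in>X. F ~= {} --> (\<forall>p<d. van K vs X F p) \<and> absc K vs X d F)"

lemma has_dim_card: "has_dim M (int d - 1) ==> G \<in> M ==> card G \<le> d" by (auto simp: has_dim_def)

text \<open>The manifold may be disconnected, so the component of the face is singled out. Its
  fundamental cycle is nonzero on every facet, and local homology is one-dimensional; so every local
  top cycle is a multiple of an absolute cycle.\<close>

lemma closed_manifold:
 fixes K :: "'k::field itself" and M :: "'v set set"
 assumes cx: "cx vs M" and top: "\<And>G. G \<in> M ==> card G \<le> Suc q"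
  and man: "homology_manifold K (int q) (geom M)" and ori: "orientable K (int q) (geom M)"
 shows "inv_cx K vs (Suc q) M"
proof -
 have dims: "homology_dim K i (geom M) (geom M - {x}) = (if i = int q then 1 else 0)" if "x \<in> geom M" for x i
  using man that by (simp add: homology_manifold_def)
 have pm: "pman K vs M (Suc q)" by (rule pman_of_dims[OF cx top]) (simp_all add: dims)
 have T1M: "T1 K vs M (Suc q) F" if F: "F \<in> M" "F ~= {}" for F
 proof -
  have fin: "finite F" by (rule cxD(4)[OF cx F(1)])
  note b = bary_geom[OF fin F(2,1)] bary_supp[OF fin F(2), symmetric]
  show ?thesis by (rule T_of_dims(2)[OF cx b top]) (simp_all add: dims b(1))
 qed
 have bp: "boundary_points K (int q) (geom M) = {}" by (auto simp: boundary_points_def dims)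
 have "absc K vs M (Suc q) F" if F: "F \<in> M" "F ~= {}" for F
  unfolding absc_def
 proof (intro allI impI)
  fix u :: "'v set => 'k" assume u: "rc vs M F (Suc q) u"
  have fin: "finite F" by (rule cxD(4)[OF cx F(1)])
  define x where "x = bary F"
  have x: "x \<in> geom M" "{v. x v ~= 0} = F" unfolding x_def by (rule bary_geom[OF fin F(2,1)], rule bary_supp[OF fin F(2)])
  define C where "C = connected_component_set (geom M) x"
  define \<Gamma> where "\<Gamma> = {G \<in> M. geom (Pow G) \<subseteq> C}"
  note cc = component_complex[OF cx x(1), folded C_def, folded \<Gamma>_def]
  have sub: "\<Gamma> \<subseteq> M" by (auto simp: \<Gamma>_def)
  have star: "G \<in> M \<longleftrightarrow> G \<in> \<Gamma>" if "E \<in> \<Gamma>" "E ~= {}" "E \<subseteq> G" for E G using cc(3)[OF that] sub by blast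
  have pg: "pman K vs \<Gamma> (Suc q)"
  proof
   show "van K vs \<Gamma> E p" if "E \<in> \<Gamma>" "E ~= {}" "p < Suc q" for E p
    by (rule van_star[OF star pman.van[OF pm]]) (use that sub in auto)
  qed (use cc(1) sub top in auto)
  have C: "C \<in> components (geom M)" using x(1) by (auto simp: components_def C_def)
  then have "homology_dim K (int q) C {} = 1" using ori bp by (simp add: orientable_def)
  then have dim: "homology_dim K (int q) (geom \<Gamma>) (geom {}) ~= 0" by (simp add: cc(2) geom_empty)
  obtain w :: "'v set => 'k" and H where w: "spt (Suc q) \<Gamma> w" "\<forall>G. bnd vs w G ~= 0 --> G ~= {} --> G \<in> {}" "w H ~= 0"
   using fundamental_exists[OF cc(1) _ _ dim] by (auto simp: cx_def cxD(1)[OF cx])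
  have conn: "connected (geom \<Gamma>)" unfolding cc(2) C_def by simp
  obtain G where G: "G \<in> \<Gamma>" "F \<subseteq> G" "card G = Suc q" using pman.pure[OF pg, of F] cc(4) x(2) F(2) by auto
  have wG: "w G ~= 0"
  proof (rule pman.fundamental_nonzero[OF pg, where N = "{}" and H = H])
   show "T0 K vs \<Gamma> (Suc q) E \<or> T1 K vs \<Gamma> (Suc q) E \<and> E \<notin> {}" if "E \<in> \<Gamma>" "E ~= {}" for E
   proof -
    have "T1 K vs \<Gamma> (Suc q) E" by (rule T1_star[OF star[OF that] T1M]) (use that sub in auto)
    then show ?thesis by simp
   qed
  qed (use conn w G in auto)
  have wr: "rc vs M F (Suc q) w" unfolding rc_def using w(1,2) F(2) spt_mono[OF w(1) sub] by auto
  obtain \<mu> where mu: "\<forall>G. F \<subseteq> G --> u G = \<mu> * w G" using T1M[OF F] u wr G(2) wG unfolding T1_def by blast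
  show "\<exists>z. spt (Suc q) M z \<and> (\<forall>G. G ~= {} --> bnd vs z G = 0) \<and> (\<forall>G. F \<subseteq> G --> z G = u G)"
  proof (intro exI[of _ "\<lambda>G. \<mu> * w G"] conjI allI impI)
   show "spt (Suc q) M (\<lambda>G. \<mu> * w G)" using spt_mono[OF w(1) sub] by (auto simp: spt_def)
   show "bnd vs (\<lambda>G. \<mu> * w G) G = 0" if "G ~= {}" for G using w(2) that by (auto simp: bnd_linear)
  qed (use mu in auto)
 qed
 then show ?thesis using cx top pman.van[OF pm] by (auto simp: inv_cx_def)
qed

lemma chains_empty: "chains n {} = {0}"
proof -
 have "\<not> singular_simplex p (top_of_set {}) f" for p and f :: "(nat => real) => 'a"
  unfolding singular_simplex_iff using nonempty_standard_simplex[of p] by simp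
 then have "kys c = {}" if "c \<in> chains n {}" for c :: "('a, 'b) kchain" using that unfolding chains_def by blast
 then show ?thesis using chains_lin(1)[of n "{}"] by (auto simp: keys_eq_empty)
qed

lemma LL_boundary: "cx vs \<Gamma> ==> spt (Suc p) \<Gamma> f ==> bdry (int p) (LL vs f) = LL vs (bnd vs f)"
 unfolding bdry_bk by (rule bk_bk_LL) (auto dest: cxD)

lemma LL_in: "cx vs \<Gamma> ==> spt (Suc p) \<Gamma> f ==> LL vs f \<in> chains (int p) (geom \<Gamma>)"
proof -
 assume h: "cx vs \<Gamma>" "spt (Suc p) \<Gamma> f"
 interpret apx vs \<Gamma> "{}" "geom {}" by (rule apx_closed) (use h in \<open>auto simp: cx_def\<close>)
 show ?thesis unfolding chains_SS using LL_keys[OF h(2)] dn by blast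
qed

text \<open>The boundary of c, realized as a singular chain, is a reduced cycle of the common
  boundary. The hypothesis bounds it in X by a singular chain, and \<open>inj\<close> relative to
  the void complex turns this into a simplicial chain.\<close>

lemma bounding_chain:
 fixes K :: "'k::field itself" and c :: "'v set => 'k"
 assumes cx: "cx vs X" "cx vs M" and c: "spt (Suc q) M c" "\<And>G. G ~= {} ==> bnd vs c G ~= 0 ==> G \<in> M \<inter> X"
  and z: "inclusion_induces_zero K (int q - 1) (geom (M \<inter> X)) (geom X)"
 shows "\<exists>x. spt (Suc q) X x \<and> (\<forall>G. G ~= {} --> bnd vs x G = bnd vs c G)"
proof (cases q)
 case 0
 \<comment> \<open>For q = 0 the boundary of c lives on the empty face alone, and the zero chain
   will do.\<close>
 have "bnd vs c G = 0" if "G ~= {}" for G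
 proof (rule ccontr)
  assume n: "bnd vs c G ~= 0"
  have "spt 0 M (bnd vs c)" by (rule bnd_spt[OF cx(2)]) (use c(1) 0 in simp)
  then have "G \<in> M \<and> card G = 0" using n by (simp add: spt_def)
  then show False using that cxD(4)[OF cx(2), of G] by simp
 qed
 then show ?thesis by (intro exI[of _ "\<lambda>_. 0"]) (simp add: spt_def bnd_linear)
next
 case (Suc r)
 let ?b = "bnd vs c"
 have cN: "cx vs (M \<inter> X)" using cx by (auto simp: cx_def)
 have b0: "spt (Suc r) M ?b" using bnd_spt[OF cx(2) c(1)] by (simp add: Suc)
 have bN: "spt (Suc r) (M \<inter> X) ?b" unfolding spt_def
 proof (intro allI impI)
  fix G assume n: "?b G ~= 0"
  then have "card G = Suc r" using b0 by (simp add: spt_def)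
  then show "G \<in> M \<inter> X \<and> card G = Suc r" using c(2)[OF _ n] by fastforce
 qed
 have LLb: "LL vs ?b = bdry (int q) (LL vs c)" using LL_boundary[OF cx(2) c(1)] by simp
 have "bdry (int r) (LL vs ?b) = LL vs (bnd vs ?b)" by (rule LL_boundary[OF cN bN])
 also have "bnd vs ?b = (\<lambda>G. 0)" using bnd_bnd[OF cxD(1)[OF cx(1)]] by blast
 finally have "bdry (int r) (LL vs ?b) = 0" by (simp add: LL_simps)
 \<comment> \<open>Reducedness in degree 0 is automatic for a boundary.\<close>
 moreover have "aug (LL vs ?b) = 0" if "r = 0" using aug_bdry[of "LL vs c"] by (simp add: LLb Suc that)
 ultimately have "LL vs ?b \<in> red_cycles (int r) (geom (M \<inter> X))"
  using LL_in[OF cN bN] by (simp add: red_cycles_def rel_cycles_def chains_lin(1) aug_def)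
 then have rb: "LL vs ?b \<in> rel_boundaries (int r) (geom X) (geom {})" using z by (simp add: inclusion_induces_zero_def Suc geom_def)
 interpret apx vs X "{}" "geom {}" by (rule apx_closed) (use cx in \<open>auto simp: cx_def\<close>)
 obtain e where e: "spt (Suc (Suc r)) X e" "spt (Suc r) {} (\<lambda>G. ?b G - bnd vs e G)"
  using inj[OF _ rb] spt_mono[OF bN, of X] by auto
 then show ?thesis by (intro exI[of _ e]) (auto simp: spt_def Suc)
qed

text \<open>The hypotheses on spaces are turned into the simplicial ones of \<open>glue\<close>. The
  delicate point is that the boundary, defined by points, has to be the realization of the common
  faces, although \<open>boundary_complex\<close> collects only the faces all of whose points are
  boundary points.\<close>

lemma attach_manifold:
 fixes K :: "'k::field itself" and M :: "'v set set"
 assumes X: "inv_cx K vs (Suc q) X" and cx: "cx vs M" and dimM: "has_dim M (int q)"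
  and conn: "connected (geom M)" and man: "homology_manifold_with_boundary K (int q) (geom M)" and ori: "orientable K (int q) (geom M)"
  and N: "boundary_complex K (int q) M = M \<inter> X"
  and manN: "homology_manifold K (int q - 1) (geom (M \<inter> X))" and dimN: "has_dim (M \<inter> X) (int q - 1)"
  and z: "inclusion_induces_zero K (int q - 1) (geom (M \<inter> X)) (geom X)"
 shows "inv_cx K vs (Suc q) (X \<union> M)"
proof -
 let ?bp = "boundary_points K (int q) (geom M)"
 have cxX: "cx vs X" and topX: "\<And>G. G \<in> X ==> card G \<le> Suc q"
  and vX: "\<And>F p. F \<in> X ==> F ~= {} ==> p < Suc q ==> van K vs X F p" "\<And>F. F \<in> X ==> F ~= {} ==> absc K vs X (Suc q) F"
  using X by (auto simp: inv_cx_def)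
 have cN: "cx vs (M \<inter> X)" using cx cxX by (auto simp: cx_def)
 have top: "card G \<le> Suc q" if "G \<in> M" for G using dimM that by (auto simp: has_dim_def)
 have topN: "card G \<le> q" if "G \<in> M \<inter> X" for G using dimN that by (auto simp: has_dim_def)
 have pm: "pman K vs M (Suc q)"
  by (rule pman_of_dims[OF cx top]) (use man in \<open>auto simp: homology_manifold_with_boundary_def\<close>)
 have bpT: "x \<in> ?bp \<longleftrightarrow> T0 K vs M (Suc q) {v. x v ~= 0}" if "x \<in> geom M" for x
  using T_of_dims(1)[OF cx that refl top] that by (auto simp: boundary_points_def)
 have T: "T0 K vs M (Suc q) F \<or> T1 K vs M (Suc q) F" if F: "F \<in> M" "F ~= {}" for F
 proof -
  have fin: "finite F" by (rule cxD(4)[OF cx F(1)])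
  note b = bary_geom[OF fin F(2,1)] bary_supp[OF fin F(2), symmetric]
  have "homology_dim K (int q) (geom M) (geom M - {bary F}) \<in> {0, 1}" using man b(1) by (auto simp: homology_manifold_with_boundary_def)
  then show ?thesis using T_of_dims[OF cx b top, where K=K] by auto
 qed
 have NT0: "T0 K vs M (Suc q) F" if F: "F \<in> M \<inter> X" "F ~= {}" for F
 proof -
  have fin: "finite F" by (rule cxD(4)[OF cN F(1)])
  have "bary F \<in> geom (Pow F)" by (rule bary_geom[OF fin F(2)]) simp
  then have "bary F \<in> ?bp" using F(1) unfolding N[symmetric] boundary_complex_def by blast
  then show ?thesis using bpT[of "bary F"] bary_supp[OF fin F(2)] by (auto simp: boundary_points_def)
 qed
 \<comment> \<open>Some point of F is interior. Its carrier, possibly a proper subface, has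
   one-dimensional local homology, and \<open>T1_up\<close> carries this to F.\<close>
 have NT1: "T1 K vs M (Suc q) F" if F: "F \<in> M" "F \<notin> X" "F ~= {}" for F
 proof -
  have "F \<notin> boundary_complex K (int q) M" using F N by auto
  then obtain y where y: "y \<in> geom (Pow F)" "y \<notin> ?bp" using F(1) by (auto simp: boundary_complex_def)
  let ?S = "{v. y v ~= 0}"
  have S: "?S \<subseteq> F" "?S ~= {}" using geom_supp[OF y(1)] by auto
  have S3: "?S \<in> M" by (rule cxD(3)[OF cx F(1) S(1)])
  have "y \<in> geom M" using y(1) S3 by (simp add: geom_def)
  then have "\<not> T0 K vs M (Suc q) ?S" using y(2) bpT by simp
  then have t1: "T1 K vs M (Suc q) ?S" using T[OF S3 S(2)] by blast
  have "\<not> T0 K vs M (Suc q) F" by (rule pman.T1_up[OF pm _ S3 S(2) t1 F(1) S(1)]) (rule T)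
  then show ?thesis using T[OF F(1,3)] by blast
 qed
 have bp: "?bp = geom (M \<inter> X)"
 proof
  show "geom (M \<inter> X) \<subseteq> ?bp"
  proof
   fix x assume x: "x \<in> geom (M \<inter> X)"
   then have s: "{v. x v ~= 0} \<in> M \<inter> X" "x \<in> geom (Pow {v. x v ~= 0})" by (auto simp: geom_def)
   then show "x \<in> ?bp" unfolding N[symmetric] boundary_complex_def by blast
  qed
  show "?bp \<subseteq> geom (M \<inter> X)"
  proof
   fix x assume x: "x \<in> ?bp"
   then have xM: "x \<in> geom M" by (simp add: boundary_points_def)
   then have s: "{v. x v ~= 0} \<in> M" "{v. x v ~= 0} ~= {}" using geom_supp by auto
   have "{v. x v ~= 0} \<in> X"
   proof (rule ccontr)
    assume "{v. x v ~= 0} \<notin> X"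
    from T1_not_T0[OF NT1[OF s(1) this s(2)]] show False using x bpT[OF xM] by simp
   qed
   then show "x \<in> geom (M \<inter> X)" using xM s by (simp add: geom_def)
  qed
 qed
 obtain G0 where G0: "G0 \<in> M" "card G0 = Suc q" using dimM by (auto simp: has_dim_def)
 have "bary G0 \<in> geom M" by (rule bary_geom[OF cxD(4)[OF cx G0(1)] _ G0(1)]) (use G0 in auto)
 then have "geom M \<in> components (geom M)" using conn by (auto simp: in_components_self)
 then have "homology_dim K (int q) (geom M) (geom M \<inter> ?bp) = 1" using ori by (simp add: orientable_def)
 moreover have "geom M \<inter> ?bp = geom (M \<inter> X)" unfolding bp using geom_mono[of "M \<inter> X" M] by auto
 ultimately have dim: "homology_dim K (int q) (geom M) (geom (M \<inter> X)) ~= 0" by simp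
 obtain c :: "'v set => 'k" and H where c: "spt (Suc q) M c" "\<forall>G. bnd vs c G ~= 0 --> G ~= {} --> G \<in> M \<inter> X" "c H ~= 0"
  using fundamental_exists[OF cx _ cN dim] by blast
 have cnz: "c G ~= 0" if G: "G \<in> M" "card G = Suc q" for G
 proof (rule pman.fundamental_nonzero[OF pm, where N = "M \<inter> X" and H = H])
  show "T0 K vs M (Suc q) F \<or> T1 K vs M (Suc q) F \<and> F \<notin> M \<inter> X" if "F \<in> M" "F ~= {}" for F
   using NT0[of F] NT1[of F] that by blast
 qed (use conn c G in auto)
 obtain x where x: "spt (Suc q) X x" "\<forall>G. G ~= {} --> bnd vs x G = bnd vs c G"
  using bounding_chain[OF cxX cx c(1) _ z] c(2) by blast
 \<comment> \<open>A nonempty common face has between 1 and q vertices, so q is positive and the top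
   degree of the boundary is a natural number.\<close>
 have Nr: "\<exists>r. q = Suc r" if F: "F \<in> M \<inter> X" "F ~= {}" for F
  using topN[OF F(1)] F(2) cxD(4)[OF cN F(1)] by (cases q) auto
 have dN: "homology_dim K i (geom (M \<inter> X)) (geom (M \<inter> X) - {x}) = (if i = int q - 1 then 1 else 0)" if "x \<in> geom (M \<inter> X)" for x i
  using manN that by (simp add: homology_manifold_def)
 have vN: "van K vs (M \<inter> X) F p" if F: "F \<in> M \<inter> X" "F ~= {}" and p: "p < q" for F p
 proof -
  obtain r where r: "q = Suc r" using Nr[OF F] by blast
  have "pman K vs (M \<inter> X) (Suc r)" by (rule pman_of_dims[OF cN]) (use topN dN r in auto)
  then show ?thesis by (rule pman.van) (use F p r in auto)
 qed
 have tN: "T1 K vs (M \<inter> X) q F" if F: "F \<in> M \<inter> X" "F ~= {}" for F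
 proof -
  obtain r where r: "q = Suc r" using Nr[OF F] by blast
  have fin: "finite F" by (rule cxD(4)[OF cN F(1)])
  note b = bary_geom[OF fin F(2,1)] bary_supp[OF fin F(2), symmetric]
  have "T1 K vs (M \<inter> X) (Suc r) F" by (rule T_of_dims(2)[OF cN b]) (use topN dN[OF b(1)] r in auto)
  then show ?thesis by (simp add: r)
 qed
 interpret glue K vs X M q c x
 proof (rule glue.intro)
  show "bnd vs c G ~= 0 ==> G \<in> M \<inter> X" "bnd vs x G = bnd vs c G" if "G ~= {}" for G using c(2) x(2) that by auto
 qed (fact cxX pm c(1) x(1) | erule (2) vX(1) | erule (1) vX(2) | erule (2) vN | erule (1) tN | erule (1) NT0 | erule (2) NT1 | erule (1) cnz | erule topX)+
 show ?thesis using cxY vanY absY topX top by (auto simp: inv_cx_def)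
qed

section \<open>Homology of the complement of a point\<close>

lemma bdry_bdry:
 fixes c :: "('a::topological_space, 'k::field) kchain"
 assumes "c \<in> chains (int (Suc p)) X"
 shows "bdry (int p) (bdry (int (Suc p)) c) = 0"
proof (cases "p = 0")
 case False
 then have p: "1 \<le> p" by simp
 have "ext (bq p) (bq (Suc p) f :: ('a, 'k) kchain) = 0" if f: "f \<in> kys c" for f
 proof -
  have sc: "singular_chain (Suc p) (top_of_set X) (frag_of f)" using f assms by (auto simp: chains_SS singular_chain_of simp del: of_nat_Suc)
  have "(bq (Suc p) f :: ('a, 'k) kchain) = iot (chain_boundary (Suc p) (frag_of f))" using iot_boundary[of "Suc p" "frag_of f", where 'k='k] by (simp add: iot_simps)
  then have "ext (bq p) (bq (Suc p) f :: ('a, 'k) kchain) = iot (chain_boundary p (chain_boundary (Suc p) (frag_of f)))" by (simp add: iot_boundary[OF p])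
  then show ?thesis using chain_boundary_boundary[OF sc] by (simp add: iot_simps)
 qed
 then have "ext (\<lambda>f. ext (bq p) (bq (Suc p) f)) c = ext (\<lambda>f. 0) c" by (intro ext_cong)
 then have "ext (bq p) (ext (bq (Suc p)) c) = 0" unfolding ext_ext by (simp add: ext_def[of "\<lambda>f. 0"])
 then show ?thesis using False by (simp add: bdry_bk bk_def del: of_nat_Suc)
qed (simp add: bdry_eq)

lemma LL_only_empty: "(\<And>G. G ~= {} ==> f G = 0) ==> (LL vs f :: ('v => real, 'k::field) kchain) = 0"
proof -
 assume f: "\<And>G. G ~= {} ==> f G = 0"
 have "lord l = (0 :: ('v => real, 'k) kchain)" if l: "l \<in> kys (BB vs f)" for l
 proof -
  obtain G where "f G ~= 0" "l = srt vs G" using keys_BB[OF l] by blast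
  then have "l = []" using f by (cases "G = {}") (auto simp: srt_def)
  then show ?thesis by (simp add: lord_def)
 qed
 then show ?thesis unfolding LL_def ext_def by simp
qed

text \<open>The inclusion of the complement induces an isomorphism in degree r. Surjectivity is the
  vanishing of local homology in degree r; injectivity is the extension of local cycles in degree r
  + 1, which is the vanishing of the connecting map from that local homology.\<close>

lemma reduced_dim_complement:
 fixes K :: "'k::field itself" and \<Delta> :: "'v set set"
 assumes cx: "cx vs \<Delta>" and y: "y \<in> geom \<Delta>" and van: "van K vs \<Delta> {v. y v ~= 0} (Suc r)" and abs: "absc K vs \<Delta> (Suc (Suc r)) {v. y v ~= 0}"
 shows "reduced_homology_dim K (int r) (geom \<Delta> - {y}) = reduced_homology_dim K (int r) (geom \<Delta>)"
proof -
 let ?X = "geom \<Delta>" and ?A = "geom \<Delta> - {y}" and ?F = "{v. y v ~= 0}"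
 let ?C = "\<lambda>n X. chains n X :: ('v => real, 'k) kchain set"
 have rI: "int r + 1 = int (Suc r)" by simp
 have AX: "?C n ?A \<subseteq> ?C n ?X" for n by (rule chains_mono) auto
 have red: "c \<in> red_cycles (int r) S \<longleftrightarrow> c \<in> ?C (int r) S \<and> bdry (int r) c = 0 \<and> (r = 0 --> aug c = 0)" for c S
  by (auto simp: red_cycles_def rel_cycles_def chains_empty aug_def)
 have rb: "c \<in> rel_boundaries (int r) S {} \<longleftrightarrow> c \<in> ?C (int r) S \<and> (\<exists>e\<in>?C (int (Suc r)) S. c = bdry (int (Suc r)) e)" for c S
  unfolding rel_boundaries_def rI chains_empty by auto
 note ctx = cx y refl
 show ?thesis unfolding reduced_homology_dim_def
 proof (rule quot_dim_cong)
  show "red_cycles (int r) ?A \<subseteq> (red_cycles (int r) ?X :: ('v => real, 'k) kchain set)" using AX[of "int r"] by (auto simp: red)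
  show "rel_boundaries (int r) ?A {} \<subseteq> (rel_boundaries (int r) ?X {} :: ('v => real, 'k) kchain set)" 
   by (rule subsetI, unfold rb) (use AX[of "int r"] AX[of "int (Suc r)"] in blast)
  show "rel_boundaries (int r) ?X {} \<inter> red_cycles (int r) ?A \<subseteq> (rel_boundaries (int r) ?A {} :: ('v => real, 'k) kchain set)"
  proof
   fix z :: "('v => real, 'k) kchain" assume "z \<in> rel_boundaries (int r) ?X {} \<inter> red_cycles (int r) ?A"
   then obtain e where e: "e \<in> ?C (int (Suc r)) ?X" "z = bdry (int (Suc r)) e" and zA: "z \<in> ?C (int r) ?A" by (auto simp: rb red)
   have "e \<in> rel_cycles (int (Suc r)) ?X ?A" using e zA by (simp add: rel_cycles_def)
   from rc_surj[OF ctx this] obtain c where c: "rc vs \<Delta> ?F (Suc (Suc r)) c" "e - LL vs c \<in> rel_boundaries (int (Suc r)) ?X ?A" by blast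
   then obtain g where g: "g \<in> ?C (int (Suc (Suc r))) ?X" "e - LL vs c - bdry (int (Suc (Suc r))) g \<in> ?C (int (Suc r)) ?A"
    by (auto simp: rel_boundaries_def add.commute)
   \<comment> \<open>An absolute cycle agreeing near y with the chain that bounds z. It has no
     effect on the boundary, and subtracting it moves the bounding chain away from y.\<close>
   obtain w where w: "spt (Suc (Suc r)) \<Delta> w" "\<forall>G. G ~= {} --> bnd vs w G = 0" "\<forall>G. ?F \<subseteq> G --> w G = c G"
    using abs c(1) unfolding absc_def by blast
   have "spt (Suc (Suc r)) \<Delta> (\<lambda>G. c G + (- 1) * w G)" by (rule spt_lin) (use c(1) w(1) in \<open>auto simp: rc_def\<close>)
   then have cw: "LL vs (\<lambda>G. c G - w G) \<in> ?C (int (Suc r)) ?A" by (intro cost_LL[OF ctx]) (use w(3) in auto)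
   define a where "a = (e - LL vs c - bdry (int (Suc (Suc r))) g) + LL vs (\<lambda>G. c G - w G)"
   have aA: "a \<in> ?C (int (Suc r)) ?A" unfolding a_def by (rule chains_lin(2)[OF g(2) cw])
   have "e = a + LL vs w + bdry (int (Suc (Suc r))) g" by (simp add: a_def LL_simps)
   then have "z = bdry (int (Suc r)) a + bdry (int (Suc r)) (LL vs w) + bdry (int (Suc r)) (bdry (int (Suc (Suc r))) g)"
    using e(2) by (simp only: bdry_lin)
   \<comment> \<open>The boundary of w may be nonzero at the empty face, but the realization
     discards that face.\<close>
   moreover have "bdry (int (Suc r)) (LL vs w) = 0" unfolding LL_boundary[OF cx w(1)] by (rule LL_only_empty) (use w(2) in blast)
   moreover have "bdry (int (Suc r)) (bdry (int (Suc (Suc r))) g) = 0" by (rule bdry_bdry[OF g(1)])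
   ultimately show "z \<in> rel_boundaries (int r) ?A {}" using aA zA by (auto simp: rb simp del: of_nat_Suc)
  qed
  fix z :: "('v => real, 'k) kchain" assume "z \<in> red_cycles (int r) ?X"
  then have z: "z \<in> ?C (int r) ?X" "bdry (int r) z = 0" "r = 0 --> aug z = 0" by (auto simp: red)
  have "z \<in> rel_cycles (int r) ?X ?A" using z chains_lin(1) by (simp add: rel_cycles_def)
  from rc_surj[OF ctx this] obtain c where c: "rc vs \<Delta> ?F (Suc r) c" "z - LL vs c \<in> rel_boundaries (int r) ?X ?A" by blast
  then obtain g where g: "g \<in> ?C (int (Suc r)) ?X" "z - LL vs c - bdry (int (Suc r)) g \<in> ?C (int r) ?A"
   unfolding rel_boundaries_def rI by blast
  \<comment> \<open>The part of the cycle near y is a relative boundary; subtracting that boundary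
    replaces z by a homologous cycle avoiding y.\<close>
  obtain e where e: "spt (Suc (Suc r)) \<Delta> e" "\<forall>G. ?F \<subseteq> G --> c G = bnd vs e G" using van c(1) unfolding van_def by blast
  have "spt (Suc r) \<Delta> (\<lambda>G. c G + (- 1) * bnd vs e G)" by (rule spt_lin) (use c(1) bnd_spt[OF cx e(1)] in \<open>auto simp: rc_def\<close>)
  then have ce: "LL vs (\<lambda>G. c G - bnd vs e G) \<in> ?C (int r) ?A" by (intro cost_LL[OF ctx]) (use e(2) in auto)
  define a where "a = (z - LL vs c - bdry (int (Suc r)) g) + LL vs (\<lambda>G. c G - bnd vs e G)"
  define t where "t = g + LL vs e"
  have aA: "a \<in> ?C (int r) ?A" unfolding a_def by (rule chains_lin(2)[OF g(2) ce])
  have tX: "t \<in> ?C (int (Suc r)) ?X" unfolding t_def by (rule chains_lin(2)[OF g(1) LL_in[OF cx e(1)]])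
  have za: "z - a = bdry (int (Suc r)) t" unfolding a_def t_def bdry_lin LL_boundary[OF cx e(1)] LL_simps(2) by simp
  have aeq: "a = z - bdry (int (Suc r)) t" unfolding za[symmetric] by simp
  have "bdry (int r) a = 0" unfolding aeq bdry_lin z(2) bdry_bdry[OF tX] by simp
  moreover have "aug a = 0" if r: "r = 0"
  proof -
   have "int (Suc r) = 1" using r by simp
   then show ?thesis using aug_bdry[of t] z(3) r unfolding aeq aug_lin by simp
  qed
  ultimately have "a \<in> red_cycles (int r) ?A" using aA by (simp add: red)
  moreover have "z - a \<in> rel_boundaries (int r) ?X {}"
   unfolding rb using tX za chains_lin(4)[OF z(1)] aA AX[of "int r"] by blast
  ultimately show "\<exists>y\<in>red_cycles (int r) ?A. z - y \<in> rel_boundaries (int r) ?X {}" by blast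
 next
  show "0 \<in> (red_cycles (int r) ?A :: ('v => real, 'k) kchain set)" by (simp add: red chains_lin bdry_lin aug_lin)
 next
  fix c d :: "('v => real, 'k) kchain" assume "c \<in> red_cycles (int r) ?A" "d \<in> red_cycles (int r) ?A"
  then show "c + d \<in> red_cycles (int r) ?A" by (simp add: red chains_lin bdry_lin aug_lin)
 next
  fix c :: "('v => real, 'k) kchain" and a assume "c \<in> red_cycles (int r) ?A"
  then show "sc a c \<in> red_cycles (int r) ?A" by (simp add: red chains_lin bdry_lin aug_lin)
 qed (fact rel_boundaries_lin)+
qed

lemma reduced_dim_negative:
 fixes K :: "'k::field itself" and X Y :: "'a::topological_space set"
 assumes "n < 0" shows "reduced_homology_dim K n X = reduced_homology_dim K n Y"
proof -
 have 1: "red_cycles n X = {0 :: ('a, 'k::field) kchain}" for X :: "'a set"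
  using assms
  by (auto simp: red_cycles_def rel_cycles_def chains_neg bdry_lin)
 have 2: "rel_boundaries n X {} = {0 :: ('a, 'k::field) kchain}" for X :: "'a set"
  using assms rel_boundaries_lin(1)[of n X "{}", where 'b='k] by (auto simp: rel_boundaries_def chains_neg)
 show ?thesis by (simp add: reduced_homology_dim_def 1 2)
qed

theorem theorem5p1:
 fixes K :: "'k::field itself"
  and \<Delta> :: "'v set set"
  and D :: "nat \<Rightarrow> 'v set set"
  and d m :: nat
 assumes "simplicial_complex \<Delta>" and "has_dim \<Delta> (int d - 1)"
  and "1 \<le> m" and "\<And>i. i \<in> {1..m} \<Longrightarrow> subcomplex (D i) \<Delta>"
  and i: "\<Delta> = (\<Union>i\<in>{1..m}. D i)"
  and ii: "has_dim (D 1) (int d - 1)"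
    "homology_manifold K (int d - 1) (geom (D 1))"
    "orientable K (int d - 1) (geom (D 1))"
  and iii: "\<And>i. i \<in> {2..m} \<Longrightarrow> has_dim (D i) (int d - 1)"
    "\<And>i. i \<in> {2..m} \<Longrightarrow> connected (geom (D i))"
    "\<And>i. i \<in> {2..m} \<Longrightarrow> homology_manifold_with_boundary K (int d - 1) (geom (D i))"
    "\<And>i. i \<in> {2..m} \<Longrightarrow> orientable K (int d - 1) (geom (D i))"
  and iii_a: "\<And>i. i \<in> {2..m} \<Longrightarrow> has_dim (boundary_complex K (int d - 1) (D i)) (int d - 2)"
    "\<And>i. i \<in> {2..m} \<Longrightarrow> connected (geom (boundary_complex K (int d - 1) (D i)))"
    "\<And>i. i \<in> {2..m} \<Longrightarrow>
     homology_manifold K (int d - 2) (geom (boundary_complex K (int d - 1) (D i)))"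
    "\<And>i. i \<in> {2..m} \<Longrightarrow>
     orientable K (int d - 2) (geom (boundary_complex K (int d - 1) (D i)))"
  and iii_b: "\<And>i. i \<in> {2..m} \<Longrightarrow>
     boundary_complex K (int d - 1) (D i) = D i \<inter> (\<Union>j\<in>{1..<i}. D j)"
  and iii_c: "\<And>i. i \<in> {2..m} \<Longrightarrow>
     inclusion_induces_zero K (int d - 2)
      (geom (boundary_complex K (int d - 1) (D i))) (geom (\<Union>j\<in>{1..<i}. D j))"
    "\<And>i. i \<in> {2..m} \<Longrightarrow>
     inclusion_induces_zero K (int d - 3)
      (geom (boundary_complex K (int d - 1) (D i))) (geom (\<Union>j\<in>{1..<i}. D j))"
 shows "buchsbaum_star K d \<Delta>"
proof -
 have fin: "finite (\<Union>\<Delta>)" using assms(1) by (simp add: simplicial_complex_def)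
 obtain vs where vs: "distinct vs" "set vs = \<Union>\<Delta>" using finite_distinct_list[OF fin] by blast
 have cx: "cx vs (D j)" if "j \<in> {1..m}" for j
  using assms(4)[OF that] vs unfolding cx_def subcomplex_def simplicial_complex_def by blast
 have cpx: "cx vs \<Delta>" using assms(1) vs unfolding cx_def simplicial_complex_def by blast
 have card: "card G \<le> d" if "G \<in> \<Delta>" for G using has_dim_card[OF assms(2) that] .
 have main: "(\<forall>p<d. van K vs \<Delta> F p) \<and> absc K vs \<Delta> d F" if F: "F \<in> \<Delta>" "F ~= {}" for F
 proof -
  have "finite F" by (rule cxD(4)[OF cpx F(1)])
  then have "0 < card F" using F(2) by (simp add: card_gt_0_iff)
  \<comment> \<open>The argument is run with q = d - 1, the dimension; the nonempty face F
    guarantees that d is positive.\<close>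
  then obtain q where d: "d = Suc q" using card[OF F(1)] by (cases d) auto
  have dd: "int d - 1 = int q" "int d - 2 = int q - 1" by (simp_all add: d)
  have "inv_cx K vs (Suc q) (\<Union>j\<in>{1..k}. D j)" if "1 \<le> k" "k \<le> m" for k
   using that
  proof (induction k rule: nat_induct_at_least)
   case base
   have "inv_cx K vs (Suc q) (D 1)"
    by (rule closed_manifold[OF cx]) (use base has_dim_card[OF ii(1)] ii[unfolded dd] d in auto)
   then show ?case by simp
  next
   case (Suc k)
   let ?X = "\<Union>j\<in>{1..k}. D j"
   have k2: "Suc k \<in> {2..m}" using Suc by simp
   have e: "{1..<Suc k} = {1..k}" "{1..Suc k} = insert (Suc k) {1..k}" by auto
   note b = iii_b[OF k2, unfolded dd e]
   have "inv_cx K vs (Suc q) (?X \<union> D (Suc k))"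
   proof (rule attach_manifold)
    show "inv_cx K vs (Suc q) ?X" using Suc by simp
    show "cx vs (D (Suc k))" by (rule cx) (use Suc in auto)
    show "has_dim (D (Suc k)) (int q)" using iii(1)[OF k2, unfolded dd] .
    show "connected (geom (D (Suc k)))" using iii(2)[OF k2] .
    show "homology_manifold_with_boundary K (int q) (geom (D (Suc k)))" using iii(3)[OF k2, unfolded dd] .
    show "orientable K (int q) (geom (D (Suc k)))" using iii(4)[OF k2, unfolded dd] .
    show "boundary_complex K (int q) (D (Suc k)) = D (Suc k) \<inter> ?X" by (rule b)
    show "homology_manifold K (int q - 1) (geom (D (Suc k) \<inter> ?X))" using iii_a(3)[OF k2, unfolded dd b] .
    show "has_dim (D (Suc k) \<inter> ?X) (int q - 1)" using iii_a(1)[OF k2, unfolded dd b] .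
    show "inclusion_induces_zero K (int q - 1) (geom (D (Suc k) \<inter> ?X)) (geom ?X)" using iii_c(1)[OF k2, unfolded dd b e] .
   qed
   moreover have "(\<Union>j\<in>{1..Suc k}. D j) = ?X \<union> D (Suc k)" unfolding e by auto
   ultimately show ?case by simp
  qed
  from this[OF assms(3) order_refl] show ?thesis using F unfolding i[symmetric] d by (simp add: inv_cx_def)
 qed
 have "{} \<in> \<Delta>" using assms(1,2) by (auto simp: has_dim_def simplicial_complex_def)
 then interpret sr_ring K \<Delta> using assms(1) by unfold_locales
 have "buchsbaum K \<Delta>"
 proof (rule buchsbaum_if_acyclic[OF vs card])
  fix F p f assume h: "F \<in> \<Delta>" "F ~= {}" "p < int d"
   and f: "\<And>G. f G ~= (0::'k) ==> G \<in> \<Delta> \<and> F \<subseteq> G \<and> int (card G) = p" "\<And>G. G \<in> \<Delta> ==> cob vs f G = 0"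
  show "\<exists>g. (\<forall>G. g G ~= 0 --> G \<in> \<Delta> \<and> F \<subseteq> G \<and> int (card G) = p - 1) \<and> (\<forall>G\<in>\<Delta>. cob vs g G = f G)"
  \<comment> \<open>No face containing the nonempty F has p \<le> 0 vertices, so the cochain is 0;
    otherwise p is shifted to match vertex counts.\<close>
  proof (cases "p \<le> 0")
   case True
   have "f G = 0" for G
   proof (rule ccontr)
    assume "f G ~= 0"
    with f(1)[OF this] True have "G \<in> \<Delta>" "F \<subseteq> G" "card G = 0" by auto
    then show False using h(2) cxD(4)[OF cpx, of G] by auto
   qed
   then show ?thesis by (intro exI[of _ "\<lambda>_. 0"]) (simp add: cob_linear)
  next
   case False
   define r where "r = nat (p - 1)"
   have r: "p = int (Suc r)" "p - 1 = int r" using False by (simp_all add: r_def)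
   have van: "van K vs \<Delta> F (Suc r)" using main[OF h(1,2)] h(3) r(1) by simp
   have f': "\<And>G. f G ~= 0 ==> G \<in> \<Delta> \<and> F \<subseteq> G \<and> card G = Suc r" using f(1) unfolding r(1) of_nat_eq_iff by blast
   from cohomology_van[OF cpx van f' f(2)]
   obtain g where g: "\<forall>G. g G ~= 0 --> G \<in> \<Delta> \<and> F \<subseteq> G \<and> card G = r" "\<forall>G\<in>\<Delta>. cob vs g G = f G" by blast
   then show ?thesis unfolding r(2) by (intro exI[of _ g]) simp
  qed
 qed
 moreover have "reduced_homology_dim K (int d - 2) (geom \<Delta> - {y}) = reduced_homology_dim K (int d - 2) (geom \<Delta>)" if y: "y \<in> geom \<Delta>" for y
 \<comment> \<open>For d < 2 the degree d - 2 is negative, where every reduced homology group is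
   zero.\<close>
 proof (cases "2 \<le> d")
  case True
  define r where "r = d - 2"
  have d: "d = Suc (Suc r)" using True by (simp add: r_def)
  have F: "{v. y v ~= 0} \<in> \<Delta>" "{v. y v ~= 0} ~= {}" using geom_supp[OF y] by auto
  have "reduced_homology_dim K (int r) (geom \<Delta> - {y}) = reduced_homology_dim K (int r) (geom \<Delta>)"
   by (rule reduced_dim_complement[OF cpx y]) (use main[OF F] d in auto)
  then show ?thesis by (simp add: d)
 next
  case False
  then show ?thesis by (intro reduced_dim_negative) simp
 qed
 ultimately show ?thesis using assms(1,2) by (simp add: buchsbaum_star_def)
qed

end
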